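(* There exists a real constant $c>0$ such that the following holds for any positive constant $C<1/9$. Let $k, n$ and $m$ be integers with $3 \leq k < n^{C}$ and $\sqrt{n}< m < \frac{c}{k}\binom nk$. Then there exists a set $\mathcal{W}$ that has probability $1-O(n^{-\omega(1)})$ in both $\mathcal{B}_{k}(n, m)$ and $\mathcal{D}_k(n, m)$, such that uniformly for all integers $k, m$ with $3 \leq k < n^{C}$ and $\sqrt{n}< m < \frac{c}{k}\binom nk$, and all $\mathbf{d} \in \mathcal{W}$, $$\Pr_{\mathcal{D}_k(n, m)}(\mathbf{d}) = \Pr_{\mathcal{B}_{k}(n, m)}(\mathbf{d}) (1 + o(1)).$$
   Context: $\mathcal{H}_k(n,m)$ is the uniform probability space of $k$-uniform hypergraphs on vertex set $[n]$ with $m$ edges, and $\mathcal{D}_k(n,m)$ is the probability space induced by the degree sequence of $\mathcal{H}_k(n,m)$, on the ground set $\Omega=\{\mathbf{d}\in\mathbb{Z}^n:\sum_v d_v=km\}$. $\mathcal{B}_k(n,m)$ is the probability space on $\Omega$ where each component $d_v$ is independently distributed as $\mathrm{Bin}(\binom{n-1}{k-1},p)$ for some $p\in(0,1)$, conditioned on $\sum_v d_v=km$; explicitly $\Pr_{\mathcal{B}_k(n,m)}(\mathbf{d})=\binom{n\binom{n-1}{k-1}}{km}^{-1}\prod_{v}\binom{\binom{n-1}{k-1}}{d_v}$. Asymptotics are as $n\to\infty$; $\omega(1)$ denotes a function tending to infinity. Uniform convergence means there is a fixed bound $g(n)\to0$ on the error for all $\mathbf{d}$ in the given set. *)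

theory Defs
  imports "HOL-Analysis.Analysis"
begin

definition hypergraphs :: "nat \<Rightarrow> nat \<Rightarrow> nat \<Rightarrow> nat set set set" where
  "hypergraphs k n m = {H. H \<subseteq> {e. e \<subseteq> {0..<n} \<and> card e = k} \<and> card H = m}"

definition hdeg :: "nat set set \<Rightarrow> nat \<Rightarrow> nat" where
  "hdeg H v = card {e \<in> H. v \<in> e}"

definition degseq :: "nat \<Rightarrow> nat set set \<Rightarrow> nat list" where
  "degseq n H = map (hdeg H) [0..<n]"

text \<open>Ground set Omega (degree sequences with nonnegative entries; sequences with a
  negative entry have probability 0 in both spaces).\<close>
definition Omega :: "nat \<Rightarrow> nat \<Rightarrow> nat \<Rightarrow> nat list set" where
  "Omega k n m = {d. length d = n \<and> sum_list d = k * m}"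

definition PrD :: "nat \<Rightarrow> nat \<Rightarrow> nat \<Rightarrow> nat list \<Rightarrow> real" where
  "PrD k n m d = real (card {H \<in> hypergraphs k n m. degseq n H = d}) / real (card (hypergraphs k n m))"

definition PrD_set :: "nat \<Rightarrow> nat \<Rightarrow> nat \<Rightarrow> nat list set \<Rightarrow> real" where
  "PrD_set k n m W = real (card {H \<in> hypergraphs k n m. degseq n H \<in> W}) / real (card (hypergraphs k n m))"

definition PrB :: "nat \<Rightarrow> nat \<Rightarrow> nat \<Rightarrow> nat list \<Rightarrow> real" where
  "PrB k n m d = (if d \<in> Omega k n m then
      (\<Prod>v<n. real (((n - 1) choose (k - 1)) choose (d ! v))) / real ((n * ((n - 1) choose (k - 1))) choose (k * m))
    else 0)"

definition PrB_set :: "nat \<Rightarrow> nat \<Rightarrow> nat \<Rightarrow> nat list set \<Rightarrow> real" where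
  "PrB_set k n m W = (\<Sum>d \<in> W \<inter> Omega k n m. PrB k n m d)"

end

theory Submission
  imports Defs "HOL-Real_Asymp.Real_Asymp"
begin

text \<open>Let \<open>p i d\<close> be the probability that \<open>d\<close> arises as the degree sequence of \<open>m - i\<close> uniformly random
  distinct edges together with \<open>k * i\<close> incidences chosen uniformly among the slots that these edges
  leave free. Then \<open>p m\<close> is the binomial model and \<open>p 0\<close> the random hypergraph, and \<open>p (i - 1)\<close> arises from
  \<open>p i\<close> by weighting each hypergraph \<open>G\<close> with a ratio \<open>T\<close>, essentially the sum over all non-edges \<open>e\<close> of
  the product of \<open>(d v - deg v) / (N - deg v)\<close> over \<open>v \<in> e\<close>. It suffices that each step changes \<open>p\<close> by a factor
  \<open>1 + \<epsilon> i\<close> with summable \<open>\<epsilon> i\<close>, up to additive errors of superpolynomially small total mass.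

  For large \<open>i\<close> the ratio \<open>T\<close> is concentrated for each typical \<open>G\<close>: expanding the products, the linear
  terms cancel because the total number of incidences is fixed, the quadratic ones are small because the
  codegrees of a random hypergraph are balanced, and the rest is a martingale; as \<open>T\<close> has mean one, it
  is concentrated at one. For small \<open>i\<close> this fails for individual \<open>G\<close>, but exchanging a vertex of an
  edge against a free incidence is an involution preserving the weights. It shows that, averaged over
  \<open>G\<close>, the edges carry their proportional share of the sum over all \<open>k\<close>-sets, which makes the averaged
  ratio close to one.\<close>

section \<open>Product binomial measures and sequential concentration\<close>

text \<open>Why the last steps resist a fixed \<open>G\<close>: for \<open>i = 1\<close> the ratio
  vanishes unless the \<open>k\<close> free incidences sit on distinct vertices forming a non-edge.
  It behaves like a multiple of an indicator and fluctuates by the edge density, which need not tend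
  to zero; only the average over all \<open>G\<close> compatible with \<open>d\<close> can be near
  one. Conversely, exchanges cannot serve all steps: their relative error contains the codegree
  error at every step and does not decay in \<open>i\<close>, while the number of steps may be
  almost as large as the number of \<open>k\<close>-sets. As \<open>m\<close> may be little more
  than \<open>sqrt n\<close>, most degrees may be zero and \<open>G\<close> itself far from regular.
  The main phase therefore looks at the complement, which keeps at least two thirds of all
  \<open>k\<close>-sets because \<open>m < M / k\<close> and \<open>3 \<le> k\<close>; this is why
  \<open>c = 1\<close> suffices. Fixing the total number of edges or incidences costs only a factor
  polynomial in that number, so concentration is proved for independent coordinates and then
  transferred.\<close>

definition Om :: "nat \<Rightarrow> nat \<Rightarrow> (nat \<Rightarrow> nat) set" where
  "Om n s = {\<delta>. (\<forall>v\<ge>n. \<delta> v = 0) \<and> (\<Sum>v<n. \<delta> v) = s}"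

text \<open>As in \<open>Om\<close>, vectors of length \<open>n\<close> are functions vanishing from
  \<open>n\<close> on, so that equality of functions is equality of vectors and
  \<open>\<delta>(n := j)\<close> appends a coordinate.\<close>

definition Dm :: "nat \<Rightarrow> (nat \<Rightarrow> nat) \<Rightarrow> (nat \<Rightarrow> nat) set" where
  "Dm n N = {\<delta>. (\<forall>v\<ge>n. \<delta> v = 0) \<and> (\<forall>v<n. \<delta> v \<le> N v)}"

lemma Dm_0 [simp]: "Dm 0 N = {\<lambda>_. 0}"
  by (auto simp: Dm_def)

lemma Dm_Suc: "bij_betw (\<lambda>(\<delta>, j). \<delta>(n := j)) (Dm n N \<times> {..N n}) (Dm (Suc n) N)"
  by (rule bij_betw_byWitness[where f' = "\<lambda>\<delta>. (\<delta>(n := 0), \<delta> n)"])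
     (auto simp: Dm_def fun_eq_iff less_Suc_eq split: if_splits)

lemma finite_Dm [simp, intro]: "finite (Dm n N)"
proof (induction n)
  case (Suc n)
  then show ?case using bij_betw_finite[OF Dm_Suc[of n N]] by simp
qed simp

lemma sum_Dm_Suc: "(\<Sum>\<delta>\<in>Dm (Suc n) N. f \<delta>) = (\<Sum>\<delta>\<in>Dm n N. \<Sum>j\<le>N n. f (\<delta>(n := j)))"
  unfolding sum.reindex_bij_betw[OF Dm_Suc, symmetric] sum.cartesian_product
  by (auto intro: sum.cong)

lemma Om_subset_Dm: "Om n s \<subseteq> Dm n (\<lambda>_. s)"
proof
  fix \<delta> assume d: "\<delta> \<in> Om n s"
  have "\<delta> v \<le> s" if "v < n" for v
    using member_le_sum[of v "{..<n}" \<delta>] that d by (auto simp: Om_def)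
  then show "\<delta> \<in> Dm n (\<lambda>_. s)" using d by (auto simp: Om_def Dm_def)
qed

lemma finite_Om [simp, intro]: "finite (Om n s)"
  by (rule finite_subset[OF Om_subset_Dm]) simp

lemma Om_Suc: "bij_betw (\<lambda>(j, \<delta>). \<delta>(n := j)) (SIGMA j:{..s}. Om n (s - j)) (Om (Suc n) s)"
  by (rule bij_betw_byWitness[where f' = "\<lambda>\<delta>. (\<delta> n, \<delta>(n := 0))"])
     (auto simp: Om_def fun_eq_iff less_Suc_eq split: if_splits)

lemma sum_Om_Suc:
  "(\<Sum>\<delta>\<in>Om (Suc n) s. f \<delta>) = (\<Sum>j\<le>s. \<Sum>\<delta>\<in>Om n (s - j). f (\<delta>(n := j)))"
proof -
  have "(\<Sum>\<delta>\<in>Om (Suc n) s. f \<delta>) = (\<Sum>z\<in>(SIGMA j:{..s}. Om n (s - j)). f (case z of (j, \<delta>) \<Rightarrow> \<delta>(n := j)))"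
    by (rule sum.reindex_bij_betw[OF Om_Suc, symmetric])
  also have "\<dots> = (\<Sum>j\<le>s. \<Sum>\<delta>\<in>Om n (s - j). f (\<delta>(n := j)))"
    by (subst sum.Sigma) (auto intro!: sum.cong)
  finally show ?thesis .
qed

text \<open>Choosing \<open>s\<close> elements from disjoint groups of sizes \<open>N v\<close> and
  recording the group counts: this is the normalising constant of the multivariate hypergeometric
  law.\<close>

lemma Om_vandermonde:
  "(\<Sum>\<delta>\<in>Om n s. \<Prod>v<n. (N v choose \<delta> v)) = ((\<Sum>v<n. N v) choose s)"
proof (induction n arbitrary: s)
  case 0
  have "Om 0 s = (if s = 0 then {\<lambda>_. 0} else {})" by (auto simp: Om_def)
  then show ?case by simp
next
  case (Suc n)
  have "(\<Sum>\<delta>\<in>Om (Suc n) s. \<Prod>v<Suc n. (N v choose \<delta> v))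
      = (\<Sum>j\<le>s. \<Sum>\<delta>\<in>Om n (s - j). (N n choose j) * (\<Prod>v<n. (N v choose \<delta> v)))"
    unfolding sum_Om_Suc by (intro sum.cong refl) (simp add: mult.commute)
  also have "\<dots> = (\<Sum>j\<le>s. (N n choose j) * ((\<Sum>v<n. N v) choose (s - j)))"
    by (simp add: sum_distrib_left[symmetric] Suc)
  also have "\<dots> = (N n + (\<Sum>v<n. N v)) choose s" by (simp add: vandermonde)
  finally show ?case by (simp add: add.commute)
qed

text \<open>The factor \<open>\<delta> v / N v\<close> removes one chosen element from the group \<open>v\<close>.\<close>

lemma Om_factor_moment:
  assumes e: "e \<subseteq> {..<n}" and N: "\<And>v. v \<in> e \<Longrightarrow> N v \<ge> 1" and s: "card e \<le> s"
  shows "(\<Sum>\<delta>\<in>Om n s. (\<Prod>v<n. real (N v choose \<delta> v)) * (\<Prod>v\<in>e. real (\<delta> v) / real (N v)))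
    = real (((\<Sum>v<n. N v) - card e) choose (s - card e))"
proof -
  define N' where "N' = (\<lambda>v. if v \<in> e then N v - 1 else N v)"
  have fe: "finite e" using e finite_subset by blast
  have card: "(\<Sum>v<n. if v \<in> e then 1 else 0) = card e"
    using e by (simp add: sum.If_cases Int_absorb1)
  have split: "(\<Prod>v<n. if v \<in> e then a v else b v) = (\<Prod>v\<in>e. a v) * (\<Prod>v\<in>{..<n} - e. b v)"
    for a b :: "nat \<Rightarrow> real"
    using e by (simp add: prod.If_cases Int_absorb1 Diff_eq)
  let ?P = "{\<delta>\<in>Om n s. \<forall>v\<in>e. \<delta> v \<ge> 1}"
  have "(\<Sum>\<delta>\<in>Om n s. (\<Prod>v<n. real (N v choose \<delta> v)) * (\<Prod>v\<in>e. real (\<delta> v) / real (N v)))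
     = (\<Sum>\<delta>\<in>?P. (\<Prod>v<n. real (N v choose \<delta> v)) * (\<Prod>v\<in>e. real (\<delta> v) / real (N v)))"
    by (intro sum.mono_neutral_right) (auto simp: fe not_less_eq_eq prod_zero_iff)
  also have "\<dots> = (\<Sum>\<delta>\<in>?P. \<Prod>v<n. real (N' v choose (\<delta> v - (if v \<in> e then 1 else 0))))"
  proof (intro sum.cong refl)
    fix \<delta> assume d: "\<delta> \<in> ?P"
    have eq: "real (N v choose \<delta> v) * (real (\<delta> v) / real (N v)) = real ((N v - 1) choose (\<delta> v - 1))"
      if v: "v \<in> e" for v
    proof -
      have "N v \<ge> 1" "\<delta> v \<ge> 1" using N[OF v] d v by auto
      then obtain a b where ab: "N v = Suc a" "\<delta> v = Suc b"
        by (metis One_nat_def Suc_le_D)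
      have "real (Suc b) * real (Suc a choose Suc b) = real (Suc a) * real (a choose b)"
        using Suc_times_binomial_eq[of a b] by (metis mult.commute of_nat_mult)
      then show ?thesis unfolding ab by (simp add: field_simps)
    qed
    have "(\<Prod>v<n. real (N v choose \<delta> v)) * (\<Prod>v\<in>e. real (\<delta> v) / real (N v))
       = (\<Prod>v\<in>e. real (N v choose \<delta> v)) * (\<Prod>v\<in>{..<n} - e. real (N v choose \<delta> v)) * (\<Prod>v\<in>e. real (\<delta> v) / real (N v))"
      using prod.subset_diff[OF e, of "\<lambda>v. real (N v choose \<delta> v)"] by (simp add: mult.commute)
    also have "\<dots> = (\<Prod>v\<in>e. real (N v choose \<delta> v) * (real (\<delta> v) / real (N v))) * (\<Prod>v\<in>{..<n} - e. real (N v choose \<delta> v))"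
      by (simp only: prod.distrib mult_ac)
    also have "\<dots> = (\<Prod>v<n. if v \<in> e then real ((N v - 1) choose (\<delta> v - 1)) else real (N v choose \<delta> v))"
      unfolding split by (simp only: eq cong: prod.cong)
    also have "\<dots> = (\<Prod>v<n. real (N' v choose (\<delta> v - (if v \<in> e then 1 else 0))))"
      by (intro prod.cong) (auto simp: N'_def)
    finally show "(\<Prod>v<n. real (N v choose \<delta> v)) * (\<Prod>v\<in>e. real (\<delta> v) / real (N v))
       = (\<Prod>v<n. real (N' v choose (\<delta> v - (if v \<in> e then 1 else 0))))" .
  qed
  also have "\<dots> = (\<Sum>\<delta>\<in>Om n (s - card e). \<Prod>v<n. real (N' v choose \<delta> v))"
  proof (rule sum.reindex_bij_witness[where j = "\<lambda>\<delta> v. \<delta> v - (if v \<in> e then 1 else 0)"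
        and i = "\<lambda>\<delta> v. \<delta> v + (if v \<in> e then 1 else 0)"])
    fix \<delta> assume d: "\<delta> \<in> ?P"
    then show "(\<lambda>v. \<delta> v - (if v \<in> e then 1 else 0) + (if v \<in> e then 1 else 0)) = \<delta>"
      by (auto simp: fun_eq_iff)
    have "(\<Sum>v<n. \<delta> v) = (\<Sum>v<n. (\<delta> v - (if v \<in> e then 1 else 0)) + (if v \<in> e then 1 else 0))"
      using d by (intro sum.cong) auto
    also have "\<dots> = (\<Sum>v<n. \<delta> v - (if v \<in> e then 1 else 0)) + card e"
      by (simp only: sum.distrib card)
    finally show "(\<lambda>v. \<delta> v - (if v \<in> e then 1 else 0)) \<in> Om n (s - card e)"
      using d by (auto simp: Om_def)
  next
    fix \<delta> assume d: "\<delta> \<in> Om n (s - card e)"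
    have "(\<Sum>v<n. \<delta> v + (if v \<in> e then 1 else 0)) = (\<Sum>v<n. \<delta> v) + card e"
      by (simp only: sum.distrib card)
    then show "(\<lambda>v. \<delta> v + (if v \<in> e then 1 else 0)) \<in> ?P"
      using d e s by (auto simp: Om_def)
  qed auto
  also have "\<dots> = real (\<Sum>\<delta>\<in>Om n (s - card e). \<Prod>v<n. (N' v choose \<delta> v))"
    by simp
  also have "\<dots> = real ((\<Sum>v<n. N' v) choose (s - card e))" by (simp only: Om_vandermonde)
  also have "(\<Sum>v<n. N' v) = (\<Sum>v<n. N v) - card e"
  proof -
    have "(\<Sum>v<n. N v) = (\<Sum>v<n. N' v + (if v \<in> e then 1 else 0))"
      by (intro sum.cong) (auto simp: N'_def dest!: N)
    also have "\<dots> = (\<Sum>v<n. N' v) + card e" by (simp only: sum.distrib card)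
    finally show ?thesis by simp
  qed
  finally show ?thesis .
qed

section \<open>Binomial laws and exponential tail bounds\<close>

definition bin :: "nat \<Rightarrow> real \<Rightarrow> nat \<Rightarrow> real" where
  "bin N x j = real (N choose j) * x ^ j * (1 - x) ^ (N - j)"

lemma bin_nonneg: "0 \<le> x \<Longrightarrow> x \<le> 1 \<Longrightarrow> 0 \<le> bin N x j"
  by (simp add: bin_def)

lemma bin_sum: "(\<Sum>j\<le>N. bin N x j) = 1"
  using binomial_ring[of x "1 - x" N] by (simp add: bin_def mult_ac)

text \<open>For \<open>l = - y\<close> with \<open>0 < y\<close> it follows from
  \<open>exp y \<ge> 1 + y\<close> and
  \<open>(1 - y + y\<^sup>2) * (1 + y) = 1 + y ^ 3 \<ge> 1\<close>.\<close>

lemma exp_le_quadratic: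
  fixes l :: real
  assumes "\<bar>l\<bar> \<le> 1"
  shows "exp l \<le> 1 + l + l\<^sup>2"
proof (cases "l \<ge> 0")
  case True then show ?thesis using exp_bound assms by auto
next
  case False
  define y where "y = - l"
  have y: "0 < y" "y \<le> 1" using False assms by (auto simp: y_def)
  have "1 + y \<le> exp y" by (rule exp_ge_add_one_self)
  then have "exp (- y) * (1 + y) \<le> 1" using y by (simp add: exp_minus field_simps)
  moreover have "1 \<le> (1 - y + y\<^sup>2) * (1 + y)" using y by (simp add: power2_eq_square algebra_simps)
  ultimately have "exp (- y) * (1 + y) \<le> (1 - y + y\<^sup>2) * (1 + y)" by linarith
  then show ?thesis using y by (simp add: y_def)
qed

text \<open>Restricting to \<open>\<bar>l\<bar> \<le> 1\<close> buys a variance proxy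
  \<open>x * N\<close> instead of \<open>N\<close>, which is what makes the bound useful at very
  small densities \<open>x\<close>.\<close>

lemma bin_mgf:
  assumes x: "0 \<le> x" "x \<le> 1" and l: "\<bar>l\<bar> \<le> 1"
  shows "(\<Sum>j\<le>N. bin N x j * exp (l * (real j - x * real N))) \<le> exp (l\<^sup>2 * (x * real N))"
proof -
  have "(\<Sum>j\<le>N. bin N x j * exp (l * (real j - x * real N)))
     = exp (- l * x * N) * (\<Sum>j\<le>N. real (N choose j) * (x * exp l) ^ j * (1 - x) ^ (N - j))"
    unfolding sum_distrib_left
    by (intro sum.cong refl)
       (simp add: bin_def power_mult_distrib exp_of_nat_mult[symmetric] algebra_simps exp_diff exp_minus exp_add field_simps)
  also have "\<dots> = exp (- l * x * N) * (x * exp l + (1 - x)) ^ N"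
    by (simp add: binomial_ring)
  also have "\<dots> \<le> exp (- l * x * N) * exp (x * (l + l\<^sup>2)) ^ N"
  proof (intro mult_left_mono power_mono)
    have "x * exp l + (1 - x) \<le> 1 + x * (l + l\<^sup>2)"
      using mult_left_mono[OF exp_le_quadratic[OF l] x(1)] by (simp add: algebra_simps)
    also have "\<dots> \<le> exp (x * (l + l\<^sup>2))" by (rule exp_ge_add_one_self)
    finally show "x * exp l + (1 - x) \<le> exp (x * (l + l\<^sup>2))" .
  qed (use x in auto)
  also have "\<dots> = exp (l\<^sup>2 * (x * real N))"
    by (simp add: exp_of_nat_mult[symmetric] exp_add[symmetric] algebra_simps)
  finally show ?thesis .
qed

definition ex :: "nat \<Rightarrow> (nat \<Rightarrow> nat) \<Rightarrow> real \<Rightarrow> ((nat \<Rightarrow> nat) \<Rightarrow> real) \<Rightarrow> real" where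
  "ex n N x f = (\<Sum>\<delta>\<in>Dm n N. (\<Prod>v<n. bin (N v) x (\<delta> v)) * f \<delta>)"

definition pr :: "nat \<Rightarrow> (nat \<Rightarrow> nat) \<Rightarrow> real \<Rightarrow> ((nat \<Rightarrow> nat) \<Rightarrow> bool) \<Rightarrow> real" where
  "pr n N x A = ex n N x (\<lambda>\<delta>. of_bool (A \<delta>))"

lemma ex_mono:
  assumes "0 \<le> x" "x \<le> 1" "\<And>\<delta>. \<delta> \<in> Dm n N \<Longrightarrow> f \<delta> \<le> g \<delta>"
  shows "ex n N x f \<le> ex n N x g"
  unfolding ex_def using assms by (intro sum_mono mult_left_mono prod_nonneg) (auto simp: bin_nonneg)

lemma ex_add: "ex n N x (\<lambda>\<delta>. f \<delta> + g \<delta>) = ex n N x f + ex n N x g"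
  by (simp add: ex_def algebra_simps sum.distrib)

lemma ex_cmult: "ex n N x (\<lambda>\<delta>. c * f \<delta>) = c * ex n N x f"
  by (simp add: ex_def sum_distrib_left mult_ac)

lemma pr_mono:
  assumes "0 \<le> x" "x \<le> 1" "\<And>\<delta>. \<delta> \<in> Dm n N \<Longrightarrow> A \<delta> \<Longrightarrow> B \<delta>"
  shows "pr n N x A \<le> pr n N x B"
  unfolding pr_def using assms by (intro ex_mono) auto

lemma pr_disj:
  assumes "0 \<le> x" "x \<le> 1"
  shows "pr n N x (\<lambda>\<delta>. A \<delta> \<or> B \<delta>) \<le> pr n N x A + pr n N x B"
  unfolding pr_def ex_add[symmetric] using assms by (intro ex_mono) auto

lemma pr_Union:
  assumes x: "0 \<le> x" "x \<le> 1" and fin: "finite I" and b: "\<And>i. i \<in> I \<Longrightarrow> pr n N x (A i) \<le> q"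
  shows "pr n N x (\<lambda>\<delta>. \<exists>i\<in>I. A i \<delta>) \<le> real (card I) * q"
  using fin b
proof (induction I)
  case empty then show ?case by (simp add: pr_def ex_def)
next
  case (insert i I)
  have "pr n N x (\<lambda>\<delta>. \<exists>i\<in>insert i I. A i \<delta>) \<le> pr n N x (A i) + pr n N x (\<lambda>\<delta>. \<exists>i\<in>I. A i \<delta>)"
    using pr_disj[OF x, of n N "A i" "\<lambda>\<delta>. \<exists>i\<in>I. A i \<delta>"] by simp
  then show ?case using insert by (fastforce simp: algebra_simps)
qed

text \<open>The martingale argument of Azuma: the function \<open>h t\<close> may depend on the
  coordinates before \<open>t\<close>, so summing over the last coordinate first leaves a constant
  factor \<open>exp (s n)\<close> and an expectation over one coordinate less.\<close>

lemma ex_mgf_seq: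
  assumes x: "0 \<le> x" "x \<le> 1"
    and pred: "\<And>t \<delta> \<delta>'. t < n \<Longrightarrow> (\<And>v. v < t \<Longrightarrow> \<delta> v = \<delta>' v) \<Longrightarrow> h t \<delta> = h t \<delta>'"
    and b: "\<And>t \<delta>. t < n \<Longrightarrow> (\<Sum>j\<le>N t. bin (N t) x j * exp (h t \<delta> j)) \<le> exp (s t)"
  shows "ex n N x (\<lambda>\<delta>. exp (\<Sum>t<n. h t \<delta> (\<delta> t))) \<le> exp (\<Sum>t<n. s t)"
  using pred b
proof (induction n)
  case 0 then show ?case by (simp add: ex_def)
next
  case (Suc n)
  have hu: "h t (\<delta>(n := j)) = h t \<delta>" if "t \<le> n" for t \<delta> j
    using that by (intro Suc.prems(1)) auto
  have pu: "(\<Prod>v<n. bin (N v) x ((\<delta>(n := j)) v)) = (\<Prod>v<n. bin (N v) x (\<delta> v))" for \<delta> j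
    by (intro prod.cong) auto
  have su: "(\<Sum>t<n. h t (\<delta>(n := j)) ((\<delta>(n := j)) t)) = (\<Sum>t<n. h t \<delta> (\<delta> t))" for \<delta> j
    by (intro sum.cong) (auto simp: hu)
  have "ex (Suc n) N x (\<lambda>\<delta>. exp (\<Sum>t<Suc n. h t \<delta> (\<delta> t)))
     = (\<Sum>\<delta>\<in>Dm n N. \<Sum>j\<le>N n. (\<Prod>v<n. bin (N v) x (\<delta> v)) * bin (N n) x j * (exp (\<Sum>t<n. h t \<delta> (\<delta> t)) * exp (h n \<delta> j)))"
    unfolding ex_def sum_Dm_Suc prod.lessThan_Suc sum.lessThan_Suc pu su
    by (simp add: hu exp_add)
  also have "\<dots> = (\<Sum>\<delta>\<in>Dm n N. ((\<Prod>v<n. bin (N v) x (\<delta> v)) * exp (\<Sum>t<n. h t \<delta> (\<delta> t))) * (\<Sum>j\<le>N n. bin (N n) x j * exp (h n \<delta> j)))"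
    by (simp add: sum_distrib_left mult_ac)
  also have "\<dots> \<le> (\<Sum>\<delta>\<in>Dm n N. ((\<Prod>v<n. bin (N v) x (\<delta> v)) * exp (\<Sum>t<n. h t \<delta> (\<delta> t))) * exp (s n))"
    using x Suc.prems(2) by (intro sum_mono mult_left_mono mult_nonneg_nonneg prod_nonneg) (auto simp: bin_nonneg)
  also have "\<dots> = ex n N x (\<lambda>\<delta>. exp (\<Sum>t<n. h t \<delta> (\<delta> t))) * exp (s n)"
    by (simp add: ex_def sum_distrib_right)
  also have "\<dots> \<le> exp (\<Sum>t<n. s t) * exp (s n)"
  proof (rule mult_right_mono)
    show "ex n N x (\<lambda>\<delta>. exp (\<Sum>t<n. h t \<delta> (\<delta> t))) \<le> exp (\<Sum>t<n. s t)"
      by (rule Suc.IH) (use Suc.prems less_SucI in blast)+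
  qed simp
  finally show ?case by (simp add: exp_add)
qed

text \<open>Markov's inequality for \<open>exp (l * S)\<close> and for \<open>exp (- l * S)\<close>,
  \<open>S\<close> being the sum of the increments; the factor two pays for the two sides.\<close>

lemma pr_seq_tail:
  assumes x: "0 \<le> x" "x \<le> 1" and l: "l > 0"
    and pred: "\<And>t \<delta> \<delta>'. t < n \<Longrightarrow> (\<And>v. v < t \<Longrightarrow> \<delta> v = \<delta>' v) \<Longrightarrow> h t \<delta> = h t \<delta>'"
    and b1: "\<And>t \<delta>. t < n \<Longrightarrow> (\<Sum>j\<le>N t. bin (N t) x j * exp (l * h t \<delta> j)) \<le> exp (s t)"
    and b2: "\<And>t \<delta>. t < n \<Longrightarrow> (\<Sum>j\<le>N t. bin (N t) x j * exp (- l * h t \<delta> j)) \<le> exp (s t)"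
  shows "pr n N x (\<lambda>\<delta>. \<tau> \<le> \<bar>\<Sum>t<n. h t \<delta> (\<delta> t)\<bar>) \<le> 2 * exp ((\<Sum>t<n. s t) - l * \<tau>)"
proof -
  have m: "ex n N x (\<lambda>\<delta>. exp (c * (\<Sum>t<n. h t \<delta> (\<delta> t)))) \<le> exp (\<Sum>t<n. s t)" if "c = l \<or> c = - l" for c
    unfolding sum_distrib_left
  proof (rule ex_mgf_seq[OF x, where h = "\<lambda>t \<delta> j. c * h t \<delta> j"])
    fix t :: nat and \<delta> \<delta>' :: "nat \<Rightarrow> nat"
    assume "t < n" "\<And>v. v < t \<Longrightarrow> \<delta> v = \<delta>' v"
    then show "(\<lambda>j. c * h t \<delta> j) = (\<lambda>j. c * h t \<delta>' j)" using pred[of t \<delta> \<delta>'] by simp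
  next
    fix t :: nat and \<delta> :: "nat \<Rightarrow> nat"
    assume "t < n"
    then show "(\<Sum>j\<le>N t. bin (N t) x j * exp (c * h t \<delta> j)) \<le> exp (s t)"
      using that b1[of t \<delta>] b2[of t \<delta>] by auto
  qed
  have "pr n N x (\<lambda>\<delta>. \<tau> \<le> \<bar>\<Sum>t<n. h t \<delta> (\<delta> t)\<bar>)
     \<le> ex n N x (\<lambda>\<delta>. exp (- l * \<tau>) * exp (l * (\<Sum>t<n. h t \<delta> (\<delta> t))) + exp (- l * \<tau>) * exp (- l * (\<Sum>t<n. h t \<delta> (\<delta> t))))"
    unfolding pr_def
  proof (intro ex_mono x)
    fix \<delta> let ?S = "\<Sum>t<n. h t \<delta> (\<delta> t)"
    show "of_bool (\<tau> \<le> \<bar>?S\<bar>) \<le> exp (- l * \<tau>) * exp (l * ?S) + exp (- l * \<tau>) * exp (- l * ?S)"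
    proof (cases "\<tau> \<le> \<bar>?S\<bar>")
      case True
      then have "\<tau> \<le> ?S \<or> \<tau> \<le> - ?S" by linarith
      then have "1 \<le> exp (- l * \<tau> + l * ?S) \<or> 1 \<le> exp (- l * \<tau> + - l * ?S)"
        using mult_left_mono[of \<tau> ?S l] mult_left_mono[of \<tau> "- ?S" l] l by auto
      then show ?thesis using True unfolding exp_add by (auto intro: add_increasing add_increasing2)
    qed auto
  qed
  also have "\<dots> = exp (- l * \<tau>) * (ex n N x (\<lambda>\<delta>. exp (l * (\<Sum>t<n. h t \<delta> (\<delta> t)))) + ex n N x (\<lambda>\<delta>. exp (- l * (\<Sum>t<n. h t \<delta> (\<delta> t)))))"
    by (simp only: ex_add ex_cmult distrib_left)
  also have "\<dots> \<le> exp (- l * \<tau>) * (exp (\<Sum>t<n. s t) + exp (\<Sum>t<n. s t))"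
    by (intro mult_left_mono add_mono m) auto
  also have "\<dots> = 2 * exp ((\<Sum>t<n. s t) - l * \<tau>)" by (simp add: exp_diff exp_minus field_simps)
  finally show ?thesis .
qed

text \<open>With \<open>x = s / S\<close> the probabilities increase up to \<open>s\<close> and
  decrease after it, so \<open>s\<close> is the mode. At least half of the mass lies in
  \<open>{0..2 * s}\<close> because the mean is \<open>s\<close>, hence the mode carries the average
  share of that half.\<close>

lemma bin_mode:
  assumes S: "0 < S" "s \<le> S"
  shows "bin S (real s / real S) s \<ge> 1 / (2 * (2 * real s + 1))"
proof (cases "s = S")
  case True then show ?thesis using S by (simp add: bin_def)
next
  case False
  define x where "x = real s / real S"
  have x: "0 \<le> x" "x < 1" using S False by (auto simp: x_def)
  have Sx: "real S * x = real s" using S by (simp add: x_def)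
  have step: "bin S x (Suc j) * (real (Suc j) * (1 - x)) = bin S x j * (real (S - j) * x)" if "j < S" for j
  proof -
    have a: "real (Suc j) * real (S choose Suc j) = real (S - j) * real (S choose j)"
      using binomial_absorb_comp[of S j] binomial_absorption[of j "S"]
      by (metis of_nat_mult)
    have b: "(1 - x) ^ (S - j) = (1 - x) ^ (S - Suc j) * (1 - x)"
      using that by (metis Suc_diff_Suc power_Suc2)
    have "bin S x (Suc j) * (real (Suc j) * (1 - x)) = (real (Suc j) * real (S choose Suc j)) * (x ^ j * x * ((1 - x) ^ (S - Suc j) * (1 - x)))"
      by (simp add: bin_def)
    also have "\<dots> = bin S x j * (real (S - j) * x)" unfolding a b[symmetric] by (simp add: bin_def)
    finally show ?thesis .
  qed
  have up: "bin S x j \<le> bin S x (Suc j)" if "Suc j \<le> s" for j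
  proof -
    have "real (Suc j) * (1 - x) \<le> real (S - j) * x"
      using that S x Sx by (simp add: of_nat_diff algebra_simps)
    then have "bin S x j * (real (Suc j) * (1 - x)) \<le> bin S x (Suc j) * (real (Suc j) * (1 - x))"
      using that S
      by (simp only: step[of j] Suc_le_lessD[of j] less_le_trans[of j s S]) (rule mult_left_mono, use x bin_nonneg[of x S j] in auto)
    then show ?thesis using x by (simp add: mult_le_cancel_right)
  qed
  have down: "bin S x (Suc j) \<le> bin S x j" if "s \<le> j" for j
  proof (cases "j < S")
    case True
    have "real j \<ge> real s" using that by simp
    then have "real (S - j) * x \<le> real (Suc j) * (1 - x)"
      using True S x Sx by (simp add: of_nat_diff algebra_simps)
    then have "bin S x (Suc j) * (real (Suc j) * (1 - x)) \<le> bin S x j * (real (Suc j) * (1 - x))"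
      unfolding step[OF True] by (intro mult_left_mono bin_nonneg) (use x in auto)
    then show ?thesis using x by (simp add: mult_le_cancel_right)
  next
    case False then show ?thesis using bin_nonneg[of x S j] x by (simp add: bin_def binomial_eq_0)
  qed
  have le: "bin S x j \<le> bin S x s" for j
  proof (cases "j \<le> s")
    case True then show ?thesis
      by (induction rule: inc_induct) (use up order_trans Suc_leI in \<open>blast+\<close>)
  next
    case False
    then have "s \<le> j" by simp
    then show ?thesis by (induction rule: dec_induct) (use down order_trans in \<open>blast+\<close>)
  qed
  have mean: "(\<Sum>j\<le>S. bin S x j * real j) = real s"
  proof -
    obtain S' where S': "S = Suc S'" using S by (cases S) auto
    have "(\<Sum>j\<le>S. bin S x j * real j) = (\<Sum>j\<le>S'. bin S x (Suc j) * real (Suc j))"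
      unfolding S' sum.atMost_Suc_shift by (simp add: S')
    also have "\<dots> = (\<Sum>j\<le>S'. real S * x * bin S' x j)"
    proof (intro sum.cong refl)
      fix j
      have "real (Suc j) * real (S choose Suc j) = real S * real (S' choose j)"
        unfolding S' by (metis Suc_times_binomial_eq mult.commute of_nat_mult)
      moreover have "bin S x (Suc j) * real (Suc j) = (real (Suc j) * real (S choose Suc j)) * (x * x ^ j * (1 - x) ^ (S' - j))"
        by (simp add: bin_def S' del: binomial_Suc_Suc of_nat_Suc)
      ultimately have "bin S x (Suc j) * real (Suc j) = (real S * real (S' choose j)) * (x * x ^ j * (1 - x) ^ (S' - j))"
        by simp
      then show "bin S x (Suc j) * real (Suc j) = real S * x * bin S' x j"
        by (simp add: bin_def)
    qed
    also have "\<dots> = real s" by (simp add: sum_distrib_left[symmetric] bin_sum Sx)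
    finally show ?thesis .
  qed
  \<comment> \<open>Markov's inequality: values beyond \<open>2 * s\<close> are at least
    \<open>2 * s + 1\<close>, while the mean is only \<open>s\<close>.\<close>
  have "(2 * real s + 1) * (\<Sum>j\<in>{..S} - {..(2 * s)}. bin S x j) \<le> (\<Sum>j\<in>{..S} - {..(2 * s)}. bin S x j * real j)"
    unfolding sum_distrib_left
  proof (rule sum_mono)
    fix j assume j: "j \<in> {..S} - {..(2 * s)}"
    have "2 * real s + 1 = real (2 * s + 1)" by simp
    also have "\<dots> \<le> real j" using j by (subst of_nat_le_iff) auto
    finally have "2 * real s + 1 \<le> real j" .
    then show "(2 * real s + 1) * bin S x j \<le> bin S x j * real j"
      using mult_right_mono[of "2 * real s + 1" "real j" "bin S x j"] bin_nonneg[of x S j] x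
      by (simp add: mult.commute)
  qed
  also have "\<dots> \<le> (\<Sum>j\<le>S. bin S x j * real j)"
    using x by (intro sum_mono2) (auto intro!: mult_nonneg_nonneg bin_nonneg)
  finally have t1: "(2 * real s + 1) * (\<Sum>j\<in>{..S} - {..(2 * s)}. bin S x j) \<le> real s" using mean by simp
  have "1 = (\<Sum>j\<le>S. bin S x j)" by (simp add: bin_sum)
  also have "\<dots> = (\<Sum>j\<in>{..S} - {..(2 * s)}. bin S x j) + (\<Sum>j\<in>{..S} \<inter> {..(2 * s)}. bin S x j)"
    by (subst sum.union_disjoint[symmetric]) (auto intro!: sum.cong)
  also have "(\<Sum>j\<in>{..S} \<inter> {..(2 * s)}. bin S x j) \<le> (\<Sum>j\<le>2 * s. bin S x j)"
    using x by (intro sum_mono2) (auto intro!: bin_nonneg)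
  also have "\<dots> \<le> real (card {..(2 * s)}) * bin S x s" by (intro sum_bounded_above le)
  finally have t2: "1 \<le> (\<Sum>j\<in>{..S} - {..(2 * s)}. bin S x j) + (2 * real s + 1) * bin S x s" by (simp add: algebra_simps)
  have "(2 * real s + 1) * (\<Sum>j\<in>{..S} - {..(2 * s)}. bin S x j) \<le> (2 * real s + 1) * (1/2)" by (rule order_trans[OF t1]) simp
  then have "(\<Sum>j\<in>{..S} - {..(2 * s)}. bin S x j) \<le> 1/2" by (rule mult_left_le_imp_le) simp
  then have "1/2 \<le> (2 * real s + 1) * bin S x s" using t2 by linarith
  then show ?thesis unfolding x_def[symmetric] by (simp add: field_simps)
qed

text \<open>On vectors of sum \<open>s\<close> the product of the binomial probabilities differs
  from the product of the \<open>choose\<close> terms only by the constant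
  \<open>x ^ s * (1 - x) ^ (S - s)\<close>. Conditioning on the sum thus costs the reciprocal of
  \<open>bin S x s\<close>, which \<open>bin_mode\<close> bounds at the optimal
  \<open>x\<close>.\<close>

lemma slice_transfer:
  assumes S: "S = (\<Sum>v<n. N v)" "0 < S" "s \<le> S"
  shows "(\<Sum>\<delta>\<in>Om n s. (\<Prod>v<n. real (N v choose \<delta> v)) * of_bool (A \<delta>))
    \<le> 2 * (2 * real s + 1) * real (S choose s) * pr n N (real s / real S) A"
proof -
  define x where "x = real s / real S"
  have x: "0 \<le> x" "x \<le> 1" using S(2,3) by (auto simp: x_def)
  let ?P = "{\<delta>\<in>Om n s. \<forall>v<n. \<delta> v \<le> N v}"
  define L where "L = (\<Sum>\<delta>\<in>Om n s. (\<Prod>v<n. real (N v choose \<delta> v)) * of_bool (A \<delta>))"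
  have L0: "L \<ge> 0" unfolding L_def by (intro sum_nonneg) (auto intro!: prod_nonneg)
  have Leq: "L = (\<Sum>\<delta>\<in>?P. (\<Prod>v<n. real (N v choose \<delta> v)) * of_bool (A \<delta>))"
    unfolding L_def by (intro sum.mono_neutral_right) (auto simp: not_le binomial_eq_0)
  have "L * (x ^ s * (1 - x) ^ (S - s)) = (\<Sum>\<delta>\<in>?P. (\<Prod>v<n. bin (N v) x (\<delta> v)) * of_bool (A \<delta>))"
    unfolding Leq sum_distrib_right
  proof (intro sum.cong refl)
    fix \<delta> assume d: "\<delta> \<in> ?P"
    have "(\<Prod>v<n. x ^ (\<delta> v)) = x ^ s" using d by (simp add: power_sum[symmetric] Om_def)
    moreover have "(\<Prod>v<n. (1 - x) ^ (N v - \<delta> v)) = (1 - x) ^ (S - s)"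
      using d sum_subtractf_nat[of "{..<n}" \<delta> N] unfolding S(1) by (simp add: power_sum[symmetric] Om_def)
    ultimately show "(\<Prod>v<n. real (N v choose \<delta> v)) * of_bool (A \<delta>) * (x ^ s * (1 - x) ^ (S - s))
       = (\<Prod>v<n. bin (N v) x (\<delta> v)) * of_bool (A \<delta>)"
      by (simp add: bin_def prod.distrib)
  qed
  also have "\<dots> \<le> pr n N x A" unfolding pr_def ex_def
    by (intro sum_mono2 finite_Dm) (auto simp: Dm_def Om_def intro!: mult_nonneg_nonneg prod_nonneg bin_nonneg x)
  finally have a: "L * (x ^ s * (1 - x) ^ (S - s)) \<le> pr n N x A" .
  have "1 \<le> 2 * (2 * real s + 1) * bin S x s"
    using bin_mode[OF S(2,3)] by (simp add: x_def field_simps)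
  then have "L \<le> L * (2 * (2 * real s + 1) * bin S x s)" using L0 by (metis mult_left_mono mult.right_neutral)
  also have "\<dots> = 2 * (2 * real s + 1) * real (S choose s) * (L * (x ^ s * (1 - x) ^ (S - s)))"
    by (simp add: bin_def mult_ac)
  also have "\<dots> \<le> 2 * (2 * real s + 1) * real (S choose s) * pr n N x A"
    by (intro mult_left_mono a) auto
  finally show ?thesis unfolding L_def x_def .
qed

section \<open>Interpolating between the two models\<close>

text \<open>A discrete Gronwall inequality run from the known end \<open>p m\<close> down to
  \<open>p 0\<close>: relative errors accumulate to at most the exponential of their sum, and that
  factor also bounds the amplification of the additive errors.\<close>

lemma gronwall_telescope:
  fixes p \<epsilon> \<beta> :: "nat \<Rightarrow> real"
  assumes "\<And>i. 1 \<le> i \<Longrightarrow> i \<le> m \<Longrightarrow> 0 \<le> \<epsilon> i" "\<And>i. 1 \<le> i \<Longrightarrow> i \<le> m \<Longrightarrow> 0 \<le> \<beta> i"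
    and "\<And>i. i \<le> m \<Longrightarrow> 0 \<le> p i"
    and "\<And>i. 1 \<le> i \<Longrightarrow> i \<le> m \<Longrightarrow> \<bar>p (i - 1) - p i\<bar> \<le> \<epsilon> i * p i + \<beta> i"
  shows "\<bar>p 0 - p m\<bar> \<le> (exp (\<Sum>i=1..m. \<epsilon> i) - 1) * p m + exp (\<Sum>i=1..m. \<epsilon> i) * (\<Sum>i=1..m. \<beta> i)"
  using assms
proof (induction m)
  case (Suc m)
  define A B E b where "A = exp (\<Sum>i=1..m. \<epsilon> i)" and "B = (\<Sum>i=1..m. \<beta> i)"
    and "E = \<epsilon> (Suc m)" and "b = \<beta> (Suc m)"
  have IH: "\<bar>p 0 - p m\<bar> \<le> (A - 1) * p m + A * B"
    unfolding A_def B_def by (rule Suc.IH) (use Suc.prems in auto)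
  have E: "0 \<le> E" "0 \<le> b" using Suc.prems(1)[of "Suc m"] Suc.prems(2)[of "Suc m"] by (auto simp: E_def b_def)
  have B: "0 \<le> B" unfolding B_def by (intro sum_nonneg) (use Suc.prems(2) in auto)
  have A: "1 \<le> A" unfolding A_def using sum_nonneg[of "{1..m}" \<epsilon>] Suc.prems(1) by auto
  have st: "\<bar>p m - p (Suc m)\<bar> \<le> E * p (Suc m) + b" using Suc.prems(4)[of "Suc m"] by (simp add: E_def b_def)
  have pm: "p m \<le> (1 + E) * p (Suc m) + b" using st by (simp add: algebra_simps)
  have p0: "0 \<le> p (Suc m)" using Suc.prems(3) by auto
  have "\<bar>p 0 - p (Suc m)\<bar> \<le> (A - 1) * p m + A * B + (E * p (Suc m) + b)" using IH st by linarith
  also have "\<dots> \<le> (A - 1) * ((1 + E) * p (Suc m) + b) + A * B + (E * p (Suc m) + b)"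
    using mult_left_mono[OF pm, of "A - 1"] A by linarith
  also have "\<dots> = (A * (1 + E) - 1) * p (Suc m) + A * (B + b)" by (simp add: algebra_simps)
  also have "\<dots> \<le> (A * exp E - 1) * p (Suc m) + A * exp E * (B + b)"
  proof (intro add_mono mult_right_mono)
    show "A * (1 + E) - 1 \<le> A * exp E - 1" using exp_ge_add_one_self[of E] A by simp
    show "A \<le> A * exp E" using E A by simp
  qed (use p0 B E in auto)
  also have "A * exp E = exp (\<Sum>i=1..Suc m. \<epsilon> i)" by (simp add: A_def E_def exp_add)
  also have "B + b = (\<Sum>i=1..Suc m. \<beta> i)" by (simp add: B_def b_def)
  finally show ?case .
qed simp

text \<open>Double counting of sets with a marked element: inserting \<open>e\<close> and removing
  it again are inverse, and a set of size \<open>Suc f\<close> has \<open>Suc f\<close> possible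
  marks.\<close>

lemma card_Suc_insert_sum:
  fixes F :: "'a set \<Rightarrow> real"
  assumes fin: "finite U"
  shows "(\<Sum>G | G \<subseteq> U \<and> card G = f. \<Sum>e\<in>U - G. F (insert e G)) = real (Suc f) * (\<Sum>G | G \<subseteq> U \<and> card G = Suc f. F G)"
proof -
  have fs: "finite {G. G \<subseteq> U \<and> card G = j}" for j
    using fin by (auto intro: finite_subset[of _ "Pow U"])
  have fG: "finite G" if "G \<subseteq> U" for G using that fin finite_subset by blast
  have "(\<Sum>G | G \<subseteq> U \<and> card G = f. \<Sum>e\<in>U - G. F (insert e G))
      = (\<Sum>(G, e)\<in>(SIGMA G:{G. G \<subseteq> U \<and> card G = f}. U - G). F (insert e G))"
    using fin fs by (subst sum.Sigma) auto
  also have "\<dots> = (\<Sum>(G, e)\<in>(SIGMA G:{G. G \<subseteq> U \<and> card G = Suc f}. G). F G)"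
    by (rule sum.reindex_bij_witness[where i = "\<lambda>(G, e). (G - {e}, e)" and j = "\<lambda>(G, e). (insert e G, e)"])
       (auto simp: fG card_insert_if card_Diff_singleton insert_absorb)
  also have "\<dots> = (\<Sum>G | G \<subseteq> U \<and> card G = Suc f. \<Sum>e\<in>G. F G)"
    using fG fs by (subst sum.Sigma) auto
  also have "\<dots> = real (Suc f) * (\<Sum>G | G \<subseteq> U \<and> card G = Suc f. F G)"
    by (auto simp: sum_distrib_left intro!: sum.cong)
  finally show ?thesis .
qed

section \<open>Slots, weights and the interpolating distributions\<close>

locale kgraph =
  fixes n k :: nat
  assumes k3: "3 \<le> k" and kn: "k < n"
begin

definition Es :: "nat set set" where "Es = {e. e \<subseteq> {0..<n} \<and> card e = k}"
definition M :: nat where "M = n choose k"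
definition N :: nat where "N = (n - 1) choose (k - 1)"
definition hg :: "nat \<Rightarrow> nat set set set" where "hg f = {G. G \<subseteq> Es \<and> card G = f}"
text \<open>A vertex owns one slot for every \<open>k\<close>-set through it. These are the slots
  not taken by \<open>G\<close>; the subtraction does not truncate for \<open>v < n\<close> because
  degrees are at most \<open>N\<close>.\<close>

definition nv :: "nat set set \<Rightarrow> nat \<Rightarrow> nat" where "nv G v = N - hdeg G v"

lemma hg_hypergraphs: "hg f = hypergraphs k n f"
  by (simp add: hg_def hypergraphs_def Es_def)

lemma finite_Es [simp, intro]: "finite Es"
  by (rule finite_subset[of _ "Pow {0..<n}"]) (auto simp: Es_def)

lemma finite_edge [intro]: "e \<in> Es \<Longrightarrow> finite e"
  using finite_subset[of e "{0..<n}"] by (auto simp: Es_def)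

lemma Es_subset: "G \<subseteq> Es \<Longrightarrow> finite G"
  using finite_subset by blast

lemma finite_hg [simp, intro]: "finite (hg f)"
  by (rule finite_subset[of _ "Pow Es"]) (auto simp: hg_def)

lemma hgD: "G \<in> hg f \<Longrightarrow> G \<subseteq> Es" "G \<in> hg f \<Longrightarrow> card G = f" "G \<in> hg f \<Longrightarrow> finite G"
  using Es_subset by (auto simp: hg_def)

lemma card_Es: "card Es = M"
  using n_subsets[of "{0..<n}" k] by (simp add: Es_def M_def)

lemma card_hg: "card (hg f) = M choose f"
  using n_subsets[of Es f] by (simp add: hg_def card_Es)

lemma card_superset:
  assumes A: "A \<subseteq> {0..<n}" "card A \<le> k"
  shows "card {e\<in>Es. A \<subseteq> e} = (n - card A) choose (k - card A)"
proof -
  have fA: "finite A" using A finite_subset by blast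
  have "bij_betw (\<lambda>e. e - A) {e\<in>Es. A \<subseteq> e} {e. e \<subseteq> {0..<n} - A \<and> card e = k - card A}"
  proof (rule bij_betw_byWitness[where f' = "\<lambda>e. e \<union> A"])
    show "(\<lambda>e. e - A) ` {e\<in>Es. A \<subseteq> e} \<subseteq> {e. e \<subseteq> {0..<n} - A \<and> card e = k - card A}"
      using fA by (auto simp: Es_def card_Diff_subset)
    show "(\<lambda>e. e \<union> A) ` {e. e \<subseteq> {0..<n} - A \<and> card e = k - card A} \<subseteq> {e\<in>Es. A \<subseteq> e}"
    proof clarify
      fix e assume e: "e \<subseteq> {0..<n} - A" "card e = k - card A"
      have "finite e" using e finite_subset by blast
      then have "card (e \<union> A) = card e + card A" using e fA by (intro card_Un_disjoint) auto
      then show "e \<union> A \<in> Es \<and> A \<subseteq> e \<union> A" using e A by (auto simp: Es_def)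
    qed
  qed auto
  then have "card {e\<in>Es. A \<subseteq> e} = card {e. e \<subseteq> {0..<n} - A \<and> card e = k - card A}"
    by (rule bij_betw_same_card)
  also have "\<dots> = card ({0..<n} - A) choose (k - card A)" by (rule n_subsets) simp
  finally show ?thesis using A fA by (simp add: card_Diff_subset)
qed

lemma card_star: "v < n \<Longrightarrow> card {e\<in>Es. v \<in> e} = N"
  using card_superset[of "{v}"] k3 by (simp add: N_def)

lemma hdeg_le: "G \<subseteq> Es \<Longrightarrow> v < n \<Longrightarrow> hdeg G v \<le> N"
  unfolding card_star[symmetric] hdeg_def by (intro card_mono) auto

lemma hdeg_outside: assumes "G \<subseteq> Es" "n \<le> v" shows "hdeg G v = 0"
proof -
  have "{e\<in>G. v \<in> e} = {}" using assms by (force simp: Es_def)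
  then show ?thesis by (simp only: hdeg_def card.empty)
qed

lemma nv_card: "G \<subseteq> Es \<Longrightarrow> v < n \<Longrightarrow> card {e\<in>Es - G. v \<in> e} = nv G v"
proof -
  assume G: "G \<subseteq> Es" and v: "v < n"
  have "{e\<in>Es - G. v \<in> e} = {e\<in>Es. v \<in> e} - {e\<in>G. v \<in> e}" using G by auto
  then show ?thesis using G v finite_subset[OF G]
    by (simp add: card_Diff_subset subset_iff card_star nv_def hdeg_def)
qed

lemma sum_card_mem:
  assumes "G \<subseteq> Es" shows "(\<Sum>v<n. card {e\<in>G. v \<in> e}) = k * card G"
proof -
  have fG: "finite G" using assms Es_subset by blast
  have "(\<Sum>v<n. card {e\<in>G. v \<in> e}) = (\<Sum>v<n. \<Sum>e\<in>G. if v \<in> e then 1 else 0)"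
    using fG by (simp add: sum.If_cases Int_def)
  also have "\<dots> = (\<Sum>e\<in>G. \<Sum>v<n. if v \<in> e then 1 else 0)" by (rule sum.swap)
  also have "\<dots> = (\<Sum>e\<in>G. k)"
  proof (intro sum.cong refl)
    fix e assume "e \<in> G"
    then have e: "e \<subseteq> {0..<n}" "card e = k" using assms by (auto simp: Es_def)
    then have "{..<n} \<inter> e = e" by auto
    then show "(\<Sum>v<n. if v \<in> e then 1 else 0) = k" using e by (simp add: sum.If_cases)
  qed
  finally show ?thesis by (simp add: mult.commute)
qed

lemma sum_hdeg: "G \<subseteq> Es \<Longrightarrow> (\<Sum>v<n. hdeg G v) = k * card G"
  unfolding hdeg_def by (rule sum_card_mem)

lemma nN: "n * N = k * M"
  using sum_card_mem[of Es] card_Es by (simp add: card_star)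

lemma sum_nv:
  assumes "G \<subseteq> Es" shows "(\<Sum>v<n. nv G v) = k * (M - card G)"
proof -
  have "(\<Sum>v<n. nv G v) = (\<Sum>v<n. card {e\<in>Es - G. v \<in> e})"
    using assms by (intro sum.cong refl nv_card[symmetric]) auto
  also have "\<dots> = k * card (Es - G)" by (rule sum_card_mem) auto
  also have "card (Es - G) = M - card G" using assms card_Es by (simp add: card_Diff_subset Es_subset)
  finally show ?thesis .
qed

lemma hdeg_insert:
  assumes "finite G" "e \<notin> G"
  shows "hdeg (insert e G) v = hdeg G v + (if v \<in> e then 1 else 0)"
proof -
  have "{e'\<in>insert e G. v \<in> e'} = (if v \<in> e then insert e {e'\<in>G. v \<in> e'} else {e'\<in>G. v \<in> e'})" by auto
  then show ?thesis using assms by (auto simp: hdeg_def)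
qed

text \<open>Given \<open>G\<close>, the missing incidences at \<open>v\<close> occupy a uniformly
  random subset of the free slots there, so this is the probability that a given free slot is
  occupied.\<close>

definition xx :: "nat set set \<Rightarrow> (nat \<Rightarrow> nat) \<Rightarrow> nat \<Rightarrow> real" where
  "xx G d v = real (d v - hdeg G v) / real (nv G v)"

text \<open>The number of slot choices that complete \<open>G\<close> to the degrees
  \<open>d\<close>. The value zero has to be forced when \<open>G\<close> exceeds \<open>d\<close>,
  since the truncated difference would give \<open>nv G v choose 0 = 1\<close>.\<close>

definition w :: "nat set set \<Rightarrow> (nat \<Rightarrow> nat) \<Rightarrow> real" where
  "w G d = (if \<forall>v<n. hdeg G v \<le> d v then \<Prod>v<n. real (nv G v choose (d v - hdeg G v)) else 0)"

lemma w_nonneg: "0 \<le> w G d"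
  by (auto simp: w_def intro!: prod_nonneg)

lemma xx_nonneg: "0 \<le> xx G d v"
  by (simp add: xx_def)

text \<open>At every vertex of \<open>e\<close> both a free slot and a missing incidence disappear,
  and \<open>(a choose b) * (b / a) = (a - 1) choose (b - 1)\<close>. If some vertex of
  \<open>e\<close> has nothing missing, both sides are zero.\<close>

lemma w_insert:
  assumes G: "G \<subseteq> Es" and e: "e \<in> Es - G"
  shows "w (insert e G) d = w G d * (\<Prod>v\<in>e. xx G d v)"
proof -
  have fG: "finite G" using G Es_subset by blast
  have hd: "hdeg (insert e G) v = hdeg G v + (if v \<in> e then 1 else 0)" for v
    using hdeg_insert[OF fG] e by auto
  have en: "e \<subseteq> {..<n}" using e by (auto simp: Es_def)
  have fe: "finite e" using e by auto
  show ?thesis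
  proof (cases "\<forall>v<n. hdeg (insert e G) v \<le> d v")
    case False
    then obtain v where v: "v < n" "d v < hdeg (insert e G) v" by (auto simp: not_le)
    have "w G d * (\<Prod>v\<in>e. xx G d v) = 0"
    proof (cases "\<forall>v<n. hdeg G v \<le> d v")
      case True
      then have "v \<in> e" "d v = hdeg G v" using v hd[of v] by (auto split: if_splits)
      then have "xx G d v = 0" by (simp add: xx_def)
      then show ?thesis using \<open>v \<in> e\<close> fe by auto
    next
      case False then show ?thesis by (auto simp: w_def)
    qed
    then show ?thesis using False by (auto simp: w_def)
  next
    case True
    have gle: "hdeg G v \<le> d v" if "v < n" for v using True that hd[of v] by (metis le_add1 le_trans)
    have f: "real (nv (insert e G) v choose (d v - hdeg (insert e G) v)) = real (nv G v choose (d v - hdeg G v)) * xx G d v"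
      if v: "v \<in> e" for v
    proof -
      have vn: "v < n" using v en by auto
      have "d v - hdeg G v \<ge> 1" using True vn hd[of v] v by (auto dest!: spec[of _ v])
      then obtain b where b: "d v - hdeg G v = Suc b" by (metis One_nat_def Suc_le_D)
      have "card {e'\<in>Es - G. v \<in> e'} \<ge> 1" using e v
        by (metis (mono_tags, lifting) One_nat_def Suc_leI card_gt_0_iff empty_iff finite_Diff finite_Es finite_subset mem_Collect_eq subsetI)
      then have "nv G v \<ge> 1" using nv_card[OF G vn] by simp
      then obtain a where a: "nv G v = Suc a" by (metis One_nat_def Suc_le_D)
      have a': "nv (insert e G) v = a" using a hd[of v] v by (simp add: nv_def)
      have b': "d v - hdeg (insert e G) v = b" using b hd[of v] v by simp
      have "real (Suc b) * real (Suc a choose Suc b) = real (Suc a) * real (a choose b)"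
        using Suc_times_binomial_eq[of a b] by (metis mult.commute of_nat_mult)
      then show ?thesis unfolding xx_def a b a' b' by (simp add: field_simps)
    qed
    have g: "real (nv (insert e G) v choose (d v - hdeg (insert e G) v)) = real (nv G v choose (d v - hdeg G v))"
      if "v \<notin> e" for v using that by (simp add: nv_def hd)
    have "w (insert e G) d = (\<Prod>v\<in>{..<n} - e. real (nv G v choose (d v - hdeg G v))) * (\<Prod>v\<in>e. real (nv G v choose (d v - hdeg G v)) * xx G d v)"
    proof -
      have "(\<Prod>v\<in>{..<n} - e. real (nv (insert e G) v choose (d v - hdeg (insert e G) v)))
          = (\<Prod>v\<in>{..<n} - e. real (nv G v choose (d v - hdeg G v)))" by (intro prod.cong refl g) auto
      moreover have "(\<Prod>v\<in>e. real (nv (insert e G) v choose (d v - hdeg (insert e G) v)))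
          = (\<Prod>v\<in>e. real (nv G v choose (d v - hdeg G v)) * xx G d v)" by (intro prod.cong refl f)
      ultimately show ?thesis
        using prod.subset_diff[OF en, of "\<lambda>v. real (nv (insert e G) v choose (d v - hdeg (insert e G) v))"]
        unfolding w_def if_P[OF True] by simp
    qed
    also have "\<dots> = w G d * (\<Prod>v\<in>e. xx G d v)"
      using gle prod.subset_diff[OF en, of "\<lambda>v. real (nv G v choose (d v - hdeg G v))"]
      by (simp add: w_def prod.distrib)
    finally show ?thesis .
  qed
qed

lemma sum_w_Suc:
  "real (Suc f) * (\<Sum>G\<in>hg (Suc f). w G d) = (\<Sum>G\<in>hg f. w G d * (\<Sum>e\<in>Es - G. \<Prod>v\<in>e. xx G d v))"
proof -
  have "real (Suc f) * (\<Sum>G\<in>hg (Suc f). w G d) = (\<Sum>G\<in>hg f. \<Sum>e\<in>Es - G. w (insert e G) d)"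
    unfolding hg_def using card_Suc_insert_sum[OF finite_Es, where f = f and F = "\<lambda>G. w G d"] by simp
  also have "\<dots> = (\<Sum>G\<in>hg f. \<Sum>e\<in>Es - G. w G d * (\<Prod>v\<in>e. xx G d v))"
    by (intro sum.cong refl w_insert) (auto simp: hg_def)
  finally show ?thesis by (simp add: sum_distrib_left)
qed

text \<open>The number of pairs of an edge set of size \<open>m - i\<close> and a set of
  \<open>k * i\<close> free slots. Whichever edges are taken, \<open>k * (M - (m - i))\<close> slots
  remain free.\<close>

definition Z :: "nat \<Rightarrow> nat \<Rightarrow> real" where
  "Z m i = real (M choose (m - i)) * real ((k * (M - (m - i))) choose (k * i))"

text \<open>The probability of \<open>d\<close> as the degree sequence of \<open>m - i\<close> random edges together with
  \<open>k * i\<close> random free incidences: \<open>p m m\<close> is the binomial model, \<open>p m 0\<close> is the degree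
  sequence of the random hypergraph.\<close>

definition p :: "nat \<Rightarrow> nat \<Rightarrow> (nat \<Rightarrow> nat) \<Rightarrow> real" where
  "p m i d = (\<Sum>G\<in>hg (m - i). w G d) / Z m i"

text \<open>The reciprocal of the mean of the edge sum in \<open>T\<close>: each of the
  \<open>K\<close> non-edges has mean product
  \<open>((k * K - k) choose (k * i - k)) / ((k * K) choose (k * i))\<close>. So \<open>T\<close>
  has mean one under a random choice of free slots.\<close>

definition cT :: "nat \<Rightarrow> nat \<Rightarrow> real" where
  "cT K i = real ((k * K) choose (k * i)) / (real K * real ((k * K - k) choose (k * i - k)))"

definition T :: "nat set set \<Rightarrow> (nat \<Rightarrow> nat) \<Rightarrow> nat \<Rightarrow> real" where
  "T G d i = cT (M - card G) i * (\<Sum>e\<in>Es - G. \<Prod>v\<in>e. xx G d v)"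

lemma p_nonneg: "0 \<le> p m i d"
  unfolding p_def Z_def by (intro divide_nonneg_nonneg sum_nonneg w_nonneg) auto

lemma Z_pos: assumes "i \<le> m" "m \<le> M" shows "0 < Z m i"
proof -
  have "m - i \<le> M" "k * i \<le> k * (M - (m - i))" using assms by auto
  then show ?thesis unfolding Z_def by (metis mult_pos_pos of_nat_0_less_iff zero_less_binomial)
qed

text \<open>Counting hypergraphs with one marked edge produces the factor \<open>Suc f\<close> on
  the side of \<open>p m (i - 1)\<close>; the quotient of the normalisers absorbs it and leaves
  exactly \<open>cT\<close>.\<close>

lemma p_rec:
  assumes i: "1 \<le> i" "i \<le> m" and m: "m \<le> M"
  shows "p m (i - 1) d = (\<Sum>G\<in>hg (m - i). w G d / Z m i * T G d i)"
proof -
  define f K where "f = m - i" and "K = M - f"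
  have K: "1 \<le> K" "f + K = M" "i \<le> K" using i m by (auto simp: f_def K_def)
  have f1: "m - (i - 1) = Suc f" using i by (simp add: f_def)
  have "real (Suc f) * real (M choose Suc f) = real K * real (M choose f)"
    using binomial_absorb_comp[of M f] binomial_absorption[of f M] K_def by (metis of_nat_mult)
  moreover have e: "k * (M - Suc f) = k * K - k" "k * (i - 1) = k * i - k" by (auto simp: K_def algebra_simps)
  have pos: "real ((k * K) choose (k * i)) \<noteq> 0" "real ((k * K - k) choose (k * i - k)) \<noteq> 0"
  proof -
    have "k * i \<le> k * K" using K by simp
    then show "real ((k * K) choose (k * i)) \<noteq> 0" "real ((k * K - k) choose (k * i - k)) \<noteq> 0"
      using diff_le_mono[of "k * i" "k * K" k] zero_less_binomial[of "k * i" "k * K"]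
        zero_less_binomial[of "k * i - k" "k * K - k"] by linarith+
  qed
  have "Z m (i - 1) = real (M choose Suc f) * real ((k * K - k) choose (k * i - k))"
    unfolding Z_def f1 e ..
  moreover have "Z m i = real (M choose f) * real ((k * K) choose (k * i))"
    unfolding Z_def f_def[symmetric] K_def[symmetric] ..
  ultimately have Zr: "real (Suc f) * Z m (i - 1) = Z m i / cT K i"
    using K pos by (simp add: cT_def del: of_nat_Suc)
  have c0: "cT K i \<noteq> 0" using K pos by (simp add: cT_def)
  have "i - 1 \<le> m" using i by simp
  then have Zp: "Z m (i - 1) \<noteq> 0" "Z m i \<noteq> 0" using Z_pos[of "i - 1" m] Z_pos[of i m] i m by auto
  have "p m (i - 1) d = (real (Suc f) * (\<Sum>G\<in>hg (Suc f). w G d)) / (real (Suc f) * Z m (i - 1))"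
    unfolding p_def f1 by (simp del: of_nat_Suc)
  also have "\<dots> = (\<Sum>G\<in>hg f. w G d * (\<Sum>e\<in>Es - G. \<Prod>v\<in>e. xx G d v)) / (Z m i / cT K i)"
    unfolding sum_w_Suc Zr ..
  also have "\<dots> = (\<Sum>G\<in>hg f. w G d / Z m i * T G d i)"
    unfolding sum_divide_distrib T_def using Zp c0
    by (intro sum.cong refl) (auto simp: hgD(2) K_def)
  finally show ?thesis by (simp add: f_def)
qed

text \<open>Passing from total degrees to missing incidences turns \<open>w\<close> into the
  hypergeometric weight on a slice, to which \<open>Om_factor_moment\<close> and
  \<open>slice_transfer\<close> apply.\<close>

lemma sum_Om_w:
  assumes G: "G \<in> hg f" and f: "f \<le> m"
  shows "(\<Sum>d\<in>Om n (k * m). w G d * \<phi> d)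
    = (\<Sum>\<delta>\<in>Om n (k * (m - f)). (\<Prod>v<n. real (nv G v choose \<delta> v)) * \<phi> (\<lambda>v. \<delta> v + hdeg G v))"
proof -
  let ?P = "{d\<in>Om n (k * m). \<forall>v<n. hdeg G v \<le> d v}"
  note GE = hgD(1)[OF G]
  have sd: "(\<Sum>v<n. hdeg G v) = k * f" using sum_hdeg[OF GE] hgD(2)[OF G] by simp
  have "(\<Sum>d\<in>Om n (k * m). w G d * \<phi> d) = (\<Sum>d\<in>?P. w G d * \<phi> d)"
    by (intro sum.mono_neutral_right) (auto simp: w_def)
  also have "\<dots> = (\<Sum>\<delta>\<in>Om n (k * (m - f)). (\<Prod>v<n. real (nv G v choose \<delta> v)) * \<phi> (\<lambda>v. \<delta> v + hdeg G v))"
  proof (rule sum.reindex_bij_witness[where i = "\<lambda>\<delta> v. \<delta> v + hdeg G v" and j = "\<lambda>d v. d v - hdeg G v"])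
    fix d assume d: "d \<in> ?P"
    have le: "hdeg G v \<le> d v" for v using d hdeg_outside[OF GE, of v] by (cases "v < n") auto
    then show "(\<lambda>v. d v - hdeg G v + hdeg G v) = d" by auto
    show "(\<lambda>v. d v - hdeg G v) \<in> Om n (k * (m - f))"
      using d sum_subtractf_nat[of "{..<n}" "hdeg G" d] sd by (auto simp: Om_def diff_mult_distrib2)
    show "(\<Prod>v<n. real (nv G v choose (d v - hdeg G v))) * \<phi> (\<lambda>v. d v - hdeg G v + hdeg G v) = w G d * \<phi> d"
      using d le by (simp add: w_def)
  next
    fix \<delta> assume d: "\<delta> \<in> Om n (k * (m - f))"
    then show "(\<lambda>v. \<delta> v + hdeg G v) \<in> ?P"
      using hdeg_outside[OF GE] sd f by (auto simp: Om_def sum.distrib algebra_simps diff_mult_distrib2)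
  qed auto
  finally show ?thesis .
qed

section \<open>Identification of the two ends of the interpolation\<close>

definition ext :: "nat list \<Rightarrow> nat \<Rightarrow> nat" where
  "ext d v = (if v < n then d ! v else 0)"

lemma bij_ext: "bij_betw ext (Omega k n m) (Om n (k * m))"
proof (rule bij_betw_byWitness[where f' = "\<lambda>\<delta>. map \<delta> [0..<n]"])
  show "\<forall>d\<in>Omega k n m. map (ext d) [0..<n] = d"
  proof
    fix d assume "d \<in> Omega k n m"
    then have "length d = n" by (simp add: Omega_def)
    then show "map (ext d) [0..<n] = d" by (intro nth_equalityI) (simp_all add: ext_def)
  qed
  show "\<forall>\<delta>\<in>Om n (k * m). ext (map \<delta> [0..<n]) = \<delta>"
    by (auto simp: Om_def ext_def fun_eq_iff)
  show "ext ` Omega k n m \<subseteq> Om n (k * m)"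
  proof clarify
    fix d assume "d \<in> Omega k n m"
    then have "length d = n" "(\<Sum>v<n. d ! v) = k * m"
      by (auto simp: Omega_def sum_list_sum_nth atLeast0LessThan)
    then show "ext d \<in> Om n (k * m)" by (auto simp: Om_def ext_def)
  qed
  show "(\<lambda>\<delta>. map \<delta> [0..<n]) ` Om n (k * m) \<subseteq> Omega k n m"
    by (auto simp: Omega_def Om_def sum_list_sum_nth atLeast0LessThan)
qed

lemma finite_Omega: "finite (Omega k n m)"
  using bij_betw_finite[OF bij_ext] by simp

lemma p_m: assumes "d \<in> Omega k n m" shows "p m m (ext d) = PrB k n m d"
proof -
  have "hg 0 = {{}}" using finite_Es by (auto simp: hg_def dest: finite_subset)
  then show ?thesis using assms nN
    by (simp add: p_def Z_def PrB_def w_def hdeg_def nv_def ext_def N_def)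
qed

text \<open>With no free incidences, \<open>hdeg G v \<le> d v\<close> for all \<open>v\<close>
  together with equal sums forces equality, so \<open>w\<close> is the indicator of the degree
  sequence.\<close>

lemma p_0: assumes d: "d \<in> Omega k n m" and m: "m \<le> M" shows "p m 0 (ext d) = PrD k n m d"
proof -
  have Z0: "Z m 0 = real (M choose m)" by (simp add: Z_def)
  have deq: "(degseq n H = d) \<longleftrightarrow> (\<forall>v<n. hdeg H v = d ! v)" for H
    using d by (auto simp: degseq_def Omega_def list_eq_iff_nth_eq)
  have "w G (ext d) = of_bool (degseq n G = d)" if G: "G \<in> hg m" for G
  proof (cases "\<forall>v<n. hdeg G v \<le> ext d v")
    case True
    have s: "(\<Sum>v<n. hdeg G v) = (\<Sum>v<n. ext d v)"
      using sum_hdeg[OF hgD(1)[OF G]] hgD(2)[OF G] bij_betwE[OF bij_ext] d by (auto simp: Om_def)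
    have "hdeg G v = ext d v" if "v < n" for v
      using sum_mono_inv[OF s _ _ finite_lessThan, of v] True that by auto
    then show ?thesis unfolding deq by (simp add: w_def ext_def)
  next
    case False
    then have "\<not> (degseq n G = d)" unfolding deq by (force simp: ext_def)
    moreover have "w G (ext d) = 0" unfolding w_def by (rule if_not_P[OF False])
    ultimately show ?thesis by simp
  qed
  then have "(\<Sum>G\<in>hg m. w G (ext d)) = (\<Sum>G\<in>hg m. of_bool (degseq n G = d))" by simp
  also have "\<dots> = real (card {H\<in>hg m. degseq n H = d})"
    by (simp add: of_bool_def sum.If_cases Int_def)
  finally show ?thesis by (simp add: p_def Z0 PrD_def hg_hypergraphs[symmetric] card_hg)
qed

lemma degseq_Omega: assumes "H \<in> hypergraphs k n m" shows "degseq n H \<in> Omega k n m"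
  using assms sum_hdeg[of H] unfolding hg_hypergraphs[symmetric]
  by (auto simp: hg_def degseq_def Omega_def sum_list_sum_nth atLeast0LessThan)

lemma PrD_set_eq: assumes "W \<subseteq> Omega k n m" shows "PrD_set k n m W = (\<Sum>d\<in>W. PrD k n m d)"
proof -
  have fW: "finite W" using assms finite_Omega finite_subset by blast
  have "{H \<in> hypergraphs k n m. degseq n H \<in> W} = (\<Union>d\<in>W. {H \<in> hypergraphs k n m. degseq n H = d})" by auto
  also have "card \<dots> = (\<Sum>d\<in>W. card {H \<in> hypergraphs k n m. degseq n H = d})"
    using fW finite_hg[of m] unfolding hg_hypergraphs by (intro card_UN_disjoint) auto
  finally show ?thesis by (simp add: PrD_set_def PrD_def sum_divide_distrib)
qed

lemma sum_PrD: assumes "m \<le> M" shows "(\<Sum>d\<in>Omega k n m. PrD k n m d) = 1"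
proof -
  have "{H \<in> hypergraphs k n m. degseq n H \<in> Omega k n m} = hypergraphs k n m"
    using degseq_Omega by auto
  then show ?thesis using assms card_hg[of m]
    unfolding PrD_set_eq[OF order_refl, symmetric] PrD_set_def hg_hypergraphs by simp
qed

lemma sum_PrB: assumes "m \<le> M" shows "(\<Sum>d\<in>Omega k n m. PrB k n m d) = 1"
proof -
  have "(\<Sum>d\<in>Omega k n m. PrB k n m d) = (\<Sum>d\<in>Omega k n m. (\<Prod>v<n. real (N choose (ext d v))) / real ((n * N) choose (k * m)))"
    by (intro sum.cong refl) (auto simp: PrB_def N_def ext_def)
  also have "\<dots> = (\<Sum>\<delta>\<in>Om n (k * m). (\<Prod>v<n. real (N choose (\<delta> v))) / real ((n * N) choose (k * m)))"
    by (rule sum.reindex_bij_betw[OF bij_ext])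
  also have "\<dots> = real (\<Sum>\<delta>\<in>Om n (k * m). \<Prod>v<n. (N choose (\<delta> v))) / real ((n * N) choose (k * m))"
    by (simp add: sum_divide_distrib)
  also have "\<dots> = 1" unfolding Om_vandermonde using assms nN by simp
  finally show ?thesis .
qed

lemma PrB_nonneg: "0 \<le> PrB k n m d"
  by (auto simp: PrB_def intro!: prod_nonneg divide_nonneg_nonneg)

text \<open>The exceptional set collects the sequences where the accumulated error \<open>\<beta>\<close> is not
  negligible; its probability in the hypergraph model is bounded through the telescoped estimate itself.\<close>

lemma good_set_exists:
  assumes m: "m \<le> M" and \<tau>: "0 < \<tau>" and s: "s \<le> 1"
    and eps: "\<And>i. 1 \<le> i \<Longrightarrow> i \<le> m \<Longrightarrow> 0 \<le> \<epsilon> i" "(\<Sum>i=1..m. \<epsilon> i) \<le> s"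
    and beta: "\<And>i d. 1 \<le> i \<Longrightarrow> i \<le> m \<Longrightarrow> 0 \<le> \<beta> i d" "(\<Sum>i=1..m. \<Sum>d\<in>Om n (k * m). \<beta> i d) \<le> \<tau>"
    and step: "\<And>i d. 1 \<le> i \<Longrightarrow> i \<le> m \<Longrightarrow> d \<in> Om n (k * m) \<Longrightarrow> \<bar>p m (i - 1) d - p m i d\<bar> \<le> \<epsilon> i * p m i d + \<beta> i d"
  shows "\<exists>W. PrB_set k n m W \<ge> 1 - sqrt \<tau> \<and> PrD_set k n m W \<ge> 1 - 3 * (sqrt \<tau> + \<tau>)
    \<and> (\<forall>d\<in>W. \<bar>PrD k n m d - PrB k n m d\<bar> \<le> (exp s - 1 + 3 * sqrt \<tau>) * PrB k n m d)"
proof -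
  define B where "B d = (\<Sum>i=1..m. \<beta> i (ext d))" for d
  define W where "W = {d\<in>Omega k n m. B d \<le> sqrt \<tau> * PrB k n m d}"
  have B0: "0 \<le> B d" for d unfolding B_def by (intro sum_nonneg beta) auto
  have sB: "(\<Sum>d\<in>Omega k n m. B d) \<le> \<tau>"
  proof -
    have "(\<Sum>d\<in>Omega k n m. B d) = (\<Sum>\<delta>\<in>Om n (k * m). \<Sum>i=1..m. \<beta> i \<delta>)"
      unfolding B_def by (rule sum.reindex_bij_betw[OF bij_ext])
    also have "\<dots> = (\<Sum>i=1..m. \<Sum>d\<in>Om n (k * m). \<beta> i d)" by (rule sum.swap)
    finally show ?thesis using beta by simp
  qed
  have es: "exp (\<Sum>i=1..m. \<epsilon> i) \<le> exp s" using eps by simp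
  have e3: "exp s \<le> 3" using s exp_le order_trans[of "exp s" "exp 1" 3] by auto
  have dif: "\<bar>PrD k n m d - PrB k n m d\<bar> \<le> (exp s - 1) * PrB k n m d + 3 * B d" if d: "d \<in> Omega k n m" for d
  proof -
    have dO: "ext d \<in> Om n (k * m)" using bij_betwE[OF bij_ext] d by auto
    have "\<bar>p m 0 (ext d) - p m m (ext d)\<bar> \<le> (exp (\<Sum>i=1..m. \<epsilon> i) - 1) * p m m (ext d) + exp (\<Sum>i=1..m. \<epsilon> i) * B d"
      unfolding B_def by (rule gronwall_telescope) (use eps beta step dO p_nonneg in auto)
    also have "\<dots> \<le> (exp s - 1) * p m m (ext d) + 3 * B d"
      using es order_trans[OF es e3] B0 p_nonneg by (intro add_mono mult_right_mono) auto
    finally show ?thesis using p_0[OF d m] p_m[OF d] by simp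
  qed
  \<comment> \<open>Markov's inequality: off \<open>W\<close> the error exceeds
    \<open>sqrt \<tau> * PrB\<close>, and its total is at most \<open>\<tau>\<close>.\<close>
  have PB: "(\<Sum>d\<in>Omega k n m - W. PrB k n m d) \<le> sqrt \<tau>"
  proof -
    have "sqrt \<tau> * (\<Sum>d\<in>Omega k n m - W. PrB k n m d) \<le> (\<Sum>d\<in>Omega k n m - W. B d)"
      unfolding sum_distrib_left by (intro sum_mono) (auto simp: W_def)
    also have "\<dots> \<le> (\<Sum>d\<in>Omega k n m. B d)" using B0 finite_Omega by (intro sum_mono2) auto
    also have "\<dots> \<le> sqrt \<tau> * sqrt \<tau>" using sB \<tau> by simp
    finally show ?thesis by (rule mult_left_le_imp_le) (use \<tau> in simp)
  qed
  have WO: "W \<subseteq> Omega k n m" by (auto simp: W_def)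
  have "PrB_set k n m W = (\<Sum>d\<in>Omega k n m. PrB k n m d) - (\<Sum>d\<in>Omega k n m - W. PrB k n m d)"
    unfolding PrB_set_def using WO by (simp add: Int_absorb2 sum_diff finite_Omega)
  then have 1: "PrB_set k n m W \<ge> 1 - sqrt \<tau>" using PB sum_PrB[OF m] by simp
  have PD: "(\<Sum>d\<in>Omega k n m - W. PrD k n m d) \<le> 3 * (sqrt \<tau> + \<tau>)"
  proof -
    have "(\<Sum>d\<in>Omega k n m - W. PrD k n m d) \<le> (\<Sum>d\<in>Omega k n m - W. 3 * PrB k n m d + 3 * B d)"
    proof (intro sum_mono)
      fix d assume "d \<in> Omega k n m - W"
      then have "PrD k n m d \<le> exp s * PrB k n m d + 3 * B d" using dif[of d] by (simp add: algebra_simps abs_le_iff)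
      also have "\<dots> \<le> 3 * PrB k n m d + 3 * B d" using e3 PrB_nonneg by (simp add: mult_right_mono)
      finally show "PrD k n m d \<le> 3 * PrB k n m d + 3 * B d" .
    qed
    also have "\<dots> = 3 * (\<Sum>d\<in>Omega k n m - W. PrB k n m d) + 3 * (\<Sum>d\<in>Omega k n m - W. B d)"
      by (simp add: sum.distrib sum_distrib_left)
    also have "(\<Sum>d\<in>Omega k n m - W. B d) \<le> (\<Sum>d\<in>Omega k n m. B d)" using B0 finite_Omega by (intro sum_mono2) auto
    finally show ?thesis using PB sB by simp
  qed
  have "PrD_set k n m W = (\<Sum>d\<in>Omega k n m. PrD k n m d) - (\<Sum>d\<in>Omega k n m - W. PrD k n m d)"
    unfolding PrD_set_eq[OF WO] using WO by (simp add: sum_diff finite_Omega)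
  then have 2: "PrD_set k n m W \<ge> 1 - 3 * (sqrt \<tau> + \<tau>)" using PD sum_PrD[OF m] by simp
  have 3: "\<bar>PrD k n m d - PrB k n m d\<bar> \<le> (exp s - 1 + 3 * sqrt \<tau>) * PrB k n m d" if "d \<in> W" for d
    using dif[of d] that by (simp add: W_def algebra_simps)
  show ?thesis using 1 2 3 by blast
qed

end

section \<open>Concentration of the transition ratio\<close>

text \<open>Expanding the power produces the product over each \<open>j\<close>-set
  \<open>fact j\<close> times, among other nonnegative terms. The induction adds one marked element
  at a time.\<close>

lemma elementary_symmetric_le:
  fixes X :: "nat \<Rightarrow> real"
  assumes V: "finite V" and X: "\<And>v. v \<in> V \<Longrightarrow> 0 \<le> X v"
  shows "(\<Sum>e | e \<subseteq> V \<and> card e = j. \<Prod>v\<in>e. X v) \<le> (\<Sum>v\<in>V. X v) ^ j / fact j"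
proof (induction j)
  case 0
  have "{e. e \<subseteq> V \<and> card e = 0} = {{}}" using V by (auto dest: finite_subset)
  then show ?case by simp
next
  case (Suc j)
  have fe: "finite e" if "e \<subseteq> V" for e using that V finite_subset by blast
  have "real (Suc j) * (\<Sum>e | e \<subseteq> V \<and> card e = Suc j. \<Prod>v\<in>e. X v)
      = (\<Sum>e | e \<subseteq> V \<and> card e = j. \<Sum>u\<in>V - e. \<Prod>v\<in>insert u e. X v)"
    by (rule card_Suc_insert_sum[OF V, symmetric])
  also have "\<dots> \<le> (\<Sum>e | e \<subseteq> V \<and> card e = j. (\<Prod>v\<in>e. X v) * (\<Sum>v\<in>V. X v))"
  proof (rule sum_mono)
    fix e assume e: "e \<in> {e. e \<subseteq> V \<and> card e = j}"
    have p: "0 \<le> (\<Prod>v\<in>e. X v)" using e X by (intro prod_nonneg) auto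
    have "(\<Sum>u\<in>V - e. \<Prod>v\<in>insert u e. X v) = (\<Prod>v\<in>e. X v) * (\<Sum>u\<in>V - e. X u)"
      using e fe by (simp add: sum_distrib_left mult.commute)
    also have "\<dots> \<le> (\<Prod>v\<in>e. X v) * (\<Sum>v\<in>V. X v)"
      using V X p by (intro mult_left_mono sum_mono2) auto
    finally show "(\<Sum>u\<in>V - e. \<Prod>v\<in>insert u e. X v) \<le> (\<Prod>v\<in>e. X v) * (\<Sum>v\<in>V. X v)" .
  qed
  also have "\<dots> = (\<Sum>e | e \<subseteq> V \<and> card e = j. \<Prod>v\<in>e. X v) * (\<Sum>v\<in>V. X v)"
    by (simp add: sum_distrib_right)
  also have "\<dots> \<le> (\<Sum>v\<in>V. X v) ^ j / fact j * (\<Sum>v\<in>V. X v)"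
    using X by (intro mult_right_mono Suc sum_nonneg) auto
  finally have "real (Suc j) * (\<Sum>e | e \<subseteq> V \<and> card e = Suc j. \<Prod>v\<in>e. X v) \<le> (\<Sum>v\<in>V. X v) ^ j / fact j * (\<Sum>v\<in>V. X v)" .
  then have "(\<Sum>e | e \<subseteq> V \<and> card e = Suc j. \<Prod>v\<in>e. X v) \<le> (\<Sum>v\<in>V. X v) ^ j / fact j * (\<Sum>v\<in>V. X v) / real (Suc j)"
    by (subst pos_le_divide_eq) (simp_all add: mult.commute)
  then show ?case by (simp add: mult_ac)
qed

text \<open>The factors are switched on one after the other, in the order of the vertices. The
  coefficient of \<open>X t - 1\<close> then involves only vertices below \<open>t\<close>, so the
  sum becomes a martingale for independent coordinates of mean one.\<close>

lemma prod_telescope: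
  fixes X :: "nat \<Rightarrow> real"
  shows "(\<Prod>v\<in>e \<inter> {..<A}. X v) = 1 + (\<Sum>t<A. (X t - 1) * (if t \<in> e then \<Prod>v\<in>e \<inter> {..<t}. X v else 0))"
proof (induction A)
  case (Suc A)
  have "e \<inter> {..<Suc A} = (if A \<in> e then insert A (e \<inter> {..<A}) else e \<inter> {..<A})"
    by (auto simp: less_Suc_eq)
  then have "(\<Prod>v\<in>e \<inter> {..<Suc A}. X v) = (\<Prod>v\<in>e \<inter> {..<A}. X v) + (X A - 1) * (if A \<in> e then \<Prod>v\<in>e \<inter> {..<A}. X v else 0)"
    by (simp add: algebra_simps)
  then show ?case using Suc by simp
qed simp

lemma sum_prod_telescope:
  fixes X :: "nat \<Rightarrow> real"
  assumes "finite F"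
  shows "(\<Sum>e\<in>F. \<Prod>v\<in>e \<inter> {..<A}. X v) = real (card F) + (\<Sum>t<A. (X t - 1) * (\<Sum>e | e \<in> F \<and> t \<in> e. \<Prod>v\<in>e \<inter> {..<t}. X v))"
proof -
  have "(\<Sum>e\<in>F. \<Prod>v\<in>e \<inter> {..<A}. X v) = (\<Sum>e\<in>F. 1 + (\<Sum>t<A. (X t - 1) * (if t \<in> e then \<Prod>v\<in>e \<inter> {..<t}. X v else 0)))"
    by (intro sum.cong refl prod_telescope)
  also have "\<dots> = real (card F) + (\<Sum>e\<in>F. \<Sum>t<A. (X t - 1) * (if t \<in> e then \<Prod>v\<in>e \<inter> {..<t}. X v else 0))"
    by (simp add: sum.distrib)
  also have "(\<Sum>e\<in>F. \<Sum>t<A. (X t - 1) * (if t \<in> e then \<Prod>v\<in>e \<inter> {..<t}. X v else 0))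
    = (\<Sum>t<A. \<Sum>e\<in>F. (X t - 1) * (if t \<in> e then \<Prod>v\<in>e \<inter> {..<t}. X v else 0))" by (rule sum.swap)
  also have "\<dots> = (\<Sum>t<A. (X t - 1) * (\<Sum>e | e \<in> F \<and> t \<in> e. \<Prod>v\<in>e \<inter> {..<t}. X v))"
    using assms by (simp add: sum_distrib_left[symmetric] sum.If_cases Int_def)
  finally show ?thesis .
qed

text \<open>Applied to a \<open>z\<close> with vanishing sum, where it turns the off-diagonal part
  into minus half of the sum of squares.\<close>

lemma sum_sq_triangle:
  fixes z :: "nat \<Rightarrow> real"
  shows "(\<Sum>t<n. z t)\<^sup>2 = (\<Sum>t<n. (z t)\<^sup>2) + 2 * (\<Sum>t<n. \<Sum>s<t. z t * z s)"
  by (induction n) (simp_all add: power2_eq_square algebra_simps sum_distrib_left)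

text \<open>Using \<open>cosh\<close> instead of \<open>exp\<close> removes the odd moments, so that
  the second and the fourth can be read off one exponential bound.\<close>

lemma cosh_ge_4: "1 + u\<^sup>2 / 2 + u ^ 4 / 24 \<le> cosh u" for u :: real
proof -
  let ?f = "\<lambda>n. if even n then u ^ n /\<^sub>R fact n else 0"
  have "sum ?f {..<5} \<le> suminf ?f"
  proof (rule sum_le_suminf)
    show "summable ?f" using cosh_converges[of u] by (simp only: sums_iff)
    show "0 \<le> ?f m" for m by (cases "even m") (simp_all add: zero_le_even_power)
  qed simp
  also have "suminf ?f = cosh u" using cosh_converges[of u] by (simp add: sums_iff)
  also have "sum ?f {..<5} = 1 + u\<^sup>2 / 2 + u ^ 4 / 24"
  proof -
    have "{..<5::nat} = {0, 1, 2, 3, 4}" by auto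
    then show ?thesis by (simp add: fact_numeral field_simps)
  qed
  finally show ?thesis .
qed

section \<open>Even central moments of a binomial variable\<close>

context
  fixes N :: nat and x :: real
  assumes x: "0 \<le> x" "x \<le> 1"
begin

lemma bin_cosh:
  assumes "\<bar>l\<bar> \<le> 1"
  shows "(\<Sum>j\<le>N. bin N x j * cosh (l * (real j - x * real N))) \<le> exp (l\<^sup>2 * (x * real N))"
proof -
  have "(\<Sum>j\<le>N. bin N x j * cosh (l * (real j - x * real N)))
     = ((\<Sum>j\<le>N. bin N x j * exp (l * (real j - x * real N))) + (\<Sum>j\<le>N. bin N x j * exp (- l * (real j - x * real N)))) / 2"
    unfolding sum.distrib[symmetric] sum_divide_distrib
    by (intro sum.cong refl) (simp add: cosh_def distrib_left add_divide_distrib)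
  also have "\<dots> \<le> (exp (l\<^sup>2 * (x * real N)) + exp ((- l)\<^sup>2 * (x * real N))) / 2"
    using assms by (intro divide_right_mono add_mono bin_mgf x) auto
  finally show ?thesis by simp
qed

text \<open>The constant terms of \<open>cosh_ge_4\<close> and of the exponential bound cancel. The
  two moments that remain are nonnegative, so each is bounded separately by the right-hand
  side.\<close>

lemma bin_moments:
  assumes l: "0 < l" "l \<le> 1" "l\<^sup>2 * (x * real N) \<le> 1"
  shows "(\<Sum>j\<le>N. bin N x j * (real j - x * real N)\<^sup>2) \<le> 4 * (x * real N)"
    and "(\<Sum>j\<le>N. bin N x j * (real j - x * real N) ^ 4) \<le> 48 * (x * real N) / l\<^sup>2"
proof -
  let ?y = "\<lambda>j. real j - x * real N"
  define a where "a = x * real N"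
  have "exp (l\<^sup>2 * a) \<le> 1 + l\<^sup>2 * a + (l\<^sup>2 * a)\<^sup>2" using l x by (intro exp_le_quadratic) (auto simp: a_def)
  also have "(l\<^sup>2 * a)\<^sup>2 \<le> l\<^sup>2 * a"
    using power_decreasing[of 1 2 "l\<^sup>2 * a"] l x by (simp add: a_def)
  finally have "exp (l\<^sup>2 * a) \<le> 1 + 2 * (l\<^sup>2 * a)" by (simp add: mult.commute)
  moreover have "(\<Sum>j\<le>N. bin N x j * cosh (l * ?y j)) \<le> exp (l\<^sup>2 * a)"
    unfolding a_def by (rule bin_cosh) (use l in simp)
  ultimately have c: "(\<Sum>j\<le>N. bin N x j * cosh (l * ?y j)) \<le> 1 + 2 * (l\<^sup>2 * a)" by (rule order_trans[rotated])
  have "(\<Sum>j\<le>N. bin N x j * (1 + (l * ?y j)\<^sup>2 / 2 + (l * ?y j) ^ 4 / 24)) \<le> (\<Sum>j\<le>N. bin N x j * cosh (l * ?y j))"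
    by (intro sum_mono mult_left_mono cosh_ge_4 bin_nonneg x)
  also have "(\<Sum>j\<le>N. bin N x j * (1 + (l * ?y j)\<^sup>2 / 2 + (l * ?y j) ^ 4 / 24))
     = 1 + l\<^sup>2 / 2 * (\<Sum>j\<le>N. bin N x j * (?y j)\<^sup>2) + l ^ 4 / 24 * (\<Sum>j\<le>N. bin N x j * (?y j) ^ 4)"
    unfolding sum_distrib_left power_mult_distrib distrib_left sum.distrib by (simp add: bin_sum mult_ac)
  finally have m: "l\<^sup>2 / 2 * (\<Sum>j\<le>N. bin N x j * (?y j)\<^sup>2) + l ^ 4 / 24 * (\<Sum>j\<le>N. bin N x j * (?y j) ^ 4) \<le> 2 * (l\<^sup>2 * a)"
    using c by linarith
  have p: "0 \<le> (\<Sum>j\<le>N. bin N x j * (?y j)\<^sup>2)" "0 \<le> (\<Sum>j\<le>N. bin N x j * (?y j) ^ 4)"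
    by (intro sum_nonneg mult_nonneg_nonneg bin_nonneg x; simp)+
  define A2 A4 where "A2 = (\<Sum>j\<le>N. bin N x j * (?y j)\<^sup>2)" and "A4 = (\<Sum>j\<le>N. bin N x j * (?y j) ^ 4)"
  have "l ^ 4 = l\<^sup>2 * l\<^sup>2" by (simp add: power4_eq_xxxx power2_eq_square)
  then have "l\<^sup>2 * (A2 / 2 + l\<^sup>2 * A4 / 24) \<le> l\<^sup>2 * (2 * a)"
    using m unfolding A2_def[symmetric] A4_def[symmetric] by (simp add: algebra_simps)
  then have m': "A2 / 2 + l\<^sup>2 * A4 / 24 \<le> 2 * a" by (rule mult_left_le_imp_le) (use l in simp)
  have p': "0 \<le> A2" "0 \<le> l\<^sup>2 * A4" using p unfolding A2_def[symmetric] A4_def[symmetric] by auto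
  have "A2 \<le> 4 * a" using m' p' by linarith
  then show "(\<Sum>j\<le>N. bin N x j * (?y j)\<^sup>2) \<le> 4 * (x * real N)" unfolding A2_def a_def .
  have "l\<^sup>2 * A4 \<le> 48 * a" using m' p' by linarith
  then have "A4 \<le> 48 * a / l\<^sup>2" using l by (simp add: pos_le_divide_eq mult.commute)
  then show "(\<Sum>j\<le>N. bin N x j * (?y j) ^ 4) \<le> 48 * (x * real N) / l\<^sup>2" unfolding A4_def a_def .
qed

text \<open>The largest admissible \<open>l\<close> is one for a mean \<open>a\<close> below one and
  \<open>1 / sqrt a\<close> above; the two cases give the summands \<open>A\<close> and
  \<open>A\<^sup>2\<close>.\<close>

lemma bin_fourth:
  assumes "x * real N \<le> A"
  shows "(\<Sum>j\<le>N. bin N x j * (real j - x * real N) ^ 4) \<le> 48 * (A + A\<^sup>2)"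
proof -
  define a where "a = x * real N"
  have a: "0 \<le> a" "a \<le> A" using x assms by (auto simp: a_def)
  have "(\<Sum>j\<le>N. bin N x j * (real j - x * real N) ^ 4) \<le> 48 * (a + a\<^sup>2)"
  proof (cases "a \<le> 1")
    case True
    then have "(\<Sum>j\<le>N. bin N x j * (real j - x * real N) ^ 4) \<le> 48 * a"
      using bin_moments(2)[of 1] a unfolding a_def[symmetric] by simp
    also have "\<dots> \<le> 48 * (a + a\<^sup>2)" by simp
    finally show ?thesis .
  next
    case False
    have "(\<Sum>j\<le>N. bin N x j * (real j - x * real N) ^ 4) \<le> 48 * a / (1 / sqrt a)\<^sup>2"
      unfolding a_def by (rule bin_moments(2)) (use False in \<open>auto simp: a_def power_divide\<close>)
    also have "\<dots> \<le> 48 * (a + a\<^sup>2)" using False by (simp add: power_divide power2_eq_square)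
    finally show ?thesis .
  qed
  also have "\<dots> \<le> 48 * (A + A\<^sup>2)" using a by (intro mult_left_mono add_mono power_mono) auto
  finally show ?thesis .
qed

lemma bin_second: "(\<Sum>j\<le>N. bin N x j * (real j - x * real N)\<^sup>2) \<le> 4 * (x * real N)"
proof (cases "x * real N \<le> 1")
  case True then show ?thesis using bin_moments(1)[of 1] by simp
next
  case False
  show ?thesis by (rule bin_moments(1)[of "1 / sqrt (x * real N)"]) (use False in \<open>auto simp: power_divide\<close>)
qed

end

text \<open>Clipped coefficients give increments that are bounded and still depend on earlier coordinates
  only; outside the exceptional event nothing is clipped.\<close>

definition clip :: "real \<Rightarrow> real \<Rightarrow> real" where "clip \<beta> c = max (- \<beta>) (min \<beta> c)"

lemma clip_le: "0 \<le> \<beta> \<Longrightarrow> \<bar>clip \<beta> c\<bar> \<le> \<beta>" by (auto simp: clip_def)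
lemma clip_id: "\<bar>c\<bar> \<le> \<beta> \<Longrightarrow> clip \<beta> c = c" by (auto simp: clip_def)

text \<open>The quadratic part of the expansion of the edge sum is governed by the codegrees. Their bulk
  \<open>\<theta> * nv G u * nv G v\<close> is harmless because the weighted fluctuations sum to zero on the slice.\<close>

locale main_phase = kgraph +
  fixes G :: "nat set set" and i :: nat and L \<theta> \<eta> :: real
  assumes G: "G \<subseteq> Es" and i8: "8 * k \<le> i" and iK: "i \<le> M - card G"
    and A1: "\<And>v. v < n \<Longrightarrow> \<bar>real (nv G v) - real k * real (M - card G) / real n\<bar> \<le> real (M - card G) / (2 * real n)"
    and A2: "\<And>u v. u < n \<Longrightarrow> v < n \<Longrightarrow> u \<noteq> v \<Longrightarrow>
      \<bar>real (card {e\<in>Es - G. u \<in> e \<and> v \<in> e}) - \<theta> * real (nv G u) * real (nv G v)\<bar> \<le> \<eta>"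
    and th: "0 \<le> \<theta>" "\<theta> * real (M - card G) \<le> 2"
    and A4: "real n ^ k \<le> 3 * fact k * real (M - card G)"
    and L: "1 \<le> L" "2 * L \<le> real k * real i" and eta: "0 \<le> \<eta>"
begin

definition "K = M - card G"
definition "x = real i / real K"
definition "av v = x * real (nv G v)"
definition "db = real k * real i / real n"
text \<open>Normalised to mean one: \<open>av v\<close> is the mean of \<open>\<delta> v\<close>
  under the product law with parameter \<open>x\<close>.\<close>

definition "X \<delta> v = real (\<delta> v) / av v"
text \<open>The deviation level of \<open>lin_conc\<close> for coefficients bounded by one: a single
  \<open>X \<delta> t - 1\<close> has variance proxy at most \<open>2 / db\<close>, all together at
  most \<open>2 * n\<^sup>2 / (k * i)\<close>, and the level is \<open>2 * sqrt L\<close> times the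
  root of that.\<close>

definition "\<sigma> = 2 * real n * sqrt (2 * L / (real k * real i))"
text \<open>Bounds the \<open>X\<close>-weighted number of \<open>k\<close>-sets through three
  vertices: an elementary symmetric polynomial of degree \<open>k - 3\<close> in numbers whose sum
  is at most \<open>n + \<sigma>\<close>.\<close>

definition "D3m = (real n + \<sigma>) ^ (k - 3) / fact (k - 3)"
text \<open>Size of the quadratic coefficients once the bulk is removed: the codegree error plus the
  fluctuation caused by the cubic terms.\<close>

definition "\<beta> = \<eta> + D3m * \<sigma>"
definition "vq = 48 * (2 * db + (2 * db)\<^sup>2)"
text \<open>The level that a single coordinate exceeds with probability at most
  \<open>2 * exp (- L)\<close>: a Gaussian part for means above \<open>L\<close> and a Poisson part
  for small ones.\<close>

definition "Y = 2 * sqrt (2 * db * L) + 2 * L"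
definition "\<tau>2 = 2 * sqrt (real n * vq * L)"
definition "\<epsilon> = \<tau>2 / (real i)\<^sup>2 + \<beta> * \<sigma>\<^sup>2 / real K"

lemma n0: "0 < real n" and k0: "0 < real k" using k3 kn by auto

lemma K0: "0 < real K" "0 < real i" "i \<le> K" using iK i8 k3 by (auto simp: K_def)

lemma x0: "0 < x" "x \<le> 1" using K0 by (auto simp: x_def)

lemma db0: "0 < db" using K0 n0 k0 by (auto simp: db_def)

lemma nv_bounds: assumes v: "v < n"
  shows "(1 - 1 / (2 * real k)) * (real k * real K / real n) \<le> real (nv G v)"
    and "real (nv G v) \<le> (1 + 1 / (2 * real k)) * (real k * real K / real n)"
proof -
  have "1 / (2 * real k) * (real k * real K / real n) = real K / (2 * real n)" using k0 by simp
  then show "(1 - 1 / (2 * real k)) * (real k * real K / real n) \<le> real (nv G v)"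
    "real (nv G v) \<le> (1 + 1 / (2 * real k)) * (real k * real K / real n)"
    using A1[OF v] unfolding K_def[symmetric] left_diff_distrib distrib_right by linarith+
qed

lemma nv_pos: "v < n \<Longrightarrow> 0 < real (nv G v)"
proof -
  assume "v < n"
  have "0 < (1 - 1 / (2 * real k)) * (real k * real K / real n)"
    using n0 k0 K0 k3 by (intro mult_pos_pos divide_pos_pos) (auto simp: field_simps)
  then show ?thesis using nv_bounds(1)[OF \<open>v < n\<close>] by linarith
qed

lemma av_bounds: assumes v: "v < n" shows "db / 2 \<le> av v" "av v \<le> 2 * db"
proof -
  have xe: "x * (real k * real K / real n) = db" using K0 by (simp add: x_def db_def)
  have k1: "1 / (2 * real k) \<le> 1 / 2" using k3 by simp
  have "(1/2) * db \<le> (1 - 1 / (2 * real k)) * db" using k1 db0 by (intro mult_right_mono) auto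
  also have "\<dots> = x * ((1 - 1 / (2 * real k)) * (real k * real K / real n))" by (simp add: xe[symmetric])
  also have "\<dots> \<le> av v" unfolding av_def using nv_bounds(1)[OF v] x0 by (intro mult_left_mono) auto
  finally show "db / 2 \<le> av v" by simp
  have "av v \<le> x * ((1 + 1 / (2 * real k)) * (real k * real K / real n))"
    unfolding av_def using nv_bounds(2)[OF v] x0 by (intro mult_left_mono) auto
  also have "\<dots> = (1 + 1 / (2 * real k)) * db" by (simp add: xe[symmetric])
  also have "\<dots> \<le> 2 * db" using k1 db0 by (intro mult_right_mono) auto
  finally show "av v \<le> 2 * db" .
qed

lemma av_pos: "v < n \<Longrightarrow> 0 < av v" using av_bounds db0 by fastforce

lemma \<sigma>_pos: "0 < \<sigma>" using L K0 n0 k0 by (auto simp: \<sigma>_def)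
lemma D3m_pos: "0 < D3m" using \<sigma>_pos n0 by (auto simp: D3m_def)
lemma \<beta>_pos: "0 < \<beta>" using \<sigma>_pos D3m_pos eta by (auto simp: \<beta>_def intro: add_nonneg_pos)

abbreviation "PR \<equiv> pr n (nv G) x"

lemma \<sigma>_sqrt: "\<sigma> * sqrt (L * (db / 2) / real n) = 2 * L"
proof -
  have "sqrt (2 * L / (real k * real i)) * sqrt (L * (db / 2) / real n) = sqrt ((L / real n)\<^sup>2)"
    unfolding real_sqrt_mult[symmetric] using K0 k0 by (simp add: db_def power2_eq_square)
  then show ?thesis using n0 L by (simp add: \<sigma>_def)
qed

lemma lin_conc:
  assumes pred: "\<And>t \<delta> \<delta>'. t < n \<Longrightarrow> (\<And>v. v < t \<Longrightarrow> \<delta> v = \<delta>' v) \<Longrightarrow> c t \<delta> = c t \<delta>'"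
    and b: "\<And>t \<delta>. t < n \<Longrightarrow> \<bar>c t \<delta>\<bar> \<le> B" and B: "0 < B"
  shows "PR (\<lambda>\<delta>. B * \<sigma> \<le> \<bar>\<Sum>t<n. (X \<delta> t - 1) * c t \<delta>\<bar>) \<le> 2 * exp (- L)"
proof -
  \<comment> \<open>The exponent of the Chernoff bound: with \<open>l = q / B\<close> every
    coordinate contributes at most \<open>L / n\<close>, while
    \<open>l * (B * \<sigma>) = 2 * L\<close>. The assumption \<open>2 * L \<le> k * i\<close> gives
    \<open>q \<le> db / 2\<close>, which keeps the argument of \<open>bin_mgf\<close> below
    one.\<close>
  define q where "q = sqrt (L * (db / 2) / real n)"
  have q: "0 < q" using L db0 n0 by (simp add: q_def)
  have q2: "q\<^sup>2 = L * (db / 2) / real n" using L db0 n0 by (simp add: q_def)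
  have qdb: "q \<le> db / 2"
  proof (rule power2_le_imp_le)
    have "L \<le> real n * (db / 2)" using L n0 by (simp add: db_def)
    then have "L * (db / 2) \<le> real n * (db / 2) * (db / 2)" using db0 by (intro mult_right_mono) auto
    then show "q\<^sup>2 \<le> (db / 2)\<^sup>2" unfolding q2 using n0 by (simp add: field_simps power2_eq_square)
  qed (use db0 in auto)
  define l where "l = q / B"
  have mg: "(\<Sum>j\<le>nv G t. bin (nv G t) x j * exp (r * ((real j / av t - 1) * c t \<delta>))) \<le> exp (L / real n)"
    if t: "t < n" and r: "\<bar>r\<bar> = l" for t \<delta> r
  proof -
    have at: "0 < av t" "db / 2 \<le> av t" using t av_pos av_bounds by auto
    define u where "u = r * c t \<delta> / av t"
    have "\<bar>r\<bar> * \<bar>c t \<delta>\<bar> \<le> l * B" unfolding r using b[OF t, of \<delta>] B q by (intro mult_left_mono) (auto simp: l_def)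
    then have rc: "\<bar>r * c t \<delta>\<bar> \<le> q" using B by (simp add: l_def abs_mult)
    have "\<bar>u\<bar> = \<bar>r * c t \<delta>\<bar> / av t" using at by (simp add: u_def)
    also have "\<dots> \<le> (db / 2) / (db / 2)" using rc qdb at db0 by (intro frac_le) auto
    finally have u1: "\<bar>u\<bar> \<le> 1" using db0 by simp
    have "(\<Sum>j\<le>nv G t. bin (nv G t) x j * exp (r * ((real j / av t - 1) * c t \<delta>)))
       = (\<Sum>j\<le>nv G t. bin (nv G t) x j * exp (u * (real j - x * real (nv G t))))"
      using at by (intro sum.cong refl) (simp add: u_def av_def[symmetric] field_simps)
    also have "\<dots> \<le> exp (u\<^sup>2 * (x * real (nv G t)))" using x0 by (intro bin_mgf u1) auto
    also have "u\<^sup>2 * (x * real (nv G t)) = (r * c t \<delta>)\<^sup>2 / av t"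
      using at by (simp add: u_def av_def[symmetric] power2_eq_square)
    also have "\<dots> \<le> q\<^sup>2 / (db / 2)" using at rc db0 q
      by (intro frac_le) (auto intro: abs_le_square_iff[THEN iffD1])
    also have "\<dots> = L / real n" unfolding q2 using db0 by simp
    finally show ?thesis by simp
  qed
  have "PR (\<lambda>\<delta>. B * \<sigma> \<le> \<bar>\<Sum>t<n. (\<lambda>j. (real j / av t - 1) * c t \<delta>) (\<delta> t)\<bar>) \<le> 2 * exp ((\<Sum>t<n. L / real n) - l * (B * \<sigma>))"
  proof (rule pr_seq_tail[where h = "\<lambda>t \<delta> j. (real j / av t - 1) * c t \<delta>"])
    show "0 < l" using q B by (simp add: l_def)
    show "(\<lambda>j. (real j / av t - 1) * c t \<delta>) = (\<lambda>j. (real j / av t - 1) * c t \<delta>')"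
      if "t < n" "\<And>v. v < t \<Longrightarrow> \<delta> v = \<delta>' v" for t \<delta> \<delta>'
      using pred[of t \<delta> \<delta>'] that by simp
    show "(\<Sum>j\<le>nv G t. bin (nv G t) x j * exp (l * ((real j / av t - 1) * c t \<delta>))) \<le> exp (L / real n)"
      if "t < n" for t \<delta> using mg[OF that, of l \<delta>] q B by (simp add: l_def)
    show "(\<Sum>j\<le>nv G t. bin (nv G t) x j * exp (- l * ((real j / av t - 1) * c t \<delta>))) \<le> exp (L / real n)"
      if "t < n" for t \<delta> using mg[OF that, of "- l" \<delta>] q B by (simp add: l_def)
  qed (use x0 in auto)
  also have "(\<Sum>t<n. L / real n) - l * (B * \<sigma>) = - L"
    using \<sigma>_sqrt[folded q_def] n0 B by (simp add: l_def mult.commute)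
  finally show ?thesis by (simp add: X_def)
qed

text \<open>\<open>D2\<close> and \<open>D3\<close> are the coefficients after telescoping twice and
  three times, always from the larger vertex to the smaller. Each of them sees only coordinates
  below its last index, so the sums are martingales at every level.\<close>

definition "D3 t s r \<delta> = (\<Sum>e | e \<in> Es - G \<and> t \<in> e \<and> s \<in> e \<and> r \<in> e. \<Prod>v\<in>e \<inter> {..<r}. X \<delta> v)"
definition "D2 t s \<delta> = (\<Sum>e | e \<in> Es - G \<and> t \<in> e \<and> s \<in> e. \<Prod>v\<in>e \<inter> {..<s}. X \<delta> v)"
definition "c2 t s r \<delta> = (if r < s \<and> s < t then clip D3m (D3 t s r \<delta>) else 0)"
definition "bt t s \<delta> = D2 t s \<delta> - \<theta> * real (nv G t) * real (nv G s)"
definition "c1 t s \<delta> = (if s < t then clip \<beta> (bt t s \<delta>) else 0)"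
definition "c0 t \<delta> = clip (\<beta> * \<sigma>) (\<Sum>s<n. (X \<delta> s - 1) * c1 t s \<delta>)"
definition "yy t j = real j - av t"
text \<open>Squares are cut off at \<open>Y\<close> so that their increments are bounded; when no
  coordinate exceeds \<open>Y\<close> nothing changes.\<close>

definition "tq t j = (if \<bar>yy t j\<bar> \<le> Y then (yy t j)\<^sup>2 else 0)"
definition "mq t = (\<Sum>j\<le>nv G t. bin (nv G t) x j * tq t j)"
definition "S \<delta> = (\<Sum>e\<in>Es - G. \<Prod>v\<in>e. X \<delta> v)"
text \<open>The clauses are ordered by dependence: prefix sums bound \<open>D3\<close>, the cubic
  sums then bound \<open>bt\<close>, the quadratic sums bound \<open>c0\<close>, and the fourth
  clause is the outer sum. The last two control the sum of squares.\<close>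

definition "bad \<delta> \<longleftrightarrow>
   (\<exists>r\<in>{..n}. 1 * \<sigma> \<le> \<bar>\<Sum>t<n. (X \<delta> t - 1) * (if t < r then 1 else 0)\<bar>)
 \<or> (\<exists>z\<in>{..<n} \<times> {..<n}. D3m * \<sigma> \<le> \<bar>\<Sum>r<n. (X \<delta> r - 1) * c2 (fst z) (snd z) r \<delta>\<bar>)
 \<or> (\<exists>t\<in>{..<n}. \<beta> * \<sigma> \<le> \<bar>\<Sum>s<n. (X \<delta> s - 1) * c1 t s \<delta>\<bar>)
 \<or> \<beta> * \<sigma> * \<sigma> \<le> \<bar>\<Sum>t<n. (X \<delta> t - 1) * c0 t \<delta>\<bar>
 \<or> (\<exists>t\<in>{..<n}. Y \<le> \<bar>yy t (\<delta> t)\<bar>)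
 \<or> \<tau>2 \<le> \<bar>\<Sum>t<n. tq t (\<delta> t) - mq t\<bar>"

lemma prod_X_cong: "(\<And>v. v < r \<Longrightarrow> \<delta> v = \<delta>' v) \<Longrightarrow> (\<Prod>v\<in>e \<inter> {..<r}. X \<delta> v) = (\<Prod>v\<in>e \<inter> {..<r}. X \<delta>' v)"
  by (intro prod.cong) (auto simp: X_def)

lemma D3_cong: "(\<And>v. v < r \<Longrightarrow> \<delta> v = \<delta>' v) \<Longrightarrow> D3 t s r \<delta> = D3 t s r \<delta>'"
  unfolding D3_def by (intro sum.cong refl prod_X_cong)

lemma D2_cong: "(\<And>v. v < s \<Longrightarrow> \<delta> v = \<delta>' v) \<Longrightarrow> D2 t s \<delta> = D2 t s \<delta>'"
  unfolding D2_def by (intro sum.cong refl prod_X_cong)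

lemma c1_cong: "(\<And>v. v < s \<Longrightarrow> \<delta> v = \<delta>' v) \<Longrightarrow> c1 t s \<delta> = c1 t s \<delta>'"
  unfolding c1_def bt_def using D2_cong[of s \<delta> \<delta>' t] by simp

lemma c0_cong: assumes "\<And>v. v < t \<Longrightarrow> \<delta> v = \<delta>' v" shows "c0 t \<delta> = c0 t \<delta>'"
proof -
  have "(X \<delta> s - 1) * c1 t s \<delta> = (X \<delta>' s - 1) * c1 t s \<delta>'" for s
    using assms c1_cong[of s \<delta> \<delta>' t] by (cases "s < t") (auto simp: X_def c1_def)
  then show ?thesis by (simp add: c0_def)
qed

lemma tail_y: assumes t: "t < n" shows "PR (\<lambda>\<delta>. Y \<le> \<bar>yy t (\<delta> t)\<bar>) \<le> 2 * exp (- L)"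
proof -
  \<comment> \<open>The best exponent as long as it is at most one, the range of
    \<open>bin_mgf\<close>; for means below \<open>L / 2\<close> the value one is taken.\<close>
  define l where "l = (if L \<le> 2 * db then sqrt (L / (2 * db)) else 1)"
  have l: "0 < l" "l \<le> 1" using L db0 by (auto simp: l_def)
  have at: "0 \<le> av t" "av t \<le> 2 * db" using av_bounds[OF t] db0 by auto
  have l2: "l\<^sup>2 * av t \<le> L"
  proof (cases "L \<le> 2 * db")
    case True
    then have "l\<^sup>2 = L / (2 * db)" using L db0 by (simp add: l_def)
    then have "l\<^sup>2 * av t \<le> L / (2 * db) * (2 * db)" using at L db0 by (simp add: mult_left_mono del: times_divide_eq_left)
    then show ?thesis using db0 by simp
  qed (use at in \<open>simp add: l_def\<close>)
  have lY: "2 * L \<le> l * Y"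
  proof (cases "L \<le> 2 * db")
    case True
    have "sqrt (L / (2 * db)) * sqrt (2 * db * L) = sqrt (L\<^sup>2)"
      unfolding real_sqrt_mult[symmetric] using db0 by (simp add: power2_eq_square)
    then have "l * Y = 2 * L + 2 * L * l" using True L by (simp add: l_def Y_def algebra_simps)
    then show ?thesis using L l by simp
  next
    case False then show ?thesis using L db0 by (simp add: l_def Y_def)
  qed
  have mg: "(\<Sum>j\<le>nv G v. bin (nv G v) x j * exp (r * (if v = t then yy t j else 0))) \<le> exp (if v = t then L else 0)"
    if "\<bar>r\<bar> = l" for v r
  proof (cases "v = t")
    case True
    have "(\<Sum>j\<le>nv G t. bin (nv G t) x j * exp (r * yy t j)) \<le> exp (r\<^sup>2 * (x * real (nv G t)))"
      unfolding yy_def av_def using x0 that l by (intro bin_mgf) auto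
    also have "r\<^sup>2 * (x * real (nv G t)) \<le> L" using l2 that by (metis av_def power2_abs)
    finally show ?thesis using True by simp
  qed (simp add: bin_sum)
  have "PR (\<lambda>\<delta>. Y \<le> \<bar>\<Sum>v<n. (\<lambda>j. if v = t then yy t j else 0) (\<delta> v)\<bar>) \<le> 2 * exp ((\<Sum>v<n. if v = t then L else 0) - l * Y)"
    by (rule pr_seq_tail[where h = "\<lambda>v \<delta> j. if v = t then yy t j else 0"])
       (use x0 l mg[where r = l] mg[where r = "- l"] in auto)
  also have "\<dots> \<le> 2 * exp (- L)" using lY t by simp
  finally show ?thesis using t by (simp add: sum.delta)
qed

lemma mq_bounds: assumes t: "t < n" shows "0 \<le> mq t" "mq t \<le> 4 * av t" "mq t \<le> Y\<^sup>2"
proof -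
  have Y0: "0 \<le> Y" using L db0 by (simp add: Y_def)
  show "0 \<le> mq t" unfolding mq_def using x0 by (intro sum_nonneg mult_nonneg_nonneg bin_nonneg) (auto simp: tq_def)
  have "mq t \<le> (\<Sum>j\<le>nv G t. bin (nv G t) x j * (real j - x * real (nv G t))\<^sup>2)"
    unfolding mq_def using x0 by (intro sum_mono mult_left_mono bin_nonneg) (auto simp: tq_def yy_def av_def)
  then show "mq t \<le> 4 * av t" using bin_second[of x "nv G t"] x0 by (simp add: av_def)
  have "mq t \<le> (\<Sum>j\<le>nv G t. bin (nv G t) x j * Y\<^sup>2)"
    unfolding mq_def using x0 Y0 by (intro sum_mono mult_left_mono bin_nonneg) (auto simp: tq_def abs_le_square_iff[symmetric])
  then show "mq t \<le> Y\<^sup>2" by (simp add: sum_distrib_right[symmetric] bin_sum)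
qed

text \<open>The fourth moment \<open>vq\<close> plays the role of the variance of the truncated
  squares, and \<open>H\<close> says that truncation at \<open>Y\<close> keeps the exponents below
  one.\<close>

lemma tail_sq:
  assumes H: "L * Y ^ 4 \<le> real n * vq"
  shows "PR (\<lambda>\<delta>. \<tau>2 \<le> \<bar>\<Sum>t<n. tq t (\<delta> t) - mq t\<bar>) \<le> 2 * exp (- L)"
proof -
  have vq: "0 < vq" using db0 by (simp add: vq_def add_pos_pos)
  have Y0: "0 < Y" using L db0 by (simp add: Y_def add_nonneg_pos)
  define l where "l = sqrt (L / (real n * vq))"
  have l: "0 < l" using L vq n0 by (simp add: l_def)
  have l2: "l\<^sup>2 = L / (real n * vq)" using L vq n0 by (simp add: l_def)
  have lY: "l * Y\<^sup>2 \<le> 1"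
  proof (rule power2_le_imp_le)
    have "(l * Y\<^sup>2)\<^sup>2 = L * Y ^ 4 / (real n * vq)" by (simp add: power_mult_distrib l2)
    also have "\<dots> \<le> 1" using H vq n0 by simp
    finally show "(l * Y\<^sup>2)\<^sup>2 \<le> 1\<^sup>2" by simp
  qed simp
  have mg: "(\<Sum>j\<le>nv G t. bin (nv G t) x j * exp (r * (tq t j - mq t))) \<le> exp (l\<^sup>2 * vq)"
    if t: "t < n" and r: "\<bar>r\<bar> = l" for t r
  proof -
    let ?b = "bin (nv G t) x"
    have r2: "r\<^sup>2 = l\<^sup>2" using r by (metis power2_abs)
    have b: "0 \<le> ?b j" for j using x0 by (intro bin_nonneg) auto
    have tq: "0 \<le> tq t j" "tq t j \<le> Y\<^sup>2" for j using Y0 by (auto simp: tq_def abs_le_square_iff[symmetric])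
    have u1: "\<bar>r * (tq t j - mq t)\<bar> \<le> 1" for j
    proof -
      have "\<bar>tq t j - mq t\<bar> \<le> Y\<^sup>2" using tq[of j] mq_bounds[OF t] by linarith
      then have "\<bar>r * (tq t j - mq t)\<bar> \<le> l * Y\<^sup>2" unfolding abs_mult r using l by (intro mult_left_mono) auto
      then show ?thesis using lY by linarith
    qed
    have "(\<Sum>j\<le>nv G t. ?b j * exp (r * (tq t j - mq t))) \<le> (\<Sum>j\<le>nv G t. ?b j * (1 + r * (tq t j - mq t) + (r * (tq t j - mq t))\<^sup>2))"
      by (intro sum_mono mult_left_mono exp_le_quadratic u1 b)
    also have "\<dots> = (\<Sum>j\<le>nv G t. ?b j) + r * ((\<Sum>j\<le>nv G t. ?b j * tq t j) - mq t * (\<Sum>j\<le>nv G t. ?b j))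
       + r\<^sup>2 * ((\<Sum>j\<le>nv G t. ?b j * (tq t j)\<^sup>2) - 2 * mq t * (\<Sum>j\<le>nv G t. ?b j * tq t j) + (mq t)\<^sup>2 * (\<Sum>j\<le>nv G t. ?b j))"
      unfolding sum_distrib_left sum_subtractf[symmetric] sum.distrib[symmetric]
      by (intro sum.cong refl) (simp add: power2_eq_square algebra_simps)
    also have "\<dots> = 1 + l\<^sup>2 * ((\<Sum>j\<le>nv G t. ?b j * (tq t j)\<^sup>2) - (mq t)\<^sup>2)"
      unfolding bin_sum mq_def[symmetric] r2 by (simp add: power2_eq_square algebra_simps)
    also have "\<dots> \<le> 1 + l\<^sup>2 * (\<Sum>j\<le>nv G t. ?b j * (tq t j)\<^sup>2)" by (simp add: mult_left_mono)
    also have "(\<Sum>j\<le>nv G t. ?b j * (tq t j)\<^sup>2) \<le> (\<Sum>j\<le>nv G t. ?b j * (real j - x * real (nv G t)) ^ 4)"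
    proof (intro sum_mono mult_left_mono b)
      fix j
      have "((real j - av t)\<^sup>2)\<^sup>2 = (real j - av t) ^ 4" by (simp add: power_mult[symmetric])
      then show "(tq t j)\<^sup>2 \<le> (real j - x * real (nv G t)) ^ 4" by (auto simp: tq_def yy_def av_def)
    qed
    also have "\<dots> \<le> vq" unfolding vq_def
      by (rule bin_fourth) (use x0 av_bounds[OF t] in \<open>auto simp: av_def\<close>)
    finally have "(\<Sum>j\<le>nv G t. ?b j * exp (r * (tq t j - mq t))) \<le> 1 + l\<^sup>2 * vq" by (simp add: mult_left_mono)
    also have "\<dots> \<le> exp (l\<^sup>2 * vq)" by (rule exp_ge_add_one_self)
    finally show ?thesis .
  qed
  have "PR (\<lambda>\<delta>. \<tau>2 \<le> \<bar>\<Sum>t<n. (\<lambda>j. tq t j - mq t) (\<delta> t)\<bar>) \<le> 2 * exp ((\<Sum>t<n. l\<^sup>2 * vq) - l * \<tau>2)"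
    by (rule pr_seq_tail[where h = "\<lambda>t \<delta> j. tq t j - mq t"]) (use x0 l mg[where r = l] mg[where r = "- l"] in auto)
  also have "(\<Sum>t<n. l\<^sup>2 * vq) = L" unfolding l2 using n0 vq by simp
  also have "l * \<tau>2 = 2 * L"
  proof -
    have "sqrt (L / (real n * vq)) * sqrt (real n * vq * L) = sqrt (L\<^sup>2)"
      unfolding real_sqrt_mult[symmetric] using n0 vq by (simp add: power2_eq_square)
    then show ?thesis using L by (simp add: l_def \<tau>2_def)
  qed
  finally show ?thesis by simp
qed

lemma pr_bad:
  assumes H: "L * Y ^ 4 \<le> real n * vq"
  shows "PR bad \<le> 4 * (real n)\<^sup>2 * exp (- L)"
proof -
  let ?q = "2 * exp (- L)"
  have x: "0 \<le> x" "x \<le> 1" using x0 by auto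
  have 1: "PR (\<lambda>\<delta>. \<exists>r\<in>{..n}. 1 * \<sigma> \<le> \<bar>\<Sum>t<n. (X \<delta> t - 1) * (if t < r then 1 else 0)\<bar>) \<le> real (card {..n}) * ?q"
    by (rule pr_Union[OF x]) (auto intro!: lin_conc[where B = 1, simplified])
  have 2: "PR (\<lambda>\<delta>. \<exists>z\<in>{..<n} \<times> {..<n}. D3m * \<sigma> \<le> \<bar>\<Sum>r<n. (X \<delta> r - 1) * c2 (fst z) (snd z) r \<delta>\<bar>) \<le> real (card ({..<n} \<times> {..<n})) * ?q"
  proof (rule pr_Union[OF x])
    fix z :: "nat \<times> nat"
    show "PR (\<lambda>\<delta>. D3m * \<sigma> \<le> \<bar>\<Sum>r<n. (X \<delta> r - 1) * c2 (fst z) (snd z) r \<delta>\<bar>) \<le> ?q"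
    proof (rule lin_conc)
      fix t and \<delta> \<delta>' :: "nat \<Rightarrow> nat" assume "\<And>v. v < t \<Longrightarrow> \<delta> v = \<delta>' v"
      then have "D3 (fst z) (snd z) t \<delta> = D3 (fst z) (snd z) t \<delta>'" by (rule D3_cong)
      then show "c2 (fst z) (snd z) t \<delta> = c2 (fst z) (snd z) t \<delta>'" by (simp add: c2_def)
    qed (use D3m_pos in \<open>auto simp: c2_def clip_le\<close>)
  qed simp
  have 3: "PR (\<lambda>\<delta>. \<exists>t\<in>{..<n}. \<beta> * \<sigma> \<le> \<bar>\<Sum>s<n. (X \<delta> s - 1) * c1 t s \<delta>\<bar>) \<le> real (card {..<n}) * ?q"
  proof (rule pr_Union[OF x])
    fix t show "PR (\<lambda>\<delta>. \<beta> * \<sigma> \<le> \<bar>\<Sum>s<n. (X \<delta> s - 1) * c1 t s \<delta>\<bar>) \<le> ?q"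
    proof (rule lin_conc)
      fix s and \<delta> \<delta>' :: "nat \<Rightarrow> nat" assume "\<And>v. v < s \<Longrightarrow> \<delta> v = \<delta>' v"
      then show "c1 t s \<delta> = c1 t s \<delta>'" by (rule c1_cong)
    qed (use \<beta>_pos in \<open>auto simp: c1_def clip_le\<close>)
  qed simp
  have 4: "PR (\<lambda>\<delta>. \<beta> * \<sigma> * \<sigma> \<le> \<bar>\<Sum>t<n. (X \<delta> t - 1) * c0 t \<delta>\<bar>) \<le> ?q"
  proof (rule lin_conc)
    fix s and \<delta> \<delta>' :: "nat \<Rightarrow> nat" assume "\<And>v. v < s \<Longrightarrow> \<delta> v = \<delta>' v"
    then show "c0 s \<delta> = c0 s \<delta>'" by (rule c0_cong)
  qed (use \<beta>_pos \<sigma>_pos in \<open>auto simp: c0_def intro!: clip_le\<close>)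
  have 5: "PR (\<lambda>\<delta>. \<exists>t\<in>{..<n}. Y \<le> \<bar>yy t (\<delta> t)\<bar>) \<le> real (card {..<n}) * ?q"
    by (rule pr_Union[OF x]) (auto intro: tail_y)
  note 6 = tail_sq[OF H]
  have "PR bad \<le> real (card {..n}) * ?q + (real (card ({..<n} \<times> {..<n})) * ?q + (real (card {..<n}) * ?q + (?q + (real (card {..<n}) * ?q + ?q))))"
    unfolding bad_def
    by (intro order_trans[OF pr_disj[OF x]] add_mono 1 2 3 4 5 6)
  also have "\<dots> = (real n * real n + 3 * real n + 3) * ?q" by (simp add: algebra_simps)
  also have "\<dots> \<le> (2 * (real n)\<^sup>2) * ?q"
  proof (rule mult_right_mono)
    have "4 \<le> real n" using k3 kn by simp
    then have "4 * real n \<le> real n * real n" by (intro mult_right_mono) auto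
    then show "real n * real n + 3 * real n + 3 \<le> 2 * (real n)\<^sup>2"
      using \<open>4 \<le> real n\<close> unfolding power2_eq_square by linarith
  qed simp
  finally show ?thesis by simp
qed

end

section \<open>Expansion of the edge sum outside the bad event\<close>

context main_phase
begin

lemma X_nonneg: "0 \<le> X \<delta> v"
  using x0 by (simp add: X_def av_def)

lemma finite_EG [simp]: "finite (Es - G)" "finite {e. e \<in> Es - G \<and> P e}"
  by auto

lemma sum_av: "(\<Sum>v<n. av v) = real k * real i"
proof -
  have "(\<Sum>v<n. real (nv G v)) = real (k * K)" using sum_nv[OF G] by (simp add: K_def flip: of_nat_sum)
  then have "(\<Sum>v<n. av v) = x * real (k * K)" unfolding av_def sum_distrib_left[symmetric] by simp
  then show ?thesis using K0 by (simp add: x_def)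
qed

lemma real_sum_Om: "\<delta> \<in> Om n s \<Longrightarrow> (\<Sum>v<n. real (\<delta> v)) = real s"
  by (auto simp: Om_def simp flip: of_nat_sum)

text \<open>The centre of \<open>S / K\<close>: the sum of squares in \<open>S_expand\<close> is
  replaced by its truncated mean.\<close>

definition "t0 = 1 - \<theta> / (2 * real K * x\<^sup>2) * (\<Sum>t<n. mq t)"

lemma th_le: "0 \<le> \<theta> / (2 * real K * x\<^sup>2)" "\<theta> / (2 * real K * x\<^sup>2) \<le> 1 / (real i)\<^sup>2"
proof -
  have "\<theta> / (2 * real K * x\<^sup>2) = (\<theta> * real K) / (2 * (real i)\<^sup>2)"
    using K0 by (simp add: x_def power_divide power2_eq_square)
  also have "\<dots> \<le> 2 / (2 * (real i)\<^sup>2)" using th by (intro divide_right_mono) (auto simp: K_def)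
  finally show "\<theta> / (2 * real K * x\<^sup>2) \<le> 1 / (real i)\<^sup>2" by simp
qed (use th in simp)

context
  fixes \<delta> :: "nat \<Rightarrow> nat"
  assumes d: "\<delta> \<in> Om n (k * i)" and nb: "\<not> bad \<delta>"
begin

lemma prefix_lt: assumes "r \<le> n" shows "(\<Sum>v<r. X \<delta> v - 1) < \<sigma>"
proof -
  have "\<bar>\<Sum>t<n. (X \<delta> t - 1) * (if t < r then 1 else 0)\<bar> < \<sigma>" using nb assms by (auto simp: bad_def not_le)
  also have "(\<Sum>t<n. (X \<delta> t - 1) * (if t < r then 1 else 0)) = (\<Sum>v<r. X \<delta> v - 1)"
    using assms by (intro sum.mono_neutral_cong_right) auto
  finally show ?thesis by linarith
qed

lemma D3_bound: assumes "r < s" "s < t" "t < n" shows "\<bar>D3 t s r \<delta>\<bar> \<le> D3m"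
proof -
  \<comment> \<open>Setting the coordinates from \<open>r\<close> on to one makes every truncated
    product a full product over \<open>e - {t, s, r}\<close>, so that
    \<open>elementary_symmetric_le\<close> applies to a prefix sum.\<close>
  define X' where "X' v = (if v < r then X \<delta> v else 1)" for v
  let ?F = "{e. e \<in> Es - G \<and> t \<in> e \<and> s \<in> e \<and> r \<in> e}"
  have pos: "0 \<le> D3 t s r \<delta>" unfolding D3_def by (intro sum_nonneg prod_nonneg) (auto simp: X_nonneg)
  have inj: "inj_on (\<lambda>e. e - {t, s, r}) ?F" by (intro inj_onI) blast
  have "D3 t s r \<delta> = (\<Sum>e\<in>?F. \<Prod>v\<in>e - {t, s, r}. X' v)"
    unfolding D3_def
  proof (intro sum.cong refl)
    fix e assume "e \<in> ?F"
    then have "finite e" by auto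
    then show "(\<Prod>v\<in>e \<inter> {..<r}. X \<delta> v) = (\<Prod>v\<in>e - {t, s, r}. X' v)"
      using assms by (intro prod.mono_neutral_cong_left) (auto simp: X'_def)
  qed
  also have "\<dots> = (\<Sum>e\<in>(\<lambda>e. e - {t, s, r}) ` ?F. \<Prod>v\<in>e. X' v)"
    by (simp only: sum.reindex[OF inj] o_def)
  also have "\<dots> \<le> (\<Sum>e | e \<subseteq> {..<n} \<and> card e = k - 3. \<Prod>v\<in>e. X' v)"
  proof (rule sum_mono2)
    show "finite {e. e \<subseteq> {..<n} \<and> card e = k - 3}" by (rule finite_subset[of _ "Pow {..<n}"]) auto
    show "(\<lambda>e. e - {t, s, r}) ` ?F \<subseteq> {e. e \<subseteq> {..<n} \<and> card e = k - 3}"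
    proof clarify
      fix e assume e: "e \<in> Es" "t \<in> e" "s \<in> e" "r \<in> e"
      then have "finite e" "card e = k" "e \<subseteq> {..<n}" using finite_edge[of e] by (auto simp: Es_def)
      moreover have "card {t, s, r} = 3" using assms by auto
      ultimately show "e - {t, s, r} \<subseteq> {..<n} \<and> card (e - {t, s, r}) = k - 3"
        using e by (subst card_Diff_subset) auto
    qed
  qed (auto intro!: prod_nonneg simp: X'_def X_nonneg)
  also have "\<dots> \<le> (\<Sum>v<n. X' v) ^ (k - 3) / fact (k - 3)"
    by (rule elementary_symmetric_le) (auto simp: X'_def X_nonneg)
  also have "\<dots> \<le> D3m" unfolding D3m_def
  proof (intro divide_right_mono power_mono sum_nonneg)
    have "(\<Sum>v<n. X' v - 1) = (\<Sum>v<r. X \<delta> v - 1)"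
      using assms by (intro sum.mono_neutral_cong_right) (auto simp: X'_def)
    then show "(\<Sum>v<n. X' v) \<le> real n + \<sigma>" using prefix_lt[of r] assms by (simp add: sum_subtractf)
  qed (auto simp: X'_def X_nonneg)
  finally show ?thesis using pos by simp
qed

lemma bt_bound: assumes "s < t" "t < n" shows "\<bar>bt t s \<delta>\<bar> \<le> \<beta>"
proof -
  let ?F = "{e. e \<in> Es - G \<and> t \<in> e \<and> s \<in> e}"
  have "D2 t s \<delta> = real (card ?F) + (\<Sum>r<s. (X \<delta> r - 1) * (\<Sum>e | e \<in> ?F \<and> r \<in> e. \<Prod>v\<in>e \<inter> {..<r}. X \<delta> v))"
    unfolding D2_def by (rule sum_prod_telescope) auto
  also have "(\<Sum>r<s. (X \<delta> r - 1) * (\<Sum>e | e \<in> ?F \<and> r \<in> e. \<Prod>v\<in>e \<inter> {..<r}. X \<delta> v)) = (\<Sum>r<s. (X \<delta> r - 1) * D3 t s r \<delta>)"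
    by (simp add: D3_def conj_ac)
  also have "\<dots> = (\<Sum>r<n. (X \<delta> r - 1) * c2 t s r \<delta>)"
    using assms D3_bound by (intro sum.mono_neutral_cong_left) (auto simp: c2_def clip_id)
  finally have "bt t s \<delta> = (real (card ?F) - \<theta> * real (nv G t) * real (nv G s)) + (\<Sum>r<n. (X \<delta> r - 1) * c2 t s r \<delta>)"
    by (simp add: bt_def)
  moreover have "\<bar>\<Sum>r<n. (X \<delta> r - 1) * c2 t s r \<delta>\<bar> \<le> D3m * \<sigma>"
    using nb assms by (auto simp: bad_def not_le intro!: less_imp_le)
  moreover have "\<bar>real (card ?F) - \<theta> * real (nv G t) * real (nv G s)\<bar> \<le> \<eta>"
    using A2[of t s] assms by auto
  ultimately show ?thesis unfolding \<beta>_def by linarith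
qed

lemma c1_sum: assumes "t < n" shows "(\<Sum>s<n. (X \<delta> s - 1) * c1 t s \<delta>) = (\<Sum>s<t. (X \<delta> s - 1) * bt t s \<delta>)"
  using assms bt_bound by (intro sum.mono_neutral_cong_right) (auto simp: c1_def clip_id)

lemma c0_eq: assumes "t < n" shows "c0 t \<delta> = (\<Sum>s<t. (X \<delta> s - 1) * bt t s \<delta>)"
proof -
  have "\<bar>\<Sum>s<n. (X \<delta> s - 1) * c1 t s \<delta>\<bar> \<le> \<beta> * \<sigma>" using nb assms by (auto simp: bad_def not_le intro!: less_imp_le)
  then show ?thesis unfolding c0_def c1_sum[OF assms] by (rule clip_id)
qed

text \<open>The linear terms are \<open>z t = nv G t * (X \<delta> t - 1)\<close>, which sum to zero
  because \<open>\<delta>\<close> and \<open>av\<close> have the same total. The bulk of the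
  quadratic coefficients contributes \<open>\<theta> * z t * z s\<close>, which therefore collapses
  to minus \<open>\<theta> / 2\<close> times the sum of squares.\<close>

lemma S_expand: "S \<delta> = real K - \<theta> / (2 * x\<^sup>2) * (\<Sum>t<n. (yy t (\<delta> t))\<^sup>2) + (\<Sum>t<n. (X \<delta> t - 1) * c0 t \<delta>)"
proof -
  define z where "z t = real (nv G t) * (X \<delta> t - 1)" for t
  have zy: "z t = yy t (\<delta> t) / x" if "t < n" for t
    using x0 nv_pos[OF that] by (simp add: z_def X_def yy_def av_def field_simps)
  have sz: "(\<Sum>t<n. z t) = 0"
  proof -
    have "(\<Sum>t<n. z t) = ((\<Sum>t<n. real (\<delta> t)) - (\<Sum>t<n. av t)) / x"
      by (simp add: zy sum_divide_distrib[symmetric] yy_def sum_subtractf)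
    then show ?thesis using real_sum_Om[OF d] sum_av by simp
  qed
  have en: "e \<inter> {..<n} = e" if "e \<in> Es - G" for e using that by (auto simp: Es_def)
  have "S \<delta> = (\<Sum>e\<in>Es - G. \<Prod>v\<in>e \<inter> {..<n}. X \<delta> v)"
    unfolding S_def by (intro sum.cong refl) (simp only: en)
  also have "\<dots> = real (card (Es - G)) + (\<Sum>t<n. (X \<delta> t - 1) * (\<Sum>e | e \<in> Es - G \<and> t \<in> e. \<Prod>v\<in>e \<inter> {..<t}. X \<delta> v))"
    by (rule sum_prod_telescope) simp
  also have "card (Es - G) = K" using G card_Es by (simp add: card_Diff_subset Es_subset K_def)
  also have "(\<Sum>t<n. (X \<delta> t - 1) * (\<Sum>e | e \<in> Es - G \<and> t \<in> e. \<Prod>v\<in>e \<inter> {..<t}. X \<delta> v))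
    = (\<Sum>t<n. z t + \<theta> * (\<Sum>s<t. z t * z s) + (X \<delta> t - 1) * c0 t \<delta>)"
  proof (intro sum.cong refl)
    fix t assume "t \<in> {..<n}" then have t: "t < n" by simp
    have "(\<Sum>e | e \<in> Es - G \<and> t \<in> e. \<Prod>v\<in>e \<inter> {..<t}. X \<delta> v)
       = real (card {e. e \<in> Es - G \<and> t \<in> e}) + (\<Sum>s<t. (X \<delta> s - 1) * (\<Sum>e | e \<in> {e. e \<in> Es - G \<and> t \<in> e} \<and> s \<in> e. \<Prod>v\<in>e \<inter> {..<s}. X \<delta> v))"
      by (rule sum_prod_telescope) simp
    also have "\<dots> = real (nv G t) + (\<Sum>s<t. (X \<delta> s - 1) * D2 t s \<delta>)"
      using nv_card[OF G t] by (simp add: D2_def conj_ac)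
    also have "(\<Sum>s<t. (X \<delta> s - 1) * D2 t s \<delta>) = (\<Sum>s<t. (X \<delta> s - 1) * bt t s \<delta>) + \<theta> * real (nv G t) * (\<Sum>s<t. z s)"
      by (simp add: bt_def z_def sum.distrib[symmetric] sum_distrib_left algebra_simps)
    finally show "(X \<delta> t - 1) * (\<Sum>e | e \<in> Es - G \<and> t \<in> e. \<Prod>v\<in>e \<inter> {..<t}. X \<delta> v)
       = z t + \<theta> * (\<Sum>s<t. z t * z s) + (X \<delta> t - 1) * c0 t \<delta>"
      unfolding c0_eq[OF t] sum_distrib_left[symmetric] by (simp add: z_def algebra_simps)
  qed
  also have "\<dots> = \<theta> * (\<Sum>t<n. \<Sum>s<t. z t * z s) + (\<Sum>t<n. (X \<delta> t - 1) * c0 t \<delta>)"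
    by (simp add: sum.distrib sz sum_distrib_left)
  also have "(\<Sum>t<n. \<Sum>s<t. z t * z s) = - (\<Sum>t<n. (z t)\<^sup>2) / 2" using sum_sq_triangle[of z n] sz by simp
  also have "(\<Sum>t<n. (z t)\<^sup>2) = (\<Sum>t<n. (yy t (\<delta> t))\<^sup>2) / x\<^sup>2"
    by (simp add: zy power_divide sum_divide_distrib)
  finally show ?thesis by simp
qed

lemma S_estimate: "\<bar>S \<delta> / real K - t0\<bar> \<le> \<epsilon>"
proof -
  have "(\<Sum>t<n. (yy t (\<delta> t))\<^sup>2) = (\<Sum>t<n. tq t (\<delta> t))"
  proof (intro sum.cong refl)
    fix t assume "t \<in> {..<n}"
    then have "\<bar>yy t (\<delta> t)\<bar> < Y" using nb by (auto simp: bad_def not_le)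
    then show "(yy t (\<delta> t))\<^sup>2 = tq t (\<delta> t)" by (simp add: tq_def)
  qed
  then have e1: "\<bar>(\<Sum>t<n. (yy t (\<delta> t))\<^sup>2) - (\<Sum>t<n. mq t)\<bar> \<le> \<tau>2"
    using nb by (auto simp: bad_def not_le sum_subtractf intro!: less_imp_le)
  have e2: "\<bar>\<Sum>t<n. (X \<delta> t - 1) * c0 t \<delta>\<bar> \<le> \<beta> * \<sigma> * \<sigma>" using nb by (auto simp: bad_def not_le intro!: less_imp_le)
  have eq: "S \<delta> / real K - t0 = - (\<theta> / (2 * real K * x\<^sup>2)) * ((\<Sum>t<n. (yy t (\<delta> t))\<^sup>2) - (\<Sum>t<n. mq t)) + (\<Sum>t<n. (X \<delta> t - 1) * c0 t \<delta>) / real K"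
    unfolding S_expand t0_def using K0 by (simp add: add_divide_distrib diff_divide_distrib algebra_simps)
  have "\<bar>S \<delta> / real K - t0\<bar> \<le> \<theta> / (2 * real K * x\<^sup>2) * \<bar>(\<Sum>t<n. (yy t (\<delta> t))\<^sup>2) - (\<Sum>t<n. mq t)\<bar> + \<bar>\<Sum>t<n. (X \<delta> t - 1) * c0 t \<delta>\<bar> / real K"
  proof -
    have "\<bar>- c * q + r / real K\<bar> \<le> c * \<bar>q\<bar> + \<bar>r\<bar> / real K" if "0 \<le> c" for c q r :: real
      using abs_triangle_ineq[of "- c * q" "r / real K"] that by (simp add: abs_mult)
    then show ?thesis unfolding eq using th_le(1) by blast
  qed
  also have "\<dots> \<le> 1 / (real i)\<^sup>2 * \<tau>2 + \<beta> * \<sigma> * \<sigma> / real K"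
    using th_le e1 e2 K0 by (intro add_mono mult_mono divide_right_mono) auto
  finally show ?thesis by (simp add: \<epsilon>_def power2_eq_square mult.assoc)
qed

end

lemma t0_bounds: "1/2 \<le> t0" "t0 \<le> 1"
proof -
  have m: "0 \<le> (\<Sum>t<n. mq t)" by (intro sum_nonneg mq_bounds) auto
  have "(\<Sum>t<n. mq t) \<le> (\<Sum>t<n. 4 * av t)" by (intro sum_mono mq_bounds) auto
  also have "\<dots> = 4 * (real k * real i)" by (simp add: sum_distrib_left[symmetric] sum_av)
  finally have "\<theta> / (2 * real K * x\<^sup>2) * (\<Sum>t<n. mq t) \<le> 1 / (real i)\<^sup>2 * (4 * (real k * real i))"
    using th_le m by (intro mult_mono) auto
  also have "\<dots> = 4 * real k / real i" using K0 by (simp add: power2_eq_square)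
  also have "\<dots> \<le> 1 / 2" using i8 K0 by (simp add: field_simps)
  finally show "1/2 \<le> t0" unfolding t0_def by simp
  show "t0 \<le> 1" unfolding t0_def using mult_nonneg_nonneg[OF th_le(1) m] by linarith
qed

text \<open>A deterministic bound for use on the bad event. The relative error
  \<open>1 / (2 * k)\<close> permitted by \<open>A1\<close> is such that its effect on a product of
  \<open>k\<close> factors is at most a factor two, by Bernoulli; \<open>A4\<close> supplies the
  factor three.\<close>

lemma S_bound: assumes d: "\<delta> \<in> Om n (k * i)" shows "0 \<le> S \<delta>" "S \<delta> \<le> 6 * real K"
proof -
  show "0 \<le> S \<delta>" unfolding S_def by (intro sum_nonneg prod_nonneg) (auto simp: X_nonneg)
  let ?q = "1 - 1 / (2 * real k)"
  have q: "0 < ?q" using k3 by (simp add: field_simps)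
  have q2: "1 / 2 \<le> ?q ^ k"
    using Bernoulli_inequality[of "- 1 / (2 * real k)" k] k3 by (simp add: field_simps)
  have avl: "?q * db \<le> av v" if "v < n" for v
  proof -
    have "?q * db = x * (?q * (real k * real K / real n))" using K0 by (simp add: x_def db_def)
    also have "\<dots> \<le> av v" unfolding av_def using nv_bounds(1)[OF that] x0 by (intro mult_left_mono) auto
    finally show ?thesis .
  qed
  have "(\<Sum>v<n. X \<delta> v) \<le> (\<Sum>v<n. real (\<delta> v) / (?q * db))"
    unfolding X_def using avl q db0 av_pos by (intro sum_mono divide_left_mono) (auto intro!: mult_pos_pos)
  also have "\<dots> = real k * real i / (?q * db)" using real_sum_Om[OF d] by (simp add: sum_divide_distrib[symmetric])
  also have "\<dots> = real n / ?q" using K0 k0 n0 by (simp add: db_def)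
  finally have sX: "(\<Sum>v<n. X \<delta> v) \<le> real n / ?q" .
  have "S \<delta> \<le> (\<Sum>e | e \<subseteq> {..<n} \<and> card e = k. \<Prod>v\<in>e. X \<delta> v)"
    unfolding S_def
  proof (rule sum_mono2)
    show "finite {e. e \<subseteq> {..<n} \<and> card e = k}" by (rule finite_subset[of _ "Pow {..<n}"]) auto
    show "Es - G \<subseteq> {e. e \<subseteq> {..<n} \<and> card e = k}" by (auto simp: Es_def)
  qed (intro prod_nonneg X_nonneg)
  also have "\<dots> \<le> (\<Sum>v<n. X \<delta> v) ^ k / fact k" by (rule elementary_symmetric_le) (auto simp: X_nonneg)
  also have "\<dots> \<le> (real n / ?q) ^ k / fact k" using sX by (intro divide_right_mono power_mono sum_nonneg) (auto simp: X_nonneg)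
  also have "\<dots> = real n ^ k / ?q ^ k / fact k" by (simp add: power_divide)
  also have "\<dots> \<le> real n ^ k / (1/2) / fact k" using q2 by (intro divide_right_mono divide_left_mono) auto
  also have "\<dots> \<le> 6 * real K" using A4 by (simp add: K_def field_simps)
  finally show "S \<delta> \<le> 6 * real K" .
qed

section \<open>The transition ratio for a fixed hypergraph\<close>

definition "Tf \<delta> = cT K i * (\<Sum>e\<in>Es - G. \<Prod>v\<in>e. real (\<delta> v) / real (nv G v))"
text \<open>The factor between \<open>S / K\<close> and \<open>Tf\<close>. It is never evaluated;
  the mean-one identity \<open>slw_mean\<close> determines it up to the error.\<close>

definition "\<kappa> = cT K i * real K * x ^ k"
definition "slw \<delta> = (\<Prod>v<n. real (nv G v choose \<delta> v)) / real ((k * K) choose (k * i))"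
definition "pb = 8 * (2 * real (k * i) + 1) * (real n)\<^sup>2 * exp (- L)"

lemma Tf_S: "Tf \<delta> = \<kappa> * (S \<delta> / real K)"
proof -
  have "real (\<delta> v) / real (nv G v) = x * X \<delta> v" for v using x0 by (simp add: X_def av_def)
  then have "(\<Sum>e\<in>Es - G. \<Prod>v\<in>e. real (\<delta> v) / real (nv G v)) = x ^ k * S \<delta>"
    unfolding S_def sum_distrib_left by (intro sum.cong refl) (auto simp: prod.distrib Es_def)
  then show ?thesis using K0 by (simp add: Tf_def \<kappa>_def)
qed

lemma ki_le: "k * i \<le> k * K" using K0 by simp

lemma \<kappa>_nonneg: "0 \<le> \<kappa>" using x0 by (simp add: \<kappa>_def cT_def)

lemma slw_nonneg: "0 \<le> slw \<delta>" by (auto simp: slw_def intro!: divide_nonneg_nonneg prod_nonneg)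

lemma slw_sum: "(\<Sum>\<delta>\<in>Om n (k * i). slw \<delta>) = 1"
proof -
  have "(\<Sum>\<delta>\<in>Om n (k * i). \<Prod>v<n. real (nv G v choose \<delta> v)) = real ((k * K) choose (k * i))"
    using Om_vandermonde[of "nv G" n "k * i"] sum_nv[OF G] by (simp add: K_def flip: of_nat_prod of_nat_sum)
  moreover have "real ((k * K) choose (k * i)) \<noteq> 0" using zero_less_binomial[OF ki_le] by linarith
  ultimately show ?thesis unfolding slw_def sum_divide_distrib[symmetric] by simp
qed

lemma slw_mean: "(\<Sum>\<delta>\<in>Om n (k * i). slw \<delta> * Tf \<delta>) = 1"
proof -
  have kk: "k \<le> k * i" "k * i - k \<le> k * K - k" using i8 k3 ki_le by (auto intro: diff_le_mono)
  have "(\<Sum>\<delta>\<in>Om n (k * i). slw \<delta> * Tf \<delta>)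
     = cT K i / real ((k * K) choose (k * i)) * (\<Sum>\<delta>\<in>Om n (k * i). \<Sum>e\<in>Es - G. (\<Prod>v<n. real (nv G v choose \<delta> v)) * (\<Prod>v\<in>e. real (\<delta> v) / real (nv G v)))"
    by (simp add: slw_def Tf_def sum_distrib_left sum_distrib_right mult_ac)
  also have "(\<Sum>\<delta>\<in>Om n (k * i). \<Sum>e\<in>Es - G. (\<Prod>v<n. real (nv G v choose \<delta> v)) * (\<Prod>v\<in>e. real (\<delta> v) / real (nv G v)))
     = (\<Sum>e\<in>Es - G. real ((k * K - k) choose (k * i - k)))"
  proof (subst sum.swap, intro sum.cong refl)
    fix e assume e: "e \<in> Es - G"
    then have ee: "e \<subseteq> {..<n}" "card e = k" by (auto simp: Es_def)
    have "(\<Sum>\<delta>\<in>Om n (k * i). (\<Prod>v<n. real (nv G v choose \<delta> v)) * (\<Prod>v\<in>e. real (\<delta> v) / real (nv G v)))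
      = real (((\<Sum>v<n. nv G v) - card e) choose (k * i - card e))"
      using ee nv_pos kk by (intro Om_factor_moment) (auto simp: Suc_le_eq)
    then show "(\<Sum>\<delta>\<in>Om n (k * i). (\<Prod>v<n. real (nv G v choose \<delta> v)) * (\<Prod>v\<in>e. real (\<delta> v) / real (nv G v))) = real ((k * K - k) choose (k * i - k))"
      using ee sum_nv[OF G] by (simp add: K_def)
  qed
  also have "\<dots> = real K * real ((k * K - k) choose (k * i - k))"
    using G card_Es by (simp add: card_Diff_subset Es_subset K_def)
  also have "cT K i / real ((k * K) choose (k * i)) * \<dots> = 1"
    using K0 zero_less_binomial[OF ki_le] zero_less_binomial[OF kk(2)] by (simp add: cT_def)
  finally show ?thesis .
qed

lemma slw_bad:
  assumes H: "L * Y ^ 4 \<le> real n * vq"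
  shows "(\<Sum>\<delta>\<in>Om n (k * i). slw \<delta> * of_bool (bad \<delta>)) \<le> pb"
proof -
  have xe: "real (k * i) / real (k * K) = x" using k0 by (simp add: x_def)
  have c: "0 < real ((k * K) choose (k * i))" using zero_less_binomial[OF ki_le] by simp
  have kK: "0 < k * K" using k3 K0 by simp
  have "(\<Sum>\<delta>\<in>Om n (k * i). (\<Prod>v<n. real (nv G v choose \<delta> v)) * of_bool (bad \<delta>))
     \<le> 2 * (2 * real (k * i) + 1) * real ((k * K) choose (k * i)) * pr n (nv G) (real (k * i) / real (k * K)) bad"
    using sum_nv[OF G] kK ki_le by (intro slice_transfer) (auto simp: K_def)
  also have "\<dots> \<le> 2 * (2 * real (k * i) + 1) * real ((k * K) choose (k * i)) * (4 * (real n)\<^sup>2 * exp (- L))"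
    unfolding xe using pr_bad[OF H] by (intro mult_left_mono) auto
  also have "\<dots> = pb * real ((k * K) choose (k * i))" by (simp add: pb_def)
  finally show ?thesis using c by (simp add: slw_def sum_divide_distrib[symmetric] pos_divide_le_eq)
qed

text \<open>On the good event, of mass at least one half, \<open>S / K \<ge> 1/4\<close>, so a mean
  of one forces \<open>\<kappa> \<le> 8\<close>. Averaging \<open>Tf - \<kappa> * t0\<close> then
  shows that \<open>\<kappa> * t0\<close> is near one. The value 48 is \<open>8 * 6\<close>, with
  the six of \<open>S_bound\<close>, and 56 adds \<open>\<kappa> * t0 \<le> 8\<close>.\<close>

lemma T_concentrated:
  assumes H: "L * Y ^ 4 \<le> real n * vq" and pb: "pb \<le> 1/2" and eps: "\<epsilon> \<le> 1/4" and d: "\<delta> \<in> Om n (k * i)"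
  shows "\<bar>Tf \<delta> - 1\<bar> \<le> 48" and "\<not> bad \<delta> \<Longrightarrow> \<bar>Tf \<delta> - 1\<bar> \<le> 16 * \<epsilon> + 56 * pb"
proof -
  have good: "(\<Sum>\<delta>\<in>Om n (k * i). slw \<delta> * of_bool (\<not> bad \<delta>)) \<ge> 1/2"
  proof -
    have "1 = (\<Sum>\<delta>\<in>Om n (k * i). slw \<delta> * of_bool (bad \<delta>)) + (\<Sum>\<delta>\<in>Om n (k * i). slw \<delta> * of_bool (\<not> bad \<delta>))"
      unfolding sum.distrib[symmetric] slw_sum[symmetric] by (intro sum.cong refl) auto
    then show ?thesis using slw_bad[OF H] pb by linarith
  qed
  have k8: "\<kappa> \<le> 8"
  proof -
    have "\<kappa> / 4 * (1/2) \<le> \<kappa> / 4 * (\<Sum>\<delta>\<in>Om n (k * i). slw \<delta> * of_bool (\<not> bad \<delta>))"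
      using good \<kappa>_nonneg by (intro mult_left_mono) auto
    also have "\<dots> \<le> (\<Sum>\<delta>\<in>Om n (k * i). slw \<delta> * Tf \<delta>)"
      unfolding sum_distrib_left
    proof (rule sum_mono)
      fix \<delta> assume dd: "\<delta> \<in> Om n (k * i)"
      show "\<kappa> / 4 * (slw \<delta> * of_bool (\<not> bad \<delta>)) \<le> slw \<delta> * Tf \<delta>"
      proof (cases "bad \<delta>")
        case True then show ?thesis using S_bound[OF dd] \<kappa>_nonneg slw_nonneg by (simp add: Tf_S)
      next
        case False
        have "1/4 \<le> S \<delta> / real K" using S_estimate[OF dd False] t0_bounds eps by linarith
        then have "\<kappa> * (1/4) \<le> Tf \<delta>" unfolding Tf_S using \<kappa>_nonneg by (intro mult_left_mono) auto
        then have "slw \<delta> * (\<kappa> * (1/4)) \<le> slw \<delta> * Tf \<delta>" using slw_nonneg by (intro mult_left_mono) auto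
        then show ?thesis using False by (simp add: mult_ac)
      qed
    qed
    finally show ?thesis unfolding slw_mean by simp
  qed
  have Tb: "0 \<le> Tf \<delta>" "Tf \<delta> \<le> 48" if dd: "\<delta> \<in> Om n (k * i)" for \<delta>
  proof -
    have s: "0 \<le> S \<delta> / real K" "S \<delta> / real K \<le> 6" using S_bound[OF dd] K0 by (auto simp: field_simps)
    show "0 \<le> Tf \<delta>" unfolding Tf_S by (rule mult_nonneg_nonneg[OF \<kappa>_nonneg s(1)])
    have "\<kappa> * (S \<delta> / real K) \<le> 8 * 6" using s k8 by (intro mult_mono) auto
    then show "Tf \<delta> \<le> 48" by (simp add: Tf_S)
  qed
  show "\<bar>Tf \<delta> - 1\<bar> \<le> 48" using Tb[OF d] by linarith
  have near: "\<bar>Tf \<delta> - \<kappa> * t0\<bar> \<le> 8 * \<epsilon>" if dd: "\<delta> \<in> Om n (k * i)" "\<not> bad \<delta>" for \<delta>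
  proof -
    have "\<bar>Tf \<delta> - \<kappa> * t0\<bar> = \<kappa> * \<bar>S \<delta> / real K - t0\<bar>"
      unfolding Tf_S right_diff_distrib[symmetric] abs_mult using \<kappa>_nonneg by simp
    also have "\<dots> \<le> 8 * \<epsilon>" using S_estimate[OF dd] k8 by (intro mult_mono) auto
    finally show ?thesis .
  qed
  have "0 \<le> t0" using t0_bounds by linarith
  then have kt: "0 \<le> \<kappa> * t0" "\<kappa> * t0 \<le> 8 * 1" using t0_bounds(2) \<kappa>_nonneg k8 by (auto intro!: mult_mono simp del: mult_1_right)
  have e0: "0 \<le> \<epsilon>" using \<beta>_pos \<sigma>_pos by (auto simp: \<epsilon>_def \<tau>2_def vq_def db_def L intro!: add_nonneg_nonneg divide_nonneg_nonneg mult_nonneg_nonneg) (use L in linarith)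
  have eq: "1 - \<kappa> * t0 = (\<Sum>\<delta>\<in>Om n (k * i). slw \<delta> * (Tf \<delta> - \<kappa> * t0))"
    by (simp add: right_diff_distrib sum_subtractf slw_mean sum_distrib_right[symmetric] slw_sum)
  have "\<bar>1 - \<kappa> * t0\<bar> \<le> (\<Sum>\<delta>\<in>Om n (k * i). slw \<delta> * (8 * \<epsilon>) + 56 * (slw \<delta> * of_bool (bad \<delta>)))"
    unfolding eq
  proof (rule order_trans[OF sum_abs sum_mono])
    fix \<delta> assume dd: "\<delta> \<in> Om n (k * i)"
    have "\<bar>Tf \<delta> - \<kappa> * t0\<bar> \<le> 8 * \<epsilon> + 56 * of_bool (bad \<delta>)"
      using near[OF dd] Tb[OF dd] kt e0 by (cases "bad \<delta>") auto
    then have "slw \<delta> * \<bar>Tf \<delta> - \<kappa> * t0\<bar> \<le> slw \<delta> * (8 * \<epsilon> + 56 * of_bool (bad \<delta>))"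
      using slw_nonneg by (intro mult_left_mono) auto
    then show "\<bar>slw \<delta> * (Tf \<delta> - \<kappa> * t0)\<bar> \<le> slw \<delta> * (8 * \<epsilon>) + 56 * (slw \<delta> * of_bool (bad \<delta>))"
      unfolding abs_mult abs_of_nonneg[OF slw_nonneg] by (simp only: distrib_left mult_ac)
  qed
  also have "\<dots> \<le> 8 * \<epsilon> + 56 * pb"
    using slw_bad[OF H] by (simp add: sum.distrib sum_distrib_left[symmetric] sum_distrib_right[symmetric] slw_sum)
  finally show "\<bar>Tf \<delta> - 1\<bar> \<le> 16 * \<epsilon> + 56 * pb" if "\<not> bad \<delta>" using near[OF d that] by linarith
qed

end

section \<open>Edge exchanges\<close>

definition esym :: "(nat \<Rightarrow> nat) \<Rightarrow> nat \<Rightarrow> nat \<Rightarrow> nat" where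
  "esym \<delta> n j = (\<Sum>e | e \<subseteq> {..<n} \<and> card e = j. \<Prod>v\<in>e. \<delta> v)"

lemma esym_0 [simp]: "esym \<delta> n 0 = 1"
proof -
  have "{e. e \<subseteq> {..<n} \<and> card e = 0} = {{}}" by (auto dest: finite_subset)
  then show ?thesis by (simp add: esym_def)
qed

lemma esym_empty: "esym \<delta> 0 (Suc j) = 0"
  by (simp add: esym_def)

lemma esym_Suc: "esym \<delta> (Suc n) (Suc j) = esym \<delta> n (Suc j) + \<delta> n * esym \<delta> n j"
proof -
  let ?A = "{e. e \<subseteq> {..<n} \<and> card e = Suc j}" and ?B = "{e. e \<subseteq> {..<n} \<and> card e = j}"
  have fin: "finite {e. e \<subseteq> {..<n} \<and> card e = j}" for j by (rule finite_subset[of _ "Pow {..<n}"]) auto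
  have fe: "finite e" if "e \<subseteq> {..<n}" for e using that finite_subset by blast
  have inj: "inj_on (insert n) ?B" by (rule inj_onI) (metis (no_types, lifting) insert_ident lessThan_iff less_irrefl mem_Collect_eq subsetD)
  have "{e. e \<subseteq> {..<Suc n} \<and> card e = Suc j} = ?A \<union> insert n ` ?B"
  proof (intro equalityI subsetI)
    fix e assume e: "e \<in> {e. e \<subseteq> {..<Suc n} \<and> card e = Suc j}"
    show "e \<in> ?A \<union> insert n ` ?B"
    proof (cases "n \<in> e")
      case True
      then have "e = insert n (e - {n})" "e - {n} \<in> ?B" using e by (auto simp: less_Suc_eq card_Diff_singleton)
      then show ?thesis by blast
    next
      case False then show ?thesis using e by (force simp: less_Suc_eq)
    qed
  next
    fix e assume "e \<in> ?A \<union> insert n ` ?B"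
    then show "e \<in> {e. e \<subseteq> {..<Suc n} \<and> card e = Suc j}"
      using fe by (auto simp: less_Suc_eq card_insert_if)
  qed
  then have "esym \<delta> (Suc n) (Suc j) = esym \<delta> n (Suc j) + (\<Sum>e\<in>insert n ` ?B. \<Prod>v\<in>e. \<delta> v)"
    unfolding esym_def using fin by (subst sum.union_disjoint[symmetric]) auto
  also have "(\<Sum>e\<in>insert n ` ?B. \<Prod>v\<in>e. \<delta> v) = (\<Sum>e\<in>?B. \<delta> n * (\<Prod>v\<in>e. \<delta> v))"
    unfolding sum.reindex[OF inj] o_def
  proof (intro sum.cong refl)
    fix e assume "e \<in> ?B"
    then show "(\<Prod>v\<in>insert n e. \<delta> v) = \<delta> n * (\<Prod>v\<in>e. \<delta> v)" using fe by (subst prod.insert) auto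
  qed
  finally show ?thesis by (simp add: esym_def sum_distrib_left)
qed

lemma esym_1: "esym \<delta> n (Suc 0) = (\<Sum>v<n. \<delta> v)"
  by (induction n) (simp_all add: esym_Suc esym_empty)

lemma choose_add_le: "(s choose Suc j) + a * (s choose j) \<le> (s + a) choose Suc j"
proof (induction a)
  case (Suc a)
  have "(s choose j) \<le> ((s + a) choose j)" by (rule binomial_right_mono) simp
  then show ?case using Suc by simp
qed simp

text \<open>For \<open>\<delta> v\<close> balls in box \<open>v\<close>, \<open>esym\<close> counts
  the \<open>j\<close>-subsets of the balls with at most one ball from each box.\<close>

lemma esym_le: "esym \<delta> n j \<le> (\<Sum>v<n. \<delta> v) choose j"
proof (induction n arbitrary: j)
  case 0 show ?case by (cases j) (simp_all add: esym_empty)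
next
  case (Suc n)
  show ?case
  proof (cases j)
    case (Suc j')
    have "esym \<delta> (Suc n) j \<le> ((\<Sum>v<n. \<delta> v) choose Suc j') + \<delta> n * ((\<Sum>v<n. \<delta> v) choose j')"
      unfolding Suc esym_Suc using Suc.IH by (intro add_mono mult_le_mono2)
    then show ?thesis using choose_add_le[of "\<Sum>v<n. \<delta> v" j' "\<delta> n"] Suc by simp
  qed simp
qed

lemma choose_add_ge_1: "((s + a) choose Suc j) \<le> (s choose Suc j) + a * ((s + a - 1) choose j)"
proof (induction a)
  case (Suc a)
  have "((s + a - 1) choose j) \<le> ((s + a) choose j)" by (rule binomial_right_mono) simp
  then have m: "a * ((s + a - 1) choose j) \<le> a * ((s + a) choose j)" by (rule mult_le_mono2)
  have "((s + Suc a) choose Suc j) = ((s + a) choose j) + ((s + a) choose Suc j)"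
    and "Suc a * ((s + Suc a - 1) choose j) = ((s + a) choose j) + a * ((s + a) choose j)" by simp_all
  then show ?case using Suc m by linarith
qed simp

text \<open>A subset of \<open>s + a\<close> balls contains none, one, or at least two of the last
  \<open>a\<close>; in the third case a pair among them is fixed and the rest is free.\<close>

lemma choose_add_ge:
  "((s + a) choose Suc (Suc j)) \<le> (s choose Suc (Suc j)) + a * (s choose Suc j) + (a choose 2) * ((s + a - 2) choose j)"
proof (induction a)
  case (Suc a)
  have "((s + a - 2) choose j) \<le> ((s + a - 1) choose j)" by (rule binomial_right_mono) simp
  then have m: "(a choose 2) * ((s + a - 2) choose j) \<le> (a choose 2) * ((s + a - 1) choose j)" by (rule mult_le_mono2)
  have "((s + a) choose Suc j) \<le> (s choose Suc j) + a * ((s + a - 1) choose j)" by (rule choose_add_ge_1)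
  moreover have "(Suc a choose 2) * ((s + a - 1) choose j) = (a choose 2) * ((s + a - 1) choose j) + a * ((s + a - 1) choose j)"
    by (simp add: numeral_2_eq_2 algebra_simps)
  moreover have "((s + Suc a) choose Suc (Suc j)) = ((s + a) choose Suc j) + ((s + a) choose Suc (Suc j))"
    "s + Suc a - 2 = s + a - 1" "Suc a * (s choose Suc j) = a * (s choose Suc j) + (s choose Suc j)" by simp_all
  ultimately show ?case using Suc m unfolding \<open>s + Suc a - 2 = s + a - 1\<close> by linarith
qed simp

text \<open>A subset of the balls that \<open>esym\<close> misses contains two balls of one box;
  such a pair and the remaining \<open>j\<close> balls are counted by the subtracted
  product.\<close>

lemma esym_ge:
  "((\<Sum>v<n. \<delta> v) choose Suc (Suc j)) \<le> esym \<delta> n (Suc (Suc j)) + (((\<Sum>v<n. \<delta> v) - 2) choose j) * (\<Sum>v<n. \<delta> v choose 2)"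
proof (induction n arbitrary: j)
  case (Suc n)
  define s D a where "s = (\<Sum>v<n. \<delta> v)" and "D = (\<Sum>v<n. \<delta> v choose 2)" and "a = \<delta> n"
  note IH = Suc.IH[folded s_def D_def]
  have "((s + a) choose Suc (Suc j)) \<le> (s choose Suc (Suc j)) + a * (s choose Suc j) + (a choose 2) * ((s + a - 2) choose j)"
    by (rule choose_add_ge)
  also have "(s choose Suc (Suc j)) + a * (s choose Suc j) \<le> esym \<delta> n (Suc (Suc j)) + a * esym \<delta> n (Suc j) + ((s + a - 2) choose j) * D"
  proof (cases j)
    case 0
    have "s choose Suc 0 = esym \<delta> n (Suc 0)" by (simp add: esym_1 s_def)
    then show ?thesis using IH[of 0] unfolding 0 by simp
  next
    case (Suc j')
    have "(((s - 2) choose j) + a * ((s - 2) choose j')) * D \<le> ((s + a - 2) choose j) * D"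
    proof (cases "D = 0")
      case False
      \<comment> \<open>Needed because \<open>s - 2\<close> truncates: a box with two balls ensures
        \<open>s + a - 2 = (s - 2) + a\<close>.\<close>
      have "2 \<le> s"
      proof (rule ccontr)
        assume "\<not> 2 \<le> s"
        then have "\<delta> v choose 2 = 0" if "v < n" for v
          using member_le_sum[of v "{..<n}" \<delta>] that by (intro binomial_eq_0) (auto simp: s_def)
        then show False using False by (simp add: D_def)
      qed
      then have e: "s + a - 2 = (s - 2) + a" by simp
      show ?thesis unfolding e Suc by (intro mult_right_mono choose_add_le) simp
    qed simp
    moreover have "a * (s choose Suc j) \<le> a * (esym \<delta> n (Suc j) + ((s - 2) choose j') * D)"
      using IH[of j'] unfolding Suc by (intro mult_left_mono) auto
    ultimately show ?thesis using IH[of j] by (simp add: algebra_simps)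
  qed
  finally show ?case by (simp add: esym_Suc s_def D_def a_def algebra_simps)
qed (simp add: esym_empty)

section \<open>The exchange involution and its two consequences\<close>

context kgraph
begin

lemma Es_lessThan: "Es = {e. e \<subseteq> {..<n} \<and> card e = k}"
  by (simp add: Es_def atLeast0LessThan)

lemma edge_lt: "G \<subseteq> Es \<Longrightarrow> g \<in> G \<Longrightarrow> u \<in> g \<Longrightarrow> u < n"
  by (auto simp: Es_lessThan)

text \<open>The edge \<open>g\<close> gives up \<open>u\<close> and takes in \<open>v\<close>; the
  last condition excludes that the new edge is already present.\<close>

definition Val :: "nat set set \<Rightarrow> (nat \<times> nat set \<times> nat) set" where
  "Val G = {(v, g, u). v < n \<and> g \<in> G \<and> u \<in> g \<and> v \<notin> g \<and> insert v (g - {u}) \<notin> G}"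

definition sw :: "nat set set \<Rightarrow> nat \<Rightarrow> nat set \<Rightarrow> nat \<Rightarrow> nat set set" where
  "sw G v g u = insert (insert v (g - {u})) (G - {g})"

lemma finite_Val [simp]: "G \<subseteq> Es \<Longrightarrow> finite (Val G)"
  by (rule finite_subset[of _ "{..<n} \<times> Es \<times> {..<n}"]) (auto simp: Val_def edge_lt)

context
  fixes G v g u
  assumes G: "G \<subseteq> Es" and V: "(v, g, u) \<in> Val G"
begin

lemma sw_facts: "v < n" "g \<in> G" "u \<in> g" "v \<notin> g" "insert v (g - {u}) \<notin> G" "u \<noteq> v" "g \<in> Es" "u < n"
  using V G by (auto simp: Val_def edge_lt)

lemma sw_edge: "insert v (g - {u}) \<in> Es"
proof -
  have "finite g" using sw_facts by auto
  moreover have "card g = k" using sw_facts by (auto simp: Es_def)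
  moreover have "0 < card g" using calculation sw_facts by (auto simp: card_gt_0_iff)
  ultimately show ?thesis using sw_facts by (auto simp: Es_def card_Diff_singleton)
qed

lemma sw_sub: "sw G v g u \<subseteq> Es" using G sw_edge by (auto simp: sw_def)

lemma sw_card: "card (sw G v g u) = card G"
proof -
  have "finite G" "0 < card G" using G Es_subset sw_facts by (auto simp: card_gt_0_iff)
  then show ?thesis using sw_facts by (simp add: sw_def card_Diff_singleton)
qed

lemma sw_back: "insert u (insert v (g - {u}) - {v}) = g" "sw (sw G v g u) u (insert v (g - {u})) v = G"
proof -
  show 1: "insert u (insert v (g - {u}) - {v}) = g" using sw_facts by auto
  show "sw (sw G v g u) u (insert v (g - {u})) v = G"
    unfolding sw_def 1 using sw_facts by (simp add: insert_absorb)
qed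

lemma sw_Val: "(u, insert v (g - {u}), v) \<in> Val (sw G v g u)"
  using sw_facts sw_back(1) by (auto simp: Val_def sw_def)

lemma hdeg_sw: "hdeg (sw G v g u) z + (if z = u then 1 else 0) = hdeg G z + (if z = v then 1 else 0)"
proof -
  have f: "finite (G - {g})" using G Es_subset by auto
  have "hdeg G z = hdeg (G - {g}) z + (if z \<in> g then 1 else 0)"
    using hdeg_insert[OF f, of g z] sw_facts by (simp add: insert_absorb)
  moreover have "hdeg (sw G v g u) z = hdeg (G - {g}) z + (if z \<in> insert v (g - {u}) then 1 else 0)"
    unfolding sw_def using sw_facts by (intro hdeg_insert f) auto
  ultimately show ?thesis using sw_facts by auto
qed

lemma xx_sw: "z \<noteq> u \<Longrightarrow> z \<noteq> v \<Longrightarrow> xx (sw G v g u) d z = xx G d z"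
  using hdeg_sw[of z] by (simp add: xx_def nv_def)

text \<open>Both hypergraphs arise from \<open>G - {g}\<close> by adding one edge. By
  \<open>w_insert\<close> either side is the weight of \<open>G - {g}\<close> times the
  \<open>xx\<close> factors of \<open>u\<close>, \<open>v\<close> and the common vertices
  \<open>g - {u}\<close>.\<close>

lemma w_sw: "w G d * xx G d v = w (sw G v g u) d * xx (sw G v g u) d u"
proof -
  let ?H = "G - {g}" and ?g' = "insert v (g - {u})"
  have H: "?H \<subseteq> Es" using G by auto
  have f: "finite ?H" by (rule Es_subset[OF H])
  have fg: "finite g" using sw_facts by auto
  have "w G d = w ?H d * (\<Prod>z\<in>g. xx ?H d z)"
    using w_insert[OF H, of g d] sw_facts by (simp add: insert_absorb)
  also have "(\<Prod>z\<in>g. xx ?H d z) = xx ?H d u * (\<Prod>z\<in>g - {u}. xx ?H d z)"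
    using fg sw_facts by (intro prod.remove) auto
  finally have 1: "w G d = w ?H d * (xx ?H d u * (\<Prod>z\<in>g - {u}. xx ?H d z))" .
  have "w (sw G v g u) d = w ?H d * (\<Prod>z\<in>?g'. xx ?H d z)"
    unfolding sw_def using sw_facts sw_edge by (intro w_insert H) auto
  also have "(\<Prod>z\<in>?g'. xx ?H d z) = xx ?H d v * (\<Prod>z\<in>g - {u}. xx ?H d z)"
    using fg sw_facts by (intro prod.insert) auto
  finally have 2: "w (sw G v g u) d = w ?H d * (xx ?H d v * (\<Prod>z\<in>g - {u}. xx ?H d z))" .
  have "hdeg G v = hdeg ?H v" using hdeg_insert[OF f, of g v] sw_facts by (simp add: insert_absorb)
  then have 3: "xx G d v = xx ?H d v" by (simp add: xx_def nv_def)
  have "hdeg (sw G v g u) u = hdeg ?H u" unfolding sw_def using hdeg_insert[OF f, of ?g' u] sw_facts by simp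
  then have 4: "xx (sw G v g u) d u = xx ?H d u" by (simp add: xx_def nv_def)
  show ?thesis unfolding 1 2 3 4 by simp
qed

end

text \<open>Moving one free incidence from \<open>v\<close> to \<open>u\<close> while the edge \<open>g\<close> trades \<open>u\<close> for \<open>v\<close> is an
  involution that preserves the weight \<open>w G d * xx G d v\<close>.\<close>

lemma swap_sum:
  "(\<Sum>G\<in>hg f. \<Sum>(v, g, u)\<in>Val G. w G d * xx G d v * F G v g u)
   = (\<Sum>G\<in>hg f. \<Sum>(v, g, u)\<in>Val G. w G d * xx G d v * F (sw G v g u) u (insert v (g - {u})) v)"
proof -
  let ?S = "SIGMA G:hg f. Val G"
  have "(\<Sum>G\<in>hg f. \<Sum>(v, g, u)\<in>Val G. w G d * xx G d v * F G v g u)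
     = (\<Sum>(G, v, g, u)\<in>?S. w G d * xx G d v * F G v g u)"
    by (subst sum.Sigma) (auto simp: hgD)
  also have "\<dots> = (\<Sum>(G, v, g, u)\<in>?S. w G d * xx G d v * F (sw G v g u) u (insert v (g - {u})) v)"
  proof (rule sum.reindex_bij_witness[where i = "\<lambda>(G, v, g, u). (sw G v g u, u, insert v (g - {u}), v)"
        and j = "\<lambda>(G, v, g, u). (sw G v g u, u, insert v (g - {u}), v)"])
    fix z assume "z \<in> ?S"
    then obtain G v g u where z: "z = (G, v, g, u)" and G: "G \<in> hg f" and V: "(v, g, u) \<in> Val G" by auto
    note GE = hgD(1)[OF G]
    have sG: "sw G v g u \<in> hg f" using sw_sub[OF GE V] sw_card[OF GE V] hgD(2)[OF G] by (simp add: hg_def)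
    show "(case case z of (G, v, g, u) \<Rightarrow> (sw G v g u, u, insert v (g - {u}), v) of (G, v, g, u) \<Rightarrow> (sw G v g u, u, insert v (g - {u}), v)) = z"
      using sw_back[OF GE V] by (simp add: z)
    then show "(case case z of (G, v, g, u) \<Rightarrow> (sw G v g u, u, insert v (g - {u}), v) of (G, v, g, u) \<Rightarrow> (sw G v g u, u, insert v (g - {u}), v)) = z" .
    show "(case z of (G, v, g, u) \<Rightarrow> (sw G v g u, u, insert v (g - {u}), v)) \<in> ?S"
      using sw_Val[OF GE V] sG by (simp add: z)
    then show "(case z of (G, v, g, u) \<Rightarrow> (sw G v g u, u, insert v (g - {u}), v)) \<in> ?S" .
    show "(case case z of (G, v, g, u) \<Rightarrow> (sw G v g u, u, insert v (g - {u}), v) of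
          (G, v, g, u) \<Rightarrow> w G d * xx G d v * F (sw G v g u) u (insert v (g - {u})) v) =
         (case z of (G, v, g, u) \<Rightarrow> w G d * xx G d v * F G v g u)"
      using sw_back[OF GE V] w_sw[OF GE V, of d] by (simp add: z)
  qed
  also have "\<dots> = (\<Sum>G\<in>hg f. \<Sum>(v, g, u)\<in>Val G. w G d * xx G d v * F (sw G v g u) u (insert v (g - {u})) v)"
    by (subst sum.Sigma) (auto simp: hgD)
  finally show ?thesis .
qed

definition Bs :: "nat set set" where "Bs = {B. B \<subseteq> {..<n} \<and> card B = k - 1}"

lemma finite_Bs [simp]: "finite Bs"
  by (rule finite_subset[of _ "Pow {..<n}"]) (auto simp: Bs_def)

lemma Bs_insert: "B \<in> Bs \<Longrightarrow> v < n \<Longrightarrow> v \<notin> B \<Longrightarrow> insert v B \<in> Es"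
  using k3 finite_subset[of B "{..<n}"] by (auto simp: Bs_def Es_lessThan)

text \<open>Every edge is counted once for each of its vertices \<open>v\<close>, split off from the
  remaining \<open>(k - 1)\<close>-set \<open>B\<close>. The vertex split off is the one to be
  exchanged.\<close>

lemma k_sum_edges:
  fixes X :: "nat \<Rightarrow> real"
  assumes F: "F \<subseteq> Es"
  shows "real k * (\<Sum>e\<in>F. \<Prod>v\<in>e. X v) = (\<Sum>v<n. \<Sum>B | B \<in> Bs \<and> v \<notin> B \<and> insert v B \<in> F. X v * (\<Prod>z\<in>B. X z))"
proof -
  have fF: "finite F" using F Es_subset by blast
  have fe: "finite e" if "e \<in> F" for e using that F by auto
  have "real k * (\<Sum>e\<in>F. \<Prod>v\<in>e. X v) = (\<Sum>e\<in>F. \<Sum>v\<in>e. \<Prod>v\<in>e. X v)"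
    unfolding sum_distrib_left using F by (intro sum.cong refl) (auto simp: Es_def)
  also have "\<dots> = (\<Sum>(e, v)\<in>(SIGMA e:F. e). \<Prod>v\<in>e. X v)" using fF fe by (subst sum.Sigma) auto
  also have "\<dots> = (\<Sum>(v, B)\<in>(SIGMA v:{..<n}. {B. B \<in> Bs \<and> v \<notin> B \<and> insert v B \<in> F}). X v * (\<Prod>z\<in>B. X z))"
  proof (rule sum.reindex_bij_witness[where j = "\<lambda>(e, v). (v, e - {v})" and i = "\<lambda>(v, B). (insert v B, v)"])
    fix z assume "z \<in> (SIGMA e:F. e)"
    then obtain e v where z: "z = (e, v)" and e: "e \<in> F" "v \<in> e" by auto
    have fin: "finite e" using fe e by auto
    have eE: "e \<subseteq> {..<n}" "card e = k" using e F by (auto simp: Es_lessThan)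
    show "(case case z of (e, v) \<Rightarrow> (v, e - {v}) of (v, B) \<Rightarrow> (insert v B, v)) = z"
      using e by (auto simp: z)
    show "(case z of (e, v) \<Rightarrow> (v, e - {v})) \<in> (SIGMA v:{..<n}. {B. B \<in> Bs \<and> v \<notin> B \<and> insert v B \<in> F})"
      using e eE fin by (auto simp: z Bs_def insert_absorb card_Diff_singleton)
    show "(case case z of (e, v) \<Rightarrow> (v, e - {v}) of (v, B) \<Rightarrow> X v * (\<Prod>z\<in>B. X z)) = (case z of (e, v) \<Rightarrow> \<Prod>v\<in>e. X v)"
      using e fin by (simp add: z prod.remove[symmetric])
  qed auto
  also have "\<dots> = (\<Sum>v<n. \<Sum>B | B \<in> Bs \<and> v \<notin> B \<and> insert v B \<in> F. X v * (\<Prod>z\<in>B. X z))"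
    by (subst sum.Sigma) auto
  finally show ?thesis .
qed

definition val :: "nat set set \<Rightarrow> nat \<Rightarrow> nat set \<Rightarrow> nat" where
  "val G v B = card {(g, u). (v, g, u) \<in> Val G \<and> u \<notin> B}"
text \<open>After the exchange, the condition \<open>insert v B \<in> G\<close> becomes
  \<open>insert u B \<in> G - {g}\<close>; these are the valid exchanges for which it holds.\<close>

definition cnt :: "nat set set \<Rightarrow> nat \<Rightarrow> nat set \<Rightarrow> nat" where
  "cnt G v B = card {(g, u). (v, g, u) \<in> Val G \<and> u \<notin> B \<and> insert u B \<in> G \<and> insert u B \<noteq> g}"

lemma fin_val [simp]: "G \<subseteq> Es \<Longrightarrow> finite {(g, u). (v, g, u) \<in> Val G \<and> P g u}"
  by (rule finite_subset[of _ "Es \<times> {..<n}"]) (auto simp: Val_def edge_lt)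

lemma val_le: assumes "G \<subseteq> Es" shows "card {(g, u). (v, g, u) \<in> Val G \<and> P g u} \<le> k * card G"
proof -
  have fG: "finite G" using assms Es_subset by blast
  have "card {(g, u). (v, g, u) \<in> Val G \<and> P g u} \<le> card (SIGMA g:G. g)"
    using fG assms by (intro card_mono finite_SigmaI) (auto simp: Val_def)
  also have "\<dots> = (\<Sum>g\<in>G. card g)" using fG assms by (subst card_SigmaI) auto
  also have "\<dots> = (\<Sum>g\<in>G. k)" using assms by (intro sum.cong) (auto simp: Es_def)
  finally show ?thesis by (simp add: mult.commute)
qed

lemma sum_Val:
  fixes h :: "nat \<Rightarrow> nat set \<Rightarrow> nat \<Rightarrow> real"
  assumes "G \<subseteq> Es"
  shows "(\<Sum>(v, g, u)\<in>Val G. h v g u) = (\<Sum>v<n. \<Sum>(g, u) | (v, g, u) \<in> Val G. h v g u)"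
proof -
  have "Val G = (SIGMA v:{..<n}. {(g, u). (v, g, u) \<in> Val G})" by (auto simp: Val_def)
  then have "(\<Sum>(v, g, u)\<in>Val G. h v g u) = (\<Sum>(v, g, u)\<in>(SIGMA v:{..<n}. {(g, u). (v, g, u) \<in> Val G}). h v g u)"
    by simp
  also have "\<dots> = (\<Sum>v<n. \<Sum>(g, u) | (v, g, u) \<in> Val G. h v g u)"
    using fin_val[OF assms, where P = "\<lambda>_ _. True"] by (subst sum.Sigma) (auto simp: case_prod_beta)
  finally show ?thesis .
qed

text \<open>The involution is applied to the free incidences at \<open>v\<close> and
  \<open>B\<close> that together form an edge. On the right the vertex completing \<open>B\<close>
  is no longer \<open>v\<close> but the vertex given up by the exchanged edge, and how often this
  succeeds depends only on counts that are regular for typical \<open>G\<close>.\<close>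

lemma swap_membership:
  "(\<Sum>G\<in>hg f. w G d * (\<Sum>v<n. \<Sum>B | B \<in> Bs \<and> v \<notin> B \<and> insert v B \<in> G. xx G d v * (\<Prod>z\<in>B. xx G d z) * real (val G v B)))
   = (\<Sum>G\<in>hg f. w G d * (\<Sum>v<n. \<Sum>B | B \<in> Bs \<and> v \<notin> B. xx G d v * (\<Prod>z\<in>B. xx G d z) * real (cnt G v B)))"
proof -
  define F where "F G v g u = (\<Sum>B | B \<in> Bs \<and> v \<notin> B \<and> u \<notin> B \<and> insert v B \<in> G. \<Prod>z\<in>B. xx G d z)" for G v u and g :: "nat set"
  have re: "(\<Sum>(g, u) | (v, g, u) \<in> Val G. \<Sum>B | B \<in> Bs \<and> v \<notin> B \<and> P u B g. r B)
      = (\<Sum>B | B \<in> Bs \<and> v \<notin> B. r B * real (card {(g, u). (v, g, u) \<in> Val G \<and> P u B g}))"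
    if G: "G \<subseteq> Es" for G v P and r :: "nat set \<Rightarrow> real"
  proof -
    let ?A = "{(g, u). (v, g, u) \<in> Val G}" and ?B = "{B. B \<in> Bs \<and> v \<notin> B}"
    have fA: "finite ?A" using fin_val[OF G, where P = "\<lambda>_ _. True"] by simp
    have "(\<Sum>(g, u)\<in>?A. \<Sum>B | B \<in> Bs \<and> v \<notin> B \<and> P u B g. r B) = (\<Sum>z\<in>?A. \<Sum>B\<in>?B. if P (snd z) B (fst z) then r B else 0)"
      by (intro sum.cong refl) (auto simp: sum.If_cases Int_def conj_ac case_prod_beta)
    also have "\<dots> = (\<Sum>B\<in>?B. \<Sum>z\<in>?A. if P (snd z) B (fst z) then r B else 0)" by (rule sum.swap)
    also have "\<dots> = (\<Sum>B\<in>?B. r B * real (card {(g, u). (v, g, u) \<in> Val G \<and> P u B g}))"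
    proof (intro sum.cong refl)
      fix B
      have "?A \<inter> {z. P (snd z) B (fst z)} = {(g, u). (v, g, u) \<in> Val G \<and> P u B g}" by auto
      then show "(\<Sum>z\<in>?A. if P (snd z) B (fst z) then r B else 0) = r B * real (card {(g, u). (v, g, u) \<in> Val G \<and> P u B g})"
        using fA by (simp add: sum.If_cases)
    qed
    finally show ?thesis .
  qed
  have L: "(\<Sum>(v, g, u)\<in>Val G. w G d * xx G d v * F G v g u)
     = w G d * (\<Sum>v<n. \<Sum>B | B \<in> Bs \<and> v \<notin> B \<and> insert v B \<in> G. xx G d v * (\<Prod>z\<in>B. xx G d z) * real (val G v B))"
    if G: "G \<in> hg f" for G
  proof -
    note GE = hgD(1)[OF G]
    have "(\<Sum>(v, g, u)\<in>Val G. w G d * xx G d v * F G v g u)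
       = (\<Sum>v<n. w G d * xx G d v * (\<Sum>(g, u) | (v, g, u) \<in> Val G. F G v g u))"
      unfolding sum_Val[OF GE] sum_distrib_left by (intro sum.cong refl) (auto simp: case_prod_beta)
    also have "\<dots> = (\<Sum>v<n. w G d * xx G d v * (\<Sum>B | B \<in> Bs \<and> v \<notin> B. (\<Prod>z\<in>B. xx G d z) * real (card {(g, u). (v, g, u) \<in> Val G \<and> u \<notin> B \<and> insert v B \<in> G})))"
      unfolding F_def by (subst re[OF GE, symmetric]) simp
    also have "\<dots> = (\<Sum>v<n. w G d * xx G d v * (\<Sum>B | B \<in> Bs \<and> v \<notin> B \<and> insert v B \<in> G. (\<Prod>z\<in>B. xx G d z) * real (val G v B)))"
    proof -
      have "(\<Sum>B | B \<in> Bs \<and> v \<notin> B. (\<Prod>z\<in>B. xx G d z) * real (card {(g, u). (v, g, u) \<in> Val G \<and> u \<notin> B \<and> insert v B \<in> G}))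
        = (\<Sum>B | B \<in> Bs \<and> v \<notin> B \<and> insert v B \<in> G. (\<Prod>z\<in>B. xx G d z) * real (val G v B))" for v
      proof (rule sum.mono_neutral_cong_right)
        show "\<forall>B\<in>{B. B \<in> Bs \<and> v \<notin> B} - {B. B \<in> Bs \<and> v \<notin> B \<and> insert v B \<in> G}.
          (\<Prod>z\<in>B. xx G d z) * real (card {(g, u). (v, g, u) \<in> Val G \<and> u \<notin> B \<and> insert v B \<in> G}) = 0"
        proof
          fix B assume "B \<in> {B. B \<in> Bs \<and> v \<notin> B} - {B. B \<in> Bs \<and> v \<notin> B \<and> insert v B \<in> G}"
          then have "{(g, u). (v, g, u) \<in> Val G \<and> u \<notin> B \<and> insert v B \<in> G} = {}" by auto
          then show "(\<Prod>z\<in>B. xx G d z) * real (card {(g, u). (v, g, u) \<in> Val G \<and> u \<notin> B \<and> insert v B \<in> G}) = 0"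
            by (simp only: card.empty of_nat_0 mult_zero_right)
        qed
      qed (auto simp: val_def)
      then show ?thesis by simp
    qed
    finally show ?thesis by (simp add: sum_distrib_left mult_ac)
  qed
  have R: "(\<Sum>(v, g, u)\<in>Val G. w G d * xx G d v * F (sw G v g u) u (insert v (g - {u})) v)
     = w G d * (\<Sum>v<n. \<Sum>B | B \<in> Bs \<and> v \<notin> B. xx G d v * (\<Prod>z\<in>B. xx G d z) * real (cnt G v B))"
    if G: "G \<in> hg f" for G
  proof -
    note GE = hgD(1)[OF G]
    have F': "F (sw G v g u) u (insert v (g - {u})) v
       = (\<Sum>B | B \<in> Bs \<and> v \<notin> B \<and> (u \<notin> B \<and> insert u B \<in> G \<and> insert u B \<noteq> g). \<Prod>z\<in>B. xx G d z)"
      if V: "(v, g, u) \<in> Val G" for v g u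
      unfolding F_def
    proof (intro sum.cong)
      show "{B. B \<in> Bs \<and> u \<notin> B \<and> v \<notin> B \<and> insert u B \<in> sw G v g u} = {B. B \<in> Bs \<and> v \<notin> B \<and> (u \<notin> B \<and> insert u B \<in> G \<and> insert u B \<noteq> g)}"
        using sw_facts[OF GE V] by (auto simp: sw_def)
      fix B assume "B \<in> {B. B \<in> Bs \<and> v \<notin> B \<and> (u \<notin> B \<and> insert u B \<in> G \<and> insert u B \<noteq> g)}"
      then show "(\<Prod>z\<in>B. xx (sw G v g u) d z) = (\<Prod>z\<in>B. xx G d z)"
        by (intro prod.cong refl xx_sw[OF GE V]) auto
    qed
    have "(\<Sum>(v, g, u)\<in>Val G. w G d * xx G d v * F (sw G v g u) u (insert v (g - {u})) v)
       = (\<Sum>(v, g, u)\<in>Val G. w G d * xx G d v * (\<Sum>B | B \<in> Bs \<and> v \<notin> B \<and> (u \<notin> B \<and> insert u B \<in> G \<and> insert u B \<noteq> g). \<Prod>z\<in>B. xx G d z))"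
      by (intro sum.cong refl) (auto simp: F')
    also have "\<dots> = (\<Sum>v<n. w G d * xx G d v * (\<Sum>(g, u) | (v, g, u) \<in> Val G. (\<Sum>B | B \<in> Bs \<and> v \<notin> B \<and> (u \<notin> B \<and> insert u B \<in> G \<and> insert u B \<noteq> g). \<Prod>z\<in>B. xx G d z)))"
      unfolding sum_Val[OF GE] by (intro sum.cong refl) (simp add: sum_distrib_left split_def)
    also have "\<dots> = (\<Sum>v<n. w G d * xx G d v * (\<Sum>B | B \<in> Bs \<and> v \<notin> B. (\<Prod>z\<in>B. xx G d z) * real (cnt G v B)))"
      unfolding cnt_def by (subst re[OF GE]) simp
    finally show ?thesis by (simp add: sum_distrib_left mult_ac)
  qed
  show ?thesis using swap_sum[of d F f] by (simp add: L R cong: sum.cong)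
qed

text \<open>The analogue of \<open>xx\<close> after one free incidence and its slot at
  \<open>v\<close> are removed, so \<open>xx * zz\<close> weighs pairs of free incidences at the
  same vertex.\<close>

definition zz :: "nat set set \<Rightarrow> (nat \<Rightarrow> nat) \<Rightarrow> nat \<Rightarrow> real" where
  "zz G d v = real (d v - hdeg G v - 1) / real (nv G v - 1)"

text \<open>An exchange moves one of two free incidences at \<open>v\<close> to another vertex
  \<open>u\<close>, where its factor reads \<open>xx G d u\<close> again. Collisions are thus
  dominated by pairs on distinct vertices, each reached through at most \<open>hdeg G u\<close>
  edges.\<close>

lemma swap_collision:
  "(\<Sum>G\<in>hg f. w G d * (\<Sum>v<n. xx G d v * zz G d v * real (val G v {})))
   \<le> (\<Sum>G\<in>hg f. w G d * (\<Sum>v<n. \<Sum>u | u < n \<and> u \<noteq> v. xx G d v * xx G d u * real (hdeg G u)))"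
proof -
  have L: "(\<Sum>(v, g, u)\<in>Val G. w G d * xx G d v * zz G d v) = w G d * (\<Sum>v<n. xx G d v * zz G d v * real (val G v {}))"
    if G: "G \<in> hg f" for G
    unfolding sum_Val[OF hgD(1)[OF G]] by (simp add: val_def sum_distrib_left case_prod_beta mult_ac)
  have R: "(\<Sum>(v, g, u)\<in>Val G. w G d * xx G d v * zz (sw G v g u) d u)
     \<le> w G d * (\<Sum>v<n. \<Sum>u | u < n \<and> u \<noteq> v. xx G d v * xx G d u * real (hdeg G u))" if G: "G \<in> hg f" for G
  proof -
    note GE = hgD(1)[OF G]
    have z: "zz (sw G v g u) d u = xx G d u" if V: "(v, g, u) \<in> Val G" for v g u
    proof -
      note sf = sw_facts[OF GE V]
      have "Suc (hdeg (sw G v g u) u) = hdeg G u" using hdeg_sw[OF GE V, of u] sf by simp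
      then have "d u - hdeg (sw G v g u) u - 1 = d u - hdeg G u" "nv (sw G v g u) u - 1 = nv G u"
        by (simp_all add: nv_def)
      then show ?thesis by (simp add: zz_def xx_def)
    qed
    have "(\<Sum>(v, g, u)\<in>Val G. w G d * xx G d v * zz (sw G v g u) d u) = (\<Sum>(v, g, u)\<in>Val G. w G d * (xx G d v * xx G d u))"
      by (intro sum.cong refl) (auto simp: z)
    also have "\<dots> \<le> (\<Sum>(v, u, g)\<in>(SIGMA v:{..<n}. SIGMA u:{u. u < n \<and> u \<noteq> v}. {g\<in>G. u \<in> g}). w G d * (xx G d v * xx G d u))"
    proof (rule sum_le_included[where i = "\<lambda>(v, u, g). (v, g, u)"])
      show "\<forall>y\<in>(SIGMA v:{..<n}. SIGMA u:{u. u < n \<and> u \<noteq> v}. {g\<in>G. u \<in> g}). 0 \<le> (case y of (v, u, g) \<Rightarrow> w G d * (xx G d v * xx G d u))"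
        by (auto intro!: mult_nonneg_nonneg w_nonneg xx_nonneg)
      show "\<forall>x\<in>Val G. \<exists>y\<in>(SIGMA v:{..<n}. SIGMA u:{u. u < n \<and> u \<noteq> v}. {g\<in>G. u \<in> g}).
          (case y of (v, u, g) \<Rightarrow> (v, g, u)) = x \<and> (case x of (v, g, u) \<Rightarrow> w G d * (xx G d v * xx G d u)) \<le> (case y of (v, u, g) \<Rightarrow> w G d * (xx G d v * xx G d u))"
      proof clarify
        fix v g u assume "(v, g, u) \<in> Val G"
        then show "\<exists>y\<in>(SIGMA v:{..<n}. SIGMA u:{u. u < n \<and> u \<noteq> v}. {g\<in>G. u \<in> g}).
          (case y of (v, u, g) \<Rightarrow> (v, g, u)) = (v, g, u) \<and> w G d * (xx G d v * xx G d u) \<le> (case y of (v, u, g) \<Rightarrow> w G d * (xx G d v * xx G d u))"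
          using sw_facts[OF GE] by (intro bexI[of _ "(v, u, g)"]) auto
      qed
    qed (use GE Es_subset in \<open>auto intro!: finite_SigmaI\<close>)
    also have "\<dots> = (\<Sum>v<n. \<Sum>u | u < n \<and> u \<noteq> v. \<Sum>g | g \<in> G \<and> u \<in> g. w G d * (xx G d v * xx G d u))"
      using Es_subset[OF GE] by (subst sum.Sigma[symmetric], simp, simp, subst sum.Sigma[symmetric], auto)
    finally show ?thesis by (simp add: hdeg_def sum_distrib_left mult_ac)
  qed
  have "(\<Sum>G\<in>hg f. w G d * (\<Sum>v<n. xx G d v * zz G d v * real (val G v {})))
      = (\<Sum>G\<in>hg f. \<Sum>(v, g, u)\<in>Val G. w G d * xx G d v * zz (sw G v g u) d u)"
    using swap_sum[of d "\<lambda>G v g u. zz G d v" f] by (simp add: L cong: sum.cong)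
  also have "\<dots> \<le> (\<Sum>G\<in>hg f. w G d * (\<Sum>v<n. \<Sum>u | u < n \<and> u \<noteq> v. xx G d v * xx G d u * real (hdeg G u)))"
    by (intro sum_mono R)
  finally show ?thesis .
qed

end

section \<open>The last steps of the interpolation\<close>

context kgraph
begin

text \<open>An inequality only because of vertices without free slots, where \<open>xx\<close> is
  zero by division by zero; otherwise this is \<open>Om_factor_moment\<close>.\<close>

lemma moment_le:
  assumes G: "G \<in> hg (m - i)" and e: "e \<subseteq> {..<n}" "card e \<le> k * i" and im: "i \<le> m"
  shows "(\<Sum>d\<in>Om n (k * m). w G d * (\<Prod>v\<in>e. xx G d v)) \<le> real ((k * (M - (m - i)) - card e) choose (k * i - card e))"
proof -
  have mi: "m - (m - i) = i" using im by simp
  have "(\<Sum>d\<in>Om n (k * m). w G d * (\<Prod>v\<in>e. xx G d v))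
     = (\<Sum>\<delta>\<in>Om n (k * i). (\<Prod>v<n. real (nv G v choose \<delta> v)) * (\<Prod>v\<in>e. real (\<delta> v) / real (nv G v)))"
    using sum_Om_w[OF G, of m "\<lambda>d. \<Prod>v\<in>e. xx G d v"] by (simp add: mi xx_def)
  also have "\<dots> \<le> real ((k * (M - (m - i)) - card e) choose (k * i - card e))"
  proof (cases "\<forall>v\<in>e. nv G v \<ge> 1")
    case True
    have "(\<Sum>\<delta>\<in>Om n (k * i). (\<Prod>v<n. real (nv G v choose \<delta> v)) * (\<Prod>v\<in>e. real (\<delta> v) / real (nv G v)))
       = real (((\<Sum>v<n. nv G v) - card e) choose (k * i - card e))"
      using True e by (intro Om_factor_moment) auto
    then show ?thesis using sum_nv[OF hgD(1)[OF G]] hgD(2)[OF G] by simp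
  next
    case False
    then obtain v where v: "v \<in> e" "nv G v = 0" by (auto simp: not_le)
    have "finite e" using e finite_subset by blast
    then have "(\<Prod>v\<in>e. real (\<delta> v) / real (nv G v)) = 0" for \<delta> using v by (intro prod_zero) auto
    then show ?thesis by simp
  qed
  finally show ?thesis .
qed

end

text \<open>\<open>GD\<close> holds the typical hypergraphs. Errors of \<open>val\<close> and
  \<open>cnt\<close> are measured against \<open>k * (m - i)\<close>, the number of pairs of an edge
  and one of its vertices, which is the trivial bound for both; \<open>\<rho>1\<close> collects the
  effect of \<open>\<xi>\<close> on products of \<open>k\<close> factors and the corrections for
  falling factorials.\<close>

locale end_phase = kgraph +
  fixes m i :: nat and \<rho> \<rho>1 \<xi> \<Delta> :: real and GD :: "nat set set set"
  assumes im: "1 \<le> i" "i < m" "m \<le> M" and mu3: "3 * (m - i) \<le> M"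
    and rho: "0 \<le> \<rho>" "\<rho> \<le> 1/6" and rho1: "0 \<le> \<rho>1" "\<rho>1 \<le> 1" and xi: "0 \<le> \<xi>" "\<xi> \<le> 1/8" and \<Delta>0: "0 \<le> \<Delta>"
    and GD: "GD \<subseteq> hg (m - i)"
    and val_good: "\<And>G v B. G \<in> GD \<Longrightarrow> v < n \<Longrightarrow> B \<in> Bs \<Longrightarrow> v \<notin> B \<Longrightarrow>
      (1 - real (m - i) / real M - \<rho>) * (real k * real (m - i)) \<le> real (val G v B) \<and>
      real (val G v B) \<le> (1 - real (m - i) / real M + \<rho>) * (real k * real (m - i))"
    and cnt_good: "\<And>G v B. G \<in> GD \<Longrightarrow> v < n \<Longrightarrow> B \<in> Bs \<Longrightarrow> v \<notin> B \<Longrightarrow>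
      (real (m - i) / real M * (1 - real (m - i) / real M) - \<rho>) * (real k * real (m - i)) \<le> real (cnt G v B) \<and>
      real (cnt G v B) \<le> (real (m - i) / real M * (1 - real (m - i) / real M) + \<rho>) * (real k * real (m - i))"
    and val0_good: "\<And>G v. G \<in> GD \<Longrightarrow> v < n \<Longrightarrow> real k * real (m - i) / 2 \<le> real (val G v {})"
    and deg_good: "\<And>G v. G \<in> GD \<Longrightarrow> v < n \<Longrightarrow> real (hdeg G v) \<le> \<Delta>"
    and nv_good: "\<And>G v. G \<in> GD \<Longrightarrow> v < n \<Longrightarrow>
      2 \<le> nv G v \<and> (1 - \<xi>) * (real k * real (M - (m - i)) / real n) \<le> real (nv G v) \<and>
      real (nv G v) \<le> (1 + \<xi>) * (real k * real (M - (m - i)) / real n)"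
    and xi_pow: "1 \<le> (1 + \<rho>1) * (1 - \<xi>) ^ k" "(1 - \<rho>1) * (1 + \<xi>) ^ k \<le> 1"
    and a0_bounds: "(1 - \<rho>1) \<le> (1 - real (m - i) / real M) * (real ((k * (M - (m - i))) choose k) / (real (M - (m - i)) * (real k * real (M - (m - i)) / real n) ^ k))"
      "(1 - real (m - i) / real M) * (real ((k * (M - (m - i))) choose k) / (real (M - (m - i)) * (real k * real (M - (m - i)) / real n) ^ k)) \<le> 1 + \<rho>1"
begin

definition "f = m - i"
definition "K = M - f"
definition "\<mu> = real f / real M"
definition "kf = real k * real f"
definition "Nb = real k * real K / real n"
text \<open>The value of \<open>c * E\<close> if every vertex had \<open>Nb\<close> free slots and
  all free incidences sat on distinct vertices. As \<open>E\<close> also counts edges of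
  \<open>G\<close>, it is close to \<open>1 / (1 - \<mu>)\<close> and not to one.\<close>

definition "a0 = real ((k * K) choose k) / (real K * Nb ^ k)"
definition "c = cT K i"
definition "s = k * i"

lemma f0: "0 < f" and K0: "0 < K" and iK: "i \<le> K" and M0: "0 < M" and fK: "f + K = M"
  using im mu3 by (auto simp: f_def K_def)

lemma n0: "0 < real n" and k0: "0 < real k" using k3 kn by auto

lemma kf0: "0 < kf" using f0 k0 by (simp add: kf_def)
lemma Nb0: "0 < Nb" using K0 k0 n0 by (simp add: Nb_def)

lemma mu: "0 \<le> \<mu>" "\<mu> \<le> 1/3"
proof -
  have "3 * real f \<le> real M" using mu3 unfolding f_def by (metis of_nat_le_iff of_nat_mult of_nat_numeral)
  then show "\<mu> \<le> 1/3" using M0 by (simp add: \<mu>_def field_simps)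
qed (simp add: \<mu>_def)

lemma s3: "3 \<le> s" "k \<le> s" "s \<le> k * K" using k3 im iK by (auto simp: s_def) (metis One_nat_def Suc_leI le_trans mult_le_mono nat_mult_1_right less_le_trans zero_less_one)

definition "P G d = (\<Sum>e\<in>G. \<Prod>v\<in>e. xx G d v)"
text \<open>Summing over all \<open>k\<close>-sets removes the dependence on which sets are edges:
  up to the variation of the slot numbers this is an elementary symmetric polynomial of the free
  incidences. The ratio is \<open>c * (E - P)\<close>.\<close>

definition "E G d = (\<Sum>e\<in>Es. \<Prod>v\<in>e. xx G d v)"
definition "W G d = w G d / Z m i"
definition "GB = hg f - GD"
definition "pg d = (\<Sum>G\<in>GD. W G d)"
definition "pbad d = (\<Sum>G\<in>GB. W G d)"
definition "R d = (\<Sum>G\<in>GD. W G d * E G d)"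
definition "Q d = (\<Sum>G\<in>GD. W G d * P G d)"
definition "bE d = (\<Sum>G\<in>GB. W G d * E G d)"
definition "b2 d = (\<Sum>G\<in>GB. W G d * (\<Sum>v<n. \<Sum>u | u < n \<and> u \<noteq> v. xx G d v * xx G d u))"

lemma finGD [simp]: "finite GD" "finite GB"
  using GD by (auto simp: GB_def f_def intro: finite_subset[OF _ finite_hg])

lemma Zp: "0 < Z m i" using Z_pos[of i m] im by simp

lemma W0: "0 \<le> W G d" using Zp w_nonneg by (simp add: W_def)

lemma split_sum: "(\<Sum>G\<in>hg f. h G) = (\<Sum>G\<in>GD. h G) + (\<Sum>G\<in>GB. h G)" for h :: "nat set set \<Rightarrow> real"
proof -
  have "hg f = GD \<union> GB" "GD \<inter> GB = {}" using GD by (auto simp: GB_def f_def)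
  then show ?thesis using sum.union_disjoint[of GD GB h] by simp
qed

lemma P_le_E: assumes "G \<in> hg f" shows "0 \<le> P G d" "P G d \<le> E G d"
proof -
  have "G \<subseteq> Es" using assms by (rule hgD)
  then show "P G d \<le> E G d" unfolding P_def E_def by (intro sum_mono2 prod_nonneg) (auto simp: xx_nonneg)
qed (auto simp: P_def xx_nonneg intro!: sum_nonneg prod_nonneg)

lemma E0: "0 \<le> E G d" by (auto simp: E_def xx_nonneg intro!: sum_nonneg prod_nonneg)

lemma GD_hg: "G \<in> GD \<Longrightarrow> G \<in> hg f" "G \<in> GB \<Longrightarrow> G \<in> hg f"
  using GD by (auto simp: f_def GB_def)

lemma GD_Es: "G \<in> GD \<Longrightarrow> G \<subseteq> Es" using GD_hg hgD by blast

definition "VL G d = (\<Sum>v<n. \<Sum>B | B \<in> Bs \<and> v \<notin> B \<and> insert v B \<in> G. xx G d v * (\<Prod>z\<in>B. xx G d z) * real (val G v B))"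
definition "VR G d = (\<Sum>v<n. \<Sum>B | B \<in> Bs \<and> v \<notin> B. xx G d v * (\<Prod>z\<in>B. xx G d z) * real (cnt G v B))"

lemma swap_W: "(\<Sum>G\<in>hg f. W G d * VL G d) = (\<Sum>G\<in>hg f. W G d * VR G d)"
  using swap_membership[of d f] unfolding VL_def VR_def W_def times_divide_eq_left sum_divide_distrib[symmetric] by simp

lemma kP: "G \<subseteq> Es \<Longrightarrow> real k * P G d = (\<Sum>v<n. \<Sum>B | B \<in> Bs \<and> v \<notin> B \<and> insert v B \<in> G. xx G d v * (\<Prod>z\<in>B. xx G d z))"
  unfolding P_def by (rule k_sum_edges)

lemma kE: "real k * E G d = (\<Sum>v<n. \<Sum>B | B \<in> Bs \<and> v \<notin> B. xx G d v * (\<Prod>z\<in>B. xx G d z))"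
proof -
  have "{B. B \<in> Bs \<and> v \<notin> B \<and> insert v B \<in> Es} = {B. B \<in> Bs \<and> v \<notin> B}" if "v < n" for v
    using Bs_insert that by auto
  then show ?thesis unfolding E_def using k_sum_edges[OF order_refl, of "xx G d"] by simp
qed

lemma sum2_bounds:
  fixes a :: "nat \<Rightarrow> nat set \<Rightarrow> real"
  assumes "\<And>v B. v < n \<Longrightarrow> B \<in> S v \<Longrightarrow> 0 \<le> a v B" and "\<And>v B. v < n \<Longrightarrow> B \<in> S v \<Longrightarrow> lo \<le> q v B \<and> q v B \<le> hi"
  shows "lo * (\<Sum>v<n. \<Sum>B\<in>S v. a v B) \<le> (\<Sum>v<n. \<Sum>B\<in>S v. a v B * q v B)"
    and "(\<Sum>v<n. \<Sum>B\<in>S v. a v B * q v B) \<le> hi * (\<Sum>v<n. \<Sum>B\<in>S v. a v B)"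
proof -
  show "lo * (\<Sum>v<n. \<Sum>B\<in>S v. a v B) \<le> (\<Sum>v<n. \<Sum>B\<in>S v. a v B * q v B)"
    unfolding sum_distrib_left
  proof (intro sum_mono)
    fix v B assume "v \<in> {..<n}" "B \<in> S v"
    then show "lo * a v B \<le> a v B * q v B" using assms[of v B] mult_left_mono[of lo "q v B" "a v B"] by (simp add: mult.commute)
  qed
  show "(\<Sum>v<n. \<Sum>B\<in>S v. a v B * q v B) \<le> hi * (\<Sum>v<n. \<Sum>B\<in>S v. a v B)"
    unfolding sum_distrib_left
  proof (intro sum_mono)
    fix v B assume "v \<in> {..<n}" "B \<in> S v"
    then show "a v B * q v B \<le> hi * a v B" using assms[of v B] mult_left_mono[of "q v B" hi "a v B"] by (simp add: mult.commute)
  qed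
qed

lemma xB0: "0 \<le> xx G d v * (\<Prod>z\<in>B. xx G d z)"
  by (intro mult_nonneg_nonneg prod_nonneg xx_nonneg)

lemma VL_bounds: assumes "G \<in> GD"
  shows "(1 - \<mu> - \<rho>) * kf * (real k * P G d) \<le> VL G d" "VL G d \<le> (1 - \<mu> + \<rho>) * kf * (real k * P G d)"
  unfolding VL_def kP[OF GD_Es[OF assms]] using val_good[OF assms, folded f_def, folded \<mu>_def kf_def] xB0
  by (intro sum2_bounds; auto)+

lemma VR_bounds: assumes "G \<in> GD"
  shows "(\<mu> * (1 - \<mu>) - \<rho>) * kf * (real k * E G d) \<le> VR G d" "VR G d \<le> (\<mu> * (1 - \<mu>) + \<rho>) * kf * (real k * E G d)"
  unfolding VR_def kE using cnt_good[OF assms, folded f_def, folded \<mu>_def kf_def] xB0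
  by (intro sum2_bounds; auto)+

lemma VLR_bad: assumes "G \<in> hg f"
  shows "0 \<le> VL G d" "VL G d \<le> kf * (real k * E G d)" "0 \<le> VR G d" "VR G d \<le> kf * (real k * E G d)"
proof -
  note GE = hgD(1)[OF assms]
  have c: "real (val G v B) \<le> kf" "real (cnt G v B) \<le> kf" for v B
    using val_le[OF GE, of v "\<lambda>g u. u \<notin> B"] val_le[OF GE, of v "\<lambda>g u. u \<notin> B \<and> insert u B \<in> G \<and> insert u B \<noteq> g"] hgD(2)[OF assms]
    unfolding val_def cnt_def kf_def of_nat_mult[symmetric] of_nat_le_iff by simp_all
  show "0 \<le> VL G d" "0 \<le> VR G d" unfolding VL_def VR_def by (auto intro!: sum_nonneg mult_nonneg_nonneg prod_nonneg xx_nonneg)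
  have "VL G d \<le> kf * (real k * P G d)"
    unfolding VL_def kP[OF GE] using c xB0 by (intro sum2_bounds(2)[where lo = 0]; auto)
  also have "\<dots> \<le> kf * (real k * E G d)" using P_le_E[OF assms] kf0 by (intro mult_left_mono) auto
  finally show "VL G d \<le> kf * (real k * E G d)" .
  show "VR G d \<le> kf * (real k * E G d)"
    unfolding VR_def kE using c xB0 by (intro sum2_bounds(2)[where lo = 0]; auto)
qed

lemma R0: "0 \<le> R d" and Q0: "0 \<le> Q d" and bE0: "0 \<le> bE d" and b20: "0 \<le> b2 d" and pb0: "0 \<le> pbad d" and pg0: "0 \<le> pg d"
  unfolding R_def Q_def bE_def b2_def pbad_def pg_def
  by (auto intro!: sum_nonneg mult_nonneg_nonneg W0 E0 xx_nonneg P_le_E(1) dest: GD_hg)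

text \<open>Up to a common factor and errors, \<open>swap_membership\<close> reads
  \<open>(1 - \<mu>) * Q = \<mu> * (1 - \<mu>) * R\<close>. The factor \<open>1 - \<mu>\<close>, the
  chance that an exchange is not blocked, occurs on both sides and cancels.\<close>

lemma membership_estimate: "\<bar>Q d - \<mu> * R d\<bar> \<le> 4 * \<rho> * R d + 2 * bE d"
proof -
  have kk: "0 < kf * real k" using kf0 k0 by simp
  have eq: "(\<Sum>G\<in>GD. W G d * VL G d) + (\<Sum>G\<in>GB. W G d * VL G d) = (\<Sum>G\<in>GD. W G d * VR G d) + (\<Sum>G\<in>GB. W G d * VR G d)"
    using swap_W[of d] unfolding split_sum .
  have "(1 - \<mu> - \<rho>) * kf * real k * Q d \<le> (\<Sum>G\<in>GD. W G d * VL G d)"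
    unfolding Q_def sum_distrib_left
  proof (intro sum_mono)
    fix G assume "G \<in> GD"
    then show "(1 - \<mu> - \<rho>) * kf * real k * (W G d * P G d) \<le> W G d * VL G d"
      using mult_left_mono[OF VL_bounds(1)[of G d] W0[of G d]] by (simp add: mult_ac)
  qed
  moreover have "(\<Sum>G\<in>GD. W G d * VL G d) \<le> (1 - \<mu> + \<rho>) * kf * real k * Q d"
    unfolding Q_def sum_distrib_left
  proof (intro sum_mono)
    fix G assume "G \<in> GD"
    then show "W G d * VL G d \<le> (1 - \<mu> + \<rho>) * kf * real k * (W G d * P G d)"
      using mult_left_mono[OF VL_bounds(2)[of G d] W0[of G d]] by (simp add: mult_ac)
  qed
  moreover have "(\<mu> * (1 - \<mu>) - \<rho>) * kf * real k * R d \<le> (\<Sum>G\<in>GD. W G d * VR G d)"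
    unfolding R_def sum_distrib_left
  proof (intro sum_mono)
    fix G assume "G \<in> GD"
    then show "(\<mu> * (1 - \<mu>) - \<rho>) * kf * real k * (W G d * E G d) \<le> W G d * VR G d"
      using mult_left_mono[OF VR_bounds(1)[of G d] W0[of G d]] by (simp add: mult_ac)
  qed
  moreover have "(\<Sum>G\<in>GD. W G d * VR G d) \<le> (\<mu> * (1 - \<mu>) + \<rho>) * kf * real k * R d"
    unfolding R_def sum_distrib_left
  proof (intro sum_mono)
    fix G assume "G \<in> GD"
    then show "W G d * VR G d \<le> (\<mu> * (1 - \<mu>) + \<rho>) * kf * real k * (W G d * E G d)"
      using mult_left_mono[OF VR_bounds(2)[of G d] W0[of G d]] by (simp add: mult_ac)
  qed
  moreover have "(\<Sum>G\<in>GB. W G d * VL G d) \<le> kf * real k * bE d" "(\<Sum>G\<in>GB. W G d * VR G d) \<le> kf * real k * bE d"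
  proof -
    have "W G d * VL G d \<le> kf * real k * (W G d * E G d)" "W G d * VR G d \<le> kf * real k * (W G d * E G d)" if "G \<in> GB" for G
      using mult_left_mono[OF VLR_bad(2)[OF GD_hg(2)[OF that], of d] W0[of G d]]
        mult_left_mono[OF VLR_bad(4)[OF GD_hg(2)[OF that], of d] W0[of G d]] by (simp_all only: mult_ac)
    then show "(\<Sum>G\<in>GB. W G d * VL G d) \<le> kf * real k * bE d" "(\<Sum>G\<in>GB. W G d * VR G d) \<le> kf * real k * bE d"
      unfolding bE_def sum_distrib_left by (auto intro!: sum_mono)
  qed
  moreover have "0 \<le> (\<Sum>G\<in>GB. W G d * VL G d)" "0 \<le> (\<Sum>G\<in>GB. W G d * VR G d)"
    by (auto intro!: sum_nonneg mult_nonneg_nonneg W0 VLR_bad GD_hg)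
  ultimately have "(1 - \<mu> - \<rho>) * kf * real k * Q d \<le> (\<mu> * (1 - \<mu>) + \<rho>) * kf * real k * R d + kf * real k * bE d"
    "(\<mu> * (1 - \<mu>) - \<rho>) * kf * real k * R d \<le> (1 - \<mu> + \<rho>) * kf * real k * Q d + kf * real k * bE d"
    using eq by linarith+
  then have "kf * real k * ((1 - \<mu> - \<rho>) * Q d) \<le> kf * real k * ((\<mu> * (1 - \<mu>) + \<rho>) * R d + bE d)"
    "kf * real k * ((\<mu> * (1 - \<mu>) - \<rho>) * R d) \<le> kf * real k * ((1 - \<mu> + \<rho>) * Q d + bE d)"
    by (simp_all add: algebra_simps)
  from mult_left_le_imp_le[OF this(1) kk] mult_left_le_imp_le[OF this(2) kk]
  have u: "(1 - \<mu> - \<rho>) * Q d \<le> (\<mu> * (1 - \<mu>) + \<rho>) * R d + bE d"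
    and l: "(\<mu> * (1 - \<mu>) - \<rho>) * R d \<le> (1 - \<mu> + \<rho>) * Q d + bE d"
    by this+
  \<comment> \<open>Here \<open>\<mu> \<le> 1/3\<close> and \<open>\<rho> \<le> 1/6\<close> are
    used: dividing by this coefficient at most doubles the errors.\<close>
  have a: "1/2 \<le> 1 - \<mu> - \<rho>" "1/2 \<le> 1 - \<mu> + \<rho>" using mu rho by linarith+
  have mr: "\<mu> * \<rho> * R d \<le> \<rho> * R d" using mult_right_mono[OF mult_left_le_one_le[of \<rho> \<mu>], of "R d"] mu rho R0[of d] by simp
  have r0: "0 \<le> \<rho> * R d" using rho R0[of d] by simp
  have nn: "0 \<le> 4 * \<rho> * R d + 2 * bE d"
    by (intro add_nonneg_nonneg mult_nonneg_nonneg) (simp_all add: rho R0 bE0)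
  have half: "(1/2) * (4 * \<rho> * R d + 2 * bE d) = 2 * (\<rho> * R d) + bE d" by (simp add: algebra_simps)
  have "(1 - \<mu> - \<rho>) * (Q d - \<mu> * R d) \<le> \<mu> * \<rho> * R d + \<rho> * R d + bE d"
    using u by (simp add: algebra_simps)
  also have "\<dots> \<le> (1/2) * (4 * \<rho> * R d + 2 * bE d)" unfolding half using mr r0 by linarith
  also have "\<dots> \<le> (1 - \<mu> - \<rho>) * (4 * \<rho> * R d + 2 * bE d)" by (rule mult_right_mono[OF a(1) nn])
  finally have q1: "Q d - \<mu> * R d \<le> 4 * \<rho> * R d + 2 * bE d" by (rule mult_left_le_imp_le) (use a in linarith)
  have "(1 - \<mu> + \<rho>) * (\<mu> * R d - Q d) \<le> \<mu> * \<rho> * R d + \<rho> * R d + bE d"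
    using l by (simp add: algebra_simps)
  then have "(1 - \<mu> + \<rho>) * (\<mu> * R d - Q d) \<le> (1/2) * (4 * \<rho> * R d + 2 * bE d)" unfolding half using mr r0 by linarith
  also have "\<dots> \<le> (1 - \<mu> + \<rho>) * (4 * \<rho> * R d + 2 * bE d)" by (rule mult_right_mono[OF a(2) nn])
  finally have q2: "\<mu> * R d - Q d \<le> 4 * \<rho> * R d + 2 * bE d" by (rule mult_left_le_imp_le) (use a in linarith)
  show ?thesis using q1 q2 by linarith
qed

end

lemma two_choose_two: "2 * real (a choose 2) = real a * real (a - 1)"
proof -
  have "even (a * (a - 1))" by (cases a) auto
  then have "2 * (a choose 2) = a * (a - 1)" by (simp add: choose_two)
  then show ?thesis by (metis of_nat_mult of_nat_numeral)
qed

section \<open>Collisions of free incidences and the averaged step\<close>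

context end_phase
begin

text \<open>Up to slot factors, twice the number of pairs of free incidences at a common
  vertex.\<close>

definition "CZ G d = (\<Sum>v<n. xx G d v * zz G d v)"
definition "X2 d = (\<Sum>G\<in>GD. W G d * CZ G d)"
definition "S2 = real (s choose 2)"
definition "k2 = real (k choose 2)"
text \<open>The contributions of the exceptional hypergraphs: their mass, their edge sums, and their
  pair sums from the collision bound.\<close>

definition "\<beta>e d = pbad d + 3 * c * bE d + real k * Nb\<^sup>2 / S2 * b2 d"
definition "\<epsilon>e = 24 * \<rho> + 3 * \<rho>1 + 3 * real k * \<Delta> / real f"

lemma c0: "0 < c"
proof -
  have "s \<le> k * K" "s - k \<le> k * K - k" using s3 by (auto intro: diff_le_mono)
  then show ?thesis using K0 unfolding c_def cT_def s_def by (intro divide_pos_pos mult_pos_pos) auto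
qed

lemma S20: "0 < S2" "(real s)\<^sup>2 \<le> 3 * S2" and k2: "0 \<le> k2" "k2 \<le> (real k)\<^sup>2 / 2"
proof -
  have c2: "2 * real (a choose 2) = real a * (real a - 1)" for a :: nat
    using two_choose_two[of a] by (cases a) simp_all
  show "0 < S2" using s3 by (simp add: S2_def)
  have "3 * real s \<le> real s * real s" using s3 by (intro mult_right_mono) auto
  then show "(real s)\<^sup>2 \<le> 3 * S2" using c2[of s] by (simp add: S2_def power2_eq_square algebra_simps)
  show "0 \<le> k2" "k2 \<le> (real k)\<^sup>2 / 2" using c2[of k] by (simp_all add: k2_def power2_eq_square algebra_simps)
qed

lemma nvb: assumes "G \<in> GD" "v < n"
  shows "2 \<le> nv G v" "(1 - \<xi>) * Nb \<le> real (nv G v)" "real (nv G v) \<le> (1 + \<xi>) * Nb"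
  using nv_good[OF assms] by (auto simp: Nb_def K_def f_def)

lemma xi7: "7/8 \<le> 1 - \<xi>" "0 < 1 - \<xi>" "1 + \<xi> \<le> 9/8" "0 < 1 + \<xi>" using xi by auto

text \<open>For typical \<open>G\<close> at least \<open>kf / 2\<close> exchanges separate a given
  collision, while a separated pair is reached at most \<open>\<Delta>\<close> times. Collisions are
  therefore rarer than pairs by a factor of order \<open>\<Delta> / kf\<close>.\<close>

lemma collision_estimate:
  assumes d: "d \<in> Om n (k * m)"
  shows "X2 d \<le> 2 / kf * (\<Delta> * (real s / ((1 - \<xi>) * Nb))\<^sup>2 * pg d + real f * b2 d)"
proof -
  let ?C = "\<lambda>G. \<Sum>v<n. xx G d v * zz G d v * real (val G v {})"
  let ?D = "\<lambda>G. \<Sum>v<n. \<Sum>u | u < n \<and> u \<noteq> v. xx G d v * xx G d u * real (hdeg G u)"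
  let ?A = "\<lambda>G. \<Sum>v<n. \<Sum>u | u < n \<and> u \<noteq> v. xx G d v * xx G d u"
  have z0: "0 \<le> zz G d v" for G v by (simp add: zz_def)
  have C0: "0 \<le> ?C G" for G by (intro sum_nonneg mult_nonneg_nonneg xx_nonneg z0) auto
  have A0: "0 \<le> ?A G" for G by (intro sum_nonneg mult_nonneg_nonneg xx_nonneg)
  have main: "(\<Sum>G\<in>hg f. W G d * ?C G) \<le> (\<Sum>G\<in>hg f. W G d * ?D G)"
    using swap_collision[of d f] Zp unfolding W_def times_divide_eq_left sum_divide_distrib[symmetric]
    by (intro divide_right_mono) auto
  have "kf / 2 * X2 d = (\<Sum>G\<in>GD. kf / 2 * (W G d * CZ G d))"
    unfolding X2_def by (rule sum_distrib_left)
  also have "\<dots> \<le> (\<Sum>G\<in>GD. W G d * ?C G)"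
  proof (rule sum_mono)
    fix G assume G: "G \<in> GD"
    have "kf / 2 * CZ G d \<le> ?C G" unfolding CZ_def sum_distrib_left
    proof (intro sum_mono)
      fix v assume "v \<in> {..<n}"
      then show "kf / 2 * (xx G d v * zz G d v) \<le> xx G d v * zz G d v * real (val G v {})"
        using mult_left_mono[OF val0_good[OF G, of v, folded f_def, folded kf_def] mult_nonneg_nonneg[OF xx_nonneg z0], of G d v G v]
        by (simp add: mult_ac)
    qed
    then have "W G d * (kf / 2 * CZ G d) \<le> W G d * ?C G" by (rule mult_left_mono[OF _ W0])
    moreover have "kf / 2 * (W G d * CZ G d) = W G d * (kf / 2 * CZ G d)" by (simp only: mult_ac)
    ultimately show "kf / 2 * (W G d * CZ G d) \<le> W G d * ?C G" by (simp only:)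
  qed
  also have "\<dots> \<le> (\<Sum>G\<in>hg f. W G d * ?C G)"
    unfolding split_sum using sum_nonneg[of GB "\<lambda>G. W G d * ?C G"] mult_nonneg_nonneg[OF W0 C0] by simp
  also note main
  also have "(\<Sum>G\<in>hg f. W G d * ?D G) \<le> (\<Sum>G\<in>GD. W G d * (\<Delta> * (real s / ((1 - \<xi>) * Nb))\<^sup>2)) + (\<Sum>G\<in>GB. W G d * (real f * ?A G))"
    unfolding split_sum
  proof (intro add_mono sum_mono)
    fix G assume G: "G \<in> GB"
    have "hdeg G u \<le> f" for u
      using hgD[OF GD_hg(2)[OF G]] unfolding hdeg_def by (metis (no_types, lifting) card_mono mem_Collect_eq subsetI)
    then have "?D G \<le> real f * ?A G" unfolding sum_distrib_left
      by (intro sum_mono) (simp add: mult.commute[of "real f"] mult_left_mono xx_nonneg)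
    then show "W G d * ?D G \<le> W G d * (real f * ?A G)" by (intro mult_left_mono W0)
  next
    fix G assume G: "G \<in> GD"
    show "W G d * ?D G \<le> W G d * (\<Delta> * (real s / ((1 - \<xi>) * Nb))\<^sup>2)"
    proof (cases "w G d = 0")
      case False
      then have le: "\<forall>v<n. hdeg G v \<le> d v" by (auto simp: w_def split: if_splits)
      have "(\<Sum>v<n. xx G d v) \<le> (\<Sum>v<n. real (d v - hdeg G v) / ((1 - \<xi>) * Nb))"
        unfolding xx_def using nvb[OF G] xi7 Nb0
        by (intro sum_mono divide_left_mono) (fastforce intro!: mult_pos_pos)+
      also have "\<dots> = real (\<Sum>v<n. d v - hdeg G v) / ((1 - \<xi>) * Nb)" by (simp add: sum_divide_distrib)
      also have "(\<Sum>v<n. d v - hdeg G v) = s"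
        using le d sum_hdeg[OF GD_Es[OF G]] hgD(2)[OF GD_hg(1)[OF G]] sum_subtractf_nat[of "{..<n}" "hdeg G" d] im
        by (auto simp: Om_def s_def f_def diff_mult_distrib2[symmetric])
      finally have sx: "(\<Sum>v<n. xx G d v) \<le> real s / ((1 - \<xi>) * Nb)" .
      have "?D G \<le> (\<Sum>v<n. \<Sum>u<n. xx G d v * xx G d u * \<Delta>)"
      proof (intro sum_mono)
        fix v assume "v \<in> {..<n}"
        have "(\<Sum>u | u < n \<and> u \<noteq> v. xx G d v * xx G d u * real (hdeg G u)) \<le> (\<Sum>u | u < n \<and> u \<noteq> v. xx G d v * xx G d u * \<Delta>)"
          using deg_good[OF G] by (intro sum_mono mult_left_mono mult_nonneg_nonneg xx_nonneg) auto
        also have "\<dots> \<le> (\<Sum>u<n. xx G d v * xx G d u * \<Delta>)"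
          using \<Delta>0 G by (intro sum_mono2) (auto intro!: mult_nonneg_nonneg xx_nonneg)
        finally show "(\<Sum>u | u < n \<and> u \<noteq> v. xx G d v * xx G d u * real (hdeg G u)) \<le> (\<Sum>u<n. xx G d v * xx G d u * \<Delta>)" .
      qed
      also have "\<dots> = \<Delta> * (\<Sum>v<n. xx G d v)\<^sup>2"
        by (simp add: power2_eq_square sum_product sum_distrib_left mult_ac)
      also have "\<dots> \<le> \<Delta> * (real s / ((1 - \<xi>) * Nb))\<^sup>2"
        using sx \<Delta>0 G by (intro mult_left_mono power_mono sum_nonneg xx_nonneg) auto
      finally show ?thesis by (intro mult_left_mono W0)
    qed (simp add: W_def)
  qed
  also have "\<dots> = \<Delta> * (real s / ((1 - \<xi>) * Nb))\<^sup>2 * pg d + real f * b2 d"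
    by (simp add: pg_def b2_def sum_distrib_left sum_distrib_right mult_ac)
  finally show ?thesis using kf0 by (simp add: field_simps)
qed

text \<open>Replacing all slot numbers by \<open>(1 - \<xi>) * Nb\<close> or
  \<open>(1 + \<xi>) * Nb\<close> turns \<open>E\<close> into \<open>esym\<close>, which is at most
  \<open>s choose k\<close> and falls short of it only through collisions.\<close>

lemma cE_bounds:
  assumes G: "G \<in> GD" and w: "w G d \<noteq> 0" and d: "d \<in> Om n (k * m)"
  shows "(1 - \<mu>) * (c * E G d) \<le> 1 + 3 * \<rho>1"
    and "1 - 2 * \<rho>1 - k2 / S2 * (((1 + \<xi>) * Nb)\<^sup>2 / 2 * CZ G d) \<le> (1 - \<mu>) * (c * E G d)"
proof -
  define \<delta> where "\<delta> v = d v - hdeg G v" for v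
  define D where "D = (\<Sum>v<n. \<delta> v choose 2)"
  have le: "\<forall>v<n. hdeg G v \<le> d v" using w by (auto simp: w_def split: if_splits)
  have s\<delta>: "(\<Sum>v<n. \<delta> v) = s"
    using le d sum_hdeg[OF GD_Es[OF G]] hgD(2)[OF GD_hg(1)[OF G]] sum_subtractf_nat[of "{..<n}" "hdeg G" d] im
    by (auto simp: Om_def s_def f_def \<delta>_def diff_mult_distrib2[symmetric])
  have xb: "real (\<delta> v) / ((1 + \<xi>) * Nb) \<le> xx G d v" "xx G d v \<le> real (\<delta> v) / ((1 - \<xi>) * Nb)" if "v < n" for v
    unfolding xx_def \<delta>_def[symmetric] using nvb[OF G that] xi7 Nb0
    by (auto intro!: divide_left_mono mult_pos_pos)
  have es: "(\<Sum>e\<in>Es. \<Prod>v\<in>e. real (\<delta> v) / q) = real (esym \<delta> n k) / q ^ k" for q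
  proof -
    have "(\<Sum>e\<in>Es. \<Prod>v\<in>e. real (\<delta> v) / q) = (\<Sum>e\<in>Es. (\<Prod>v\<in>e. real (\<delta> v)) / q ^ k)"
      by (intro sum.cong refl) (auto simp: prod_dividef Es_def)
    then show ?thesis by (simp add: esym_def Es_lessThan sum_divide_distrib)
  qed
  have "E G d \<le> (\<Sum>e\<in>Es. \<Prod>v\<in>e. real (\<delta> v) / ((1 - \<xi>) * Nb))"
    unfolding E_def using xb xx_nonneg by (intro sum_mono prod_mono) (auto simp: Es_lessThan)
  also have "\<dots> = real (esym \<delta> n k) / ((1 - \<xi>) * Nb) ^ k" by (rule es)
  also have "\<dots> \<le> real (s choose k) / ((1 - \<xi>) * Nb) ^ k"
    using esym_le[of \<delta> n k] s\<delta> xi7 Nb0 by (intro divide_right_mono) auto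
  finally have U: "E G d \<le> real (s choose k) / ((1 - \<xi>) * Nb) ^ k" .
  have "real (esym \<delta> n k) / ((1 + \<xi>) * Nb) ^ k = (\<Sum>e\<in>Es. \<Prod>v\<in>e. real (\<delta> v) / ((1 + \<xi>) * Nb))" by (rule es[symmetric])
  also have "\<dots> \<le> E G d"
    unfolding E_def using xb Nb0 xi7 by (intro sum_mono prod_mono) (auto simp: Es_lessThan)
  finally have L: "real (esym \<delta> n k) / ((1 + \<xi>) * Nb) ^ k \<le> E G d" .
  define j where "j = k - 2"
  have j: "k = Suc (Suc j)" using k3 by (simp add: j_def)
  have "s choose k \<le> esym \<delta> n k + ((s - 2) choose (k - 2)) * D"
    using esym_ge[where \<delta> = \<delta> and n = n and j = j] unfolding s\<delta> D_def[symmetric] j[symmetric] by (simp add: j_def)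
  then have "real (s choose k) - real ((s - 2) choose (k - 2)) * real D \<le> real (esym \<delta> n k)"
    by (metis diff_le_eq of_nat_add of_nat_le_iff of_nat_mult)
  moreover have "real (s choose k) * k2 = S2 * real ((s - 2) choose (k - 2))"
  proof -
    have "(s choose k) * (k choose 2) = (s choose 2) * ((s - 2) choose (k - 2))"
      by (rule choose_mult) (use s3 k3 in auto)
    then show ?thesis unfolding S2_def k2_def by (metis of_nat_mult)
  qed
  then have "real ((s - 2) choose (k - 2)) = k2 / S2 * real (s choose k)" using S20 by (simp add: field_simps)
  ultimately have es_lo: "real (s choose k) * (1 - k2 / S2 * real D) \<le> real (esym \<delta> n k)" by (simp add: algebra_simps)
  \<comment> \<open>Counting \<open>k\<close>-subsets of \<open>s\<close>-subsets in both orders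
    eliminates \<open>s\<close> from \<open>c * (s choose k)\<close>.\<close>
  have "(k * K choose s) * (s choose k) = (k * K choose k) * ((k * K - k) choose (s - k))"
    by (rule choose_mult) (use s3 in auto)
  then have cc: "real (k * K choose s) * real (s choose k) = real (k * K choose k) * real ((k * K - k) choose (s - k))"
    by (metis of_nat_mult)
  have pos: "0 < real ((k * K - k) choose (s - k))" using s3 diff_le_mono[of s "k * K" k] by simp
  have a0: "c * real (s choose k) / Nb ^ k = a0"
    using cc pos K0 Nb0 unfolding c_def cT_def s_def[symmetric] a0_def by (simp add: field_simps)
  have mu1: "0 \<le> 1 - \<mu>" using mu by simp
  have a0b: "1 - \<rho>1 \<le> (1 - \<mu>) * a0" "(1 - \<mu>) * a0 \<le> 1 + \<rho>1"
    using a0_bounds unfolding a0_def \<mu>_def Nb_def K_def f_def by simp_all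
  have "(1 - \<mu>) * (c * E G d) \<le> (1 - \<mu>) * (c * (real (s choose k) / ((1 - \<xi>) * Nb) ^ k))"
    using U c0 mu1 by (intro mult_left_mono) auto
  also have "\<dots> = (1 - \<mu>) * a0 / (1 - \<xi>) ^ k" by (simp add: a0[symmetric] power_mult_distrib)
  also have "\<dots> \<le> (1 + \<rho>1) / (1 - \<xi>) ^ k" using a0b xi7 by (intro divide_right_mono) auto
  also have "\<dots> \<le> (1 + \<rho>1) * (1 + \<rho>1)"
    using mult_left_mono[OF xi_pow(1), of "1 + \<rho>1"] rho1 xi7 by (simp add: pos_divide_le_eq mult_ac)
  also have "\<dots> \<le> 1 + 3 * \<rho>1"
    using mult_left_le_one_le[of \<rho>1 \<rho>1] rho1 by (simp add: algebra_simps)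
  finally show "(1 - \<mu>) * (c * E G d) \<le> 1 + 3 * \<rho>1" .
  define y where "y = k2 / S2 * real D"
  have y0: "0 \<le> y" using k2 S20 by (simp add: y_def)
  have lo: "1 - 2 * \<rho>1 - y \<le> (1 - \<mu>) * (c * E G d)"
  \<comment> \<open>For \<open>y > 1\<close> the lower bound is negative while \<open>c * E\<close>
    is not.\<close>
  proof (cases "y \<le> 1")
    case False
    have "0 \<le> (1 - \<mu>) * (c * E G d)" using mu1 c0 E0 by simp
    then show ?thesis using False rho1 by linarith
  next
    case True
    have "1 - 2 * \<rho>1 - y \<le> (1 - \<rho>1)\<^sup>2 * (1 - y)"
    proof -
      have "(1 - \<rho>1)\<^sup>2 \<le> 1" using rho1 by (simp add: power_le_one)
      then have "(1 - \<rho>1)\<^sup>2 * y \<le> y" using y0 by (simp add: mult_left_le_one_le)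
      moreover have "1 - 2 * \<rho>1 \<le> (1 - \<rho>1)\<^sup>2" by (simp add: power2_eq_square algebra_simps)
      ultimately show ?thesis by (simp add: algebra_simps)
    qed
    also have "\<dots> = (1 - \<rho>1) * ((1 - \<rho>1) * (1 - y))" by (simp add: power2_eq_square)
    also have "\<dots> \<le> ((1 - \<mu>) * a0) * ((1 / (1 + \<xi>) ^ k) * (1 - y))"
    proof (intro mult_mono)
      show "1 - \<rho>1 \<le> 1 / (1 + \<xi>) ^ k" using xi_pow(2) xi7 by (simp add: pos_le_divide_eq)
    qed (use a0b rho1 True xi7 in auto)
    also have "\<dots> = (1 - \<mu>) * (c * (real (s choose k) * (1 - y) / ((1 + \<xi>) * Nb) ^ k))"
      by (simp add: a0[symmetric] power_mult_distrib mult_ac)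
    also have "\<dots> \<le> (1 - \<mu>) * (c * (real (esym \<delta> n k) / ((1 + \<xi>) * Nb) ^ k))"
      using es_lo c0 mu1 xi7 Nb0 unfolding y_def by (intro mult_left_mono divide_right_mono) auto
    also have "\<dots> \<le> (1 - \<mu>) * (c * E G d)" using L c0 mu1 by (intro mult_left_mono) auto
    finally show ?thesis .
  qed
  have "real D \<le> ((1 + \<xi>) * Nb)\<^sup>2 / 2 * CZ G d"
    unfolding D_def CZ_def of_nat_sum sum_distrib_left
  proof (intro sum_mono)
    fix v assume "v \<in> {..<n}" then have v: "v < n" by simp
    have nv: "0 < real (nv G v)" "0 < real (nv G v - 1)" "real (nv G v - 1) \<le> real (nv G v)" using nvb[OF G v] by auto
    have z0: "0 \<le> xx G d v * zz G d v" by (simp add: zz_def xx_def)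
    have "real (\<delta> v choose 2) = real (\<delta> v) * real (\<delta> v - 1) / 2"
      using two_choose_two[of "\<delta> v"] by simp
    also have "\<dots> = (real (nv G v) * real (nv G v - 1)) / 2 * (xx G d v * zz G d v)"
      using nv by (simp add: xx_def zz_def \<delta>_def)
    also have "\<dots> \<le> ((1 + \<xi>) * Nb)\<^sup>2 / 2 * (xx G d v * zz G d v)"
    proof (intro mult_right_mono divide_right_mono z0)
      show "real (nv G v) * real (nv G v - 1) \<le> ((1 + \<xi>) * Nb)\<^sup>2"
        unfolding power2_eq_square using nvb[OF G v] nv by (intro mult_mono) auto
    qed auto
    finally show "real (\<delta> v choose 2) \<le> ((1 + \<xi>) * Nb)\<^sup>2 / 2 * (xx G d v * zz G d v)" .
  qed
  then have "y \<le> k2 / S2 * (((1 + \<xi>) * Nb)\<^sup>2 / 2 * CZ G d)"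
    unfolding y_def using k2 S20 by (intro mult_left_mono) auto
  then show "1 - 2 * \<rho>1 - k2 / S2 * (((1 + \<xi>) * Nb)\<^sup>2 / 2 * CZ G d) \<le> (1 - \<mu>) * (c * E G d)"
    using lo by linarith
qed

text \<open>On average the edges take the share \<open>\<mu>\<close> of \<open>E\<close>, so
  \<open>p m (i - 1) d\<close> is about \<open>(1 - \<mu>) * (c * R d)\<close>. This is compared
  with \<open>p m i d\<close> by \<open>cE_bounds\<close>, with the collisions averaged as
  well.\<close>

lemma end_step:
  assumes d: "d \<in> Om n (k * m)"
  shows "\<bar>p m (i - 1) d - p m i d\<bar> \<le> \<epsilon>e * p m i d + \<beta>e d"
proof -
  have pi: "p m i d = pg d + pbad d"
    unfolding p_def f_def[symmetric] pg_def pbad_def W_def split_sum sum_divide_distrib[symmetric] add_divide_distrib by simp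
  have TE: "T G d i = c * (E G d - P G d)" if "G \<in> hg f" for G
  proof -
    have "(\<Sum>e\<in>Es - G. \<Prod>v\<in>e. xx G d v) = E G d - P G d"
      unfolding E_def P_def using hgD(1)[OF that] by (simp add: sum_diff)
    then show ?thesis using hgD(2)[OF that] by (simp add: T_def c_def K_def)
  qed
  have "p m (i - 1) d = (\<Sum>G\<in>hg f. W G d * T G d i)"
    unfolding f_def W_def by (rule p_rec) (use im in auto)
  also have "\<dots> = (\<Sum>G\<in>hg f. c * (W G d * E G d) - c * (W G d * P G d))"
    by (intro sum.cong refl) (simp add: TE algebra_simps)
  also have "\<dots> = c * R d - c * Q d + (\<Sum>G\<in>GB. c * (W G d * E G d) - c * (W G d * P G d))"
    unfolding split_sum by (simp add: R_def Q_def sum_distrib_left sum_subtractf)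
  finally have p1: "p m (i - 1) d = c * R d - c * Q d + (\<Sum>G\<in>GB. c * (W G d * E G d) - c * (W G d * P G d))" .
  have bd: "0 \<le> (\<Sum>G\<in>GB. c * (W G d * E G d) - c * (W G d * P G d))"
      "(\<Sum>G\<in>GB. c * (W G d * E G d) - c * (W G d * P G d)) \<le> c * bE d"
  proof -
    have "c * (W G d * P G d) \<le> c * (W G d * E G d)" "0 \<le> c * (W G d * P G d)" if "G \<in> GB" for G
      using P_le_E[OF GD_hg(2)[OF that], of d] c0 W0[of G d] by (auto intro!: mult_left_mono mult_nonneg_nonneg)
    then show "0 \<le> (\<Sum>G\<in>GB. c * (W G d * E G d) - c * (W G d * P G d))"
      "(\<Sum>G\<in>GB. c * (W G d * E G d) - c * (W G d * P G d)) \<le> c * bE d"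
      unfolding bE_def sum_distrib_left by (auto intro!: sum_nonneg sum_mono)
  qed
  have qr: "\<bar>c * Q d - \<mu> * (c * R d)\<bar> \<le> 4 * \<rho> * (c * R d) + 2 * (c * bE d)"
    using mult_left_mono[OF membership_estimate[of d], of c] c0
    by (simp add: abs_mult[of c, symmetric, unfolded abs_of_pos[OF c0]] algebra_simps)
  have up: "(1 - \<mu>) * (c * R d) \<le> (1 + 3 * \<rho>1) * pg d"
    unfolding R_def pg_def sum_distrib_left
  proof (intro sum_mono)
    fix G assume G: "G \<in> GD"
    have "W G d * ((1 - \<mu>) * (c * E G d)) \<le> W G d * (1 + 3 * \<rho>1)"
    proof (cases "w G d = 0")
      case False then show ?thesis by (intro mult_left_mono W0 cE_bounds G d)
    qed (simp add: W_def)
    then show "(1 - \<mu>) * (c * (W G d * E G d)) \<le> (1 + 3 * \<rho>1) * W G d" by (simp add: mult_ac)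
  qed
  let ?h = "k2 / S2 * (((1 + \<xi>) * Nb)\<^sup>2 / 2)"
  have lo: "(1 - 2 * \<rho>1) * pg d - ?h * X2 d \<le> (1 - \<mu>) * (c * R d)"
    unfolding R_def pg_def X2_def sum_distrib_left sum_subtractf[symmetric]
  proof (intro sum_mono)
    fix G assume G: "G \<in> GD"
    have "W G d * (1 - 2 * \<rho>1 - k2 / S2 * (((1 + \<xi>) * Nb)\<^sup>2 / 2 * CZ G d)) \<le> W G d * ((1 - \<mu>) * (c * E G d))"
    proof (cases "w G d = 0")
      case False then show ?thesis by (intro mult_left_mono W0 cE_bounds G d)
    qed (simp add: W_def)
    then show "(1 - 2 * \<rho>1) * W G d - ?h * (W G d * CZ G d) \<le> (1 - \<mu>) * (c * (W G d * E G d))"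
      by (simp add: algebra_simps)
  qed
  have h0: "0 \<le> ?h" using k2 S20 by simp
  have hX: "?h * X2 d \<le> 3 * real k * \<Delta> / real f * pg d + real k * Nb\<^sup>2 / S2 * b2 d"
  proof -
      have "?h * X2 d \<le> ?h * (2 / kf * (\<Delta> * (real s / ((1 - \<xi>) * Nb))\<^sup>2 * pg d + real f * b2 d))"
      using collision_estimate[OF d] h0 by (rule mult_left_mono)
    also have "\<dots> = k2 * ((1 + \<xi>) / (1 - \<xi>))\<^sup>2 * ((real s)\<^sup>2 / S2) * (\<Delta> / kf * pg d) + k2 * (1 + \<xi>)\<^sup>2 / real k * (Nb\<^sup>2 / S2 * b2 d)"
    proof -
      have "k2 / S2 * ((u * Nb)\<^sup>2 / 2) * (2 / kf * (\<Delta> * (real s / (q * Nb))\<^sup>2 * pg d + real f * b2 d))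
        = k2 * (u / q)\<^sup>2 * ((real s)\<^sup>2 / S2) * (\<Delta> / kf * pg d) + k2 * u\<^sup>2 / real k * (Nb\<^sup>2 / S2 * b2 d)"
        if "0 < u" "0 < q" for u q
        using Nb0 kf0 f0 k0 S20 that by (simp add: power_mult_distrib power_divide kf_def field_simps)
      then show ?thesis using xi7 by blast
    qed
    also have "\<dots> \<le> (real k)\<^sup>2 / 2 * 2 * 3 * (\<Delta> / kf * pg d) + (real k)\<^sup>2 / 2 * 2 / real k * (Nb\<^sup>2 / S2 * b2 d)"
    proof (intro add_mono mult_right_mono mult_mono divide_right_mono)
      have "(1 + \<xi>) / (1 - \<xi>) \<le> (9/8) / (7/8)" using xi7 by (intro frac_le) auto
      then have "((1 + \<xi>) / (1 - \<xi>))\<^sup>2 \<le> (9/7)\<^sup>2" using xi7 by (intro power_mono) auto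
      also have "(9/7)\<^sup>2 \<le> (2 :: real)" by (simp add: power2_eq_square)
      finally show "((1 + \<xi>) / (1 - \<xi>))\<^sup>2 \<le> 2" .
      have "(1 + \<xi>)\<^sup>2 \<le> (9/8)\<^sup>2" using xi7 by (intro power_mono) auto
      then show "(1 + \<xi>)\<^sup>2 \<le> 2" by (simp add: power2_eq_square)
      show "(real s)\<^sup>2 / S2 \<le> 3" using S20 by (simp add: pos_divide_le_eq)
    qed (use k2 S20 pg0 b20 \<Delta>0 kf0 in auto)
    also have "\<dots> = 3 * real k * \<Delta> / real f * pg d + real k * Nb\<^sup>2 / S2 * b2 d"
      using k0 f0 by (simp add: kf_def power2_eq_square field_simps)
    finally show ?thesis .
  qed
  have cR: "c * R d \<le> 6 * pg d"
  proof -
    have "(2/3) * (c * R d) \<le> (1 - \<mu>) * (c * R d)" using mu c0 R0[of d] by (intro mult_right_mono) auto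
    also have "\<dots> \<le> (1 + 3 * \<rho>1) * pg d" by (rule up)
    also have "\<dots> \<le> 4 * pg d" using rho1 pg0[of d] by (intro mult_right_mono) auto
    finally show ?thesis by simp
  qed
  have "\<rho> * (c * R d) \<le> \<rho> * (6 * pg d)" using cR rho by (intro mult_left_mono) auto
  then have r24: "4 * \<rho> * (c * R d) \<le> 24 * \<rho> * pg d" by simp
  have k\<Delta>: "0 \<le> real k * \<Delta> / real f * pg d" using \<Delta>0 pg0[of d] by simp
  have g: "0 \<le> \<rho>1 * pg d" "0 \<le> \<rho> * pg d" "0 \<le> c * bE d" "0 \<le> real k * Nb\<^sup>2 / S2 * b2 d"
    using rho rho1 pg0[of d] c0 bE0[of d] S20 b20[of d] by auto
  define A B C D' where "A = \<rho>1 * pg d" and "B = real k * \<Delta> / real f * pg d" and "C = c * bE d" and "D' = real k * Nb\<^sup>2 / S2 * b2 d"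
  define r where "r = \<rho> * pg d"
  have up': "(1 - \<mu>) * (c * R d) \<le> pg d + 3 * A" and lo': "pg d - 2 * A - (3 * B + D') \<le> (1 - \<mu>) * (c * R d)"
    using up lo hX by (simp_all add: A_def B_def D'_def algebra_simps)
  have qr': "\<bar>c * Q d - \<mu> * (c * R d)\<bar> \<le> 24 * r + 2 * C" using qr r24 by (simp add: C_def r_def)
  have e: "(1 - \<mu>) * (c * R d) = c * R d - \<mu> * (c * R d)" by (simp add: algebra_simps)
  have diff: "\<bar>p m (i - 1) d - pg d\<bar> \<le> 24 * r + 3 * A + 3 * B + 3 * C + D'"
    using p1 bd qr' up' lo' g k\<Delta> unfolding e A_def[symmetric] B_def[symmetric] C_def[symmetric] D'_def[symmetric] r_def[symmetric]
    by (auto simp: abs_le_iff)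
  have e0: "0 \<le> \<epsilon>e" using rho rho1 \<Delta>0 by (simp add: \<epsilon>e_def)
  have "24 * r + 3 * A + 3 * B = \<epsilon>e * pg d" by (simp add: \<epsilon>e_def A_def B_def r_def algebra_simps)
  also have "\<dots> \<le> \<epsilon>e * p m i d" using pi pb0[of d] e0 by (intro mult_left_mono) auto
  finally have "24 * r + 3 * A + 3 * B \<le> \<epsilon>e * p m i d" .
  then have "\<bar>p m (i - 1) d - p m i d\<bar> \<le> \<epsilon>e * p m i d + (pbad d + 3 * C + D')"
    using diff pi pb0[of d] by linarith
  then show ?thesis by (simp add: \<beta>e_def C_def D'_def)
qed

lemma \<beta>e_nonneg: "0 \<le> \<beta>e d"
  using pb0[of d] bE0[of d] b20[of d] c0 S20 by (simp add: \<beta>e_def)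

text \<open>Given \<open>G\<close>, all contributions are moments of the free incidences that
  \<open>moment_le\<close> bounds uniformly in \<open>G\<close>, so only the proportion of
  exceptional hypergraphs remains.\<close>

lemma sum_\<beta>e:
  "(\<Sum>d\<in>Om n (k * m). \<beta>e d) \<le> 6 * real k * (real (card GB) / real (M choose f))"
proof -
  define Pb where "Pb = real (card GB) / real (M choose f)"
  define CC where "CC = real ((k * K) choose s)"
  have CC: "0 < CC" using s3 by (simp add: CC_def)
  have Z: "Z m i = real (M choose f) * CC" by (simp add: Z_def CC_def K_def f_def s_def)
  have Mf: "0 < real (M choose f)" using fK by simp
  \<comment> \<open>One estimate for three cases: \<open>g e\<close> is empty for the mass, an edge
    for the edge sums, and a pair of vertices for the collisions.\<close>
  have gen: "(\<Sum>d\<in>Om n (k * m). \<Sum>G\<in>GB. W G d * (\<Sum>e\<in>F. \<Prod>v\<in>g e. xx G d v)) \<le> real (card F) * (real ((k * K - r) choose (s - r)) / CC) * Pb"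
    if F: "\<And>e. e \<in> F \<Longrightarrow> g e \<subseteq> {..<n} \<and> card (g e) = r" and r: "r \<le> s" for F and g :: "'a \<Rightarrow> nat set" and r
  proof -
    have "(\<Sum>d\<in>Om n (k * m). \<Sum>G\<in>GB. W G d * (\<Sum>e\<in>F. \<Prod>v\<in>g e. xx G d v))
       = (\<Sum>G\<in>GB. \<Sum>e\<in>F. (\<Sum>d\<in>Om n (k * m). w G d * (\<Prod>v\<in>g e. xx G d v)) / Z m i)"
      unfolding W_def sum_distrib_left sum_divide_distrib
      by (subst sum.swap, intro sum.cong refl, subst sum.swap) simp
    also have "\<dots> \<le> (\<Sum>G\<in>GB. \<Sum>e\<in>F. real ((k * K - r) choose (s - r)) / Z m i)"
    proof (intro sum_mono divide_right_mono)
      fix G e assume "G \<in> GB" "e \<in> F"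
      then have "G \<in> hg (m - i)" "g e \<subseteq> {..<n}" "card (g e) = r" using GD_hg(2)[of G] F by (auto simp: f_def)
      then show "(\<Sum>d\<in>Om n (k * m). w G d * (\<Prod>v\<in>g e. xx G d v)) \<le> real ((k * K - r) choose (s - r))"
        using moment_le[of G m i "g e"] r im by (simp add: s_def K_def f_def)
    qed (use Zp in simp)
    also have "\<dots> = real (card F) * (real ((k * K - r) choose (s - r)) / CC) * Pb"
      by (simp add: Z Pb_def mult_ac)
    finally show ?thesis .
  qed
  have 1: "(\<Sum>d\<in>Om n (k * m). pbad d) \<le> Pb"
    using gen[of "{()}" "\<lambda>_. {}" 0] CC by (simp add: pbad_def CC_def)
  have 2: "(\<Sum>d\<in>Om n (k * m). 3 * c * bE d) \<le> 5 * Pb"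
  proof -
    have "(\<Sum>d\<in>Om n (k * m). bE d) \<le> real (card Es) * (real ((k * K - k) choose (s - k)) / CC) * Pb"
      unfolding bE_def E_def by (rule gen[of Es "\<lambda>e. e"]) (use s3 in \<open>auto simp: Es_lessThan\<close>)
    then have "3 * c * (\<Sum>d\<in>Om n (k * m). bE d) \<le> 3 * c * (real (card Es) * (real ((k * K - k) choose (s - k)) / CC) * Pb)"
      using c0 by (intro mult_left_mono) auto
    also have "\<dots> = 3 * (real M / real K) * Pb"
    proof -
      have "0 < real ((k * K - k) choose (s - k))" using s3 diff_le_mono[of s "k * K" k] by simp
      then show ?thesis using CC K0 by (simp add: c_def cT_def s_def[symmetric] CC_def[symmetric] card_Es)
    qed
    also have "\<dots> \<le> 5 * Pb"
    proof (intro mult_right_mono)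
      have "3 * f \<le> f + K" using mu3 fK by (simp add: f_def)
      then have "3 * M \<le> 5 * K" using fK by linarith
      then have "3 * real M \<le> 5 * real K" by (metis of_nat_le_iff of_nat_mult of_nat_numeral)
      then show "3 * (real M / real K) \<le> 5" using K0 by (simp add: field_simps)
    qed (simp add: Pb_def)
    finally show ?thesis by (simp add: sum_distrib_left)
  qed
  have 3: "(\<Sum>d\<in>Om n (k * m). real k * Nb\<^sup>2 / S2 * b2 d) \<le> 3 * real k * Pb"
  proof -
    let ?F = "SIGMA v:{..<n}. {u. u < n \<and> u \<noteq> v}"
    have cF: "card ?F \<le> n * n"
    proof -
      have "card ?F \<le> card ({..<n} \<times> {..<n})" by (intro card_mono) auto
      then show ?thesis by simp
    qed
    have "(\<Sum>v<n. \<Sum>u | u < n \<and> u \<noteq> v. xx G d v * xx G d u) = (\<Sum>e\<in>?F. \<Prod>v\<in>{fst e, snd e}. xx G d v)" for G d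
    proof -
      have "(\<Sum>v<n. \<Sum>u | u < n \<and> u \<noteq> v. xx G d v * xx G d u) = (\<Sum>(v, u)\<in>?F. xx G d v * xx G d u)"
        by (subst sum.Sigma) auto
      also have "\<dots> = (\<Sum>e\<in>?F. \<Prod>v\<in>{fst e, snd e}. xx G d v)" by (intro sum.cong refl) auto
      finally show ?thesis .
    qed
    then have "(\<Sum>d\<in>Om n (k * m). b2 d) \<le> real (card ?F) * (real ((k * K - 2) choose (s - 2)) / CC) * Pb"
      unfolding b2_def using s3 by (simp only:) (rule gen, auto)
    also have "\<dots> \<le> (real n * real n) * (real ((k * K - 2) choose (s - 2)) / CC) * Pb"
    proof (intro mult_right_mono)
      show "real (card ?F) \<le> real n * real n" using cF by (metis of_nat_le_iff of_nat_mult)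
    qed (use CC in \<open>auto simp: Pb_def\<close>)
    finally have b: "(\<Sum>d\<in>Om n (k * m). b2 d) \<le> (real n * real n) * (real ((k * K - 2) choose (s - 2)) / CC) * Pb" .
    define A2 where "A2 = real ((k * K) choose 2)"
    have A2: "0 < A2" "(real (k * K))\<^sup>2 \<le> 3 * A2"
    proof -
      have kK: "3 \<le> k * K" using s3 by linarith
      have "2 * A2 = real (k * K) * (real (k * K) - 1)"
      proof -
        have "real (k * K - 1) = real (k * K) - 1" using kK by (subst of_nat_diff) linarith+
        then show ?thesis unfolding A2_def two_choose_two by (simp only:)
      qed
      moreover have "3 * real (k * K) \<le> real (k * K) * real (k * K)" using kK by (intro mult_right_mono) (auto simp del: of_nat_mult)
      ultimately show "(real (k * K))\<^sup>2 \<le> 3 * A2" by (simp add: power2_eq_square algebra_simps)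
      show "0 < A2" using kK by (simp add: A2_def)
    qed
    have "((k * K) choose s) * (s choose 2) = ((k * K) choose 2) * ((k * K - 2) choose (s - 2))"
      by (rule choose_mult) (use s3 in auto)
    then have cc: "CC * S2 = A2 * real ((k * K - 2) choose (s - 2))" unfolding CC_def S2_def A2_def by (metis of_nat_mult)
    have "(\<Sum>d\<in>Om n (k * m). real k * Nb\<^sup>2 / S2 * b2 d) = real k * Nb\<^sup>2 / S2 * (\<Sum>d\<in>Om n (k * m). b2 d)"
      by (rule sum_distrib_left[symmetric])
    also have "\<dots> \<le> real k * Nb\<^sup>2 / S2 * ((real n * real n) * (real ((k * K - 2) choose (s - 2)) / CC) * Pb)"
      using b S20 by (intro mult_left_mono) auto
    also have "\<dots> = real k * ((real (k * K))\<^sup>2 / A2) * Pb"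
    proof -
      have "real ((k * K - 2) choose (s - 2)) / CC = S2 / A2" using cc CC A2 by (simp add: field_simps)
      then show ?thesis using S20 n0 by (simp add: Nb_def power2_eq_square)
    qed
    also have "\<dots> \<le> real k * 3 * Pb"
      using A2 by (intro mult_right_mono mult_left_mono) (auto simp: Pb_def pos_divide_le_eq)
    finally show ?thesis by (simp add: mult_ac)
  qed
  have "(\<Sum>d\<in>Om n (k * m). \<beta>e d) \<le> Pb + 5 * Pb + 3 * real k * Pb"
    unfolding \<beta>e_def sum.distrib using 1 2 3 by linarith
  also have "\<dots> = (6 + 3 * real k) * Pb" by (simp add: algebra_simps)
  also have "\<dots> \<le> (6 * real k) * Pb" using k3 by (intro mult_right_mono) (auto simp: Pb_def)
  finally show ?thesis by (simp add: Pb_def)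
qed

end

section \<open>Degrees and codegrees of random hypergraphs\<close>

context kgraph
begin

definition codeg :: "nat set set \<Rightarrow> nat set \<Rightarrow> nat" where
  "codeg G B = card {e\<in>G. B \<subseteq> e}"
definition links :: "nat \<Rightarrow> nat \<Rightarrow> nat set set" where
  "links u v = {A. A \<subseteq> {0..<n} - {u, v} \<and> card A = k - 1}"
text \<open>These pairs of edges, differing only in \<open>u\<close> and \<open>v\<close>, are
  exactly what blocks an exchange of \<open>u\<close> for \<open>v\<close>.\<close>

definition colink :: "nat set set \<Rightarrow> nat \<Rightarrow> nat \<Rightarrow> nat" where
  "colink G u v = card {A\<in>links u v. insert u A \<in> G \<and> insert v A \<in> G}"

text \<open>Numbering the \<open>k\<close>-sets makes a hypergraph a 0-1 vector of length
  \<open>M\<close>; the box measure with all sizes one is then the binomial random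
  hypergraph.\<close>

definition en :: "nat \<Rightarrow> nat set" where "en = (SOME h. bij_betw h {..<M} Es)"
definition gs :: "(nat \<Rightarrow> nat) \<Rightarrow> nat set set" where "gs \<delta> = en ` {j. j < M \<and> \<delta> j \<noteq> 0}"

lemma en_bij: "bij_betw en {..<M} Es"
  unfolding en_def using ex_bij_betw_nat_finite[OF finite_Es] card_Es
  by (intro someI_ex[of "\<lambda>h. bij_betw h {..<M} Es"]) (simp add: atLeast0LessThan)

lemma en_eq: "i < M \<Longrightarrow> j < M \<Longrightarrow> en i = en j \<longleftrightarrow> i = j"
  using en_bij by (auto simp: bij_betw_def inj_on_def)

lemma en_Es: "j < M \<Longrightarrow> en j \<in> Es"
  using en_bij by (auto simp: bij_betw_def)

lemma en_surj: assumes "e \<in> Es" obtains j where "j < M" "en j = e"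
  using assms bij_betw_imp_surj_on[OF en_bij] by (metis imageE lessThan_iff)

lemma en_img: assumes "Q \<subseteq> Es" shows "en ` {j. j < M \<and> en j \<in> Q} = Q"
proof
  show "Q \<subseteq> en ` {j. j < M \<and> en j \<in> Q}"
  proof
    fix e assume e: "e \<in> Q"
    then obtain j where "j < M" "en j = e" using assms en_surj by blast
    then show "e \<in> en ` {j. j < M \<and> en j \<in> Q}" using e by blast
  qed
qed auto

lemma gs_mem: "j < M \<Longrightarrow> en j \<in> gs \<delta> \<longleftrightarrow> \<delta> j \<noteq> 0"
  by (auto simp: gs_def en_eq)

lemma gs_sub: "gs \<delta> \<subseteq> Es" by (auto simp: gs_def en_Es)

lemma hg_transfer:
  assumes f: "f \<le> M" and M: "0 < M"
  shows "real (card {G\<in>hg f. A G}) \<le> 2 * (2 * real f + 1) * real (M choose f) * pr M (\<lambda>_. 1) (real f / real M) (\<lambda>\<delta>. A (gs \<delta>))"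
proof -
  define ind where "ind G j = (if j < M \<and> en j \<in> G then 1 else 0 :: nat)" for G j
  have gi: "gs (ind G) = G" if "G \<subseteq> Es" for G
  proof -
    have "gs (ind G) = en ` {j. j < M \<and> en j \<in> G}" by (simp add: gs_def ind_def)
    also have "\<dots> = G" by (rule en_img[OF that])
    finally show ?thesis .
  qed
  have iOm: "ind G \<in> Om M f" if G: "G \<in> hg f" for G
  proof -
    have "(\<Sum>j<M. ind G j) = card {j. j < M \<and> en j \<in> G}"
      by (simp add: ind_def sum.If_cases Int_def)
    also have "\<dots> = card (en ` {j. j < M \<and> en j \<in> G})"
      by (rule card_image[symmetric]) (auto simp: inj_on_def en_eq)
    also have "en ` {j. j < M \<and> en j \<in> G} = G" by (rule en_img[OF hgD(1)[OF G]])
    finally show ?thesis using hgD(2)[OF G] by (auto simp: Om_def ind_def)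
  qed
  have "real (card {G\<in>hg f. A G}) = (\<Sum>G | G \<in> hg f \<and> A G. 1)" by simp
  also have "\<dots> \<le> (\<Sum>\<delta>\<in>Om M f. (\<Prod>j<M. real (1 choose \<delta> j)) * of_bool (A (gs \<delta>)))"
  proof (rule sum_le_included[where i = gs])
    show "\<forall>G\<in>{G. G \<in> hg f \<and> A G}. \<exists>\<delta>\<in>Om M f. gs \<delta> = G \<and> 1 \<le> (\<Prod>j<M. real (1 choose \<delta> j)) * of_bool (A (gs \<delta>))"
    proof
      fix G assume G: "G \<in> {G. G \<in> hg f \<and> A G}"
      have "(\<Prod>j<M. real (1 choose ind G j)) = 1" by (intro prod.neutral) (auto simp: ind_def)
      then show "\<exists>\<delta>\<in>Om M f. gs \<delta> = G \<and> 1 \<le> (\<Prod>j<M. real (1 choose \<delta> j)) * of_bool (A (gs \<delta>))"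
        using G iOm gi hgD(1) by (intro bexI[of _ "ind G"]) auto
    qed
  qed (auto intro!: mult_nonneg_nonneg prod_nonneg)
  also have "\<dots> \<le> 2 * (2 * real f + 1) * real (M choose f) * pr M (\<lambda>_. 1) (real f / real M) (\<lambda>\<delta>. A (gs \<delta>))"
    using slice_transfer[of M "\<lambda>_. 1" M f "\<lambda>\<delta>. A (gs \<delta>)"] f M by simp
  finally show ?thesis .
qed

context
  fixes \<mu> :: real
  assumes mu: "0 \<le> \<mu>" "\<mu> \<le> 1"
begin

text \<open>Only the coordinates in \<open>J\<close> enter the variance, so the bound involves
  \<open>card J\<close> and not the number of all \<open>k\<close>-sets. The coefficients may depend
  on earlier coordinates, which the quadratic statistic \<open>colink\<close> requires.\<close>

lemma edge_conc:
  assumes pred: "\<And>j \<delta> \<delta>'. j < M \<Longrightarrow> (\<And>i. i < j \<Longrightarrow> \<delta> i = \<delta>' i) \<Longrightarrow> c j \<delta> = c j \<delta>'"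
    and b: "\<And>j \<delta>. j < M \<Longrightarrow> \<bar>c j \<delta>\<bar> \<le> of_bool (j \<in> J)" and J: "J \<subseteq> {..<M}"
    and l: "0 < l" "l \<le> 1"
  shows "pr M (\<lambda>_. 1) \<mu> (\<lambda>\<delta>. t \<le> \<bar>\<Sum>j<M. (real (\<delta> j) - \<mu>) * c j \<delta>\<bar>) \<le> 2 * exp (l\<^sup>2 * \<mu> * real (card J) - l * t)"
proof -
  have mg: "(\<Sum>i\<le>1. bin 1 \<mu> i * exp (r * ((real i - \<mu>) * c j \<delta>))) \<le> exp (l\<^sup>2 * \<mu> * of_bool (j \<in> J))"
    if j: "j < M" and r: "\<bar>r\<bar> = l" for j \<delta> r
  proof -
    have u: "\<bar>r * c j \<delta>\<bar> \<le> l * of_bool (j \<in> J)" unfolding abs_mult r using b[OF j] l by (intro mult_left_mono) auto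
    then have u1: "\<bar>r * c j \<delta>\<bar> \<le> 1" using l by (auto split: if_splits simp: of_bool_def)
    have "(\<Sum>i\<le>1. bin 1 \<mu> i * exp (r * c j \<delta> * (real i - \<mu> * real 1))) \<le> exp ((r * c j \<delta>)\<^sup>2 * (\<mu> * real 1))"
      by (rule bin_mgf[OF mu u1])
    also have "(r * c j \<delta>)\<^sup>2 * (\<mu> * real 1) \<le> l\<^sup>2 * \<mu> * of_bool (j \<in> J)"
    proof -
      have "(r * c j \<delta>)\<^sup>2 \<le> (l * of_bool (j \<in> J))\<^sup>2" using u by (metis abs_le_square_iff abs_of_nonneg l(1) less_imp_le mult_nonneg_nonneg of_bool_def zero_le_one le_numeral_extra(3))
      then show ?thesis using mu mult_right_mono[of "(r * c j \<delta>)\<^sup>2" "(l * of_bool (j \<in> J))\<^sup>2" \<mu>] by (auto simp: mult_ac split: if_splits simp: of_bool_def)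
    qed
    finally show ?thesis by (simp add: mult_ac)
  qed
  have "pr M (\<lambda>_. 1) \<mu> (\<lambda>\<delta>. t \<le> \<bar>\<Sum>j<M. (\<lambda>i. (real i - \<mu>) * c j \<delta>) (\<delta> j)\<bar>) \<le> 2 * exp ((\<Sum>j<M. l\<^sup>2 * \<mu> * of_bool (j \<in> J)) - l * t)"
  proof (rule pr_seq_tail[OF mu l(1), where h = "\<lambda>j \<delta> i. (real i - \<mu>) * c j \<delta>"])
    show "(\<lambda>i. (real i - \<mu>) * c j \<delta>) = (\<lambda>i. (real i - \<mu>) * c j \<delta>')"
      if "j < M" "\<And>i. i < j \<Longrightarrow> \<delta> i = \<delta>' i" for j \<delta> \<delta>' using pred[of j \<delta> \<delta>'] that by simp
    show "(\<Sum>i\<le>1. bin 1 \<mu> i * exp (l * ((real i - \<mu>) * c j \<delta>))) \<le> exp (l\<^sup>2 * \<mu> * of_bool (j \<in> J))" if "j < M" for j \<delta>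
      using mg[OF that, of l] l by simp
    show "(\<Sum>i\<le>1. bin 1 \<mu> i * exp (- l * ((real i - \<mu>) * c j \<delta>))) \<le> exp (l\<^sup>2 * \<mu> * of_bool (j \<in> J))" if "j < M" for j \<delta>
      using mg[OF that, of "- l"] l by simp
  qed
  also have "(\<Sum>j<M. l\<^sup>2 * \<mu> * of_bool (j \<in> J)) = l\<^sup>2 * \<mu> * real (card J)"
    using J by (simp add: sum_distrib_left[symmetric] of_bool_def sum.If_cases Int_absorb1)
  finally show ?thesis by simp
qed

lemma sum_en: "(\<Sum>j<M. h (en j)) = (\<Sum>e\<in>Es. h e)" for h :: "nat set \<Rightarrow> real"
  by (rule sum.reindex_bij_betw[OF en_bij])

lemma subset_conc:
  assumes Q: "Q \<subseteq> Es" and l: "0 < l" "l \<le> 1"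
  shows "pr M (\<lambda>_. 1) \<mu> (\<lambda>\<delta>. t \<le> \<bar>real (card (gs \<delta> \<inter> Q)) - \<mu> * real (card Q)\<bar>) \<le> 2 * exp (l\<^sup>2 * \<mu> * real (card Q) - l * t)"
proof -
  let ?J = "{j. j < M \<and> en j \<in> Q}"
  have cJ: "card ?J = card Q"
  proof -
    have "en ` ?J = Q" by (rule en_img[OF Q])
    moreover have "inj_on en ?J" by (auto simp: inj_on_def en_eq)
    ultimately show ?thesis using card_image[of en ?J] by simp
  qed
  have eq: "(\<Sum>j<M. (real (\<delta> j) - \<mu>) * of_bool (j \<in> ?J)) = real (card (gs \<delta> \<inter> Q)) - \<mu> * real (card Q)"
    if d: "\<delta> \<in> Dm M (\<lambda>_. 1)" for \<delta>
  proof -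
    have "real (\<delta> j) = of_bool (en j \<in> gs \<delta>)" if "j < M" for j
      using gs_mem[OF that, of \<delta>] d that by (auto simp: Dm_def le_Suc_eq)
    then have "(\<Sum>j<M. (real (\<delta> j) - \<mu>) * of_bool (j \<in> ?J)) = (\<Sum>j<M. (of_bool (en j \<in> gs \<delta>) - \<mu>) * of_bool (en j \<in> Q))"
      by (intro sum.cong) auto
    also have "\<dots> = (\<Sum>e\<in>Es. (of_bool (e \<in> gs \<delta>) - \<mu>) * of_bool (e \<in> Q))" by (rule sum_en)
    also have "\<dots> = (\<Sum>e\<in>Q. of_bool (e \<in> gs \<delta>) - \<mu>)"
      using Q by (intro sum.mono_neutral_cong_right) auto
    also have "\<dots> = real (card (gs \<delta> \<inter> Q)) - \<mu> * real (card Q)"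
      using Q finite_subset[OF Q] by (simp add: sum_subtractf of_bool_def sum.If_cases Int_commute)
    finally show ?thesis .
  qed
  have "pr M (\<lambda>_. 1) \<mu> (\<lambda>\<delta>. t \<le> \<bar>real (card (gs \<delta> \<inter> Q)) - \<mu> * real (card Q)\<bar>)
     \<le> pr M (\<lambda>_. 1) \<mu> (\<lambda>\<delta>. t \<le> \<bar>\<Sum>j<M. (real (\<delta> j) - \<mu>) * of_bool (j \<in> ?J)\<bar>)"
  proof (rule pr_mono[OF mu])
    fix \<delta> assume "\<delta> \<in> Dm M (\<lambda>_. 1)" and t: "t \<le> \<bar>real (card (gs \<delta> \<inter> Q)) - \<mu> * real (card Q)\<bar>"
    from t show "t \<le> \<bar>\<Sum>j<M. (real (\<delta> j) - \<mu>) * of_bool (j \<in> ?J)\<bar>" unfolding eq[OF \<open>\<delta> \<in> Dm M (\<lambda>_. 1)\<close>] .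
  qed
  also have "\<dots> \<le> 2 * exp (l\<^sup>2 * \<mu> * real (card ?J) - l * t)"
    by (rule edge_conc) (use l in auto)
  finally show ?thesis unfolding cJ .
qed

text \<open>For the two indicators \<open>a\<close>, \<open>b\<close> of a pair, with
  \<open>a\<close> revealed first, \<open>a * b - \<mu>\<^sup>2 = (b - \<mu>) * a + (a - \<mu>) *
  \<mu>\<close>. The pairs are disjoint, so this is a single martingale on
  \<open>2 * card (links u v)\<close> coordinates.\<close>

lemma colink_conc:
  assumes uv: "u < n" "v < n" "u \<noteq> v" and l: "0 < l" "l \<le> 1"
  shows "pr M (\<lambda>_. 1) \<mu> (\<lambda>\<delta>. t \<le> \<bar>real (colink (gs \<delta>) u v) - \<mu>\<^sup>2 * real (card (links u v))\<bar>)
    \<le> 2 * exp (l\<^sup>2 * \<mu> * real (2 * card (links u v)) - l * t)"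
proof -
  let ?L = "links u v"
  have fL: "finite ?L" by (rule finite_subset[of _ "Pow {0..<n}"]) (auto simp: links_def)
  define ix where "ix e = (THE j. j < M \<and> en j = e)" for e
  have ix: "ix e < M" "en (ix e) = e" if e: "e \<in> Es" for e
  proof -
    obtain j where "j < M" "en j = e" using en_surj[OF e] by blast
    then have "ix e = j" unfolding ix_def by (intro the_equality) (auto simp: en_eq)
    then show "ix e < M" "en (ix e) = e" using \<open>j < M\<close> \<open>en j = e\<close> by auto
  qed
  have ix_en: "ix (en j) = j" if "j < M" for j using ix[OF en_Es[OF that]] that en_eq by blast
  have insE: "insert z A \<in> Es" if A: "A \<in> ?L" and z: "z \<in> {u, v}" for z A
  proof -
    have f: "finite A" "A \<subseteq> {0..<n}" "u \<notin> A" "v \<notin> A" "card A = k - 1"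
      using A finite_subset[of A "{0..<n} - {u, v}"] by (auto simp: links_def)
    then have "card (insert z A) = k" using z k3 by auto
    then show ?thesis using f z uv by (auto simp: Es_def)
  qed
  define a b where "a A = ix (insert u A)" and "b A = ix (insert v A)" for A
  have aM: "a A < M" "b A < M" "en (a A) = insert u A" "en (b A) = insert v A" if "A \<in> ?L" for A
    using ix insE[OF that] by (auto simp: a_def b_def)
  have ab: "a A \<noteq> b A" if "A \<in> ?L" for A
    using aM[OF that] that uv by (auto simp: links_def)
  have inja: "inj_on a ?L"
  proof (rule inj_onI)
    fix A A' assume h: "A \<in> ?L" "A' \<in> ?L" "a A = a A'"
    then have "insert u A = insert u A'" using aM by metis
    then show "A = A'" using h by (auto simp: links_def)
  qed
  have injb: "inj_on b ?L"
  proof (rule inj_onI)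
    fix A A' assume h: "A \<in> ?L" "A' \<in> ?L" "b A = b A'"
    then have "insert v A = insert v A'" using aM by metis
    then show "A = A'" using h by (auto simp: links_def)
  qed
  have dis: "a ` ?L \<inter> b ` ?L = {}"
  proof -
    have "a A \<noteq> b A'" if "A \<in> ?L" "A' \<in> ?L" for A A'
    proof
      assume "a A = b A'"
      then have "insert u A = insert v A'" using aM that by metis
      then show False using that uv by (auto simp: links_def)
    qed
    then show ?thesis by auto
  qed
  let ?J = "a ` ?L \<union> b ` ?L"
  define par where "par j = (if u \<in> en j then b (en j - {u}) else a (en j - {v}))" for j
  have par: "par (a A) = b A" "par (b A) = a A" if "A \<in> ?L" for A
    using aM[OF that] that uv by (auto simp: par_def links_def)
  \<comment> \<open>The later member of a pair carries the value of its partner, the earlier one the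
    mean. The \<open>min 1\<close> keeps the coefficient bounded for vectors outside the box too, as
    \<open>edge_conc\<close> asks for all \<open>\<delta>\<close>.\<close>
  define c where "c j \<delta> = (if j \<in> ?J then (if par j < j then real (min 1 (\<delta> (par j))) else \<mu>) else 0)" for j and \<delta> :: "nat \<Rightarrow> nat"
  have cJ: "card ?J = 2 * card ?L"
    using card_Un_disjoint[OF _ _ dis] fL card_image[OF inja] card_image[OF injb] by simp
  have eq: "(\<Sum>j<M. (real (\<delta> j) - \<mu>) * c j \<delta>) = real (colink (gs \<delta>) u v) - \<mu>\<^sup>2 * real (card ?L)"
    if d: "\<delta> \<in> Dm M (\<lambda>_. 1)" for \<delta>
  proof -
    have d1: "real (min 1 (\<delta> j)) = real (\<delta> j)" "real (\<delta> j) = of_bool (en j \<in> gs \<delta>)" if "j < M" for j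
      using gs_mem[OF that, of \<delta>] d that by (auto simp: Dm_def le_Suc_eq)
    have "(\<Sum>j<M. (real (\<delta> j) - \<mu>) * c j \<delta>) = (\<Sum>j\<in>?J. (real (\<delta> j) - \<mu>) * c j \<delta>)"
      using aM by (intro sum.mono_neutral_right) (auto simp: c_def)
    also have "\<dots> = (\<Sum>j\<in>a ` ?L. (real (\<delta> j) - \<mu>) * c j \<delta>) + (\<Sum>j\<in>b ` ?L. (real (\<delta> j) - \<mu>) * c j \<delta>)"
      using fL dis by (intro sum.union_disjoint) auto
    also have "\<dots> = (\<Sum>A\<in>?L. (real (\<delta> (a A)) - \<mu>) * c (a A) \<delta> + (real (\<delta> (b A)) - \<mu>) * c (b A) \<delta>)"
      by (simp add: sum.reindex[OF inja] sum.reindex[OF injb] sum.distrib)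
    also have "\<dots> = (\<Sum>A\<in>?L. real (\<delta> (a A)) * real (\<delta> (b A)) - \<mu>\<^sup>2)"
    proof (intro sum.cong refl)
      fix A assume A: "A \<in> ?L"
      have ca: "c (a A) \<delta> = (if b A < a A then real (\<delta> (b A)) else \<mu>)" "c (b A) \<delta> = (if a A < b A then real (\<delta> (a A)) else \<mu>)"
        using A par[OF A] d1 aM[OF A] by (auto simp: c_def)
      show "(real (\<delta> (a A)) - \<mu>) * c (a A) \<delta> + (real (\<delta> (b A)) - \<mu>) * c (b A) \<delta> = real (\<delta> (a A)) * real (\<delta> (b A)) - \<mu>\<^sup>2"
        unfolding ca using ab[OF A] by (cases "a A < b A") (auto simp: algebra_simps power2_eq_square)
    qed
    also have "\<dots> = (\<Sum>A\<in>?L. of_bool (insert u A \<in> gs \<delta> \<and> insert v A \<in> gs \<delta>)) - \<mu>\<^sup>2 * real (card ?L)"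
    proof -
      have "real (\<delta> (a A)) * real (\<delta> (b A)) = of_bool (insert u A \<in> gs \<delta> \<and> insert v A \<in> gs \<delta>)" if "A \<in> ?L" for A
        using d1(2)[of "a A"] d1(2)[of "b A"] aM[OF that] by simp
      then show ?thesis by (simp add: sum_subtractf)
    qed
    also have "(\<Sum>A\<in>?L. of_bool (insert u A \<in> gs \<delta> \<and> insert v A \<in> gs \<delta>)) = real (colink (gs \<delta>) u v)"
      using fL by (simp add: colink_def of_bool_def sum.If_cases Int_def)
    finally show ?thesis .
  qed
  have "pr M (\<lambda>_. 1) \<mu> (\<lambda>\<delta>. t \<le> \<bar>real (colink (gs \<delta>) u v) - \<mu>\<^sup>2 * real (card ?L)\<bar>)
    \<le> pr M (\<lambda>_. 1) \<mu> (\<lambda>\<delta>. t \<le> \<bar>\<Sum>j<M. (real (\<delta> j) - \<mu>) * c j \<delta>\<bar>)"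
  proof (rule pr_mono[OF mu])
    fix \<delta> assume "\<delta> \<in> Dm M (\<lambda>_. 1)" and t: "t \<le> \<bar>real (colink (gs \<delta>) u v) - \<mu>\<^sup>2 * real (card ?L)\<bar>"
    from t show "t \<le> \<bar>\<Sum>j<M. (real (\<delta> j) - \<mu>) * c j \<delta>\<bar>" unfolding eq[OF \<open>\<delta> \<in> Dm M (\<lambda>_. 1)\<close>] .
  qed
  also have "\<dots> \<le> 2 * exp (l\<^sup>2 * \<mu> * real (card ?J) - l * t)"
  proof (rule edge_conc)
    fix j and \<delta> \<delta>' :: "nat \<Rightarrow> nat" assume "\<And>i. i < j \<Longrightarrow> \<delta> i = \<delta>' i"
    then show "c j \<delta> = c j \<delta>'" by (simp add: c_def)
  qed (use l mu aM in \<open>auto simp: c_def min_def\<close>)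
  finally show ?thesis unfolding cJ .
qed

end


section \<open>Counting valid exchanges by degrees and codegrees\<close>

lemma BsD: assumes "B \<in> Bs" shows "B \<subseteq> {..<n}" "card B = k - 1" "finite B"
  using assms finite_subset[of B "{..<n}"] by (auto simp: Bs_def)

lemma EsD: assumes "e \<in> Es" shows "e \<subseteq> {..<n}" "card e = k" "finite e"
  using assms finite_edge[OF assms] by (auto simp: Es_def)

lemma codeg_count:
  assumes G: "G \<subseteq> Es" and B: "B \<in> Bs"
  shows "card {u. u < n \<and> u \<notin> B \<and> insert u B \<in> G} = codeg G B"
proof -
  have "bij_betw (\<lambda>u. insert u B) {u. u < n \<and> u \<notin> B \<and> insert u B \<in> G} {e\<in>G. B \<subseteq> e}"
    unfolding bij_betw_def
  proof
    show "inj_on (\<lambda>u. insert u B) {u. u < n \<and> u \<notin> B \<and> insert u B \<in> G}" by (rule inj_onI) auto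
    show "(\<lambda>u. insert u B) ` {u. u < n \<and> u \<notin> B \<and> insert u B \<in> G} = {e\<in>G. B \<subseteq> e}"
    proof
      show "{e\<in>G. B \<subseteq> e} \<subseteq> (\<lambda>u. insert u B) ` {u. u < n \<and> u \<notin> B \<and> insert u B \<in> G}"
      proof
        fix e assume e: "e \<in> {e\<in>G. B \<subseteq> e}"
        then have eE: "e \<in> Es" using G by auto
        have "card (e - B) = 1" using e BsD[OF B] EsD[OF eE] k3 by (subst card_Diff_subset) auto
        then obtain u where u: "e - B = {u}" by (auto simp: card_1_singleton_iff)
        then have "e = insert u B" "u \<notin> B" "u < n" using e EsD(1)[OF eE] by auto
        then show "e \<in> (\<lambda>u. insert u B) ` {u. u < n \<and> u \<notin> B \<and> insert u B \<in> G}" using e by auto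
      qed
    qed auto
  qed
  then show ?thesis unfolding codeg_def by (rule bij_betw_same_card)
qed

lemma codeg_le_hdeg:
  assumes G: "G \<subseteq> Es" and z: "z \<in> B" shows "codeg G B \<le> hdeg G z"
  unfolding codeg_def hdeg_def using z Es_subset[OF G] by (intro card_mono) auto

lemma Bs_of_edge: assumes "h \<in> Es" "v \<in> h" shows "h - {v} \<in> Bs"
  using EsD[OF assms(1)] assms(2) by (auto simp: Bs_def)

text \<open>A blocked exchange is read off the edge \<open>h\<close> that blocks it:
  \<open>g\<close> is a further edge containing \<open>h - {v}\<close>, and subtracting one removes
  \<open>h\<close> itself.\<close>

lemma exchange_count:
  assumes G: "G \<subseteq> Es" and v: "v < n"
  shows "real (card {(g, u). g \<in> G \<and> u \<in> g \<and> v \<notin> g \<and> insert v (g - {u}) \<in> G})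
    = (\<Sum>h | h \<in> G \<and> v \<in> h. real (codeg G (h - {v})) - 1)"
proof -
  let ?U = "\<lambda>h. {u. u < n \<and> u \<notin> h - {v} \<and> insert u (h - {v}) \<in> G}"
  let ?X = "{(g, u). g \<in> G \<and> u \<in> g \<and> v \<notin> g \<and> insert v (g - {u}) \<in> G}"
  have fG: "finite G" using G by (rule Es_subset)
  have "bij_betw (\<lambda>(g, u). (insert v (g - {u}), u)) ?X (SIGMA h:{h\<in>G. v \<in> h}. ?U h - {v})"
  proof (rule bij_betw_byWitness[where f' = "\<lambda>(h, u). (insert u (h - {v}), u)"])
    show "\<forall>a\<in>?X. (\<lambda>(h, u). (insert u (h - {v}), u)) ((\<lambda>(g, u). (insert v (g - {u}), u)) a) = a" by auto
    show "\<forall>a\<in>(SIGMA h:{h\<in>G. v \<in> h}. ?U h - {v}). (\<lambda>(g, u). (insert v (g - {u}), u)) ((\<lambda>(h, u). (insert u (h - {v}), u)) a) = a"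
      by (auto simp: insert_absorb)
    show "(\<lambda>(g, u). (insert v (g - {u}), u)) ` ?X \<subseteq> (SIGMA h:{h\<in>G. v \<in> h}. ?U h - {v})"
    proof
      fix a assume "a \<in> (\<lambda>(g, u). (insert v (g - {u}), u)) ` ?X"
      then obtain g u where a: "a = (insert v (g - {u}), u)" and h: "g \<in> G" "u \<in> g" "v \<notin> g" "insert v (g - {u}) \<in> G"
        by auto
      have "u < n" using h G EsD(1)[of g] by auto
      moreover have "insert u (insert v (g - {u}) - {v}) = g" using h by auto
      ultimately show "a \<in> (SIGMA h:{h\<in>G. v \<in> h}. ?U h - {v})" unfolding a using h by auto
    qed
    show "(\<lambda>(h, u). (insert u (h - {v}), u)) ` (SIGMA h:{h\<in>G. v \<in> h}. ?U h - {v}) \<subseteq> ?X"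
    proof
      fix a assume "a \<in> (\<lambda>(h, u). (insert u (h - {v}), u)) ` (SIGMA h:{h\<in>G. v \<in> h}. ?U h - {v})"
      then obtain h u where a: "a = (insert u (h - {v}), u)" and h: "h \<in> G" "v \<in> h" "u \<noteq> v" "insert u (h - {v}) \<in> G" "u \<notin> h - {v}"
        by auto
      then have "insert v (insert u (h - {v}) - {u}) = h" by auto
      then show "a \<in> ?X" unfolding a using h by auto
    qed
  qed
  then have "card ?X = card (SIGMA h:{h\<in>G. v \<in> h}. ?U h - {v})" by (rule bij_betw_same_card)
  also have "\<dots> = (\<Sum>h | h \<in> G \<and> v \<in> h. card (?U h - {v}))"
    using fG by (intro card_SigmaI) auto
  finally have "real (card ?X) = (\<Sum>h | h \<in> G \<and> v \<in> h. real (card (?U h - {v})))" by simp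
  also have "\<dots> = (\<Sum>h | h \<in> G \<and> v \<in> h. real (codeg G (h - {v})) - 1)"
  proof (intro sum.cong refl)
    fix h assume h: "h \<in> {h. h \<in> G \<and> v \<in> h}"
    have fu: "finite (?U h)" by simp
    have vU: "v \<in> ?U h" using h v by (auto simp: insert_absorb)
    have "card (?U h) = codeg G (h - {v})" using codeg_count[OF G Bs_of_edge[of h v]] h G by auto
    then show "real (card (?U h - {v})) = real (codeg G (h - {v})) - 1"
      using card.remove[OF fu vU] by simp
  qed
  finally show ?thesis .
qed

lemma pairs_card:
  assumes G: "G \<in> hg f" shows "card {(g, u). g \<in> G \<and> u \<in> g} = k * f" "finite {(g, u). g \<in> G \<and> u \<in> g}"
proof -
  have e: "{(g, u). g \<in> G \<and> u \<in> g} = (SIGMA g:G. g)" by auto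
  have fg: "\<forall>g\<in>G. finite g" using hgD(1)[OF G] by auto
  show "finite {(g, u). g \<in> G \<and> u \<in> g}" unfolding e using hgD(3)[OF G] fg by auto
  have "card (SIGMA g:G. g) = (\<Sum>g\<in>G. card g)" using hgD(3)[OF G] fg by (intro card_SigmaI) auto
  also have "\<dots> = (\<Sum>g\<in>G. k)" using hgD(1)[OF G] by (intro sum.cong) (auto simp: Es_def)
  finally show "card {(g, u). g \<in> G \<and> u \<in> g} = k * f" unfolding e using hgD(2)[OF G] by simp
qed

text \<open>Of the \<open>k * f\<close> pairs of an edge and one of its vertices, at most
  \<open>k * \<Delta>\<close> have \<open>v\<close> in the edge and at most
  \<open>k * \<Delta>\<close> have \<open>u\<close> in \<open>B\<close>. The blocked ones number
  about \<open>hdeg G v\<close> times a codegree, that is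
  \<open>\<mu> * N * (\<mu> * n) = \<mu> * (k * f)\<close>.\<close>

lemma val_bound:
  assumes G: "G \<in> hg f" and v: "v < n" and B: "finite B" "card B \<le> k" "B \<subseteq> {..<n}"
    and \<mu>: "0 \<le> \<mu>" "real k * real f = real n * (\<mu> * real N)"
    and D: "\<And>u. u < n \<Longrightarrow> real (hdeg G u) \<le> \<Delta>"
    and e3: "\<bar>real (hdeg G v) - \<mu> * real N\<bar> \<le> e3"
    and e2: "\<And>B. B \<in> Bs \<Longrightarrow> \<bar>real (codeg G B) - \<mu> * real n\<bar> \<le> e2"
  shows "\<bar>real (val G v B) - (1 - \<mu>) * (real k * real f)\<bar> \<le> 2 * real k * \<Delta> + \<Delta> * (e2 + 1) + \<mu> * real n * e3"
proof -
  note GE = hgD(1)[OF G]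
  let ?A = "{(g, u). g \<in> G \<and> u \<in> g}"
  let ?V = "{(g, u). (v, g, u) \<in> Val G \<and> u \<notin> B}"
  let ?X = "{(g, u). g \<in> G \<and> u \<in> g \<and> v \<notin> g \<and> insert v (g - {u}) \<in> G}"
  let ?S = "SIGMA g:{g\<in>G. v \<in> g}. g" and ?T = "SIGMA u:B. {g\<in>G. u \<in> g}"
  have fin: "finite ?A" and cA: "card ?A = k * f" using pairs_card[OF G] by auto
  have D0: "0 \<le> \<Delta>" using D[OF v] by linarith
  have VA: "?V \<subseteq> ?A" by (auto simp: Val_def)
  have XA: "?X \<subseteq> ?A - ?V" by (auto simp: Val_def)
  have "card (?A - ?V) = card ?A - card ?V" using fin VA by (intro card_Diff_subset) (auto intro: finite_subset)
  moreover have "card ?V \<le> card ?A" by (rule card_mono[OF fin VA])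
  ultimately have valE: "real (val G v B) = real k * real f - real (card (?A - ?V))"
    unfolding val_def cA by simp
  have lo: "real (card ?X) \<le> real (card (?A - ?V))" using card_mono[OF _ XA] fin by auto
  have cS: "real (card ?S) \<le> real k * \<Delta>"
  proof -
    have "card ?S = (\<Sum>g | g \<in> G \<and> v \<in> g. card g)" using hgD(3)[OF G] GE by (intro card_SigmaI) auto
    also have "\<dots> = (\<Sum>g | g \<in> G \<and> v \<in> g. k)" using GE by (intro sum.cong) (auto simp: Es_def)
    finally have "real (card ?S) = real (hdeg G v) * real k" by (simp add: hdeg_def)
    then show ?thesis using mult_right_mono[OF D[OF v], of "real k"] by (simp add: mult.commute)
  qed
  have cT: "real (card ?T) \<le> real k * \<Delta>"
  proof -
    have "card ?T = (\<Sum>u\<in>B. hdeg G u)" unfolding hdeg_def using hgD(3)[OF G] B by (intro card_SigmaI) auto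
    then have "real (card ?T) = (\<Sum>u\<in>B. real (hdeg G u))" by simp
    also have "\<dots> \<le> (\<Sum>u\<in>B. \<Delta>)" using B D by (intro sum_mono) auto
    also have "\<dots> \<le> real k * \<Delta>" using B D0 by (simp add: mult_right_mono)
    finally show ?thesis .
  qed
  have fST: "finite ?S" "finite ?T" "finite ?X"
  proof -
    show "finite ?S" using hgD(3)[OF G] GE by (intro finite_SigmaI) auto
    show "finite ?T" using hgD(3)[OF G] B by (intro finite_SigmaI) auto
    show "finite ?X" using XA fin finite_subset[of ?X ?A] by blast
  qed
  have "?A - ?V \<subseteq> ?S \<union> ((\<lambda>(u, g). (g, u)) ` ?T \<union> ?X)"
  proof
    fix a assume a: "a \<in> ?A - ?V"
    obtain g u where gu: "a = (g, u)" by (cases a) auto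
    show "a \<in> ?S \<union> ((\<lambda>(u, g). (g, u)) ` ?T \<union> ?X)"
      using a v unfolding gu by (cases "v \<in> g"; cases "u \<in> B") (auto simp: Val_def image_iff)
  qed
  then have "card (?A - ?V) \<le> card (?S \<union> ((\<lambda>(u, g). (g, u)) ` ?T \<union> ?X))" using fST by (intro card_mono) auto
  also have "\<dots> \<le> card ?S + (card ((\<lambda>(u, g). (g, u)) ` ?T) + card ?X)"
    by (meson card_Un_le order_trans add_left_mono)
  also have "\<dots> \<le> card ?S + (card ?T + card ?X)" using card_image_le[OF fST(2)] by simp
  finally have hi: "real (card (?A - ?V)) \<le> 2 * real k * \<Delta> + real (card ?X)" using cS cT by linarith
  have X: "\<bar>real (card ?X) - \<mu> * (real k * real f)\<bar> \<le> \<Delta> * (e2 + 1) + \<mu> * real n * e3"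
  proof -
    have eX: "real (card ?X) - \<mu> * (real k * real f) = (\<Sum>h | h \<in> G \<and> v \<in> h. real (codeg G (h - {v})) - 1 - \<mu> * real n) + \<mu> * real n * (real (hdeg G v) - \<mu> * real N)"
      unfolding exchange_count[OF GE v] \<mu>(2) by (simp add: sum_subtractf hdeg_def algebra_simps)
    have "\<bar>\<Sum>h | h \<in> G \<and> v \<in> h. real (codeg G (h - {v})) - 1 - \<mu> * real n\<bar> \<le> (\<Sum>h | h \<in> G \<and> v \<in> h. \<bar>real (codeg G (h - {v})) - 1 - \<mu> * real n\<bar>)"
      by (rule sum_abs)
    also have "\<dots> \<le> (\<Sum>h | h \<in> G \<and> v \<in> h. e2 + 1)"
    proof (rule sum_mono)
      fix h assume "h \<in> {h. h \<in> G \<and> v \<in> h}"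
      then have "h - {v} \<in> Bs" using Bs_of_edge GE by auto
      from e2[OF this] show "\<bar>real (codeg G (h - {v})) - 1 - \<mu> * real n\<bar> \<le> e2 + 1" by linarith
    qed
    also have "\<dots> = real (hdeg G v) * (e2 + 1)" by (simp add: hdeg_def)
    also have "\<dots> \<le> \<Delta> * (e2 + 1)"
    proof (rule mult_right_mono[OF D[OF v]])
      have "card {..<k - 1} = k - 1" by simp
      moreover have "{..<k - 1} \<subseteq> {..<n}" using kn by auto
      ultimately have "{..<k - 1} \<in> Bs" by (auto simp: Bs_def)
      from e2[OF this] show "0 \<le> e2 + 1" by linarith
    qed
    finally have 1: "\<bar>\<Sum>h | h \<in> G \<and> v \<in> h. real (codeg G (h - {v})) - 1 - \<mu> * real n\<bar> \<le> \<Delta> * (e2 + 1)" .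
    have 2: "\<bar>\<mu> * real n * (real (hdeg G v) - \<mu> * real N)\<bar> \<le> \<mu> * real n * e3"
      unfolding abs_mult using \<mu>(1) e3 by (simp add: mult_left_mono)
    show ?thesis unfolding eX using 1 2 by linarith
  qed
  have kD: "0 \<le> 2 * real k * \<Delta>" using D0 by simp
  have "(1 - \<mu>) * (real k * real f) = real k * real f - \<mu> * (real k * real f)" by (simp add: algebra_simps)
  then show ?thesis unfolding valE using lo hi X kD unfolding abs_le_iff by linarith
qed

text \<open>An edge at \<open>u\<close> either can exchange \<open>u\<close> for \<open>v\<close>,
  or contains \<open>v\<close> already, or is blocked by an existing edge.\<close>

lemma move_count:
  assumes G: "G \<subseteq> Es" and uv: "u < n" "v < n" "u \<noteq> v"
  shows "hdeg G u = card {g\<in>G. u \<in> g \<and> v \<notin> g \<and> insert v (g - {u}) \<notin> G} + codeg G {u, v} + colink G u v"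
proof -
  have fG: "finite G" using G by (rule Es_subset)
  let ?S = "{g\<in>G. u \<in> g \<and> v \<notin> g \<and> insert v (g - {u}) \<notin> G}"
  let ?P = "{g\<in>G. {u, v} \<subseteq> g}" and ?C = "{g\<in>G. u \<in> g \<and> v \<notin> g \<and> insert v (g - {u}) \<in> G}"
  have "bij_betw (\<lambda>g. g - {u}) ?C {A\<in>links u v. insert u A \<in> G \<and> insert v A \<in> G}"
  proof (rule bij_betw_byWitness[where f' = "insert u"])
    show "(\<lambda>g. g - {u}) ` ?C \<subseteq> {A\<in>links u v. insert u A \<in> G \<and> insert v A \<in> G}"
    proof
      fix A assume "A \<in> (\<lambda>g. g - {u}) ` ?C"
      then obtain g where g: "g \<in> ?C" "A = g - {u}" by blast
      then have gE: "g \<in> Es" using G by auto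
      have "card A = k - 1" using g EsD[OF gE] by simp
      then show "A \<in> {A\<in>links u v. insert u A \<in> G \<and> insert v A \<in> G}"
        using g EsD(1)[OF gE] by (auto simp: links_def insert_absorb)
    qed
    show "insert u ` {A\<in>links u v. insert u A \<in> G \<and> insert v A \<in> G} \<subseteq> ?C"
    proof
      fix g assume "g \<in> insert u ` {A\<in>links u v. insert u A \<in> G \<and> insert v A \<in> G}"
      then obtain A where g: "g = insert u A" and A: "A \<in> links u v" "insert u A \<in> G" "insert v A \<in> G" by blast
      then have "u \<notin> A" "v \<notin> A" by (auto simp: links_def)
      then have "insert v (insert u A - {u}) = insert v A" by auto
      then show "g \<in> ?C" unfolding g using A \<open>v \<notin> A\<close> uv by auto
    qed
  qed (auto simp: links_def)
  then have C: "card ?C = colink G u v" unfolding colink_def by (rule bij_betw_same_card)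
  have "{g\<in>G. u \<in> g} = ?S \<union> (?P \<union> ?C)" by auto
  then have "hdeg G u = card (?S \<union> (?P \<union> ?C))" by (simp add: hdeg_def)
  also have "\<dots> = card ?S + card (?P \<union> ?C)" using fG by (intro card_Un_disjoint) auto
  also have "card (?P \<union> ?C) = card ?P + card ?C" using fG by (intro card_Un_disjoint) auto
  finally show ?thesis using C by (simp add: codeg_def)
qed

lemma cnt_sum:
  assumes G: "G \<subseteq> Es" and v: "v < n"
  defines "U \<equiv> \<lambda>B. {u. u < n \<and> u \<notin> B \<and> insert u B \<in> G} - {v}"
    and "S \<equiv> \<lambda>u. {g\<in>G. u \<in> g \<and> v \<notin> g \<and> insert v (g - {u}) \<notin> G}"
  shows "cnt G v B = (\<Sum>u\<in>U B. card (S u - {insert u B}))"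
proof -
  have fG: "finite G" using G by (rule Es_subset)
  have "{(g, u). (v, g, u) \<in> Val G \<and> u \<notin> B \<and> insert u B \<in> G \<and> insert u B \<noteq> g} = prod.swap ` (SIGMA u:U B. S u - {insert u B})" (is "?L = ?R")
  proof
    show "?L \<subseteq> ?R"
    proof clarify
      fix g u assume h: "(v, g, u) \<in> Val G" "u \<notin> B" "insert u B \<in> G" "insert u B \<noteq> g"
      then have "u < n" using G EsD(1)[of g] by (auto simp: Val_def)
      then have "(u, g) \<in> (SIGMA u:U B. S u - {insert u B})" using h by (auto simp: Val_def U_def S_def)
      then show "(g, u) \<in> ?R" by force
    qed
    show "?R \<subseteq> ?L" using v by (auto simp: U_def S_def Val_def)
  qed
  then have "cnt G v B = card (SIGMA u:U B. S u - {insert u B})"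
    unfolding cnt_def by (simp add: card_image)
  also have "\<dots> = (\<Sum>u\<in>U B. card (S u - {insert u B}))" using fG by (intro card_SigmaI) (auto simp: U_def S_def)
  finally show ?thesis .
qed

lemma U_card:
  assumes G: "G \<subseteq> Es" and B: "B \<in> Bs"
  shows "real (codeg G B) - 1 \<le> real (card ({u. u < n \<and> u \<notin> B \<and> insert u B \<in> G} - {v}))"
    "real (card ({u. u < n \<and> u \<notin> B \<and> insert u B \<in> G} - {v})) \<le> real (codeg G B)"
proof -
  let ?U = "{u. u < n \<and> u \<notin> B \<and> insert u B \<in> G}"
  have c: "card ?U = codeg G B" by (rule codeg_count[OF G B])
  show "real (card (?U - {v})) \<le> real (codeg G B)" unfolding c[symmetric] by (simp add: card_Diff1_le)
  have "card ?U - 1 \<le> card (?U - {v})" by (simp add: card_Diff_singleton_if)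
  then show "real (codeg G B) - 1 \<le> real (card (?U - {v}))" unfolding c by linarith
qed

lemma cnt_upper:
  assumes G: "G \<subseteq> Es" and v: "v < n" and B: "B \<in> Bs" and D: "\<And>u. u < n \<Longrightarrow> real (hdeg G u) \<le> \<Delta>" and D0: "0 \<le> \<Delta>"
  shows "real (cnt G v B) \<le> real (codeg G B) * \<Delta>"
proof -
  have fG: "finite G" using G by (rule Es_subset)
  let ?U = "{u. u < n \<and> u \<notin> B \<and> insert u B \<in> G} - {v}"
  have "real (cnt G v B) = (\<Sum>u\<in>?U. real (card ({g\<in>G. u \<in> g \<and> v \<notin> g \<and> insert v (g - {u}) \<notin> G} - {insert u B})))"
    unfolding cnt_sum[OF G v] by simp
  also have "\<dots> \<le> (\<Sum>u\<in>?U. \<Delta>)"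
  proof (rule sum_mono)
    fix u assume u: "u \<in> ?U"
    have "card ({g\<in>G. u \<in> g \<and> v \<notin> g \<and> insert v (g - {u}) \<notin> G} - {insert u B}) \<le> hdeg G u"
      unfolding hdeg_def using fG by (intro card_mono) auto
    then show "real (card ({g\<in>G. u \<in> g \<and> v \<notin> g \<and> insert v (g - {u}) \<notin> G} - {insert u B})) \<le> \<Delta>"
      using D[of u] u by force
  qed
  also have "\<dots> \<le> real (codeg G B) * \<Delta>" using U_card(2)[OF G B] D0 by (simp add: mult_right_mono)
  finally show ?thesis .
qed

text \<open>About \<open>\<mu> * n\<close> vertices \<open>u\<close> complete \<open>B\<close> to an
  edge, and each has about \<open>\<mu> * N - \<mu>\<^sup>2 * N\<close> edges that can exchange it;
  the product is \<open>\<mu> * (1 - \<mu>) * (k * f)\<close>. Excluding \<open>insert u B\<close>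
  costs at most one for each \<open>u\<close>.\<close>

lemma cnt_bound:
  assumes G: "G \<in> hg f" and v: "v < n" and B: "B \<in> Bs" "v \<notin> B"
    and \<mu>: "0 \<le> \<mu>" "\<mu> \<le> 1" "real k * real f = real n * (\<mu> * real N)"
    and e3: "\<And>u. u < n \<Longrightarrow> \<bar>real (hdeg G u) - \<mu> * real N\<bar> \<le> e3"
    and e2: "\<bar>real (codeg G B) - \<mu> * real n\<bar> \<le> e2"
    and e4: "\<And>u. u < n \<Longrightarrow> u \<noteq> v \<Longrightarrow> \<bar>real (colink G u v) - \<mu>\<^sup>2 * real N\<bar> \<le> e4"
    and q2: "\<And>u. u < n \<Longrightarrow> u \<noteq> v \<Longrightarrow> real (codeg G {u, v}) \<le> q2" and q20: "0 \<le> q2" "0 \<le> e4"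
  shows "\<bar>real (cnt G v B) - \<mu> * (1 - \<mu>) * (real k * real f)\<bar>
    \<le> (e2 + 1) * (\<mu> * real N) + (\<mu> * real n + e2) * (e3 + e4 + q2 + 1)"
proof -
  note GE = hgD(1)[OF G] note fG = hgD(3)[OF G]
  let ?U = "{u. u < n \<and> u \<notin> B \<and> insert u B \<in> G} - {v}"
  let ?S = "\<lambda>u. {g\<in>G. u \<in> g \<and> v \<notin> g \<and> insert v (g - {u}) \<notin> G}"
  let ?a = "\<lambda>u. real (card (?S u - {insert u B}))"
  let ?E = "e3 + e4 + q2 + 1"
  let ?b = "\<mu> * (1 - \<mu>) * real N"
  have E0: "0 \<le> ?E" using e3[OF v] q20 by linarith
  have a: "\<bar>?a u - ?b\<bar> \<le> ?E" if u: "u \<in> ?U" for u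
  proof -
    have un: "u < n" "u \<noteq> v" using u by auto
    have 1: "real (hdeg G u) = real (card (?S u)) + real (codeg G {u, v}) + real (colink G u v)"
      using move_count[OF GE un(1) v un(2)] by simp
    have "card (?S u) - 1 \<le> card (?S u - {insert u B})" "card (?S u - {insert u B}) \<le> card (?S u)"
      using fG by (auto simp: card_Diff_singleton_if)
    then have 2: "real (card (?S u)) - 1 \<le> ?a u" "?a u \<le> real (card (?S u))" by linarith+
    have b: "?b = \<mu> * real N - \<mu>\<^sup>2 * real N" by (simp add: algebra_simps power2_eq_square)
    show ?thesis unfolding b using 1 2 e3[OF un(1)] e4[OF un] q2[OF un] by (simp only: abs_le_iff) linarith
  qed
  have c: "\<bar>real (card ?U) - \<mu> * real n\<bar> \<le> e2 + 1" "real (card ?U) \<le> \<mu> * real n + e2"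
    using U_card[OF GE B(1), of v] e2 by (simp_all only: abs_le_iff) linarith+
  have cn: "real (cnt G v B) = (\<Sum>u\<in>?U. ?a u)" unfolding cnt_sum[OF GE v] by simp
  have "real (cnt G v B) - \<mu> * (1 - \<mu>) * (real k * real f) = (\<Sum>u\<in>?U. ?a u - ?b) + (real (card ?U) - \<mu> * real n) * ?b"
  proof -
    have "(\<Sum>u\<in>?U. ?a u - ?b) = real (cnt G v B) - real (card ?U) * ?b" unfolding cn by (simp only: sum_subtractf sum_constant)
    then show ?thesis unfolding \<mu>(3) by (simp add: algebra_simps)
  qed
  moreover have "\<bar>\<Sum>u\<in>?U. ?a u - ?b\<bar> \<le> (\<mu> * real n + e2) * ?E"
  proof -
    have "\<bar>\<Sum>u\<in>?U. ?a u - ?b\<bar> \<le> (\<Sum>u\<in>?U. \<bar>?a u - ?b\<bar>)" by (rule sum_abs)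
    also have "\<dots> \<le> (\<Sum>u\<in>?U. ?E)" by (intro sum_mono a)
    also have "\<dots> = real (card ?U) * ?E" by (simp only: sum_constant)
    also have "\<dots> \<le> (\<mu> * real n + e2) * ?E" by (intro mult_right_mono c E0)
    finally show ?thesis .
  qed
  moreover have "\<bar>(real (card ?U) - \<mu> * real n) * ?b\<bar> \<le> (e2 + 1) * (\<mu> * real N)"
  proof -
    have b: "0 \<le> ?b" "?b \<le> \<mu> * real N"
    proof -
      show "0 \<le> ?b" using \<mu> by simp
      have "\<mu> * (1 - \<mu>) \<le> \<mu>" using \<mu> by (simp add: algebra_simps)
      then show "?b \<le> \<mu> * real N" by (rule mult_right_mono) simp
    qed
    have "\<bar>(real (card ?U) - \<mu> * real n) * ?b\<bar> = \<bar>real (card ?U) - \<mu> * real n\<bar> * ?b" by (subst abs_mult) (simp only: abs_of_nonneg[OF b(1)])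
    also have "\<dots> \<le> (e2 + 1) * (\<mu> * real N)" by (rule mult_mono[OF c(1) b(2) _ b(1)]) (use e2 in linarith)
    finally show ?thesis .
  qed
  ultimately show ?thesis by linarith
qed


section \<open>Typical hypergraphs and their probability\<close>

definition N1 :: nat where "N1 = (n - 2) choose (k - 1)"
definition N2 :: nat where "N2 = (n - 2) choose (k - 2)"

text \<open>Deviations are measured against the complete hypergraph, not against the mean
  \<open>\<mu> * N\<close>. This makes sense for very sparse \<open>G\<close>, and it is the
  regularity of the complement that is exploited.\<close>

definition main_good :: "real \<Rightarrow> real \<Rightarrow> real \<Rightarrow> nat set set \<Rightarrow> bool" where
  "main_good \<mu> b a G \<longleftrightarrow> (\<forall>v<n. \<bar>real (hdeg G v) - \<mu> * real N\<bar> \<le> b * real N) \<and>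
    (\<forall>u<n. \<forall>v<n. u \<noteq> v \<longrightarrow> \<bar>real (codeg G {u, v}) - \<mu> * real N2\<bar> \<le> a * real N2)"

text \<open>The degree bound is one-sided with a term \<open>L\<close> for mean degrees below it. A
  \<open>(k - 1)\<close>-set lies in \<open>n - k + 1\<close> many \<open>k\<close>-sets, the scale
  for its codegree.\<close>

definition end_good :: "real \<Rightarrow> real \<Rightarrow> real \<Rightarrow> nat set set \<Rightarrow> bool" where
  "end_good \<mu> a L G \<longleftrightarrow> (\<forall>v<n. real (hdeg G v) \<le> 2 * \<mu> * real N + L) \<and>
    (\<forall>B\<in>Bs. \<bar>real (codeg G B) - \<mu> * real (n - k + 1)\<bar> \<le> a * real (n - k + 1)) \<and>
    (\<forall>u<n. \<forall>v<n. u \<noteq> v \<longrightarrow> \<bar>real (colink G u v) - \<mu>\<^sup>2 * real N1\<bar> \<le> 2 * a * real N1)"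

definition star :: "nat set \<Rightarrow> nat set set" where "star A = {e\<in>Es. A \<subseteq> e}"

lemma codeg_star: "G \<subseteq> Es \<Longrightarrow> codeg G A = card (G \<inter> star A)"
  unfolding codeg_def star_def by (intro arg_cong[of _ _ card]) auto

lemma hdeg_codeg: "hdeg G v = codeg G {v}" by (simp add: codeg_def hdeg_def)

lemma card_star_set: assumes "A \<subseteq> {..<n}" "card A \<le> k" shows "card (star A) = (n - card A) choose (k - card A)"
  unfolding star_def using card_superset[of A] assms by (simp add: atLeast0LessThan)

lemma card_links: assumes "u < n" "v < n" "u \<noteq> v" shows "card (links u v) = N1"
proof -
  have "card ({0..<n} - {u, v}) = n - 2" using assms by (subst card_Diff_subset) auto
  then show ?thesis unfolding links_def N1_def using n_subsets[of "{0..<n} - {u, v}" "k - 1"] by simp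
qed

lemma card_Bs_le: "real (card Bs) \<le> real n ^ (k - 1)"
proof -
  have "card Bs = n choose (k - 1)" unfolding Bs_def using n_subsets[of "{..<n}" "k - 1"] by simp
  also have "\<dots> \<le> n ^ (k - 1)" by (rule binomial_le_pow) (use kn in simp)
  finally show ?thesis by (metis of_nat_le_iff of_nat_power)
qed

context
  fixes \<mu> a b E L :: real
  assumes mu: "0 \<le> \<mu>" "\<mu> \<le> 1" and a: "0 < a" "a \<le> 1" and b: "0 < b" "b \<le> 1"
begin

abbreviation "PG A \<equiv> pr M (\<lambda>_. 1) \<mu> (\<lambda>\<delta>. A (gs \<delta>))"

lemma star_conc:
  assumes r: "0 < r" "r \<le> 1" and E: "4 * E \<le> r\<^sup>2 * real (card (star A))"
  shows "PG (\<lambda>G. r * real (card (star A)) \<le> \<bar>real (codeg G A) - \<mu> * real (card (star A))\<bar>) \<le> 2 * exp (- E)"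
proof -
  have "PG (\<lambda>G. r * real (card (star A)) \<le> \<bar>real (codeg G A) - \<mu> * real (card (star A))\<bar>)
      \<le> 2 * exp ((r / 2)\<^sup>2 * \<mu> * real (card (star A)) - r / 2 * (r * real (card (star A))))"
    using subset_conc[OF mu, of "star A" "r / 2" "r * real (card (star A))"] r
    by (simp add: codeg_star[OF gs_sub] star_def)
  also have "(r / 2)\<^sup>2 * \<mu> * real (card (star A)) - r / 2 * (r * real (card (star A))) \<le> - E"
  proof -
    have "(r / 2)\<^sup>2 * \<mu> * real (card (star A)) \<le> (r / 2)\<^sup>2 * 1 * real (card (star A))"
      using mu by (intro mult_right_mono mult_left_mono) auto
    then show ?thesis using E by (simp add: power2_eq_square)
  qed
  finally show ?thesis by simp
qed

lemma PG_Un: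
  assumes "finite I" "\<And>i. i \<in> I \<Longrightarrow> PG (A i) \<le> q"
  shows "PG (\<lambda>G. \<exists>i\<in>I. A i G) \<le> real (card I) * q"
  using pr_Union[OF mu assms(1), where A = "\<lambda>i \<delta>. A i (gs \<delta>)" and n = M and N = "\<lambda>_. 1" and q = q] assms(2) by simp

lemma main_good_PG:
  assumes E: "4 * E \<le> b\<^sup>2 * real N" "4 * E \<le> a\<^sup>2 * real N2"
  shows "PG (\<lambda>G. \<not> main_good \<mu> b a G) \<le> 4 * real n ^ 2 * exp (- E)"
proof -
  have s1: "card (star {v}) = N" if "v < n" for v using card_star_set[of "{v}"] that k3 by (simp add: N_def)
  have s2: "card (star {u, v}) = N2" if "u < n" "v < n" "u \<noteq> v" for u v
    using card_star_set[of "{u, v}"] that k3 by (simp add: N2_def numeral_2_eq_2)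
  let ?A = "\<lambda>v G. b * real N \<le> \<bar>real (codeg G {v}) - \<mu> * real N\<bar>"
  let ?B = "\<lambda>(u, v) G. a * real N2 \<le> \<bar>real (codeg G {u, v}) - \<mu> * real N2\<bar>"
  let ?I = "{(u, v). u < n \<and> v < n \<and> u \<noteq> v}"
  have I: "finite ?I" "card ?I \<le> n\<^sup>2"
  proof -
    have s: "?I \<subseteq> {..<n} \<times> {..<n}" by auto
    show "finite ?I" using finite_subset[OF s] by simp
    show "card ?I \<le> n\<^sup>2" using card_mono[OF _ s] by (simp add: card_cartesian_product power2_eq_square)
  qed
  have "PG (\<lambda>G. \<not> main_good \<mu> b a G) \<le> PG (\<lambda>G. (\<exists>v\<in>{..<n}. ?A v G) \<or> (\<exists>p\<in>?I. ?B p G))"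
    by (rule pr_mono[OF mu]) (force simp: main_good_def hdeg_codeg not_le)
  also have "\<dots> \<le> PG (\<lambda>G. \<exists>v\<in>{..<n}. ?A v G) + PG (\<lambda>G. \<exists>p\<in>?I. ?B p G)" by (rule pr_disj[OF mu])
  also have "\<dots> \<le> real (card {..<n}) * (2 * exp (- E)) + real (card ?I) * (2 * exp (- E))"
  proof (intro add_mono PG_Un)
    show "PG (?A v) \<le> 2 * exp (- E)" if "v \<in> {..<n}" for v
      using star_conc[OF b, of "{v}"] E s1 that by simp
    show "PG (?B p) \<le> 2 * exp (- E)" if "p \<in> ?I" for p
      using star_conc[OF a, of "{fst p, snd p}"] E s2 that by (auto split: prod.splits)
  qed (use I in auto)
  also have "\<dots> \<le> real n ^ 2 * (2 * exp (- E)) + real n ^ 2 * (2 * exp (- E))"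
  proof (intro add_mono mult_right_mono)
    have "1 * real n \<le> real n * real n" using kn by (intro mult_right_mono) auto
    then show "real (card {..<n}) \<le> real n ^ 2" by (simp add: power2_eq_square)
    show "real (card ?I) \<le> real n ^ 2" using of_nat_mono[OF I(2), where 'a = real] by (simp only: of_nat_power)
  qed auto
  finally show ?thesis by (simp add: mult_ac)
qed

text \<open>The union bound over all \<open>(k - 1)\<close>-sets is responsible for
  \<open>n ^ k\<close>, so \<open>E\<close> will have to exceed \<open>k * ln n\<close>.\<close>

lemma end_good_PG:
  assumes E: "4 * E \<le> a\<^sup>2 * real (n - k + 1)" "4 * E \<le> a\<^sup>2 * real N1"
  shows "PG (\<lambda>G. \<not> end_good \<mu> a L G) \<le> 2 * real n * exp (- L) + 4 * real n ^ k * exp (- E)"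
proof -
  have s1: "card (star {v}) = N" if "v < n" for v using card_star_set[of "{v}"] that k3 by (simp add: N_def)
  have s2: "card (star B) = n - k + 1" if "B \<in> Bs" for B
  proof -
    have "n - (k - 1) = n - k + 1" "k - (k - 1) = 1" using k3 kn by auto
    then show ?thesis using card_star_set[of B] that BsD[OF that] by simp
  qed
  let ?A = "\<lambda>v G. \<mu> * real N + L \<le> \<bar>real (codeg G {v}) - \<mu> * real N\<bar>"
  let ?B = "\<lambda>B G. a * real (n - k + 1) \<le> \<bar>real (codeg G B) - \<mu> * real (n - k + 1)\<bar>"
  let ?C = "\<lambda>(u, v) G. 2 * a * real N1 \<le> \<bar>real (colink G u v) - \<mu>\<^sup>2 * real N1\<bar>"
  let ?I = "{(u, v). u < n \<and> v < n \<and> u \<noteq> v}"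
  have I: "finite ?I" "card ?I \<le> n\<^sup>2"
  proof -
    have s: "?I \<subseteq> {..<n} \<times> {..<n}" by auto
    show "finite ?I" using finite_subset[OF s] by simp
    show "card ?I \<le> n\<^sup>2" using card_mono[OF _ s] by (simp add: card_cartesian_product power2_eq_square)
  qed
  have "PG (\<lambda>G. \<not> end_good \<mu> a L G) \<le> PG (\<lambda>G. (\<exists>v\<in>{..<n}. ?A v G) \<or> (\<exists>B\<in>Bs. ?B B G) \<or> (\<exists>p\<in>?I. ?C p G))"
  proof (rule pr_mono[OF mu])
    fix \<delta> assume h: "\<not> end_good \<mu> a L (gs \<delta>)"
    let ?G = "gs \<delta>"
    consider v where "v < n" "2 * \<mu> * real N + L < real (hdeg ?G v)"
      | B where "B \<in> Bs" "a * real (n - k + 1) < \<bar>real (codeg ?G B) - \<mu> * real (n - k + 1)\<bar>"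
      | u v where "u < n" "v < n" "u \<noteq> v" "2 * a * real N1 < \<bar>real (colink ?G u v) - \<mu>\<^sup>2 * real N1\<bar>"
      using h unfolding end_good_def not_less[symmetric] by blast
    then show "(\<exists>v\<in>{..<n}. ?A v ?G) \<or> (\<exists>B\<in>Bs. ?B B ?G) \<or> (\<exists>p\<in>?I. ?C p ?G)"
    proof cases
      case 1
      then have "?A v ?G" unfolding hdeg_codeg by linarith
      then show ?thesis using 1 by blast
    next
      case 2
      then show ?thesis by (meson less_imp_le)
    next
      case 3
      then have "(u, v) \<in> ?I" "?C (u, v) ?G" by auto
      then show ?thesis by blast
    qed
  qed
  also have "\<dots> \<le> PG (\<lambda>G. \<exists>v\<in>{..<n}. ?A v G) + (PG (\<lambda>G. \<exists>B\<in>Bs. ?B B G) + PG (\<lambda>G. \<exists>p\<in>?I. ?C p G))"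
    by (rule order_trans[OF pr_disj[OF mu]]) (intro add_left_mono pr_disj[OF mu])
  also have "\<dots> \<le> real (card {..<n}) * (2 * exp (- L)) + (real (card Bs) * (2 * exp (- E)) + real (card ?I) * (2 * exp (- E)))"
  proof (intro add_mono PG_Un)
    show "PG (?A v) \<le> 2 * exp (- L)" if v: "v \<in> {..<n}" for v
    proof -
      \<comment> \<open>At exponent one the variance term \<open>\<mu> * N\<close> cancels part of
        the deviation \<open>\<mu> * N + L\<close> and leaves \<open>- L\<close>; hence the shape
        \<open>2 * \<mu> * N + L\<close> in \<open>end_good\<close>.\<close>
      have "PG (?A v) \<le> 2 * exp (1\<^sup>2 * \<mu> * real (card (star {v})) - 1 * (\<mu> * real N + L))"
        using subset_conc[OF mu, of "star {v}" 1 "\<mu> * real N + L"] v s1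
        by (simp add: codeg_star[OF gs_sub] star_def)
      then show ?thesis using v s1 by simp
    qed
    show "PG (?B B) \<le> 2 * exp (- E)" if "B \<in> Bs" for B
      using star_conc[OF a, of B] E s2[OF that] by simp
    show "PG (?C p) \<le> 2 * exp (- E)" if p: "p \<in> ?I" for p
    proof -
      obtain u v where uv: "p = (u, v)" "u < n" "v < n" "u \<noteq> v" using p by auto
      have "PG (?C p) \<le> 2 * exp ((a / 2)\<^sup>2 * \<mu> * real (2 * N1) - a / 2 * (2 * a * real N1))"
        using colink_conc[OF mu uv(2-4), of "a / 2" "2 * a * real N1"] a card_links[OF uv(2-4)] by (simp add: uv(1))
      also have "(a / 2)\<^sup>2 * \<mu> * real (2 * N1) - a / 2 * (2 * a * real N1) \<le> - E"
      proof -
        define X where "X = a\<^sup>2 * real N1"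
        have "(a / 2)\<^sup>2 * \<mu> * real (2 * N1) = \<mu> * X / 2" "a / 2 * (2 * a * real N1) = X"
          by (simp_all add: X_def power2_eq_square)
        moreover have X0: "0 \<le> X" by (simp add: X_def)
        moreover have "\<mu> * X \<le> 1 * X" by (rule mult_right_mono[OF mu(2) X0])
        moreover have "4 * E \<le> X" using E by (simp add: X_def)
        ultimately show ?thesis by linarith
      qed
      finally show ?thesis by simp
    qed
  qed (use I in auto)
  also have "\<dots> \<le> real n * (2 * exp (- L)) + (real n ^ k * (2 * exp (- E)) + real n ^ k * (2 * exp (- E)))"
  proof (intro add_mono mult_right_mono)
    have n1: "1 \<le> real n" using kn by simp
    show "real (card Bs) \<le> real n ^ k" using card_Bs_le power_increasing[OF _ n1, of "k - 1" k] by linarith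
    have "real (card ?I) \<le> real n ^ 2" using of_nat_mono[OF I(2), where 'a = real] by (simp only: of_nat_power)
    then show "real (card ?I) \<le> real n ^ k" using power_increasing[OF _ n1, of 2 k] k3 by linarith
  qed auto
  finally show ?thesis by (simp add: mult_ac)
qed

end

lemma main_good_prob:
  assumes f: "f \<le> M" and ab: "0 < a" "a \<le> 1" "0 < b" "b \<le> 1"
    and E: "4 * E \<le> b\<^sup>2 * real N" "4 * E \<le> a\<^sup>2 * real N2"
  shows "real (card {G\<in>hg f. \<not> main_good (real f / real M) b a G}) / real (M choose f)
    \<le> 2 * (2 * real f + 1) * (4 * real n ^ 2 * exp (- E))"
proof -
  have M: "0 < M" unfolding M_def using kn by simp
  have mu: "0 \<le> real f / real M" "real f / real M \<le> 1" using f M by auto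
  have c: "0 < real (M choose f)" using f zero_less_binomial by simp
  have "real (card {G\<in>hg f. \<not> main_good (real f / real M) b a G}) \<le> 2 * (2 * real f + 1) * real (M choose f) * pr M (\<lambda>_. 1) (real f / real M) (\<lambda>\<delta>. \<not> main_good (real f / real M) b a (gs \<delta>))"
    by (rule hg_transfer[OF f M])
  also have "\<dots> \<le> 2 * (2 * real f + 1) * real (M choose f) * (4 * real n ^ 2 * exp (- E))"
    by (intro mult_left_mono main_good_PG mu ab E) auto
  finally show ?thesis using c by (simp add: divide_le_eq mult_ac)
qed

lemma end_good_prob:
  assumes f: "f \<le> M" and ab: "0 < a" "a \<le> 1"
    and E: "4 * E \<le> a\<^sup>2 * real (n - k + 1)" "4 * E \<le> a\<^sup>2 * real N1"
  shows "real (card {G\<in>hg f. \<not> end_good (real f / real M) a L G}) / real (M choose f)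
    \<le> 2 * (2 * real f + 1) * (2 * real n * exp (- L) + 4 * real n ^ k * exp (- E))"
proof -
  have M: "0 < M" unfolding M_def using kn by simp
  have mu: "0 \<le> real f / real M" "real f / real M \<le> 1" using f M by auto
  have c: "0 < real (M choose f)" using f zero_less_binomial by simp
  have "real (card {G\<in>hg f. \<not> end_good (real f / real M) a L G}) \<le> 2 * (2 * real f + 1) * real (M choose f) * pr M (\<lambda>_. 1) (real f / real M) (\<lambda>\<delta>. \<not> end_good (real f / real M) a L (gs \<delta>))"
    by (rule hg_transfer[OF f M])
  also have "\<dots> \<le> 2 * (2 * real f + 1) * real (M choose f) * (2 * real n * exp (- L) + 4 * real n ^ k * exp (- E))"
    by (intro mult_left_mono end_good_PG[OF mu ab ab] E) auto
  finally show ?thesis using c by (simp add: divide_le_eq mult_ac)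
qed

end

section \<open>Bounding a single step\<close>

text \<open>Every factor of the falling factorial lies between \<open>A - k\<close> and
  \<open>A\<close>, and Bernoulli bounds \<open>(1 - k / A) ^ k\<close> from below.\<close>

lemma falling_bounds:
  assumes "k \<le> A" "0 < A"
  shows "real (A choose k) * fact k \<le> real A ^ k"
    and "real A ^ k * (1 - real k ^ 2 / real A) \<le> real (A choose k) * fact k"
proof -
  have e: "real (A choose k) * fact k = (\<Prod>i=0..<k. real A - real i)"
    by (simp add: binomial_gbinomial gbinomial_prod_rev)
  have "(\<Prod>i=0..<k. real A - real i) \<le> (\<Prod>i=0..<k. real A)"
    using assms by (intro prod_mono) auto
  then show "real (A choose k) * fact k \<le> real A ^ k" unfolding e by simp
  have "1 + real k * (- (real k / real A)) \<le> (1 + - (real k / real A)) ^ k"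
    using assms by (intro Bernoulli_inequality) auto
  then have "real A ^ k * (1 - real k ^ 2 / real A) \<le> real A ^ k * (1 - real k / real A) ^ k"
    by (intro mult_left_mono) (auto simp: power2_eq_square)
  also have "\<dots> = (\<Prod>i=0..<k. real A - real k)"
    using assms by (simp add: power_mult_distrib[symmetric] right_diff_distrib)
  also have "\<dots> \<le> (\<Prod>i=0..<k. real A - real i)"
    using assms by (intro prod_mono) auto
  finally show "real A ^ k * (1 - real k ^ 2 / real A) \<le> real (A choose k) * fact k" unfolding e .
qed

text \<open>Everything is expressed by \<open>s = sqrt (k * L / i)\<close>, with
  \<open>\<sigma> = 2 * sqrt 2 * n * s / k\<close>. The codegree error gives
  \<open>24 * a * s\<^sup>2\<close>, the cubic terms \<open>204 * s ^ 3\<close>, and the fluctuation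
  of the squares the remaining \<open>28\<close> and \<open>20\<close>.\<close>

lemma main_eps_arith:
  fixes n k i L a s K M N2 \<sigma> D vq :: real
  assumes pos: "0 < n" "3 \<le> k" "0 < i" "1 \<le> L" "0 < a" "0 < K"
    and s: "0 \<le> s" "s\<^sup>2 = k * L / i" and \<sigma>: "\<sigma> = 2 * n * sqrt (2 * L / (k * i))"
    and a: "1 \<le> a\<^sup>2 * n" and N2: "0 \<le> N2" "N2 \<le> M * (k / n)\<^sup>2" "2 * M \<le> 3 * K"
    and D: "D \<le> 9 * K * (k / n) ^ 3"
    and vq: "vq = 48 * (2 * (k * i / n) + (2 * (k * i / n))\<^sup>2)"
  shows "2 * sqrt (n * vq * L) / i\<^sup>2 + (2 * a * N2 + D * \<sigma>) * \<sigma>\<^sup>2 / K \<le> 52 * a * s\<^sup>2 + 224 * s ^ 3"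
proof -
  have \<sigma>2: "\<sigma> = 2 * sqrt 2 * n * s / k"
  proof -
    have "2 * L / (k * i) = 2 * (s / k)\<^sup>2" using pos s(2) by (simp add: power_divide field_simps power2_eq_square)
    then have "sqrt (2 * L / (k * i)) = sqrt 2 * (s / k)" using s pos by (simp add: real_sqrt_mult)
    then show ?thesis unfolding \<sigma> by simp
  qed
  have \<sigma>0: "0 \<le> \<sigma>" unfolding \<sigma>2 using pos s by simp
  have s2: "sqrt 2 \<le> 1.4143" by (rule real_le_lsqrt) (auto simp: power2_eq_square)
  have \<sigma>sq: "\<sigma>\<^sup>2 = 8 * (n / k)\<^sup>2 * s\<^sup>2" unfolding \<sigma>2 by (simp add: power_divide power_mult_distrib)
  have 1: "2 * a * N2 * \<sigma>\<^sup>2 / K \<le> 24 * a * s\<^sup>2"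
  proof -
    have "N2 \<le> 3 / 2 * K * (k / n)\<^sup>2"
    proof -
      have "M * (k / n)\<^sup>2 \<le> 3 / 2 * K * (k / n)\<^sup>2" using N2 by (intro mult_right_mono) auto
      then show ?thesis using N2 by linarith
    qed
    then have "2 * a * N2 * \<sigma>\<^sup>2 \<le> 2 * a * (3 / 2 * K * (k / n)\<^sup>2) * \<sigma>\<^sup>2"
      using pos by (intro mult_right_mono mult_left_mono) auto
    also have "\<dots> = 24 * a * s\<^sup>2 * K" unfolding \<sigma>sq using pos by (simp add: field_simps)
    finally show ?thesis using pos by (simp add: divide_le_eq)
  qed
  have 2: "D * \<sigma> * \<sigma>\<^sup>2 / K \<le> 204 * s ^ 3"
  proof -
    have "D * \<sigma> * \<sigma>\<^sup>2 = D * \<sigma> ^ 3" by (simp add: power2_eq_square power3_eq_cube)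
    also have "\<dots> \<le> 9 * K * (k / n) ^ 3 * \<sigma> ^ 3" using D \<sigma>0 by (intro mult_right_mono) auto
    also have "\<dots> = 9 * K * (8 * (2 * sqrt 2) * s ^ 3)" unfolding \<sigma>2 using pos
      by (simp add: field_simps power3_eq_cube)
    also have "\<dots> = K * s ^ 3 * (144 * sqrt 2)" by simp
    also have "\<dots> \<le> K * s ^ 3 * 204" using s2 pos s by (intro mult_left_mono) auto
    finally show ?thesis using pos by (simp add: divide_le_eq mult_ac)
  qed
  have 3: "2 * sqrt (n * vq * L) / i\<^sup>2 \<le> 28 * a * s\<^sup>2 + 20 * s ^ 3"
  proof -
    have e: "n * vq * L = 96 * (k * i * L) + 192 * (k\<^sup>2 * i\<^sup>2 * L / n)"
      unfolding vq using pos by (simp add: field_simps power2_eq_square)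
    have sL: "s\<^sup>2 * i = k * L" using s pos by simp
    have "k * i * L \<le> (i\<^sup>2 * s ^ 3)\<^sup>2"
    proof -
      have "(i\<^sup>2 * s ^ 3)\<^sup>2 = i * (s\<^sup>2 * i) ^ 3" by (simp add: power2_eq_square power3_eq_cube algebra_simps)
      also have "\<dots> = i * (k * L) ^ 3" by (simp only: sL)
      finally have "(i\<^sup>2 * s ^ 3)\<^sup>2 = i * (k * L) ^ 3" .
      moreover have "(k * L) ^ 1 \<le> (k * L) ^ 3"
        using pos mult_mono[of 1 k 1 L] by (intro power_increasing) auto
      ultimately show ?thesis using pos by (simp add: mult_ac)
    qed
    moreover have "k\<^sup>2 * i\<^sup>2 * L / n \<le> (i\<^sup>2 * (a * s\<^sup>2))\<^sup>2"
    proof -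
      have "(i\<^sup>2 * (a * s\<^sup>2))\<^sup>2 = i\<^sup>2 * (a\<^sup>2 * (s\<^sup>2 * i)\<^sup>2)" by (simp add: power2_eq_square algebra_simps)
      also have "\<dots> = i\<^sup>2 * (a\<^sup>2 * (k * L)\<^sup>2)" by (simp only: sL)
      finally have e2: "(i\<^sup>2 * (a * s\<^sup>2))\<^sup>2 = i\<^sup>2 * (a\<^sup>2 * (k * L)\<^sup>2)" .
      have "L * 1 \<le> L\<^sup>2 * (a\<^sup>2 * n)" using pos a by (intro mult_mono) (auto simp: power2_eq_square)
      then have "(k\<^sup>2 * i\<^sup>2) * L \<le> (k\<^sup>2 * i\<^sup>2) * (L\<^sup>2 * (a\<^sup>2 * n))" by (intro mult_left_mono) auto
      then show ?thesis unfolding e2 using pos by (simp add: divide_le_eq power_mult_distrib mult_ac)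
    qed
    ultimately have "n * vq * L \<le> 96 * (i\<^sup>2 * s ^ 3)\<^sup>2 + 192 * (i\<^sup>2 * (a * s\<^sup>2))\<^sup>2" unfolding e by linarith
    also have "\<dots> \<le> (10 * (i\<^sup>2 * s ^ 3) + 14 * (i\<^sup>2 * (a * s\<^sup>2)))\<^sup>2"
    proof -
      have "0 \<le> (i\<^sup>2 * s ^ 3) * (i\<^sup>2 * (a * s\<^sup>2))" using pos s by simp
      then show ?thesis unfolding power2_sum power_mult_distrib[of "10::real"] power_mult_distrib[of "14::real"]
        using zero_le_power2[of "i\<^sup>2 * s ^ 3"] zero_le_power2[of "i\<^sup>2 * (a * s\<^sup>2)"] by simp
    qed
    finally have "sqrt (n * vq * L) \<le> 10 * (i\<^sup>2 * s ^ 3) + 14 * (i\<^sup>2 * (a * s\<^sup>2))"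
      using pos s by (intro real_le_lsqrt) auto
    then show ?thesis using pos by (simp add: divide_le_eq algebra_simps)
  qed
  have "(2 * a * N2 + D * \<sigma>) * \<sigma>\<^sup>2 / K = 2 * a * N2 * \<sigma>\<^sup>2 / K + D * \<sigma> * \<sigma>\<^sup>2 / K"
    by (simp add: add_divide_distrib distrib_right)
  then show ?thesis using 1 2 3 by linarith
qed

text \<open>Supplies the hypothesis \<open>H\<close> of \<open>tail_sq\<close>: the bound on
  \<open>L ^ 3\<close> handles the part quadratic in \<open>db\<close>, the bound on
  \<open>L ^ 5\<close> the part linear in it.\<close>

lemma main_H_arith:
  fixes n k i L db :: real
  assumes pos: "0 < n" "3 \<le> k" "0 < i" "1 \<le> L" and db: "db = k * i / n"
    and L: "3 * L ^ 3 \<le> n" "L ^ 5 \<le> 2 * i"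
  shows "L * (2 * sqrt (2 * db * L) + 2 * L) ^ 4 \<le> n * (48 * (2 * db + (2 * db)\<^sup>2))"
proof -
  have db0: "0 \<le> db" unfolding db using pos by simp
  define q where "q = sqrt (2 * db * L)"
  have q2: "q\<^sup>2 = 2 * db * L" unfolding q_def using db0 pos by simp
  have "(q + L)\<^sup>2 \<le> 2 * (q\<^sup>2 + L\<^sup>2)" using zero_le_power2[of "q - L"] by (simp add: power2_eq_square algebra_simps)
  then have "((q + L)\<^sup>2)\<^sup>2 \<le> (2 * (q\<^sup>2 + L\<^sup>2))\<^sup>2" by (intro power_mono) auto
  also have "\<dots> \<le> 8 * ((q\<^sup>2)\<^sup>2 + (L\<^sup>2)\<^sup>2)" using zero_le_power2[of "q\<^sup>2 - L\<^sup>2"] by (simp add: power2_eq_square algebra_simps)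
  finally have "(q + L) ^ 4 \<le> 8 * (4 * db\<^sup>2 * L\<^sup>2 + L ^ 4)" unfolding q2 by (simp add: power_mult_distrib power2_eq_square numeral_eq_Suc algebra_simps)
  then have "16 * L * (q + L) ^ 4 \<le> 16 * L * (8 * (4 * db\<^sup>2 * L\<^sup>2 + L ^ 4))" using pos by (intro mult_left_mono) auto
  also have "\<dots> = 512 * db\<^sup>2 * L ^ 3 + 128 * L ^ 5" by (simp add: algebra_simps numeral_eq_Suc)
  also have "\<dots> \<le> 192 * (db\<^sup>2 * n) + 96 * (k * i)"
  proof -
    have "db\<^sup>2 * (3 * L ^ 3) \<le> db\<^sup>2 * n" using L by (intro mult_left_mono) auto
    moreover have "3 * i \<le> k * i" using pos by (intro mult_right_mono) auto
    moreover have "0 \<le> db\<^sup>2 * n" using pos by simp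
    ultimately show ?thesis using L pos by (simp only: mult.assoc mult.left_commute[of _ 3])
  qed
  also have "\<dots> = n * (48 * (2 * db + (2 * db)\<^sup>2))" unfolding db using pos by (simp add: field_simps power2_eq_square)
  finally have h: "16 * L * (q + L) ^ 4 \<le> n * (48 * (2 * db + (2 * db)\<^sup>2))" .
  have "L * (2 * q + 2 * L) ^ 4 = L * (2 * (q + L)) ^ 4" by (simp only: distrib_left)
  also have "\<dots> = 16 * L * (q + L) ^ 4" unfolding power_mult_distrib by simp
  finally show ?thesis using h unfolding q_def[symmetric] by linarith
qed

context kgraph
begin

lemma nN_real: "real n * real N = real k * real M" using nN by (metis of_nat_mult)

lemma N2_real: "real n * (real n - 1) * real N2 = real k * (real k - 1) * real M"
proof -
  obtain n' k' where e: "n = Suc (Suc n')" "k = Suc (Suc k')" using k3 kn that[of "n - 2" "k - 2"] by auto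
  have "Suc k' * (Suc n' choose Suc k') = Suc n' * (n' choose k')" using binomial_absorption[of k' "Suc n'"] by simp
  then have "real (Suc k') * real N = real (Suc n') * real N2" unfolding N_def N2_def of_nat_mult[symmetric] of_nat_eq_iff by (simp add: e)
  then have "real n * (real (Suc k') * real N) = real n * (real (Suc n') * real N2)" by (rule arg_cong)
  then have "real n * (real (Suc n') * real N2) = real (Suc k') * (real n * real N)" by (simp only: mult.left_commute[of "real n" "real (Suc k')"])
  then show ?thesis unfolding nN_real using e by (simp add: mult_ac)
qed

lemma N_split: "N = N1 + N2"
proof -
  obtain n' k' where e: "n = Suc (Suc n')" "k = Suc (Suc k')" using k3 kn that[of "n - 2" "k - 2"] by auto
  show ?thesis unfolding N_def N1_def N2_def by (simp add: e)
qed

lemma M_lower: assumes "2 * real k ^ 2 \<le> real n" shows "real n ^ k \<le> 2 * fact k * real M"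
proof -
  have "1 / 2 \<le> 1 - real k ^ 2 / real n" using assms kn by (simp add: field_simps)
  then have "real n ^ k * (1 / 2) \<le> real n ^ k * (1 - real k ^ 2 / real n)" by (intro mult_left_mono) auto
  also have "\<dots> \<le> real M * fact k" unfolding M_def by (rule falling_bounds(2)) (use kn in auto)
  finally show ?thesis by (simp add: mult_ac)
qed


text \<open>Typical \<open>G\<close> satisfy the hypotheses of \<open>main_phase\<close>. The
  exceptional event is returned as an unnamed \<open>bd\<close>, since all that matters outside is
  its weight.\<close>

lemma main_good_T:
  assumes G: "G \<in> hg f" and mg: "main_good (real f / real M) b a G" and f: "3 * f \<le> M" "f + i \<le> M"
    and k: "8 * real k * b \<le> 1" "8 * real k ^ 2 \<le> real n" and ab: "0 < b" "b \<le> 1" "5 * b \<le> a" and an: "1 \<le> a\<^sup>2 * real n"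
    and i: "8 * k \<le> i" and L: "1 \<le> L" "3 * L ^ 3 \<le> real n" "L ^ 5 \<le> 2 * real i" "2 * L \<le> real k * real i"
    and y: "y = sqrt (real k * L / real i)" "y \<le> 1 / 3" and \<epsilon>: "\<epsilon> = 52 * a * y\<^sup>2 + 224 * y ^ 3" "\<epsilon> \<le> 1 / 4"
    and pb: "pb = 8 * (2 * real (k * i) + 1) * (real n)\<^sup>2 * exp (- L)" "pb \<le> 1 / 2"
  obtains bd where
    "\<And>\<delta>. \<delta> \<in> Om n (k * i) \<Longrightarrow> \<bar>cT (M - f) i * (\<Sum>e\<in>Es - G. \<Prod>v\<in>e. real (\<delta> v) / real (nv G v)) - 1\<bar> \<le> 16 * \<epsilon> + 56 * pb + 48 * of_bool (bd \<delta>)"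
    "(\<Sum>\<delta>\<in>Om n (k * i). (\<Prod>v<n. real (nv G v choose \<delta> v)) * of_bool (bd \<delta>)) \<le> pb * real ((k * (M - f)) choose (k * i))"
proof -
  note GE = hgD(1)[OF G] note cG = hgD(2)[OF G]
  define K where "K = M - f"
  define \<mu> where "\<mu> = real f / real M"
  define Nb where "Nb = real k * real K / real n"
  \<comment> \<open>Chosen so that \<open>\<theta> * Nb\<^sup>2\<close> is the expected codegree
    \<open>(1 - \<mu>) * N2\<close> in the complement.\<close>
  define \<theta> where "\<theta> = (1 - \<mu>) * real N2 / Nb\<^sup>2"
  have n0: "0 < real n" and k0: "0 < real k" and k3': "3 \<le> real k" using k3 kn by auto
  have i0: "0 < real i" using i k3 by simp
  have M0: "0 < real M" unfolding M_def using kn by simp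
  have KM: "real K = real M - real f" unfolding K_def using f by simp
  have f3: "3 * real f \<le> real M" using f(1) by (metis of_nat_le_iff of_nat_mult of_nat_numeral)
  have K2: "2 * real M \<le> 3 * real K" using KM f3 by linarith
  have K0: "0 < real K" using K2 M0 by linarith
  have mu: "0 \<le> \<mu>" "\<mu> \<le> 1/3" "1 - \<mu> = real K / real M" using f3 M0 KM by (auto simp: \<mu>_def field_simps)
  have N: "real N = real k * real M / real n" using nN_real n0 by (simp add: field_simps)
  have Nb0: "0 < Nb" using k0 K0 n0 by (simp add: Nb_def)
  have NbN: "Nb = (1 - \<mu>) * real N" unfolding Nb_def N mu(3) using M0 by simp
  have nvN: "real (nv G v) = real N - real (hdeg G v)" if "v < n" for v
    using hdeg_le[OF GE that] by (simp add: nv_def)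
  have nvb: "\<bar>real (nv G v) - Nb\<bar> \<le> b * real N" if "v < n" for v
  proof -
    have "\<bar>real (hdeg G v) - \<mu> * real N\<bar> \<le> b * real N" using mg that unfolding main_good_def \<mu>_def by blast
    then show ?thesis unfolding nvN[OF that] NbN by (simp add: algebra_simps abs_le_iff)
  qed
  have N15: "real N \<le> 3 / 2 * Nb" unfolding N Nb_def using K2 k0 n0 by (simp add: field_simps)
  \<comment> \<open>Converts deviations relative to \<open>N\<close> into deviations relative to the
    mean complement degree \<open>Nb\<close>, using \<open>N \<le> 3/2 * Nb\<close>.\<close>
  define \<xi> where "\<xi> = 3 / 2 * b"
  have \<xi>: "0 \<le> \<xi>" "\<xi> \<le> 1 / 2" 
  proof -
    have "8 * real k * b \<ge> 8 * 3 * b" using k3' ab by (intro mult_right_mono) auto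
    then show "\<xi> \<le> 1 / 2" using k(1) unfolding \<xi>_def by linarith
  qed (use ab in \<open>simp add: \<xi>_def\<close>)
  have nvx: "\<bar>real (nv G v) - Nb\<bar> \<le> \<xi> * Nb" if "v < n" for v
  proof -
    have "b * real N \<le> b * (3 / 2 * Nb)" using N15 ab by (intro mult_left_mono) auto
    then show ?thesis using nvb[OF that] by (simp add: \<xi>_def)
  qed
  have "main_phase n k G i L \<theta> (2 * a * real N2)"
  proof unfold_locales
    show "G \<subseteq> Es" by (rule GE)
    show "8 * k \<le> i" by (rule i)
    show "i \<le> M - card G" using f cG by simp
    show "1 \<le> L" "2 * L \<le> real k * real i" using L by auto
    show "0 \<le> 2 * a * real N2" using ab by simp
    show "real n ^ k \<le> 3 * fact k * real (M - card G)"
    proof -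
      have "real n ^ k \<le> 2 * fact k * real M" using k(2) by (intro M_lower) linarith
      also have "\<dots> = fact k * (2 * real M)" by simp
      also have "\<dots> \<le> fact k * (3 * real K)" using K2 by (intro mult_left_mono) auto
      finally show ?thesis using cG by (simp add: K_def mult_ac)
    qed
    show "\<bar>real (nv G v) - real k * real (M - card G) / real n\<bar> \<le> real (M - card G) / (2 * real n)" if "v < n" for v
    proof -
      have "\<xi> * Nb \<le> real K / (2 * real n)"
      proof -
        have "\<xi> * real k \<le> 1 / 2" using k(1) ab k0 unfolding \<xi>_def by (simp add: mult_ac) 
        then have "(\<xi> * real k) * (real K / real n) \<le> 1 / 2 * (real K / real n)" using K0 n0 by (intro mult_right_mono) auto
        then show ?thesis by (simp add: Nb_def)
      qed
      then show ?thesis using nvx[OF that] cG unfolding Nb_def K_def by simp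
    qed
    show "0 \<le> \<theta>" using mu by (simp add: \<theta>_def)
    have th: "\<theta> * real K = real n * real N2 * real n / (real k ^ 2 * real M)"
      unfolding \<theta>_def mu(3) Nb_def using K0 M0 n0 k0 by (simp add: field_simps power2_eq_square)
    show "\<theta> * real (M - card G) \<le> 2"
    proof -
      have n1: "1 < real n" using kn k3 by simp
      have "\<theta> * real K = real n / (real k ^ 2 * real M * (real n - 1)) * (real n * (real n - 1) * real N2)"
        unfolding th using n1 by simp
      also have "\<dots> = real n * (real k - 1) / (real k * (real n - 1))"
        unfolding N2_real using k0 M0 by (simp add: power2_eq_square)
      finally have "\<theta> * real K = real n * (real k - 1) / (real k * (real n - 1))" .
      also have "\<dots> \<le> 1" using n1 k0 kn by (simp add: divide_le_eq algebra_simps)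
      finally show ?thesis using cG by (simp add: K_def)
    qed
    show "\<bar>real (card {e\<in>Es - G. u \<in> e \<and> v \<in> e}) - \<theta> * real (nv G u) * real (nv G v)\<bar> \<le> 2 * a * real N2"
      if uv: "u < n" "v < n" "u \<noteq> v" for u v
    proof -
      have "card (star {u, v}) = N2" using card_star_set[of "{u, v}"] uv k3 by (simp add: N2_def numeral_2_eq_2)
      moreover have "{e\<in>Es - G. u \<in> e \<and> v \<in> e} = star {u, v} - G" by (auto simp: star_def)
      moreover have "card (star {u, v} - G) = card (star {u, v}) - card (star {u, v} \<inter> G)"
        by (rule card_Diff_subset_Int) (use hgD(3)[OF G] in auto)
      moreover have "card (star {u, v} \<inter> G) = codeg G {u, v}" by (simp add: codeg_star[OF GE] Int_commute)
      moreover have "card (star {u, v} \<inter> G) \<le> card (star {u, v})" by (intro card_mono) (auto simp: star_def)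
      ultimately have c: "real (card {e\<in>Es - G. u \<in> e \<and> v \<in> e}) = real N2 - real (codeg G {u, v})" by simp
      have d: "\<bar>real (codeg G {u, v}) - \<mu> * real N2\<bar> \<le> a * real N2" using mg uv unfolding main_good_def \<mu>_def by blast
      define p q where "p = real (nv G u) - Nb" and "q = real (nv G v) - Nb"
      have pq: "\<bar>p\<bar> \<le> \<xi> * Nb" "\<bar>q\<bar> \<le> \<xi> * Nb" using nvx uv by (auto simp: p_def q_def)
      have "real (nv G u) * real (nv G v) - Nb\<^sup>2 = Nb * p + Nb * q + p * q"
        by (simp add: p_def q_def power2_eq_square algebra_simps)
      then have "\<bar>real (nv G u) * real (nv G v) - Nb\<^sup>2\<bar> \<le> \<bar>Nb * p\<bar> + \<bar>Nb * q\<bar> + \<bar>p * q\<bar>" by linarith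
      also have "\<dots> \<le> Nb * (\<xi> * Nb) + Nb * (\<xi> * Nb) + (\<xi> * Nb) * (\<xi> * Nb)"
        unfolding abs_mult using pq Nb0 \<xi>(1) by (intro add_mono mult_mono) auto
      also have "\<dots> = (2 * \<xi> + \<xi> * \<xi>) * Nb\<^sup>2" by (simp add: power2_eq_square algebra_simps)
      also have "\<dots> \<le> (5 / 2 * \<xi>) * Nb\<^sup>2"
      proof (rule mult_right_mono)
        have "\<xi> * \<xi> \<le> 1 / 2 * \<xi>" by (rule mult_right_mono[OF \<xi>(2,1)])
        then show "2 * \<xi> + \<xi> * \<xi> \<le> 5 / 2 * \<xi>" by linarith
      qed simp
      finally have "\<theta> * \<bar>real (nv G u) * real (nv G v) - Nb\<^sup>2\<bar> \<le> \<theta> * ((5 / 2 * \<xi>) * Nb\<^sup>2)"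
        using mu by (intro mult_left_mono) (auto simp: \<theta>_def)
      also have "\<dots> = (5 / 2 * \<xi>) * ((1 - \<mu>) * real N2)" unfolding \<theta>_def using Nb0 by simp
      also have "\<dots> \<le> a * (1 * real N2)"
        using mu ab \<xi> by (intro mult_mono mult_right_mono) (auto simp: \<xi>_def)
      finally have e: "\<theta> * \<bar>real (nv G u) * real (nv G v) - Nb\<^sup>2\<bar> \<le> a * real N2" by simp
      have "\<theta> * \<bar>real (nv G u) * real (nv G v) - Nb\<^sup>2\<bar> = \<bar>\<theta> * (real (nv G u) * real (nv G v) - Nb\<^sup>2)\<bar>"
        using mu by (simp add: abs_mult \<theta>_def)
      also have "\<theta> * (real (nv G u) * real (nv G v) - Nb\<^sup>2) = \<theta> * real (nv G u) * real (nv G v) - (real N2 - \<mu> * real N2)"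
        unfolding \<theta>_def using Nb0 by (simp add: field_simps)
      finally show ?thesis unfolding c using d e by linarith
    qed
  qed
  then interpret mp: main_phase n k G i L \<theta> "2 * a * real N2" .
  have mK: "mp.K = K" by (simp add: mp.K_def K_def cG)
  have kk: "real (k * i) = real k * real i" by simp
  have pbe: "mp.pb = pb" by (simp add: mp.pb_def pb)
  have H: "L * mp.Y ^ 4 \<le> real n * mp.vq"
    unfolding mp.Y_def mp.vq_def by (rule main_H_arith[OF n0 k3' i0 L(1) mp.db_def L(2,3)])
  have y0: "0 \<le> y" "y\<^sup>2 = real k * L / real i" using y k0 L i0 by auto
  \<comment> \<open>The \<open>k - 3\<close> factors \<open>1 + 3 * y / k\<close> multiply to at
    most \<open>exp (3 * y) \<le> 3\<close>, which is where \<open>y \<le> 1/3\<close>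
    enters.\<close>
  have D: "mp.D3m \<le> 9 * real K * (real k / real n) ^ 3"
  proof -
    have \<sigma>: "mp.\<sigma> \<le> real n * (3 * y / real k)"
    proof -
      have "2 * L / (real k * real i) = 2 * (y / real k)\<^sup>2" using y0 k0 i0 by (simp add: power_divide field_simps power2_eq_square)
      then have "sqrt (2 * L / (real k * real i)) = sqrt 2 * (y / real k)" using y0 k0 by (simp add: real_sqrt_mult)
      then have "mp.\<sigma> = real n * (2 * sqrt 2 * y / real k)" by (simp add: mp.\<sigma>_def)
      moreover have "sqrt 2 \<le> 3 / 2" by (rule real_le_lsqrt) (auto simp: power2_eq_square)
      ultimately show ?thesis using y0 k0 n0 by (auto intro!: mult_left_mono divide_right_mono mult_right_mono)
    qed
    have \<sigma>0: "0 \<le> mp.\<sigma>" using L k0 i0 by (simp add: mp.\<sigma>_def)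
    have "(real n + mp.\<sigma>) ^ (k - 3) \<le> (real n * (1 + 3 * y / real k)) ^ (k - 3)"
      using \<sigma> \<sigma>0 n0 by (intro power_mono) (auto simp: algebra_simps)
    also have "\<dots> \<le> real n ^ (k - 3) * 3"
    proof -
      have "(1 + 3 * y / real k) ^ (k - 3) \<le> (1 + 3 * y / real k) ^ k" using y0 k0 by (intro power_increasing) auto
      also have "\<dots> \<le> exp (3 * y / real k) ^ k" using y0 k0 by (intro power_mono exp_ge_add_one_self) auto
      also have "\<dots> = exp (3 * y)" using k0 by (simp add: exp_of_nat_mult[symmetric])
      also have "\<dots> \<le> exp 1" using y by simp
      also have "\<dots> \<le> 3" using e_less_272 by simp
      finally show ?thesis by (simp add: power_mult_distrib mult_left_mono)
    qed
    finally have 1: "mp.D3m \<le> 3 * (real n ^ (k - 3) / fact (k - 3))"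
      unfolding mp.D3m_def by (simp add: divide_right_mono)
    have "real n ^ (k - 3) / fact (k - 3) \<le> 3 * real K * (real k / real n) ^ 3"
    proof -
      obtain j where j: "k = Suc (Suc (Suc j))" using k3 that[of "k - 3"] by auto
      have "fact k = real k * (real k - 1) * (real k - 2) * fact (k - 3)" unfolding j by (simp add: algebra_simps)
      also have "\<dots> \<le> real k ^ 3 * fact (k - 3)"
      proof (rule mult_right_mono)
        have "real k * (real k - 1) * (real k - 2) \<le> real k * real k * real k"
          using k3' by (intro mult_mono) auto
        then show "real k * (real k - 1) * (real k - 2) \<le> real k ^ 3" by (simp add: power3_eq_cube)
      qed simp
      finally have fk: "fact k \<le> real k ^ 3 * fact (k - 3)" .
      have "real n ^ (k - 3) * real n ^ 3 = real n ^ k" using k3 by (simp add: power_add[symmetric])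
      also have "\<dots> \<le> 3 * fact k * real K" using mp.A4 cG by (simp add: K_def)
      also have "\<dots> \<le> 3 * (real k ^ 3 * fact (k - 3)) * real K" using fk by (intro mult_right_mono) auto
      finally show ?thesis using n0 by (simp add: field_simps power_divide)
    qed
    then show ?thesis using 1 by simp
  qed
  have ep: "mp.\<epsilon> \<le> \<epsilon>"
  proof -
    have "real N2 \<le> real M * (real k / real n)\<^sup>2"
    proof -
      have n1: "1 < real n" using kn k3 by simp
      have "real N2 = real k * (real k - 1) * real M / (real n * (real n - 1))"
        using N2_real n1 by (simp add: field_simps)
      moreover have "(real k - 1) / (real n - 1) \<le> real k / real n" using n1 kn k3' by (simp add: field_simps)
      then have "(real k / real n * real M) * ((real k - 1) / (real n - 1)) \<le> (real k / real n * real M) * (real k / real n)"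
        using k0 n0 M0 by (intro mult_left_mono) auto
      ultimately show ?thesis by (simp add: power2_eq_square mult_ac)
    qed
    then have "2 * sqrt (real n * mp.vq * L) / (real i)\<^sup>2 + (2 * a * real N2 + mp.D3m * mp.\<sigma>) * mp.\<sigma>\<^sup>2 / real K \<le> 52 * a * y\<^sup>2 + 224 * y ^ 3"
      using ab by (intro main_eps_arith[OF n0 k3' i0 L(1) _ K0 y0 mp.\<sigma>_def an _ _ K2 D]) (auto simp: mp.vq_def mp.db_def)
    then show ?thesis unfolding \<epsilon> mp.\<epsilon>_def mp.\<beta>_def mp.\<tau>2_def mK .
  qed
  have e4: "mp.\<epsilon> \<le> 1 / 4" using ep \<epsilon> by linarith
  have p2: "mp.pb \<le> 1 / 2" using pbe pb by linarith
  show thesis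
  proof (rule that[of mp.bad])
    fix \<delta> assume d: "\<delta> \<in> Om n (k * i)"
    have eT: "mp.Tf \<delta> = cT (M - f) i * (\<Sum>e\<in>Es - G. \<Prod>v\<in>e. real (\<delta> v) / real (nv G v))"
      by (simp add: mp.Tf_def mp.K_def cG)
    have "\<bar>mp.Tf \<delta> - 1\<bar> \<le> 48" by (rule mp.T_concentrated(1)[OF H p2 e4 d])
    moreover have "\<not> mp.bad \<delta> \<Longrightarrow> \<bar>mp.Tf \<delta> - 1\<bar> \<le> 16 * mp.\<epsilon> + 56 * mp.pb" by (rule mp.T_concentrated(2)[OF H p2 e4 d])
    moreover have "0 \<le> \<epsilon>" unfolding \<epsilon>(1) using y0(1) ab by (intro add_nonneg_nonneg mult_nonneg_nonneg) auto
    moreover have "0 \<le> pb" unfolding pb by simp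
    ultimately show "\<bar>cT (M - f) i * (\<Sum>e\<in>Es - G. \<Prod>v\<in>e. real (\<delta> v) / real (nv G v)) - 1\<bar> \<le> 16 * \<epsilon> + 56 * pb + 48 * of_bool (mp.bad \<delta>)"
      unfolding eT[symmetric] using ep pbe by (cases "mp.bad \<delta>"; simp only: of_bool_def if_True if_False simp_thms; linarith)
  next
    have "i \<le> K" using f(2) unfolding K_def by linarith
    then have "k * i \<le> k * K" by simp
    then have c: "0 < real ((k * K) choose (k * i))" by simp
    have "(\<Sum>\<delta>\<in>Om n (k * i). mp.slw \<delta> * of_bool (mp.bad \<delta>)) \<le> pb" using mp.slw_bad[OF H] pbe by simp
    then have "(\<Sum>\<delta>\<in>Om n (k * i). (\<Prod>v<n. real (nv G v choose \<delta> v)) * of_bool (mp.bad \<delta>)) / real ((k * K) choose (k * i)) \<le> pb"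
      unfolding mp.slw_def mK sum_divide_distrib by simp
    then show "(\<Sum>\<delta>\<in>Om n (k * i). (\<Prod>v<n. real (nv G v choose \<delta> v)) * of_bool (mp.bad \<delta>)) \<le> pb * real ((k * (M - f)) choose (k * i))"
      using c by (simp add: divide_le_eq K_def)
  qed
qed


text \<open>For typical \<open>G\<close> the ratio is off by at most \<open>48\<close> more on the
  bad slice vectors. For the other \<open>G\<close> the crude \<open>T + 1\<close> bounds the
  deviation, and it has mean at most two; so the additive errors total at most
  \<open>48 * pb + 2 * q\<close>.\<close>

lemma main_step:
  assumes i1: "1 \<le> i" "i \<le> m" and m: "m \<le> M" "3 * (m - i) \<le> M"
    and k: "8 * real k * b \<le> 1" "8 * real k ^ 2 \<le> real n" and ab: "0 < b" "b \<le> 1" "5 * b \<le> a" and an: "1 \<le> a\<^sup>2 * real n"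
    and i: "8 * k \<le> i" and L: "1 \<le> L" "3 * L ^ 3 \<le> real n" "L ^ 5 \<le> 2 * real i" "2 * L \<le> real k * real i"
    and y: "y = sqrt (real k * L / real i)" "y \<le> 1 / 3" and \<epsilon>: "\<epsilon> = 52 * a * y\<^sup>2 + 224 * y ^ 3" "\<epsilon> \<le> 1 / 4"
    and pb: "pb = 8 * (2 * real (k * i) + 1) * (real n)\<^sup>2 * exp (- L)" "pb \<le> 1 / 2"
    and q: "real (card {G\<in>hg (m - i). \<not> main_good (real (m - i) / real M) b a G}) / real (M choose (m - i)) \<le> q"
  shows "\<exists>\<beta>. (\<forall>d. 0 \<le> \<beta> d) \<and> (\<Sum>d\<in>Om n (k * m). \<beta> d) \<le> 48 * pb + 2 * q \<and>
    (\<forall>d\<in>Om n (k * m). \<bar>p m (i - 1) d - p m i d\<bar> \<le> (16 * \<epsilon> + 56 * pb) * p m i d + \<beta> d)"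
proof -
  define f K where "f = m - i" and "K = M - f"
  define mg where "mg = main_good (real f / real M) b a"
  have fK: "f + K = M" "i \<le> K" "m - f = i" "f \<le> m" using i1 m by (auto simp: f_def K_def)
  define GD where "GD = {G\<in>hg f. mg G}"
  define GB where "GB = {G\<in>hg f. \<not> mg G}"
  define tt where "tt G \<delta> = cT K i * (\<Sum>e\<in>Es - G. \<Prod>v\<in>e. real (\<delta> v) / real (nv G v))" for G and \<delta> :: "nat \<Rightarrow> nat"
  define CC where "CC = real ((k * K) choose (k * i))"
  have kiK: "k * i \<le> k * K" using fK by simp
  then have CC0: "0 < CC" by (simp add: CC_def)
  have Ck0: "0 < real ((k * K - k) choose (k * i - k))" using diff_le_mono[OF kiK, of k] by simp
  have K0: "0 < real K" using i1 fK by simp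
  have cf: "0 < real (M choose f)" using fK by simp
  have Z: "Z m i = real (M choose f) * CC" by (simp add: Z_def CC_def K_def f_def)
  have Z0: "0 < Z m i" using Z cf CC0 by simp
  define P where "P G bd \<longleftrightarrow> (\<forall>\<delta>\<in>Om n (k * i). \<bar>tt G \<delta> - 1\<bar> \<le> 16 * \<epsilon> + 56 * pb + 48 * of_bool (bd \<delta>)) \<and>
    (\<Sum>\<delta>\<in>Om n (k * i). (\<Prod>v<n. real (nv G v choose \<delta> v)) * of_bool (bd \<delta>)) \<le> pb * CC" for G bd
  have "\<exists>bd. P G bd" if G: "G \<in> GD" for G
  proof -
    have h: "G \<in> hg f" "main_good (real f / real M) b a G" "3 * f \<le> M" "f + i \<le> M"
      using G m fK by (auto simp: GD_def mg_def f_def)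
    obtain bd where "\<And>\<delta>. \<delta> \<in> Om n (k * i) \<Longrightarrow> \<bar>cT (M - f) i * (\<Sum>e\<in>Es - G. \<Prod>v\<in>e. real (\<delta> v) / real (nv G v)) - 1\<bar> \<le> 16 * \<epsilon> + 56 * pb + 48 * of_bool (bd \<delta>)"
      "(\<Sum>\<delta>\<in>Om n (k * i). (\<Prod>v<n. real (nv G v choose \<delta> v)) * of_bool (bd \<delta>)) \<le> pb * real ((k * (M - f)) choose (k * i))"
      by (rule main_good_T[OF h k ab an i L y \<epsilon> pb]) blast
    then have "P G bd" unfolding P_def tt_def CC_def K_def by blast
    then show ?thesis by blast
  qed
  then have "\<forall>G\<in>GD. \<exists>bd. P G bd" by blast
  from bchoice[OF this] obtain bd where Pb: "\<forall>G\<in>GD. P G (bd G)" by blast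
  have bd: "G \<in> GD \<Longrightarrow> \<delta> \<in> Om n (k * i) \<Longrightarrow> \<bar>tt G \<delta> - 1\<bar> \<le> 16 * \<epsilon> + 56 * pb + 48 * of_bool (bd G \<delta>)"
    "G \<in> GD \<Longrightarrow> (\<Sum>\<delta>\<in>Om n (k * i). (\<Prod>v<n. real (nv G v choose \<delta> v)) * of_bool (bd G \<delta>)) \<le> pb * CC" for G \<delta>
    using Pb unfolding P_def by blast+
  define ft where "ft G d v = d v - hdeg G v" for G and d :: "nat \<Rightarrow> nat" and v
  define \<beta> where "\<beta> d = (\<Sum>G\<in>GD. w G d * (48 * of_bool (bd G (ft G d))) / Z m i) + (\<Sum>G\<in>GB. w G d * (T G d i + 1) / Z m i)" for d
  have fin: "finite GD" "finite GB" by (auto simp: GD_def GB_def)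
  have split: "(\<Sum>G\<in>hg f. h G) = (\<Sum>G\<in>GD. h G) + (\<Sum>G\<in>GB. h G)" for h :: "nat set set \<Rightarrow> real"
  proof -
    have "hg f = GD \<union> GB" "GD \<inter> GB = {}" by (auto simp: GD_def GB_def)
    then show ?thesis using sum.union_disjoint[of GD GB h] fin by simp
  qed
  have hgG: "G \<in> hg f" if "G \<in> GD \<or> G \<in> GB" for G using that by (auto simp: GD_def GB_def)
  have cT0: "0 \<le> cT K i" unfolding cT_def by simp
  have T_tt: "T G d i = tt G (ft G d)" if "G \<in> hg f" for G d
    unfolding T_def tt_def ft_def xx_def by (simp add: hgD(2)[OF that] K_def)
  have T0: "0 \<le> T G d i" if "G \<in> hg f" for G d
    unfolding T_def using cT0 by (auto simp: hgD(2)[OF that] K_def[symmetric] xx_nonneg intro!: mult_nonneg_nonneg sum_nonneg prod_nonneg)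
  have \<epsilon>0: "0 \<le> 16 * \<epsilon> + 56 * pb"
  proof -
    have "0 \<le> \<epsilon>" using ab L y by (auto simp: \<epsilon>(1))
    moreover have "0 \<le> pb" by (simp add: pb(1))
    ultimately show ?thesis by linarith
  qed
  have ft: "ft G d \<in> Om n (k * i)" if G: "G \<in> hg f" and d: "d \<in> Om n (k * m)" and w: "w G d \<noteq> 0" for G d
  proof -
    have le: "hdeg G v \<le> d v" if "v < n" for v using w that by (auto simp: w_def split: if_splits)
    have "(\<Sum>v<n. d v - hdeg G v) = (\<Sum>v<n. d v) - (\<Sum>v<n. hdeg G v)" using le by (intro sum_subtractf_nat) auto
    also have "\<dots> = k * m - k * f" using d sum_hdeg[OF hgD(1)[OF G]] hgD(2)[OF G] by (simp add: Om_def)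
    finally have "(\<Sum>v<n. d v - hdeg G v) = k * i" using fK(3) by (simp add: diff_mult_distrib2[symmetric])
    then show ?thesis using d by (auto simp: Om_def ft_def)
  qed
  have step: "\<bar>p m (i - 1) d - p m i d\<bar> \<le> (16 * \<epsilon> + 56 * pb) * p m i d + \<beta> d" if d: "d \<in> Om n (k * m)" for d
  proof -
    have "p m i d = (\<Sum>G\<in>hg f. w G d / Z m i)" by (simp add: p_def f_def sum_divide_distrib)
    moreover have "p m (i - 1) d = (\<Sum>G\<in>hg f. w G d / Z m i * T G d i)" unfolding f_def by (rule p_rec[OF i1 m(1)])
    ultimately have e: "p m (i - 1) d - p m i d = (\<Sum>G\<in>hg f. w G d / Z m i * (T G d i - 1))"
      by (simp add: sum_subtractf right_diff_distrib)
    have "\<bar>p m (i - 1) d - p m i d\<bar> \<le> (\<Sum>G\<in>hg f. \<bar>w G d / Z m i * (T G d i - 1)\<bar>)" unfolding e by (rule sum_abs)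
    also have "\<dots> = (\<Sum>G\<in>GD. \<bar>w G d / Z m i * (T G d i - 1)\<bar>) + (\<Sum>G\<in>GB. \<bar>w G d / Z m i * (T G d i - 1)\<bar>)" by (rule split)
    also have "\<dots> \<le> (\<Sum>G\<in>GD. w G d / Z m i * (16 * \<epsilon> + 56 * pb) + w G d * (48 * of_bool (bd G (ft G d))) / Z m i)
        + (\<Sum>G\<in>GB. w G d * (T G d i + 1) / Z m i)"
    proof (intro add_mono sum_mono)
      fix G assume G: "G \<in> GD"
      have w0: "0 \<le> w G d / Z m i" using w_nonneg Z0 by simp
      show "\<bar>w G d / Z m i * (T G d i - 1)\<bar> \<le> w G d / Z m i * (16 * \<epsilon> + 56 * pb) + w G d * (48 * of_bool (bd G (ft G d))) / Z m i"
      proof (cases "w G d = 0")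
        case False
        have "\<bar>T G d i - 1\<bar> \<le> 16 * \<epsilon> + 56 * pb + 48 * of_bool (bd G (ft G d))"
          unfolding T_tt[OF hgG[of G, OF disjI1[OF G]]] by (rule bd(1)[OF G ft[OF hgG[of G, OF disjI1[OF G]] d False]])
        from mult_left_mono[OF this w0] show ?thesis unfolding abs_mult abs_of_nonneg[OF w0] by (simp add: distrib_left)
      qed simp
    next
      fix G assume G: "G \<in> GB"
      have w0: "0 \<le> w G d / Z m i" using w_nonneg Z0 by simp
      have "\<bar>T G d i - 1\<bar> \<le> T G d i + 1" using T0[OF hgG[of G, OF disjI2[OF G]], of d] by linarith
      from mult_left_mono[OF this w0] show "\<bar>w G d / Z m i * (T G d i - 1)\<bar> \<le> w G d * (T G d i + 1) / Z m i"
        unfolding abs_mult abs_of_nonneg[OF w0] by simp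
    qed
    also have "\<dots> = (\<Sum>G\<in>GD. w G d / Z m i) * (16 * \<epsilon> + 56 * pb) + \<beta> d"
      unfolding \<beta>_def sum.distrib sum_distrib_right by simp
    also have "(\<Sum>G\<in>GD. w G d / Z m i) * (16 * \<epsilon> + 56 * pb) \<le> p m i d * (16 * \<epsilon> + 56 * pb)"
    proof (rule mult_right_mono[OF _ \<epsilon>0])
      have "(\<Sum>G\<in>GD. w G d / Z m i) \<le> (\<Sum>G\<in>hg f. w G d / Z m i)"
        using w_nonneg Z0 by (intro sum_mono2) (auto simp: GD_def)
      then show "(\<Sum>G\<in>GD. w G d / Z m i) \<le> p m i d" by (simp add: p_def f_def sum_divide_distrib)
    qed
    finally show ?thesis by (simp add: mult.commute)
  qed
  have \<beta>0: "0 \<le> \<beta> d" for d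
  proof -
    have "0 \<le> (\<Sum>G\<in>GD. w G d * (48 * of_bool (bd G (ft G d))) / Z m i)"
      using w_nonneg Z0 by (intro sum_nonneg divide_nonneg_pos mult_nonneg_nonneg) auto
    moreover have "0 \<le> (\<Sum>G\<in>GB. w G d * (T G d i + 1) / Z m i)"
      using w_nonneg Z0 T0 hgG by (intro sum_nonneg divide_nonneg_pos mult_nonneg_nonneg) (auto intro: add_nonneg_nonneg)
    ultimately show ?thesis by (simp add: \<beta>_def)
  qed
  have s1: "(\<Sum>d\<in>Om n (k * m). w G d * (48 * of_bool (bd G (ft G d))) / Z m i) \<le> 48 * pb / real (M choose f)" if G: "G \<in> GD" for G
  proof -
    have ftd: "ft G (\<lambda>v. \<delta> v + hdeg G v) = \<delta>" for \<delta> by (rule ext) (simp add: ft_def)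
    have "(\<Sum>d\<in>Om n (k * m). w G d * of_bool (bd G (ft G d)))
      = (\<Sum>\<delta>\<in>Om n (k * i). (\<Prod>v<n. real (nv G v choose \<delta> v)) * of_bool (bd G \<delta>))"
      using sum_Om_w[OF hgG[of G, OF disjI1[OF G]] fK(4), of "\<lambda>d. of_bool (bd G (ft G d))"] unfolding ftd fK(3) .
    also have "\<dots> \<le> pb * CC" by (rule bd(2)[OF G])
    finally have h: "(\<Sum>d\<in>Om n (k * m). w G d * of_bool (bd G (ft G d))) \<le> pb * CC" .
    have "(\<Sum>d\<in>Om n (k * m). w G d * (48 * of_bool (bd G (ft G d))) / Z m i)
       = 48 / Z m i * (\<Sum>d\<in>Om n (k * m). w G d * of_bool (bd G (ft G d)))"
      unfolding sum_distrib_left by (intro sum.cong refl) simp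
    also have "\<dots> \<le> 48 / Z m i * (pb * CC)" using h Z0 by (intro mult_left_mono) auto
    also have "\<dots> = 48 * pb / real (M choose f)" unfolding Z using CC0 by simp
    finally show ?thesis .
  qed
  have s2: "(\<Sum>d\<in>Om n (k * m). w G d * (T G d i + 1) / Z m i) \<le> 2 / real (M choose f)" if "G \<in> GB" for G
  proof -
    have G: "G \<in> hg f" using hgG that by blast
    have G': "G \<in> hg (m - i)" using G by (simp add: f_def)
    have mm: "k * (M - (m - i)) = k * K" by (simp add: K_def f_def)
    have a: "(\<Sum>d\<in>Om n (k * m). w G d) \<le> CC"
      using moment_le[OF G' _ _ i1(2), of "{}", unfolded mm] by (simp add: CC_def)
    have "(\<Sum>d\<in>Om n (k * m). w G d * T G d i) = cT K i * (\<Sum>e\<in>Es - G. \<Sum>d\<in>Om n (k * m). w G d * (\<Prod>v\<in>e. xx G d v))"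
      unfolding sum.swap[of _ "Om n (k * m)" "Es - G"] T_def hgD(2)[OF G] K_def[symmetric]
      by (simp add: sum_distrib_left mult_ac)
    also have "\<dots> \<le> cT K i * (\<Sum>e\<in>Es - G. real ((k * K - k) choose (k * i - k)))"
    proof (intro mult_left_mono sum_mono cT0)
      fix e assume "e \<in> Es - G"
      then have e: "e \<subseteq> {..<n}" "card e = k" using EsD by auto
      have "k \<le> k * i" using i1 by simp
      then show "(\<Sum>d\<in>Om n (k * m). w G d * (\<Prod>v\<in>e. xx G d v)) \<le> real ((k * K - k) choose (k * i - k))"
        using moment_le[OF G' e(1) _ i1(2), unfolded mm] e(2) by simp
    qed
    also have "\<dots> = cT K i * (real K * real ((k * K - k) choose (k * i - k)))"
    proof -
      have "card (Es - G) = K" using card_Es hgD[OF G] by (simp add: card_Diff_subset K_def)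
      then show ?thesis by simp
    qed
    also have "\<dots> = CC" using K0 Ck0 unfolding cT_def CC_def by simp
    finally have b: "(\<Sum>d\<in>Om n (k * m). w G d * T G d i) \<le> CC" .
    have "(\<Sum>d\<in>Om n (k * m). w G d * (T G d i + 1) / Z m i) = ((\<Sum>d\<in>Om n (k * m). w G d * T G d i) + (\<Sum>d\<in>Om n (k * m). w G d)) / Z m i"
      by (simp add: sum_divide_distrib[symmetric] sum.distrib distrib_left)
    also have "\<dots> \<le> (CC + CC) / Z m i" using a b Z0 by (intro divide_right_mono add_mono) auto
    also have "\<dots> = 2 / real (M choose f)" unfolding Z using CC0 by simp
    finally show ?thesis .
  qed
  have "(\<Sum>d\<in>Om n (k * m). \<beta> d) = (\<Sum>G\<in>GD. \<Sum>d\<in>Om n (k * m). w G d * (48 * of_bool (bd G (ft G d))) / Z m i)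
      + (\<Sum>G\<in>GB. \<Sum>d\<in>Om n (k * m). w G d * (T G d i + 1) / Z m i)"
    unfolding \<beta>_def sum.distrib by (intro arg_cong2[where f = "(+)"] sum.swap)
  also have "\<dots> \<le> (\<Sum>G\<in>GD. 48 * pb / real (M choose f)) + (\<Sum>G\<in>GB. 2 / real (M choose f))"
    by (intro add_mono sum_mono s1 s2)
  also have "\<dots> = real (card GD) / real (M choose f) * (48 * pb) + 2 * (real (card GB) / real (M choose f))" by simp
  also have "\<dots> \<le> 1 * (48 * pb) + 2 * q"
  proof (intro add_mono mult_right_mono mult_left_mono)
    have "card GD \<le> M choose f" unfolding card_hg[symmetric] by (intro card_mono) (auto simp: GD_def)
    then show "real (card GD) / real (M choose f) \<le> 1" using cf by simp
    show "real (card GB) / real (M choose f) \<le> q" using q unfolding GB_def mg_def f_def .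
  qed (simp_all add: pb(1))
  finally have "(\<Sum>d\<in>Om n (k * m). \<beta> d) \<le> 48 * pb + 2 * q" by simp
  then show ?thesis using \<beta>0 step by blast
qed


lemma size_lower: assumes "8 * real k ^ 2 \<le> real n"
  shows "n \<le> M" "n - 2 \<le> N2" "(n - 1) choose 2 \<le> N" "(n - 2) choose 2 \<le> N1" "n \<le> N" "72 \<le> n"
proof -
  have "8 * k ^ 2 \<le> n" using assms by (metis of_nat_le_iff of_nat_mult of_nat_numeral of_nat_power)
  moreover have "3 * k \<le> k ^ 2" using k3 by (simp add: power2_eq_square)
  ultimately have k8: "24 * k \<le> n" by linarith
  then show n72: "72 \<le> n" using k3 by linarith
  have "n choose 1 \<le> n choose k" by (rule binomial_mono) (use k8 k3 in linarith)+
  then show "n \<le> M" by (simp add: M_def)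
  have "(n - 2) choose 1 \<le> (n - 2) choose (k - 2)" by (rule binomial_mono) (use k8 k3 in linarith)+
  then show "n - 2 \<le> N2" by (simp add: N2_def)
  show N: "(n - 1) choose 2 \<le> N" unfolding N_def by (rule binomial_mono) (use k8 k3 in linarith)+
  show "(n - 2) choose 2 \<le> N1" unfolding N1_def by (rule binomial_mono) (use k8 k3 in linarith)+
  obtain j where j: "n = Suc (Suc (Suc j))" using that[of "n - 3"] n72 by auto
  have "(n - 1) choose 2 = (Suc (Suc j) * Suc j) div 2" by (simp add: choose_two j)
  moreover have "2 * n \<le> Suc (Suc j) * Suc j"
  proof -
    have "Suc (Suc j) * 4 \<le> Suc (Suc j) * Suc j" using j n72 by (intro mult_le_mono2) linarith
    then show ?thesis using j by simp
  qed
  then have "n \<le> (Suc (Suc j) * Suc j) div 2" by linarith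
  ultimately show "n \<le> N" using N by linarith
qed

lemma codeg_near:
  assumes \<mu>: "0 \<le> \<mu>" "\<mu> \<le> 1" and a: "0 \<le> a" and h: "\<bar>c - \<mu> * real (n - k + 1)\<bar> \<le> a * real (n - k + 1)"
  shows "\<bar>c - \<mu> * real n\<bar> \<le> a * real n + real k"
proof -
  define r where "r = real (n - k + 1)"
  have e: "r = real n - (real k - 1)" using kn by (simp add: r_def)
  have 1: "a * r \<le> a * real n" using a k3 unfolding e by (intro mult_left_mono) auto
  have 2: "0 \<le> \<mu> * (real k - 1)" "\<mu> * (real k - 1) \<le> 1 * (real k - 1)" using \<mu> k3 by (auto intro!: mult_right_mono)
  have 3: "\<mu> * r = \<mu> * real n - \<mu> * (real k - 1)" unfolding e by (simp add: right_diff_distrib)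
  define t where "t = \<mu> * (real k - 1)"
  have 4: "0 \<le> t" "t \<le> real k" using 2 by (auto simp: t_def)
  have "\<bar>c - (\<mu> * real n - t)\<bar> \<le> a * r" using h[folded r_def] unfolding 3 t_def .
  then show ?thesis using 1 4 unfolding abs_le_iff by linarith
qed

text \<open>For mean degree below \<open>L\<close> all corrections are of order
  \<open>k * L\<^sup>2\<close>, which the hypothesis on \<open>18 * L\<^sup>2\<close> compares with
  \<open>k * f\<close>. For larger mean degree \<open>\<Delta>\<close> is at most three times the
  mean, and \<open>10 * k \<le> a * n\<close> absorbs the lower-order terms.\<close>

lemma end_good_val:
  assumes G: "G \<in> hg f" and mg: "main_good (real f / real M) b a G" and eg: "end_good (real f / real M) a L G"
    and f: "f \<le> M" and k: "8 * real k ^ 2 \<le> real n" "10 * real k \<le> a * real n" and ab: "0 < b" "5 * b \<le> a" "a \<le> 1"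
    and L: "1 \<le> L" "real f / real M * real N < L \<Longrightarrow> 18 * L\<^sup>2 \<le> a * real f"
    and v: "v < n" and B: "finite B" "card B \<le> k" "B \<subseteq> {..<n}"
  shows "\<bar>real (val G v B) - (1 - real f / real M) * (real k * real f)\<bar> \<le> 20 * a * (real k * real f)"
    and "B \<in> Bs \<Longrightarrow> v \<notin> B \<Longrightarrow> \<bar>real (cnt G v B) - real f / real M * (1 - real f / real M) * (real k * real f)\<bar> \<le> 20 * a * (real k * real f)"
proof -
  define \<mu> where "\<mu> = real f / real M"
  define kf where "kf = real k * real f"
  define \<Delta> where "\<Delta> = 2 * \<mu> * real N + L"
  note GE = hgD(1)[OF G]
  note sl = size_lower[OF k(1)]
  have n0: "0 < real n" and k0: "3 \<le> real k" using k3 kn by auto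
  have a0: "0 < a" using ab by linarith
  have M0: "0 < real M" using sl by linarith
  have mu: "0 \<le> \<mu>" "\<mu> \<le> 1" using f M0 by (auto simp: \<mu>_def)
  have kfe: "real k * real f = real n * (\<mu> * real N)"
  proof -
    have "real n * (\<mu> * real N) = \<mu> * (real n * real N)" by simp
    also have "\<dots> = real k * real f" unfolding nN_real \<mu>_def using M0 by simp
    finally show ?thesis by simp
  qed
  have kf0: "0 \<le> kf" by (simp add: kf_def)
  have nN': "real n \<le> real N" using sl by simp
  have D: "real (hdeg G u) \<le> \<Delta>" if "u < n" for u using eg that unfolding end_good_def \<mu>_def \<Delta>_def by blast
  have D0: "0 \<le> \<Delta>" using D[OF v] by linarith
  have e3: "\<bar>real (hdeg G u) - \<mu> * real N\<bar> \<le> b * real N" if "u < n" for u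
    using mg that unfolding main_good_def \<mu>_def by blast
  have e2: "\<bar>real (codeg G B) - \<mu> * real n\<bar> \<le> a * real n + real k" if "B \<in> Bs" for B
    using eg that a0 unfolding end_good_def \<mu>_def[symmetric] by (intro codeg_near mu) auto
  have cdeg: "real (codeg G B) \<le> \<Delta>" if B: "B \<in> Bs" for B
  proof -
    have "B \<noteq> {}" using BsD[OF B] k3 by auto
    then obtain z where z: "z \<in> B" by blast
    then have "z < n" using BsD[OF B] by auto
    then show ?thesis using D codeg_le_hdeg[OF GE z] by (meson of_nat_le_iff order_trans)
  qed
  have \<mu>N: "0 \<le> \<mu> * real N" using mu by simp
  have err3: "\<mu> * real n * (b * real N) = b * kf" unfolding kf_def kfe by simp
  have bk: "b * kf \<le> a / 5 * kf" using ab kf0 by (intro mult_right_mono) auto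
  show "\<bar>real (val G v B) - (1 - real f / real M) * (real k * real f)\<bar> \<le> 20 * a * (real k * real f)"
  proof (cases "\<mu> * real N < L")
    case True
    have \<Delta>3: "\<Delta> \<le> 3 * L" unfolding \<Delta>_def using True by linarith
    have e2': "\<bar>real (codeg G B) - \<mu> * real n\<bar> \<le> 3 * L" if "B \<in> Bs" for B
    proof -
      have "\<mu> * real n \<le> \<mu> * real N" using mu nN' by (intro mult_left_mono) auto
      moreover have "0 \<le> \<mu> * real n" using mu by simp
      ultimately show ?thesis using cdeg[OF that] \<Delta>3 True by linarith
    qed
    have "\<bar>real (val G v B) - (1 - \<mu>) * (real k * real f)\<bar> \<le> 2 * real k * \<Delta> + \<Delta> * (3 * L + 1) + \<mu> * real n * (b * real N)"
      by (rule val_bound[OF G v B mu(1) kfe D e3[OF v] e2'])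
    also have "\<dots> \<le> 2 * real k * (3 * L) + (3 * L) * (3 * L + 1) + a / 5 * kf"
    proof -
      have "2 * real k * \<Delta> \<le> 2 * real k * (3 * L)" using \<Delta>3 by (intro mult_left_mono) auto
      moreover have "\<Delta> * (3 * L + 1) \<le> (3 * L) * (3 * L + 1)" using \<Delta>3 L by (intro mult_right_mono) auto
      ultimately show ?thesis unfolding err3 using bk by linarith
    qed
    also have "\<dots> \<le> real k * (18 * L\<^sup>2) + a / 5 * kf"
    proof -
      have "1 * L \<le> L * L" using L by (intro mult_right_mono) auto
      then have L2: "L \<le> L\<^sup>2" by (simp add: power2_eq_square)
      have "real k * L \<le> real k * L\<^sup>2" using L2 by (intro mult_left_mono) auto
      moreover have "3 * L\<^sup>2 \<le> real k * L\<^sup>2" using k0 by (intro mult_right_mono) auto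
      moreover have "2 * real k * (3 * L) + 3 * L * (3 * L + 1) + a / 5 * kf = 6 * (real k * L) + 9 * L\<^sup>2 + 3 * L + a / 5 * kf"
        by (simp add: algebra_simps power2_eq_square)
      moreover have "0 \<le> L\<^sup>2" by simp
      ultimately show ?thesis using L2 by linarith
    qed
    also have "\<dots> \<le> real k * (a * real f) + a / 5 * kf"
      using L(2) True unfolding \<mu>_def by (intro add_right_mono mult_left_mono) auto
    also have "\<dots> = 6 / 5 * (a * kf)" by (simp add: kf_def)
    also have "\<dots> \<le> 20 * (a * kf)" using a0 kf0 by (intro mult_right_mono) auto
    finally show ?thesis by (simp add: \<mu>_def kf_def mult_ac)
  next
    case False
    have \<Delta>3: "\<Delta> \<le> 3 * (\<mu> * real N)" unfolding \<Delta>_def using False by linarith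
    have "\<bar>real (val G v B) - (1 - \<mu>) * (real k * real f)\<bar> \<le> 2 * real k * \<Delta> + \<Delta> * (a * real n + real k + 1) + \<mu> * real n * (b * real N)"
      by (rule val_bound[OF G v B mu(1) kfe D e3[OF v] e2])
    also have "\<dots> = \<Delta> * (a * real n + 3 * real k + 1) + b * kf" unfolding err3 by (simp add: algebra_simps)
    also have "\<dots> \<le> (3 * (\<mu> * real N)) * (2 * (a * real n)) + a / 5 * kf"
    proof -
      have "a * real n + 3 * real k + 1 \<le> 2 * (a * real n)" using k(2) k0 by linarith
      then have "\<Delta> * (a * real n + 3 * real k + 1) \<le> (3 * (\<mu> * real N)) * (2 * (a * real n))"
        using \<Delta>3 \<mu>N a0 k0 by (intro mult_mono) auto
      then show ?thesis using bk by linarith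
    qed
    also have "\<dots> = 31 / 5 * (a * kf)" unfolding kf_def kfe by simp
    also have "\<dots> \<le> 20 * (a * kf)" using a0 kf0 by (intro mult_right_mono) auto
    finally show ?thesis by (simp add: \<mu>_def kf_def mult_ac)
  qed
  show "\<bar>real (cnt G v B) - real f / real M * (1 - real f / real M) * (real k * real f)\<bar> \<le> 20 * a * (real k * real f)" if B: "B \<in> Bs" and vB: "v \<notin> B"
  \<comment> \<open>For density below \<open>a\<close>, both \<open>cnt\<close> and its predicted
    value are at most \<open>20 * a * (k * f)\<close>, so their difference is too.\<close>
  proof (cases "a \<le> \<mu>")
    case True
    have aN: "10 * real k \<le> a * real N" using k(2) mult_left_mono[OF nN', of a] a0 by linarith
    have N2N: "real N2 \<le> a / 10 * real N"
    proof -
      have n1: "1 < real n" using kn k3 by simp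
      have "real n * ((real n - 1) * real N2) = real n * ((real k - 1) * real N)"
        using N2_real nN_real by (simp add: mult_ac)
      then have e: "(real n - 1) * real N2 = (real k - 1) * real N" using n0 by simp
      have "real k - 1 \<le> a / 10 * (real n - 1)" using k(2) ab a0 by (simp add: algebra_simps)
      then have "(real k - 1) * real N \<le> (a / 10 * (real n - 1)) * real N" by (intro mult_right_mono) auto
      then have "(real n - 1) * real N2 \<le> (real n - 1) * (a / 10 * real N)" unfolding e by (simp add: mult_ac)
      then show ?thesis using n1 by simp
    qed
    define e4 where "e4 = 21 / 10 * a * real N"
    define q2 where "q2 = a / 5 * real N"
    have mu2: "\<mu>\<^sup>2 \<le> 1" using mu by (simp add: power_le_one)
    have he4: "\<bar>real (colink G u v) - \<mu>\<^sup>2 * real N\<bar> \<le> e4" if u: "u < n" "u \<noteq> v" for u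
    proof -
      have 1: "\<bar>real (colink G u v) - \<mu>\<^sup>2 * real N1\<bar> \<le> 2 * a * real N1" using eg u v unfolding end_good_def \<mu>_def by blast
      have 2: "real N = real N1 + real N2" using N_split by simp
      have "2 * a * real N1 \<le> 2 * a * real N" unfolding 2 using a0 by (intro mult_left_mono) auto
      moreover have "0 \<le> \<mu>\<^sup>2 * real N2" "\<mu>\<^sup>2 * real N2 \<le> 1 * real N2" using mult_right_mono[OF mu2, of "real N2"] by auto
      moreover have "\<mu>\<^sup>2 * real N = \<mu>\<^sup>2 * real N1 + \<mu>\<^sup>2 * real N2" unfolding 2 by (rule distrib_left)
      ultimately show ?thesis using 1 N2N unfolding e4_def by linarith
    qed
    have hq2: "real (codeg G {u, v}) \<le> q2" if u: "u < n" "u \<noteq> v" for u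
    proof -
      have 1: "\<bar>real (codeg G {u, v}) - \<mu> * real N2\<bar> \<le> a * real N2" using mg u v unfolding main_good_def \<mu>_def by blast
      have "\<mu> * real N2 \<le> 1 * real N2" "a * real N2 \<le> 1 * real N2" using mult_right_mono[OF mu(2), of "real N2"] mult_right_mono[OF ab(3), of "real N2"] by auto
      then show ?thesis using 1 N2N unfolding q2_def by linarith
    qed
    have "\<bar>real (cnt G v B) - \<mu> * (1 - \<mu>) * (real k * real f)\<bar>
      \<le> (a * real n + real k + 1) * (\<mu> * real N) + (\<mu> * real n + (a * real n + real k)) * (b * real N + e4 + q2 + 1)"
      by (rule cnt_bound[OF G v B vB mu kfe e3 e2[OF B] he4 hq2]) (use a0 in \<open>auto simp: q2_def e4_def\<close>)
    also have "\<dots> \<le> (6 / 5 * (a * real n)) * (\<mu> * real N) + (\<mu> * real n + 6 / 5 * (\<mu> * real n)) * (3 * (a * real N))"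
    proof (intro add_mono mult_mono)
      show "a * real n + real k + 1 \<le> 6 / 5 * (a * real n)" using k(2) k0 by linarith
      show "a * real n + real k \<le> 6 / 5 * (\<mu> * real n)" using k(2) k0 mult_right_mono[OF True, of "real n"] by linarith
      have "b * real N \<le> a / 5 * real N" using ab by (intro mult_right_mono) auto
      moreover have "1 \<le> a / 10 * real N" using aN k0 by linarith
      ultimately show "b * real N + e4 + q2 + 1 \<le> 3 * (a * real N)" unfolding e4_def q2_def by (simp add: algebra_simps)
    qed (use mu a0 ab in \<open>auto simp: e4_def q2_def\<close>)
    also have "\<dots> = 39 / 5 * (a * kf)" unfolding kf_def kfe by (simp add: algebra_simps)
    also have "\<dots> \<le> 20 * (a * kf)" using a0 kf0 by (intro mult_right_mono) auto
    finally show ?thesis by (simp add: \<mu>_def kf_def mult_ac)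
  next
    case False
    have c0: "real (cnt G v B) \<le> real (codeg G B) * \<Delta>" by (rule cnt_upper[OF GE v B D D0])
    have "real (codeg G B) * \<Delta> \<le> 20 * (a * kf)"
    proof (cases "\<mu> * real N < L")
      case True
      have \<Delta>3: "\<Delta> \<le> 3 * L" unfolding \<Delta>_def using True by linarith
      have "real (codeg G B) * \<Delta> \<le> (3 * L) * (3 * L)" using cdeg[OF B] \<Delta>3 D0 L by (intro mult_mono) auto
      also have "\<dots> \<le> 18 * L\<^sup>2" by (simp add: power2_eq_square)
      also have "\<dots> \<le> a * real f" using L(2) True unfolding \<mu>_def by blast
      also have "\<dots> \<le> 20 * (a * kf)"
      proof -
        have "1 * (a * real f) \<le> (20 * real k) * (a * real f)" using k0 a0 by (intro mult_right_mono) auto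
        then show ?thesis by (simp add: kf_def mult_ac)
      qed
      finally show ?thesis .
    next
      case False2: False
      have \<Delta>3: "\<Delta> \<le> 3 * (\<mu> * real N)" unfolding \<Delta>_def using False2 by linarith
      have "\<mu> * real n \<le> a * real n" using False by (intro mult_right_mono) auto
      then have "real (codeg G B) \<le> 3 * (a * real n)" using e2[OF B] k(2) k0 by linarith
      then have "real (codeg G B) * \<Delta> \<le> (3 * (a * real n)) * (3 * (\<mu> * real N))" using \<Delta>3 D0 a0 by (intro mult_mono) auto
      also have "\<dots> = 9 * (a * kf)" unfolding kf_def kfe by simp
      also have "\<dots> \<le> 20 * (a * kf)" using a0 kf0 by (intro mult_right_mono) auto
      finally show ?thesis .
    qed
    then have 1: "real (cnt G v B) \<le> 20 * (a * kf)" using c0 by linarith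
    have "\<mu> * (1 - \<mu>) \<le> 20 * a"
    proof -
      have "\<mu> * (1 - \<mu>) \<le> \<mu> * 1" using mu by (intro mult_left_mono) auto
      then show ?thesis using False a0 by linarith
    qed
    then have 2: "\<mu> * (1 - \<mu>) * kf \<le> 20 * a * kf" using kf0 by (intro mult_right_mono) auto
    have 3: "0 \<le> \<mu> * (1 - \<mu>) * kf" using mu kf0 by simp
    have "\<bar>real (cnt G v B) - \<mu> * (1 - \<mu>) * kf\<bar> \<le> 20 * a * kf" using 1 2 3 by (simp only: abs_le_iff mult.assoc) linarith
    then show ?thesis by (simp add: \<mu>_def kf_def)
  qed
qed


text \<open>In the error, \<open>480 * a\<close> is \<open>24 * (20 * a)\<close> from the exchange
  counts. The slot numbers and falling factorials give \<open>9 * k * b\<close> and half of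
  \<open>12 * k\<^sup>2 / n\<close>; collisions give the other half and the term with
  \<open>L\<close>.\<close>

lemma end_step_ex:
  assumes im: "1 \<le> i" "i < m" "m \<le> M" and mu3: "3 * (m - i) \<le> M"
    and k: "8 * real k * b \<le> 1" "8 * real k ^ 2 \<le> real n" "10 * real k \<le> a * real n"
    and ab: "0 < b" "b \<le> 1" "5 * b \<le> a" "120 * a \<le> 1"
    and L: "1 \<le> L" "real (m - i) / real M * real N < L \<Longrightarrow> 18 * L\<^sup>2 \<le> a * real (m - i)"
    and q: "real (card {G\<in>hg (m - i). \<not> main_good (real (m - i) / real M) b a G}) / real (M choose (m - i)) \<le> q1"
      "real (card {G\<in>hg (m - i). \<not> end_good (real (m - i) / real M) a L G}) / real (M choose (m - i)) \<le> q2"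
  shows "\<exists>\<beta>. (\<forall>d. 0 \<le> \<beta> d) \<and> (\<Sum>d\<in>Om n (k * m). \<beta> d) \<le> 6 * real k * (q1 + q2) \<and>
    (\<forall>d\<in>Om n (k * m). \<bar>p m (i - 1) d - p m i d\<bar>
      \<le> (480 * a + 9 * real k * b + 12 * real k ^ 2 / real n + 3 * real k * L / real (m - i)) * p m i d + \<beta> d)"
proof -
  define f K where "f = m - i" and "K = M - f"
  define \<mu> where "\<mu> = real f / real M"
  define Nb where "Nb = real k * real K / real n"
  define GD where "GD = {G\<in>hg f. main_good \<mu> b a G \<and> end_good \<mu> a L G}"
  define \<xi> where "\<xi> = 3 / 2 * b"
  define \<rho>1 where "\<rho>1 = 3 * real k * b + 2 * real k ^ 2 / real n"
  define \<Delta> where "\<Delta> = 2 * \<mu> * real N + L"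
  note sl = size_lower[OF k(2)]
  have n0: "0 < real n" and k0: "3 \<le> real k" using k3 kn by auto
  have a0: "0 < a" and a1: "a \<le> 1" using ab by linarith+
  have M0: "0 < real M" using sl by linarith
  have fM: "f \<le> M" "3 * f \<le> M" and f0: "0 < real f" using im mu3 by (auto simp: f_def)
  have f3: "3 * real f \<le> real M" using fM(2) by (metis of_nat_le_iff of_nat_mult of_nat_numeral)
  have KM: "real K = real M - real f" unfolding K_def using fM by simp
  have K2: "2 * real M \<le> 3 * real K" using KM f3 by linarith
  have K0: "0 < real K" using K2 M0 by linarith
  have mu: "0 \<le> \<mu>" "\<mu> \<le> 1/3" "1 - \<mu> = real K / real M" using f3 M0 KM by (auto simp: \<mu>_def field_simps)
  have N: "real N = real k * real M / real n" using nN_real n0 by (simp add: field_simps)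
  have Nb0: "0 < Nb" using k0 K0 n0 by (simp add: Nb_def)
  have NbN: "Nb = (1 - \<mu>) * real N" unfolding Nb_def N mu(3) using M0 by simp
  have N15: "real N \<le> 3 / 2 * Nb" unfolding N Nb_def using K2 k0 n0 by (simp add: field_simps)
  have kxi: "real k * \<xi> \<le> 3 / 16" using k(1) unfolding \<xi>_def by (simp add: mult_ac)
  have xi: "0 \<le> \<xi>" "\<xi> \<le> 1 / 8"
  proof -
    show x0: "0 \<le> \<xi>" using ab by (simp add: \<xi>_def)
    have "3 * \<xi> \<le> real k * \<xi>" using k0 x0 by (intro mult_right_mono) auto
    then show "\<xi> \<le> 1 / 8" using kxi by linarith
  qed
  have kn2: "real k ^ 2 / real n \<le> 1 / 8" using k(2) n0 by (simp add: field_simps)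
  have rho1: "2 * (real k * \<xi>) \<le> \<rho>1" "2 * (real k ^ 2 / real n) \<le> \<rho>1" "0 \<le> \<rho>1" "\<rho>1 \<le> 1"
  proof -
    have "\<rho>1 = 2 * (real k * \<xi>) + 2 * (real k ^ 2 / real n)" by (simp add: \<rho>1_def \<xi>_def)
    moreover have "0 \<le> real k * \<xi>" "0 \<le> real k ^ 2 / real n" using xi by auto
    ultimately show "2 * (real k * \<xi>) \<le> \<rho>1" "2 * (real k ^ 2 / real n) \<le> \<rho>1" "0 \<le> \<rho>1" "\<rho>1 \<le> 1"
      using kxi kn2 by linarith+
  qed
  have nvx: "\<bar>real (nv G v) - Nb\<bar> \<le> \<xi> * Nb" if G: "G \<in> GD" and v: "v < n" for G v
  proof -
    have GE: "G \<subseteq> Es" using G by (auto simp: GD_def dest: hgD(1))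
    have "\<bar>real (hdeg G v) - \<mu> * real N\<bar> \<le> b * real N" using G v unfolding GD_def main_good_def by blast
    moreover have "real (nv G v) = real N - real (hdeg G v)" using hdeg_le[OF GE v] by (simp add: nv_def)
    ultimately have "\<bar>real (nv G v) - Nb\<bar> \<le> b * real N" unfolding NbN by (simp add: algebra_simps abs_le_iff)
    moreover have "b * real N \<le> b * (3 / 2 * Nb)" using N15 ab by (intro mult_left_mono) auto
    ultimately show ?thesis by (simp add: \<xi>_def)
  qed
  have vb: "\<bar>real (val G v B) - (1 - \<mu>) * (real k * real f)\<bar> \<le> 20 * a * (real k * real f)"
    if "G \<in> GD" "v < n" "finite B" "card B \<le> k" "B \<subseteq> {..<n}" for G v B
    using end_good_val(1)[of G f b a L v B, folded \<mu>_def] that fM k ab a1 L by (auto simp: GD_def \<mu>_def f_def)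
  have cb: "\<bar>real (cnt G v B) - \<mu> * (1 - \<mu>) * (real k * real f)\<bar> \<le> 20 * a * (real k * real f)"
    if "G \<in> GD" "v < n" "B \<in> Bs" "v \<notin> B" for G v B
    using end_good_val(2)[of G f b a L v B, folded \<mu>_def] that fM k ab a1 L BsD[OF that(3)] by (auto simp: GD_def \<mu>_def f_def)
  have "end_phase n k m i (20 * a) \<rho>1 \<xi> \<Delta> GD"
  proof unfold_locales
    show "1 \<le> i" "i < m" "m \<le> M" "3 * (m - i) \<le> M" using im mu3 by auto
    show "0 \<le> 20 * a" "20 * a \<le> 1 / 6" using a0 ab by auto
    show "0 \<le> \<rho>1" "\<rho>1 \<le> 1" "0 \<le> \<xi>" "\<xi> \<le> 1 / 8" by (fact rho1 xi)+
    show "0 \<le> \<Delta>" unfolding \<Delta>_def using mu L by simp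
    show "GD \<subseteq> hg (m - i)" by (auto simp: GD_def f_def)
    show "(1 - real (m - i) / real M - 20 * a) * (real k * real (m - i)) \<le> real (val G v B) \<and>
      real (val G v B) \<le> (1 - real (m - i) / real M + 20 * a) * (real k * real (m - i))"
      if "G \<in> GD" "v < n" "B \<in> Bs" "v \<notin> B" for G v B
    proof -
      have "\<bar>real (val G v B) - (1 - \<mu>) * (real k * real f)\<bar> \<le> 20 * a * (real k * real f)"
        using that BsD[OF that(3)] by (intro vb) auto
      then have "(1 - \<mu>) * (real k * real f) - 20 * a * (real k * real f) \<le> real (val G v B)"
        "real (val G v B) \<le> (1 - \<mu>) * (real k * real f) + 20 * a * (real k * real f)" by linarith+
      then show ?thesis unfolding f_def[symmetric] \<mu>_def[symmetric] by (simp only: left_diff_distrib distrib_right)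
    qed
    show "(real (m - i) / real M * (1 - real (m - i) / real M) - 20 * a) * (real k * real (m - i)) \<le> real (cnt G v B) \<and>
      real (cnt G v B) \<le> (real (m - i) / real M * (1 - real (m - i) / real M) + 20 * a) * (real k * real (m - i))"
      if "G \<in> GD" "v < n" "B \<in> Bs" "v \<notin> B" for G v B
    proof -
      define z where "z = \<mu> * (1 - \<mu>)"
      have "\<bar>real (cnt G v B) - z * (real k * real f)\<bar> \<le> 20 * a * (real k * real f)"
        unfolding z_def by (rule cb[OF that])
      then have "z * (real k * real f) - 20 * a * (real k * real f) \<le> real (cnt G v B)"
        "real (cnt G v B) \<le> z * (real k * real f) + 20 * a * (real k * real f)" by linarith+
      then show ?thesis unfolding f_def[symmetric] \<mu>_def[symmetric] z_def[symmetric] by (simp only: left_diff_distrib distrib_right)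
    qed
    show "real k * real (m - i) / 2 \<le> real (val G v {})" if "G \<in> GD" "v < n" for G v
    proof -
      have "\<bar>real (val G v {}) - (1 - \<mu>) * (real k * real f)\<bar> \<le> 20 * a * (real k * real f)"
        using that by (intro vb) auto
      then have "(1 - \<mu> - 20 * a) * (real k * real f) \<le> real (val G v {})" unfolding left_diff_distrib by linarith
      moreover have "1 / 2 * (real k * real f) \<le> (1 - \<mu> - 20 * a) * (real k * real f)"
        using mu ab by (intro mult_right_mono) auto
      ultimately show ?thesis by (simp add: f_def)
    qed
    show "real (hdeg G v) \<le> \<Delta>" if "G \<in> GD" "v < n" for G v
      using that unfolding GD_def end_good_def \<Delta>_def by blast
    show "2 \<le> nv G v \<and> (1 - \<xi>) * (real k * real (M - (m - i)) / real n) \<le> real (nv G v) \<and>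
      real (nv G v) \<le> (1 + \<xi>) * (real k * real (M - (m - i)) / real n)" if "G \<in> GD" "v < n" for G v
    proof -
      have 1: "(1 - \<xi>) * Nb \<le> real (nv G v)" "real (nv G v) \<le> (1 + \<xi>) * Nb"
        using nvx[OF that] unfolding left_diff_distrib distrib_right by linarith+
      have "7 / 8 * Nb \<le> (1 - \<xi>) * Nb" using xi Nb0 by (intro mult_right_mono) auto
      moreover have "72 \<le> real N" using sl by linarith
      ultimately have "2 \<le> real (nv G v)" using 1 N15 by linarith
      then show ?thesis using 1 unfolding Nb_def K_def f_def by linarith
    qed
    show "1 \<le> (1 + \<rho>1) * (1 - \<xi>) ^ k"
    proof -
      define t where "t = real k * \<xi>"
      have t: "0 \<le> t" "t \<le> 3 / 16" using xi kxi by (auto simp: t_def)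
      have "1 + real k * (- \<xi>) \<le> (1 + - \<xi>) ^ k" using xi by (intro Bernoulli_inequality) auto
      then have "1 - t \<le> (1 - \<xi>) ^ k" by (simp add: t_def)
      then have "(1 + 2 * t) * (1 - t) \<le> (1 + \<rho>1) * (1 - \<xi>) ^ k"
        using rho1 t by (intro mult_mono) (auto simp: t_def)
      moreover have "t * t \<le> 3 / 16 * t" using t by (intro mult_right_mono) auto
      ultimately show ?thesis using t by (simp add: algebra_simps)
    qed
    show "(1 - \<rho>1) * (1 + \<xi>) ^ k \<le> 1"
    proof -
      have "(1 - \<rho>1) * (1 + \<xi>) ^ k \<le> exp (- \<rho>1) * exp \<xi> ^ k"
        using rho1 xi exp_ge_add_one_self[of "- \<rho>1"] exp_ge_add_one_self[of \<xi>] by (intro mult_mono power_mono) auto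
      also have "\<dots> = exp (real k * \<xi> - \<rho>1)" by (simp add: exp_of_nat_mult[symmetric] exp_add[symmetric])
      also have "\<dots> \<le> 1"
      proof -
        have "0 \<le> real k * \<xi>" using xi by simp
        then show ?thesis using rho1 by simp
      qed
      finally show ?thesis .
    qed
    \<comment> \<open>Splits into \<open>u\<close>, which replaces the falling factorial of
      \<open>k * K\<close> by a power, and \<open>w'\<close>, which replaces
      \<open>M * fact k\<close> by \<open>n ^ k\<close>.\<close>
    define X where "X = (1 - real (m - i) / real M) * (real ((k * (M - (m - i))) choose k) / (real (M - (m - i)) * (real k * real (M - (m - i)) / real n) ^ k))"
    define A where "A = k * K"
    have kA: "k \<le> A" "0 < A" using K0 k3 by (auto simp: A_def)
    have An: "real A = real k * real K" by (simp add: A_def)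
    have fb: "real (A choose k) * fact k \<le> real A ^ k" "real A ^ k * (1 - real k ^ 2 / real A) \<le> real (A choose k) * fact k"
      by (rule falling_bounds[OF kA])+
    have fn: "real M * fact k \<le> real n ^ k" "real n ^ k * (1 - real k ^ 2 / real n) \<le> real M * fact k"
      unfolding M_def by (rule falling_bounds; use kn in simp)+
    have Ak: "0 < real A ^ k" and nk: "0 < real n ^ k" using kA n0 by auto
    define u where "u = real (A choose k) * fact k / real A ^ k"
    define w' where "w' = real n ^ k / (real M * fact k)"
    have X: "X = u * w'"
    proof -
      have "X = real K / real M * (real (A choose k) / (real K * (real A / real n) ^ k))"
        unfolding X_def f_def[symmetric] \<mu>_def[symmetric] K_def[symmetric] mu(3) An A_def[symmetric] by simp
      also have "\<dots> = u * w'" unfolding u_def w'_def power_divide using K0 M0 Ak nk by (simp add: field_simps)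
      finally show ?thesis .
    qed
    have u: "1 - real k ^ 2 / real A \<le> u" "u \<le> 1" using fb Ak by (auto simp: u_def divide_le_eq le_divide_eq mult.commute)
    have u0: "0 \<le> u" by (simp add: u_def)
    have w1: "1 \<le> w'" using fn(1) M0 by (simp add: w'_def le_divide_eq)
    have w2: "w' * (1 - real k ^ 2 / real n) \<le> 1" using fn(2) M0 by (simp add: w'_def divide_le_eq mult.commute)
    have w3: "w' \<le> 1 + \<rho>1"
    proof -
      define t where "t = real k ^ 2 / real n"
      have t: "0 \<le> t" "t \<le> 1 / 8" using kn2 by (auto simp: t_def)
      have "t * t \<le> 1 / 8 * t" using t by (intro mult_right_mono) auto
      then have "1 \<le> (1 + 2 * t) * (1 - t)" using t by (simp add: algebra_simps)
      then have "w' * (1 - t) \<le> (1 + 2 * t) * (1 - t)" using w2 unfolding t_def by linarith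
      then have "w' \<le> 1 + 2 * t" using t by (simp add: mult_le_cancel_right)
      then show ?thesis using rho1(2) by (simp add: t_def)
    qed
    show "1 - \<rho>1 \<le> (1 - real (m - i) / real M) * (real ((k * (M - (m - i))) choose k) / (real (M - (m - i)) * (real k * real (M - (m - i)) / real n) ^ k))"
    proof -
      have "real k ^ 2 / real A = real k / real K" unfolding An using k0 by (simp add: power2_eq_square)
      also have "\<dots> \<le> real k ^ 2 / real n"
      proof -
        have "2 * real n \<le> 3 * real K" using K2 sl(1) by linarith
        then have "real n \<le> real k * real K" using mult_right_mono[OF k0, of "real K"] K0 n0 by linarith
        then have "real k * real n \<le> real k * (real k * real K)" using k0 by (intro mult_left_mono) auto
        then show ?thesis using K0 n0 by (simp add: divide_le_eq le_divide_eq power2_eq_square mult_ac)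
      qed
      finally have "1 - \<rho>1 \<le> u" using u(1) rho1(2) by (smt (verit) zero_le_divide_iff zero_le_power2 of_nat_0_le_iff)
      also have "u = u * 1" by simp
      also have "\<dots> \<le> u * w'" using w1 u0 by (rule mult_left_mono)
      finally show ?thesis unfolding X[symmetric] X_def .
    qed
    show "(1 - real (m - i) / real M) * (real ((k * (M - (m - i))) choose k) / (real (M - (m - i)) * (real k * real (M - (m - i)) / real n) ^ k)) \<le> 1 + \<rho>1"
    proof -
      have "u * w' \<le> 1 * w'" using u(2) w1 by (intro mult_right_mono) auto
      then show ?thesis using w3 unfolding X[symmetric] X_def by linarith
    qed
  qed
  then interpret ep: end_phase n k m i "20 * a" \<rho>1 \<xi> \<Delta> GD .
  have epf: "ep.f = f" by (simp add: ep.f_def f_def)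
  have ee: "ep.\<epsilon>e \<le> 480 * a + 9 * real k * b + 12 * real k ^ 2 / real n + 3 * real k * L / real (m - i)"
  proof -
    have "\<mu> * real N / real f = real k / real n" unfolding \<mu>_def N using f0 M0 by simp
    then have "3 * real k * \<Delta> / real f = 6 * real k * (real k / real n) + 3 * real k * L / real f"
      unfolding \<Delta>_def by (simp add: add_divide_distrib distrib_left flip: times_divide_eq_right)
    moreover have "ep.\<epsilon>e = 24 * (20 * a) + 3 * \<rho>1 + 3 * real k * \<Delta> / real f" by (simp only: ep.\<epsilon>e_def epf)
    ultimately show ?thesis unfolding \<rho>1_def f_def by (simp add: power2_eq_square)
  qed
  have GB: "real (card ep.GB) / real (M choose f) \<le> q1 + q2"
  proof -
    have "ep.GB = hg f - GD" by (simp only: ep.GB_def epf)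
    then have "ep.GB \<subseteq> {G\<in>hg f. \<not> main_good \<mu> b a G} \<union> {G\<in>hg f. \<not> end_good \<mu> a L G}"
      unfolding GD_def by auto
    then have "card ep.GB \<le> card ({G\<in>hg f. \<not> main_good \<mu> b a G} \<union> {G\<in>hg f. \<not> end_good \<mu> a L G})"
      by (intro card_mono) auto
    also have "\<dots> \<le> card {G\<in>hg f. \<not> main_good \<mu> b a G} + card {G\<in>hg f. \<not> end_good \<mu> a L G}" by (rule card_Un_le)
    finally have "real (card ep.GB) / real (M choose f) \<le> (real (card {G\<in>hg f. \<not> main_good \<mu> b a G}) + real (card {G\<in>hg f. \<not> end_good \<mu> a L G})) / real (M choose f)"
      by (intro divide_right_mono) auto
    also have "\<dots> \<le> q1 + q2" unfolding add_divide_distrib using q by (intro add_mono) (auto simp: f_def \<mu>_def)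
    finally show ?thesis .
  qed
  have "(\<Sum>d\<in>Om n (k * m). ep.\<beta>e d) \<le> 6 * real k * (real (card ep.GB) / real (M choose f))"
    using ep.sum_\<beta>e unfolding epf .
  also have "\<dots> \<le> 6 * real k * (q1 + q2)" using GB by (intro mult_left_mono) auto
  finally have s: "(\<Sum>d\<in>Om n (k * m). ep.\<beta>e d) \<le> 6 * real k * (q1 + q2)" .
  have "\<bar>p m (i - 1) d - p m i d\<bar>
      \<le> (480 * a + 9 * real k * b + 12 * real k ^ 2 / real n + 3 * real k * L / real (m - i)) * p m i d + ep.\<beta>e d"
    if d: "d \<in> Om n (k * m)" for d
    using ep.end_step[OF d] mult_right_mono[OF ee p_nonneg[of m i d]] by linarith
  then show ?thesis using s ep.\<beta>e_nonneg by blast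
qed

end

section \<open>Summing the errors\<close>

lemma harmonic_le: "(\<Sum>i=1..m. 1 / real i) \<le> 1 + ln (real m)" if "1 \<le> m"
  using that
proof (induction m rule: nat_induct_at_least)
  case (Suc m)
  have "ln (1 - 1 / real (Suc m)) \<le> - (1 / real (Suc m))"
    using ln_le_minus_one[of "1 - 1 / real (Suc m)"] Suc by simp
  moreover have "1 - 1 / real (Suc m) = real m / real (Suc m)" by (simp add: field_simps)
  moreover have "ln (real m / real (Suc m)) = ln (real m) - ln (real (Suc m))" using Suc.hyps by (simp add: ln_div)
  ultimately have "1 / real (Suc m) \<le> ln (real (Suc m)) - ln (real m)" by simp
  then show ?case using Suc by simp
qed simp

lemma inverse_squares_le: "(\<Sum>i=1..m. 1 / (real i)\<^sup>2) \<le> 2 - 1 / real m" if "1 \<le> m"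
  using that
proof (induction m rule: nat_induct_at_least)
  case (Suc m)
  have "1 / (real (Suc m))\<^sup>2 \<le> 1 / (real m * real (Suc m))"
    using Suc by (intro divide_left_mono) (auto simp: power2_eq_square)
  also have "\<dots> = 1 / real m - 1 / real (Suc m)" using Suc by (simp add: field_simps)
  finally show ?case using Suc by simp
qed simp

context kgraph
begin

text \<open>The real \<open>\<kappa>\<close> stands for an upper bound on \<open>k\<close>, so that
  apart from the range of \<open>m\<close> all numerical hypotheses depend on \<open>n\<close> only
  and the result is uniform in \<open>k\<close> and \<open>m\<close>. \<open>\<Lambda>\<close>
  bounds the deviation parameter of every main step because \<open>ln i \<le> \<kappa> * l\<close>;
  \<open>I0\<close> separates the phases.\<close>

lemma assembly:
  fixes a b E \<kappa> l \<Lambda> I0 B \<delta> S s \<tau> :: real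
  defines "q1 \<equiv> 24 * exp (\<kappa> * l) * (real n)\<^sup>2 * exp (- E)"
    and "q2 \<equiv> 12 * real n ^ 3 * exp (- l\<^sup>2) + 12 * exp (\<kappa> * l) * real n * exp (- B) + 24 * exp (2 * \<kappa> * l) * (real n)\<^sup>2 * exp (- E)"
    and "P \<equiv> \<kappa> * (real n)\<^sup>2 * exp (- l\<^sup>2)"
  assumes m: "sqrt (real n) < real m" "real k * real m < real M"
    and l: "l = ln (real n)" "1 \<le> l" and \<kappa>: "real k \<le> \<kappa>"
    and num: "8 * \<kappa> * b \<le> 1" "8 * \<kappa>\<^sup>2 \<le> real n" "10 * \<kappa> \<le> a * real n" "0 < b" "b \<le> 1" "5 * b \<le> a" "120 * a \<le> 1" "1 \<le> a\<^sup>2 * real n"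
    and \<Lambda>: "\<Lambda> = l\<^sup>2 + 4 * \<kappa> * l" "3 * \<Lambda> ^ 3 \<le> real n"
    and E: "4 * E \<le> a\<^sup>2 * (real n - 2)" "4 * E \<le> b\<^sup>2 * ((real n - 1) * (real n - 2) / 2)" "4 * E \<le> a\<^sup>2 * (real n - \<kappa> + 1)"
    and I0: "0 \<le> I0" "2 * I0 \<le> sqrt (real n)" and fl: "36 * l ^ 4 \<le> a * sqrt (real n)" and B: "1 \<le> B" "B \<le> real n"
    and MI: "\<And>i::nat. I0 < real i \<Longrightarrow> 8 * \<kappa> \<le> real i \<and> (l\<^sup>2 + 4 * ln (real i)) ^ 5 \<le> 2 * real i \<and> 2 * (l\<^sup>2 + 4 * ln (real i)) \<le> real i
      \<and> sqrt (\<kappa> * (l\<^sup>2 + 4 * ln (real i)) / real i) \<le> 1 / 30 \<and> sqrt (\<kappa> * (l\<^sup>2 + 4 * ln (real i)) / real i) ^ 3 \<le> \<delta> * real i powr (- 101 / 100)"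
    and S: "\<And>m. (\<Sum>i=1..m. real i powr (- 101 / 100)) \<le> S" and \<delta>: "0 \<le> \<delta>"
    and P: "48 * P \<le> 1"
    and s: "I0 * (480 * a + 9 * \<kappa> * b + 12 * \<kappa>\<^sup>2 / real n + 3 * \<kappa> * (2 * l\<^sup>2 / sqrt (real n) + B / (real n)\<^sup>2))
       + 832 * a * \<kappa> * \<Lambda> * (1 + \<kappa> * l) + 3584 * \<delta> * S + 2688 * P \<le> s" "s \<le> 1"
    and \<tau>: "I0 * (6 * \<kappa> * (q1 + q2)) + 2304 * P + 2 * exp (\<kappa> * l) * q1 \<le> \<tau>" "0 < \<tau>"
  shows "\<exists>W. PrB_set k n m W \<ge> 1 - sqrt \<tau> \<and> PrD_set k n m W \<ge> 1 - 3 * (sqrt \<tau> + \<tau>)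
    \<and> (\<forall>d\<in>W. \<bar>PrD k n m d - PrB k n m d\<bar> \<le> (exp s - 1 + 3 * sqrt \<tau>) * PrB k n m d)"
proof -
  have n1: "1 < real n" and k3': "3 \<le> real k" using k3 kn by auto
  have n0: "0 < real n" using n1 by linarith
  have \<kappa>3: "3 \<le> \<kappa>" using \<kappa> k3' by linarith
  have a0: "0 < a" and a1: "a \<le> 1" using num by linarith+
  have k1: "8 * real k * b \<le> 1"
  proof -
    have "real k * (8 * b) \<le> \<kappa> * (8 * b)" by (intro mult_right_mono \<kappa>) (use num in auto)
    then show ?thesis using num(1) by simp
  qed
  have k2: "8 * real k ^ 2 \<le> real n" using power_mono[OF \<kappa>, of 2] num by auto
  have k10: "10 * real k \<le> a * real n" using \<kappa> num by linarith
  note sl = size_lower[OF k2]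
  have m0: "0 < real m" using m(1) n0 by (meson less_trans real_sqrt_gt_zero)
  have m1: "1 \<le> m" using m0 by simp
  have m3: "3 * real m \<le> real M" using mult_right_mono[OF k3', of "real m"] m(2) m0 by linarith
  have m3': "3 * m \<le> M" using m3 by (metis of_nat_le_iff of_nat_mult of_nat_numeral)
  have mM: "m \<le> M" using m3' by linarith
  have nk: "real n ^ k \<le> exp (\<kappa> * l)"
  proof -
    have "real n ^ k = exp (real k * l)" using n0 by (simp add: l(1) exp_of_nat_mult)
    also have "\<dots> \<le> exp (\<kappa> * l)" using \<kappa> l(2) by simp
    finally show ?thesis .
  qed
  have Mx: "real M \<le> exp (\<kappa> * l)"
  proof -
    have "M \<le> n ^ k" unfolding M_def by (rule binomial_le_pow) (use kn in simp)
    then have "real M \<le> real n ^ k" by (metis of_nat_le_iff of_nat_power)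
    then show ?thesis using nk by linarith
  qed
  have x1: "1 \<le> exp (\<kappa> * l)" using \<kappa>3 l(2) by simp
  have lnm: "ln (real i) \<le> \<kappa> * l" if "1 \<le> i" "i \<le> m" for i
  proof -
    have "real i \<le> exp (\<kappa> * l)" using that mM Mx by linarith
    then have "ln (real i) \<le> ln (exp (\<kappa> * l))" using that by (subst ln_le_cancel_iff) auto
    then show ?thesis by simp
  qed
  define e1 where "e1 i = 832 * a * \<kappa> * \<Lambda> * (1 / real i) + 3584 * \<delta> * (real i powr (- 101 / 100)) + 1344 * P * (1 / (real i)\<^sup>2)" for i :: nat
  define e2 where "e2 = 480 * a + 9 * \<kappa> * b + 12 * \<kappa>\<^sup>2 / real n + 3 * \<kappa> * (2 * l\<^sup>2 / sqrt (real n) + B / (real n)\<^sup>2)"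
  define b1 where "b1 i = 1152 * P * (1 / (real i)\<^sup>2) + 2 * q1" for i :: nat
  define b2 where "b2 = 6 * \<kappa> * (q1 + q2)"
  define \<epsilon> where "\<epsilon> i = of_bool (real i \<le> I0) * e2 + e1 i" for i :: nat
  have P0: "0 \<le> P" unfolding P_def using \<kappa>3 by simp
  have \<Lambda>0: "0 \<le> \<Lambda>" unfolding \<Lambda>(1) using l(2) \<kappa>3 by simp
  have e10: "0 \<le> e1 i" for i unfolding e1_def using a0 \<kappa>3 \<Lambda>0 \<delta> P0 by simp
  have e20: "0 \<le> e2" unfolding e2_def using a0 num \<kappa>3 B by simp
  have q10: "0 \<le> q1" "0 \<le> q2" unfolding q1_def q2_def by auto
  have b10: "0 \<le> b1 i" for i unfolding b1_def using P0 q10 by simp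
  have b20: "0 \<le> b2" unfolding b2_def using q10 \<kappa>3 by simp
  have E1: "4 * E \<le> b\<^sup>2 * real N" "4 * E \<le> a\<^sup>2 * real N2" "4 * E \<le> a\<^sup>2 * real (n - k + 1)" "4 * E \<le> a\<^sup>2 * real N1"
  proof -
    have c2: "real (j choose 2) = real j * (real j - 1) / 2" for j
      by (cases j) (simp_all add: choose_two real_of_nat_div field_simps)
    have "real ((n - 1) choose 2) = (real n - 1) * (real n - 2) / 2" unfolding c2 using kn by (simp add: of_nat_diff)
    then have "(real n - 1) * (real n - 2) / 2 \<le> real N" using sl(3) by (metis of_nat_le_iff)
    then have "b\<^sup>2 * ((real n - 1) * (real n - 2) / 2) \<le> b\<^sup>2 * real N" by (intro mult_left_mono) auto
    then show "4 * E \<le> b\<^sup>2 * real N" using E by linarith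
    have "real n - 2 \<le> real N2" using sl(2) by linarith
    then have "a\<^sup>2 * (real n - 2) \<le> a\<^sup>2 * real N2" by (intro mult_left_mono) auto
    then show "4 * E \<le> a\<^sup>2 * real N2" using E by linarith
    have "real n - \<kappa> + 1 \<le> real (n - k + 1)" using \<kappa> kn by simp
    then have "a\<^sup>2 * (real n - \<kappa> + 1) \<le> a\<^sup>2 * real (n - k + 1)" by (intro mult_left_mono) auto
    then show "4 * E \<le> a\<^sup>2 * real (n - k + 1)" using E by linarith
    have "real n - 2 \<le> real N1"
    proof -
      have "(n - 2) * 1 \<le> (n - 2) choose 2"
      proof -
        have "(n - 2) * 2 \<le> (n - 2) * (n - 2 - 1)" using sl(6) by (intro mult_le_mono2) linarith
        then show ?thesis unfolding choose_two by linarith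
      qed
      then show ?thesis using sl(4) by linarith
    qed
    then have "a\<^sup>2 * (real n - 2) \<le> a\<^sup>2 * real N1" by (intro mult_left_mono) auto
    then show "4 * E \<le> a\<^sup>2 * real N1" using E by linarith
  qed
  have six: "2 * (2 * F + 1) \<le> 6 * X" if "F \<le> X" "1 \<le> X" for F X :: real using that by simp
  have eight: "8 * (2 * F + 1) \<le> 24 * F" if "1 \<le> F" for F :: real using that by simp
  have fx: "2 * (2 * real f + 1) \<le> 6 * exp (\<kappa> * l)" if "f \<le> m" for f
  proof -
    have "real f \<le> exp (\<kappa> * l)" using that mM Mx by linarith
    then show ?thesis using x1 by (intro six)
  qed
  have Q1: "real (card {G\<in>hg f. \<not> main_good (real f / real M) b a G}) / real (M choose f) \<le> q1" if f: "f \<le> m" for f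
  proof -
    have "real (card {G\<in>hg f. \<not> main_good (real f / real M) b a G}) / real (M choose f) \<le> 2 * (2 * real f + 1) * (4 * real n ^ 2 * exp (- E))"
      using f mM a0 a1 num E1 by (intro main_good_prob) auto
    also have "\<dots> \<le> 6 * exp (\<kappa> * l) * (4 * real n ^ 2 * exp (- E))" using fx[OF f] by (intro mult_right_mono) auto
    finally show ?thesis by (simp add: q1_def)
  qed
  \<comment> \<open>For many edges the prefactor \<open>2 * (2 * f + 1)\<close> can outgrow
    \<open>exp (l\<^sup>2)\<close>, so beyond \<open>n\<^sup>2\<close> edges the larger parameter
    \<open>B\<close> is used; the mean degree there is at least \<open>n\<close>, which makes this
    harmless.\<close>
  define Le where "Le f = (if real f \<le> (real n)\<^sup>2 then l\<^sup>2 else B)" for f :: nat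
  have Q2: "real (card {G\<in>hg f. \<not> end_good (real f / real M) a (Le f) G}) / real (M choose f) \<le> q2" if f: "f \<le> m" for f
  proof -
    have "real (card {G\<in>hg f. \<not> end_good (real f / real M) a (Le f) G}) / real (M choose f)
       \<le> 2 * (2 * real f + 1) * (2 * real n * exp (- Le f) + 4 * real n ^ k * exp (- E))"
      using f mM a0 a1 E1 by (intro end_good_prob) auto
    also have "\<dots> = 2 * (2 * real f + 1) * (2 * real n * exp (- Le f)) + 2 * (2 * real f + 1) * (4 * real n ^ k * exp (- E))"
      by (rule distrib_left)
    also have "2 * (2 * real f + 1) * (4 * real n ^ k * exp (- E)) \<le> 24 * exp (2 * \<kappa> * l) * (real n)\<^sup>2 * exp (- E)"
    proof -
      have "2 * (2 * real f + 1) * (4 * real n ^ k * exp (- E)) \<le> 6 * exp (\<kappa> * l) * (4 * exp (\<kappa> * l) * exp (- E))"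
        by (rule mult_mono[OF fx[OF f]]) (use nk in auto)
      also have "\<dots> = 24 * exp (2 * \<kappa> * l) * 1 * exp (- E)" by (simp add: exp_add[symmetric] mult_ac)
      also have "\<dots> \<le> 24 * exp (2 * \<kappa> * l) * (real n)\<^sup>2 * exp (- E)" using n1 by (intro mult_right_mono mult_left_mono) auto
      finally show ?thesis .
    qed
    also have "2 * (2 * real f + 1) * (2 * real n * exp (- Le f)) \<le> 12 * real n ^ 3 * exp (- l\<^sup>2) + 12 * exp (\<kappa> * l) * real n * exp (- B)"
    proof (cases "real f \<le> (real n)\<^sup>2")
      case True
      have "1 \<le> (real n)\<^sup>2" using n1 by simp
      with True have "2 * (2 * real f + 1) \<le> 6 * (real n)\<^sup>2" by (rule six)
      then have "2 * (2 * real f + 1) * (2 * real n * exp (- Le f)) \<le> 6 * (real n)\<^sup>2 * (2 * real n * exp (- Le f))"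
        by (intro mult_right_mono) auto
      also have "\<dots> = 12 * real n ^ 3 * exp (- l\<^sup>2)" using True by (simp add: Le_def power2_eq_square power3_eq_cube)
      finally show ?thesis by (simp add: add_increasing2)
    next
      case False
      have "2 * (2 * real f + 1) * (2 * real n * exp (- Le f)) \<le> 6 * exp (\<kappa> * l) * (2 * real n * exp (- Le f))"
        using fx[OF f] by (intro mult_right_mono) auto
      also have "\<dots> = 12 * exp (\<kappa> * l) * real n * exp (- B)" using False by (simp add: Le_def)
      finally show ?thesis by (simp add: add_increasing)
    qed
    finally show ?thesis by (simp add: q2_def)
  qed
  define Q where "Q i \<beta> \<longleftrightarrow> (\<forall>d. 0 \<le> \<beta> d) \<and> (\<Sum>d\<in>Om n (k * m). \<beta> d) \<le> of_bool (real i \<le> I0) * b2 + b1 i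
    \<and> (\<forall>d\<in>Om n (k * m). \<bar>p m (i - 1) d - p m i d\<bar> \<le> \<epsilon> i * p m i d + \<beta> d)" for i \<beta>
  have Qi: "\<exists>\<beta>. Q i \<beta>" if i: "i \<in> {1..m}" for i
  proof -
    have i1: "1 \<le> i" "i \<le> m" using i by auto
    have mi3: "3 * (m - i) \<le> M" using m3' by linarith
    have mim: "m - i \<le> m" by simp
    show ?thesis
    proof (cases "real i \<le> I0")
      case True
      define f where "f = m - i"
      have im: "i < m"
      proof -
        have "real i < real m" using True I0 m(1) by linarith
        then show ?thesis by simp
      qed
      have fr: "real f = real m - real i" using im by (simp add: f_def)
      have f2: "sqrt (real n) / 2 \<le> real f" using fr True I0 m(1) by linarith
      have sq0: "0 < sqrt (real n)" using n0 by simp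
      have f0: "0 < real f" using f2 sq0 by linarith
      have L1: "1 \<le> Le f" unfolding Le_def using l B by simp
      have L2: "18 * (Le f)\<^sup>2 \<le> a * real f" if h: "real f / real M * real N < Le f"
      proof (cases "real f \<le> (real n)\<^sup>2")
        case True
        have "18 * (l\<^sup>2)\<^sup>2 \<le> a * (sqrt (real n) / 2)" using fl by simp
        also have "\<dots> \<le> a * real f" using f2 a0 by (intro mult_left_mono) auto
        finally show ?thesis using True by (simp add: Le_def)
      next
        case False
        have M0: "0 < real M" using sl(1) n0 by linarith
        have "real f / real M * real N = real k * real f / real n"
          using nN_real n0 M0 by (simp add: field_simps)
        moreover have "real n \<le> real k * real f / real n"
        proof -
          have "real n * real n \<le> real f" using False by (simp add: power2_eq_square)
          also have "\<dots> \<le> real k * real f" using k3' mult_right_mono[of 1 "real k" "real f"] by simp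
          finally show ?thesis using n0 by (simp add: le_divide_eq)
        qed
        \<comment> \<open>Contradicts \<open>B \<le> real n\<close>: beyond \<open>n\<^sup>2\<close>
          edges the sparse case cannot occur.\<close>
        ultimately have "real n < B" using h False by (simp add: Le_def)
        then show ?thesis using B by linarith
      qed
      obtain \<beta> where \<beta>: "\<forall>d. 0 \<le> \<beta> d" "(\<Sum>d\<in>Om n (k * m). \<beta> d) \<le> 6 * real k * (q1 + q2)"
        "\<forall>d\<in>Om n (k * m). \<bar>p m (i - 1) d - p m i d\<bar>
          \<le> (480 * a + 9 * real k * b + 12 * real k ^ 2 / real n + 3 * real k * Le f / real (m - i)) * p m i d + \<beta> d"
        using end_step_ex[OF i1(1) im mM mi3 k1 k2 k10 num(4,5,6,7) L1[unfolded f_def] L2[unfolded f_def] Q1[OF mim] Q2[OF mim]]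
        unfolding f_def by blast
      have LF: "Le f / real f \<le> 2 * l\<^sup>2 / sqrt (real n) + B / (real n)\<^sup>2"
      proof (cases "real f \<le> (real n)\<^sup>2")
        case True
        have "l\<^sup>2 / real f \<le> l\<^sup>2 / (sqrt (real n) / 2)" using f2 sq0 f0 by (intro divide_left_mono) auto
        then show ?thesis using True B n0 by (simp add: Le_def add_increasing2 mult.commute)
      next
        case False
        have "B / real f \<le> B / (real n)\<^sup>2" using False B n0 f0 by (intro divide_left_mono) auto
        then show ?thesis using False sq0 by (simp add: Le_def add_increasing)
      qed
      have "480 * a + 9 * real k * b + 12 * real k ^ 2 / real n + 3 * real k * Le f / real (m - i) \<le> e2"
      proof -
        have 1: "9 * real k * b \<le> 9 * \<kappa> * b" using \<kappa> num by (intro mult_right_mono) auto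
        have 2: "12 * real k ^ 2 / real n \<le> 12 * \<kappa>\<^sup>2 / real n" using power_mono[OF \<kappa>, of 2] n0 by (intro divide_right_mono) auto
        have "3 * real k * (Le f / real f) \<le> 3 * \<kappa> * (2 * l\<^sup>2 / sqrt (real n) + B / (real n)\<^sup>2)"
          using LF \<kappa> L1 f0 by (intro mult_mono) auto
        then show ?thesis unfolding e2_def f_def[symmetric] using 1 2 by simp
      qed
      then have ee: "480 * a + 9 * real k * b + 12 * real k ^ 2 / real n + 3 * real k * Le f / real (m - i) \<le> \<epsilon> i"
        unfolding \<epsilon>_def using True e10[of i] by simp
      have "6 * real k * (q1 + q2) \<le> b2" unfolding b2_def using \<kappa> q10 by (intro mult_right_mono) auto
      then have "(\<Sum>d\<in>Om n (k * m). \<beta> d) \<le> of_bool (real i \<le> I0) * b2 + b1 i" using \<beta>(2) True b10[of i] by simp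
      moreover have "\<bar>p m (i - 1) d - p m i d\<bar> \<le> \<epsilon> i * p m i d + \<beta> d" if d: "d \<in> Om n (k * m)" for d
        using \<beta>(3)[rule_format, OF d] mult_right_mono[OF ee p_nonneg[of m i d]] by linarith
      ultimately show ?thesis using \<beta>(1) unfolding Q_def by blast
    next
      case False
      have i0: "0 < real i" using i1 by simp
      \<comment> \<open>The term \<open>4 * ln i\<close> turns \<open>exp (- L)\<close> into
        \<open>exp (- l\<^sup>2) / i ^ 4\<close>, which remains summable after the factor
        \<open>k * i\<close> of \<open>pb\<close>, however many steps there are.\<close>
      define L where "L = l\<^sup>2 + 4 * ln (real i)"
      define y where "y = sqrt (real k * L / real i)"
      have mi: "8 * \<kappa> \<le> real i" "L ^ 5 \<le> 2 * real i" "2 * L \<le> real i" "sqrt (\<kappa> * L / real i) \<le> 1 / 30"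
        "sqrt (\<kappa> * L / real i) ^ 3 \<le> \<delta> * real i powr (- 101 / 100)"
        using MI[of i] False unfolding L_def by auto
      have ln0: "0 \<le> ln (real i)" using i1 by simp
      have L1: "1 \<le> L" unfolding L_def using l(2) ln0 by (simp add: add_increasing2)
      have L\<Lambda>: "L \<le> \<Lambda>" unfolding L_def \<Lambda>(1) using lnm[OF i1] by simp
      have L3: "3 * L ^ 3 \<le> real n" using power_mono[OF L\<Lambda>, of 3] L1 \<Lambda>(2) by simp
      have i8: "8 * k \<le> i"
      proof -
        have "real (8 * k) \<le> real i" using mi(1) \<kappa> by simp
        then show ?thesis by (simp only: of_nat_le_iff)
      qed
      have "1 * real i \<le> real k * real i" using k3' by (intro mult_right_mono) auto
      then have Lk: "2 * L \<le> real k * real i" using mi(3) by linarith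
      have kL: "real k * L / real i \<le> \<kappa> * L / real i" using \<kappa> L1 i0 by (intro divide_right_mono mult_right_mono) auto
      have yk: "y \<le> sqrt (\<kappa> * L / real i)" unfolding y_def using kL by simp
      have y0: "0 \<le> y" unfolding y_def using L1 i0 by simp
      have y30: "y \<le> 1 / 30" using yk mi(4) by linarith
      have y3: "y ^ 3 \<le> \<delta> * real i powr (- 101 / 100)" using power_mono[OF yk y0, of 3] mi(5) by linarith
      have y2: "y\<^sup>2 \<le> \<kappa> * \<Lambda> * (1 / real i)"
      proof -
        have "y\<^sup>2 = real k * L / real i" unfolding y_def using L1 i0 by simp
        also have "\<dots> \<le> \<kappa> * \<Lambda> / real i" using \<kappa> L\<Lambda> L1 i0 \<kappa>3 by (intro divide_right_mono mult_mono) auto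
        finally show ?thesis by simp
      qed
      define ep where "ep = 52 * a * y\<^sup>2 + 224 * y ^ 3"
      have ep4: "ep \<le> 1 / 4"
      proof -
        have "y\<^sup>2 \<le> (1 / 30)\<^sup>2" "y ^ 3 \<le> (1 / 30) ^ 3" using y0 y30 by (auto intro!: power_mono)
        moreover from this have "52 * a * y\<^sup>2 \<le> 52 * 1 * (1 / 30)\<^sup>2" using a0 a1 by (intro mult_mono) auto
        ultimately show ?thesis unfolding ep_def by (simp add: power2_eq_square power3_eq_cube)
      qed
      define pb where "pb = 8 * (2 * real (k * i) + 1) * (real n)\<^sup>2 * exp (- L)"
      have pbP: "pb \<le> 24 * P * (1 / (real i)\<^sup>2)"
      proof -
        have eL: "exp (- L) = exp (- l\<^sup>2) * (1 / real i ^ 4)"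
        proof -
          have "exp (- L) = exp (- l\<^sup>2) * exp (- (4 * ln (real i)))" unfolding L_def by (simp add: exp_add[symmetric])
          also have "exp (- (4 * ln (real i))) = 1 / real i ^ 4"
            using i0 exp_of_nat_mult[of 4 "ln (real i)"] by (simp add: exp_minus inverse_eq_divide)
          finally show ?thesis .
        qed
        have "1 \<le> real (k * i)" using k3 i1 by (metis One_nat_def Suc_leI le_trans mult_le_mono nat_mult_1 of_nat_1 of_nat_le_iff numeral_3_eq_3 Suc_le_mono le0)
        then have "8 * (2 * real (k * i) + 1) \<le> 24 * real (k * i)" by (intro eight)
        also have "\<dots> \<le> 24 * (\<kappa> * real i)" using \<kappa> i0 by simp
        finally have "pb \<le> 24 * (\<kappa> * real i) * (real n)\<^sup>2 * exp (- L)" unfolding pb_def by (intro mult_right_mono) auto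
        also have "\<dots> = 24 * P * (1 / (real i)\<^sup>2) * (1 / real i)" unfolding eL P_def using i0
          by (simp add: field_simps power2_eq_square numeral_eq_Suc)
        also have "\<dots> \<le> 24 * P * (1 / (real i)\<^sup>2) * 1" using i1 P0 by (intro mult_left_mono) auto
        finally show ?thesis by simp
      qed
      have pb2: "pb \<le> 1 / 2"
      proof -
        have "1 / (real i)\<^sup>2 \<le> 1" using i1 by simp
        then have "24 * P * (1 / (real i)\<^sup>2) \<le> 24 * P * 1" using P0 by (intro mult_left_mono) auto
        then show ?thesis using pbP P by linarith
      qed
      obtain \<beta> where \<beta>: "\<forall>d. 0 \<le> \<beta> d" "(\<Sum>d\<in>Om n (k * m). \<beta> d) \<le> 48 * pb + 2 * q1"
        "\<forall>d\<in>Om n (k * m). \<bar>p m (i - 1) d - p m i d\<bar> \<le> (16 * ep + 56 * pb) * p m i d + \<beta> d"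
        using main_step[OF i1 mM mi3 k1 k2 num(4,5,6,8) i8 L1 L3 mi(2) Lk y_def _ ep_def ep4 pb_def pb2 Q1[OF mim]] y30 by auto
      have ee: "16 * ep + 56 * pb \<le> \<epsilon> i"
      proof -
        have "832 * a * y\<^sup>2 \<le> 832 * a * (\<kappa> * \<Lambda> * (1 / real i))" by (rule mult_left_mono[OF y2]) (use a0 in simp)
        then have 1: "832 * a * y\<^sup>2 \<le> 832 * a * \<kappa> * \<Lambda> * (1 / real i)" by (simp only: mult.assoc)
        have "3584 * y ^ 3 \<le> 3584 * (\<delta> * real i powr (- 101 / 100))" by (rule mult_left_mono[OF y3]) simp
        then have 2: "3584 * y ^ 3 \<le> 3584 * \<delta> * (real i powr (- 101 / 100))" by (simp only: mult.assoc)
        have "56 * pb \<le> 56 * (24 * P * (1 / (real i)\<^sup>2))" by (rule mult_left_mono[OF pbP]) simp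
        then have 3: "56 * pb \<le> 1344 * P * (1 / (real i)\<^sup>2)" by simp
        have "16 * ep = 832 * a * y\<^sup>2 + 3584 * y ^ 3" by (simp add: ep_def)
        then have "16 * ep + 56 * pb \<le> e1 i" unfolding e1_def using 1 2 3 by linarith
        then show ?thesis unfolding \<epsilon>_def using False by simp
      qed
      have "(\<Sum>d\<in>Om n (k * m). \<beta> d) \<le> of_bool (real i \<le> I0) * b2 + b1 i" using \<beta>(2) False pbP unfolding b1_def by simp
      moreover have "\<bar>p m (i - 1) d - p m i d\<bar> \<le> \<epsilon> i * p m i d + \<beta> d" if d: "d \<in> Om n (k * m)" for d
        using \<beta>(3)[rule_format, OF d] mult_right_mono[OF ee p_nonneg[of m i d]] by linarith
      ultimately show ?thesis using \<beta>(1) unfolding Q_def by blast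
    qed
  qed
  then have "\<forall>i\<in>{1..m}. \<exists>\<beta>. Q i \<beta>" by blast
  from bchoice[OF this] obtain \<beta> where \<beta>: "\<forall>i\<in>{1..m}. Q i (\<beta> i)" by blast
  have few: "(\<Sum>i=1..m. of_bool (real i \<le> I0) * c) \<le> I0 * c" if c: "0 \<le> c" for c :: real
  proof -
    have sub: "{i\<in>{1..m}. real i \<le> I0} \<subseteq> {1..nat \<lfloor>I0\<rfloor>}" by (auto simp: le_nat_iff le_floor_iff)
    have "(\<Sum>i=1..m. of_bool (real i \<le> I0) * c) = real (card {i\<in>{1..m}. real i \<le> I0}) * c"
      by (simp add: sum_distrib_right[symmetric] Int_def)
    also have "\<dots> \<le> I0 * c"
    proof (rule mult_right_mono[OF _ c])
      have "real (card {i\<in>{1..m}. real i \<le> I0}) \<le> real (nat \<lfloor>I0\<rfloor>)" using card_mono[OF _ sub] by simp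
      also have "\<dots> \<le> I0" using I0(1) by simp
      finally show "real (card {i\<in>{1..m}. real i \<le> I0}) \<le> I0" .
    qed
    finally show ?thesis .
  qed
  have sq2: "(\<Sum>i=1..m. 1 / (real i)\<^sup>2) \<le> 2"
  proof -
    have "0 \<le> 1 / real m" by simp
    then show ?thesis using inverse_squares_le[OF m1] by linarith
  qed
  have se: "(\<Sum>i=1..m. \<epsilon> i) \<le> s"
  proof -
    have "(\<Sum>i=1..m. e1 i) = 832 * a * \<kappa> * \<Lambda> * (\<Sum>i=1..m. 1 / real i) + 3584 * \<delta> * (\<Sum>i=1..m. real i powr (- 101 / 100)) + 1344 * P * (\<Sum>i=1..m. 1 / (real i)\<^sup>2)"
      unfolding e1_def sum.distrib sum_distrib_left by simp
    also have "\<dots> \<le> 832 * a * \<kappa> * \<Lambda> * (1 + \<kappa> * l) + 3584 * \<delta> * S + 1344 * P * 2"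
      using harmonic_le[OF m1] lnm[OF m1 order_refl] S[of m] sq2 a0 \<kappa>3 \<Lambda>0 \<delta> P0 by (intro add_mono mult_left_mono) auto
    finally have "(\<Sum>i=1..m. e1 i) \<le> 832 * a * \<kappa> * \<Lambda> * (1 + \<kappa> * l) + 3584 * \<delta> * S + 2688 * P" by simp
    then have "(\<Sum>i=1..m. \<epsilon> i) \<le> I0 * e2 + (832 * a * \<kappa> * \<Lambda> * (1 + \<kappa> * l) + 3584 * \<delta> * S + 2688 * P)"
      unfolding \<epsilon>_def sum.distrib using few[OF e20] by linarith
    then show ?thesis using s(1) unfolding e2_def by linarith
  qed
  have sb: "(\<Sum>i=1..m. \<Sum>d\<in>Om n (k * m). \<beta> i d) \<le> \<tau>"
  proof -
    have "(\<Sum>i=1..m. \<Sum>d\<in>Om n (k * m). \<beta> i d) \<le> (\<Sum>i=1..m. of_bool (real i \<le> I0) * b2 + b1 i)"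
      using \<beta> unfolding Q_def by (intro sum_mono) blast
    also have "\<dots> = (\<Sum>i=1..m. of_bool (real i \<le> I0) * b2) + (1152 * P * (\<Sum>i=1..m. 1 / (real i)\<^sup>2) + real m * (2 * q1))"
      unfolding b1_def sum.distrib sum_distrib_left by simp
    also have "\<dots> \<le> I0 * b2 + (1152 * P * 2 + exp (\<kappa> * l) * (2 * q1))"
    proof -
      have "real m \<le> exp (\<kappa> * l)" using mM Mx by linarith
      then have "real m * (2 * q1) \<le> exp (\<kappa> * l) * (2 * q1)" using q10 by (intro mult_right_mono) auto
      moreover have "1152 * P * (\<Sum>i=1..m. 1 / (real i)\<^sup>2) \<le> 1152 * P * 2" using sq2 P0 by (intro mult_left_mono) auto
      ultimately show ?thesis using few[OF b20] by linarith
    qed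
    also have "\<dots> \<le> \<tau>" using \<tau>(1) unfolding b2_def by simp
    finally show ?thesis .
  qed
  show ?thesis
  proof (rule good_set_exists[OF mM \<tau>(2) s(2)])
    show "0 \<le> \<epsilon> i" for i unfolding \<epsilon>_def using e20 e10 by simp
    show "0 \<le> \<beta> i d" if "1 \<le> i" "i \<le> m" for i d using \<beta> that unfolding Q_def by simp
    show "\<bar>p m (i - 1) d - p m i d\<bar> \<le> \<epsilon> i * p m i d + \<beta> i d" if "1 \<le> i" "i \<le> m" "d \<in> Om n (k * m)" for i d
      using \<beta> that unfolding Q_def by simp
  qed (fact se sb)+
qed

end

section \<open>Asymptotics\<close>

text \<open>Degrees deviate relatively by at most \<open>n powr -0.9\<close>, codegrees by \<open>n powr -0.42\<close>, and the
  phases meet at \<open>i = n powr 0.36\<close>. The main phase costs about \<open>(k / i) powr 1.5\<close> per step, hence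
  \<open>k powr 1.5 * n powr -0.18\<close> in total, and the end phase \<open>k * n powr (0.36 - 0.5)\<close>; both vanish for
  \<open>k \<le> n powr (1/9)\<close>.\<close>

lemma large_conditions:
  "\<forall>\<^sub>F x::real in at_top. 8 * x powr (1/9) * x powr (-9/10) \<le> 1 \<and> 8 * (x powr (1/9))\<^sup>2 \<le> x \<and> 10 * x powr (1/9) \<le> x powr (-42/100) * x
    \<and> 5 * x powr (-9/10) \<le> x powr (-42/100) \<and> 120 * x powr (-42/100) \<le> 1 \<and> 1 \<le> (x powr (-42/100))\<^sup>2 * x \<and> 3 * ((ln x)\<^sup>2 + 4 * x powr (1/9) * ln x) ^ 3 \<le> x
    \<and> 4 * (x powr (16/100) / 8) \<le> (x powr (-42/100))\<^sup>2 * (x - 2) \<and> 4 * (x powr (16/100) / 8) \<le> (x powr (-9/10))\<^sup>2 * ((x - 1) * (x - 2) / 2) \<and> 4 * (x powr (16/100) / 8) \<le> (x powr (-42/100))\<^sup>2 * (x - x powr (1/9) + 1)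
    \<and> 2 * x powr (36/100) \<le> sqrt x \<and> 36 * ln x ^ 4 \<le> x powr (-42/100) * sqrt x \<and> 1 \<le> x powr (15/100) \<and> x powr (15/100) \<le> x
    \<and> 48 * (x powr (1/9) * x\<^sup>2 * exp (- (ln x)\<^sup>2)) \<le> 1 \<and> 1 \<le> ln x \<and> 4 \<le> x"
  by (intro eventually_conj; real_asymp)

lemma error_tendsto:
  "((\<lambda>x::real. x powr (36/100) * (480 * x powr (-42/100) + 9 * x powr (1/9) * x powr (-9/10) + 12 * (x powr (1/9))\<^sup>2 / x
   + 3 * x powr (1/9) * (2 * (ln x)\<^sup>2 / sqrt x + x powr (15/100) / x\<^sup>2))
   + 832 * x powr (-42/100) * x powr (1/9) * ((ln x)\<^sup>2 + 4 * x powr (1/9) * ln x) * (1 + x powr (1/9) * ln x)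
   + 2688 * (x powr (1/9) * x\<^sup>2 * exp (- (ln x)\<^sup>2))) \<longlongrightarrow> 0) at_top"
  by real_asymp

text \<open>The union bounds cost \<open>exp (n powr (1/9) * ln n)\<close>, which
  \<open>exp (- (n powr (16/100) / 8))\<close> and \<open>exp (- (n powr (15/100)))\<close> both
  beat. The exponent \<open>16/100\<close> is that of \<open>a\<^sup>2 * n\<close>.\<close>

lemma failure_small:
  "\<forall>\<^sub>F x::real in at_top. x powr (36/100) * (6 * x powr (1/9) * (24 * exp (x powr (1/9) * ln x) * x\<^sup>2 * exp (- (x powr (16/100) / 8)) +
   (12 * x ^ 3 * exp (- (ln x)\<^sup>2) + 12 * exp (x powr (1/9) * ln x) * x * exp (- (x powr (15/100))) + 24 * exp (2 * x powr (1/9) * ln x) * x\<^sup>2 * exp (- (x powr (16/100) / 8)))))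
   + 2304 * (x powr (1/9) * x\<^sup>2 * exp (- (ln x)\<^sup>2)) + 2 * exp (x powr (1/9) * ln x) * (24 * exp (x powr (1/9) * ln x) * x\<^sup>2 * exp (- (x powr (16/100) / 8)))
    \<le> exp (- ((ln x)\<^sup>2 / 2))"
  by real_asymp

text \<open>Conditions on the step index alone. The factor \<open>100/36\<close> bounds
  \<open>ln n\<close> by \<open>ln y\<close>, since the main phase starts at
  \<open>n powr (36/100)\<close>.\<close>

lemma index_conditions:
  "\<forall>\<^sub>F y::real in at_top. (ln y * (100/36))\<^sup>2 + 4 * ln y \<le> y powr (1/1000) \<and> 8 * y powr (31/100) \<le> y \<and> y powr (-689/1000) \<le> 1/900
   \<and> (y powr (1/1000)) ^ 5 \<le> 2 * y \<and> 2 * y powr (1/1000) \<le> y \<and> 1 \<le> y"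
  by (intro eventually_conj; real_asymp)

text \<open>From \<open>x powr (36/100) \<le> y\<close> one gets
  \<open>x powr (1/9) \<le> y powr (31/100)\<close>, so all bounds become powers of
  \<open>y\<close>. The cube is at most \<open>y powr (- 2067/2000)\<close>; the surplus over
  \<open>- 101/100\<close> is enough for a factor \<open>y powr (- 2/100)\<close>, which becomes
  decay in \<open>x\<close>.\<close>

lemma late_index:
  fixes x y :: real
  assumes x: "1 \<le> x" and xy: "x powr (36/100) \<le> y"
    and c: "(ln y * (100/36))\<^sup>2 + 4 * ln y \<le> y powr (1/1000)" "8 * y powr (31/100) \<le> y" "y powr (-689/1000) \<le> 1/900"
      "(y powr (1/1000)) ^ 5 \<le> 2 * y" "2 * y powr (1/1000) \<le> y" "1 \<le> y"
  shows "8 * x powr (1/9) \<le> y \<and> ((ln x)\<^sup>2 + 4 * ln y) ^ 5 \<le> 2 * y \<and> 2 * ((ln x)\<^sup>2 + 4 * ln y) \<le> y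
    \<and> sqrt (x powr (1/9) * ((ln x)\<^sup>2 + 4 * ln y) / y) \<le> 1 / 30
    \<and> sqrt (x powr (1/9) * ((ln x)\<^sup>2 + 4 * ln y) / y) ^ 3 \<le> x powr (-72/10000) * y powr (-101/100)"
proof -
  define L where "L = (ln x)\<^sup>2 + 4 * ln y"
  have y0: "0 < y" and x0: "0 < x" using c x by linarith+
  have "ln (x powr (36/100)) \<le> ln y" using xy x0 by (subst ln_le_cancel_iff) (auto simp: y0)
  then have lx: "ln x \<le> ln y * (100/36)" using x0 by (simp add: ln_powr)
  have lx0: "0 \<le> ln x" and ly0: "0 \<le> ln y" using x c by auto
  have "(ln x)\<^sup>2 \<le> (ln y * (100/36))\<^sup>2" using lx lx0 by (rule power_mono)
  then have L: "L \<le> y powr (1/1000)" using c(1) unfolding L_def by linarith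
  have L0: "0 \<le> L" unfolding L_def using ly0 by simp
  have \<kappa>: "x powr (1/9) \<le> y powr (31/100)"
  proof -
    have "x powr (1/9) = (x powr (36/100)) powr (100/324)" by (simp add: powr_powr)
    also have "\<dots> \<le> y powr (100/324)" using xy by (intro powr_mono2) auto
    also have "\<dots> \<le> y powr (31/100)" using c(6) by (intro powr_mono) auto
    finally show ?thesis .
  qed
  have r: "x powr (1/9) * L / y \<le> y powr (-689/1000)"
  proof -
    have "x powr (1/9) * L \<le> y powr (31/100) * y powr (1/1000)" using \<kappa> L L0 by (intro mult_mono) auto
    also have "\<dots> = y powr (-689/1000) * y" using y0 powr_add[of y "-689/1000" 1] by (simp add: powr_add[symmetric])
    finally show ?thesis using y0 by (simp add: divide_le_eq)
  qed
  have r0: "0 \<le> x powr (1/9) * L / y" using L0 y0 by simp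
  have 1: "sqrt (x powr (1/9) * L / y) \<le> 1 / 30"
  proof (rule real_le_lsqrt)
    have "(1 / 30 :: real)\<^sup>2 = 1 / 900" by (simp add: power2_eq_square)
    then show "x powr (1/9) * L / y \<le> (1 / 30)\<^sup>2" using r c(3) by linarith
  qed simp
  have "sqrt (x powr (1/9) * L / y) \<le> sqrt (y powr (-689/1000))" using r by simp
  also have "\<dots> = y powr (-689/2000)" using y0 by (simp add: powr_half_sqrt[symmetric] powr_powr)
  finally have "sqrt (x powr (1/9) * L / y) ^ 3 \<le> (y powr (-689/2000)) ^ 3" using r0 by (intro power_mono) auto
  also have "\<dots> = y powr (-2067/2000)" using y0 by (simp add: powr_power)
  also have "\<dots> \<le> y powr (-2/100 + -101/100)" using c(6) by (intro powr_mono) auto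
  also have "\<dots> = y powr (-2/100) * y powr (-101/100)" by (rule powr_add)
  also have "\<dots> \<le> x powr (-72/10000) * y powr (-101/100)"
  proof (rule mult_right_mono)
    have "y powr (-2/100) \<le> (x powr (36/100)) powr (-2/100)" using xy x0 y0 by (intro powr_mono2') auto
    then show "y powr (-2/100) \<le> x powr (-72/10000)" by (simp add: powr_powr)
  qed simp
  finally have 2: "sqrt (x powr (1/9) * L / y) ^ 3 \<le> x powr (-72/10000) * y powr (-101/100)" .
  have "L ^ 5 \<le> (y powr (1/1000)) ^ 5" using L L0 by (rule power_mono)
  then show ?thesis using \<kappa> L c 1 2 unfolding L_def[symmetric] by linarith
qed

theorem theorem1p1:
  "\<exists>c::real. c > 0 \<and>
     (\<forall>C::real. 0 < C \<and> C < 1/9 \<longrightarrow>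
       (\<exists>(W :: nat \<Rightarrow> nat \<Rightarrow> nat \<Rightarrow> nat list set) (h :: nat \<Rightarrow> real) (g :: nat \<Rightarrow> real).
          filterlim h at_top sequentially \<and> g \<longlonglongrightarrow> 0 \<and>
          (\<forall>n k m :: nat.
             3 \<le> k \<and> real k < real n powr C \<and>
             sqrt (real n) < real m \<and> real m < c / real k * real (n choose k) \<longrightarrow>
               PrB_set k n m (W n k m) \<ge> 1 - real n powr (- h n) \<and>
               PrD_set k n m (W n k m) \<ge> 1 - real n powr (- h n) \<and>
               (\<forall>d \<in> W n k m. \<bar>PrD k n m d - PrB k n m d\<bar> \<le> g n * PrB k n m d))))"
proof -
  \<comment> \<open>An exponent just below \<open>- 1\<close>: the sum over all steps is then
    bounded uniformly in \<open>m\<close>.\<close>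
  define S where "S = (\<Sum>i. real i powr (-101/100))"
  have summ: "summable (\<lambda>i. real i powr (-101/100))" by (subst summable_real_powr_iff) simp
  have S: "(\<Sum>i=1..m. real i powr (-101/100)) \<le> S" for m
    unfolding S_def by (rule sum_le_suminf[OF summ]) auto
  define s where "s x = x powr (36/100) * (480 * x powr (-42/100) + 9 * x powr (1/9) * x powr (-9/10) + 12 * (x powr (1/9))\<^sup>2 / x
   + 3 * x powr (1/9) * (2 * (ln x)\<^sup>2 / sqrt x + x powr (15/100) / x\<^sup>2))
   + 832 * x powr (-42/100) * x powr (1/9) * ((ln x)\<^sup>2 + 4 * x powr (1/9) * ln x) * (1 + x powr (1/9) * ln x)
   + 2688 * (x powr (1/9) * x\<^sup>2 * exp (- (ln x)\<^sup>2)) + 3584 * x powr (-72/10000) * S" for x :: real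
  have s0: "(s \<longlongrightarrow> 0) at_top"
  proof -
    have "((\<lambda>x::real. 3584 * x powr (-72/10000)) \<longlongrightarrow> 0) at_top" by real_asymp
    then have "((\<lambda>x::real. 3584 * x powr (-72/10000) * S) \<longlongrightarrow> 0 * S) at_top" by (rule tendsto_mult_right)
    from tendsto_add[OF error_tendsto this] show ?thesis unfolding s_def by simp
  qed
  then have s1: "\<forall>\<^sub>F x in at_top. s x \<le> 1" by (rule eventually_mono[OF order_tendstoD(2)[of _ 0 _ 1]]) auto
  obtain y0 :: real where y0: "\<And>y. y0 \<le> y \<Longrightarrow> (ln y * (100/36))\<^sup>2 + 4 * ln y \<le> y powr (1/1000) \<and> 8 * y powr (31/100) \<le> y \<and> y powr (-689/1000) \<le> 1/900
   \<and> (y powr (1/1000)) ^ 5 \<le> 2 * y \<and> 2 * y powr (1/1000) \<le> y \<and> 1 \<le> y"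
    using index_conditions unfolding eventually_at_top_linorder by blast
  have "filterlim (\<lambda>x::real. x powr (36/100)) at_top at_top" by real_asymp
  then have ly: "\<forall>\<^sub>F x::real in at_top. y0 \<le> x powr (36/100)" unfolding filterlim_at_top by blast
  have "\<exists>x0. \<forall>x\<ge>x0. (8 * x powr (1/9) * x powr (-9/10) \<le> 1 \<and> 8 * (x powr (1/9))\<^sup>2 \<le> x \<and> 10 * x powr (1/9) \<le> x powr (-42/100) * x
    \<and> 5 * x powr (-9/10) \<le> x powr (-42/100) \<and> 120 * x powr (-42/100) \<le> 1 \<and> 1 \<le> (x powr (-42/100))\<^sup>2 * x \<and> 3 * ((ln x)\<^sup>2 + 4 * x powr (1/9) * ln x) ^ 3 \<le> x
    \<and> 4 * (x powr (16/100) / 8) \<le> (x powr (-42/100))\<^sup>2 * (x - 2) \<and> 4 * (x powr (16/100) / 8) \<le> (x powr (-9/10))\<^sup>2 * ((x - 1) * (x - 2) / 2) \<and> 4 * (x powr (16/100) / 8) \<le> (x powr (-42/100))\<^sup>2 * (x - x powr (1/9) + 1)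
    \<and> 2 * x powr (36/100) \<le> sqrt x \<and> 36 * ln x ^ 4 \<le> x powr (-42/100) * sqrt x \<and> 1 \<le> x powr (15/100) \<and> x powr (15/100) \<le> x
    \<and> 48 * (x powr (1/9) * x\<^sup>2 * exp (- (ln x)\<^sup>2)) \<le> 1 \<and> 1 \<le> ln x \<and> 4 \<le> x) \<and>
    (x powr (36/100) * (6 * x powr (1/9) * (24 * exp (x powr (1/9) * ln x) * x\<^sup>2 * exp (- (x powr (16/100) / 8)) +
     (12 * x ^ 3 * exp (- (ln x)\<^sup>2) + 12 * exp (x powr (1/9) * ln x) * x * exp (- (x powr (15/100))) + 24 * exp (2 * x powr (1/9) * ln x) * x\<^sup>2 * exp (- (x powr (16/100) / 8)))))
     + 2304 * (x powr (1/9) * x\<^sup>2 * exp (- (ln x)\<^sup>2)) + 2 * exp (x powr (1/9) * ln x) * (24 * exp (x powr (1/9) * ln x) * x\<^sup>2 * exp (- (x powr (16/100) / 8)))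
     \<le> exp (- ((ln x)\<^sup>2 / 2))) \<and> s x \<le> 1 \<and> y0 \<le> x powr (36/100)" (is "\<exists>x0. \<forall>x\<ge>x0. ?P x")
    using eventually_conj[OF large_conditions eventually_conj[OF failure_small eventually_conj[OF s1 ly]]]
    unfolding eventually_at_top_linorder .
  then obtain x0 where x0: "\<forall>x\<ge>x0. ?P x" by (rule exE)
  text \<open>Below \<open>x0\<close> the exponent \<open>0\<close> makes the empty set admissible.\<close>
  define h where "h n = (if x0 \<le> real n then ln (real n) / 4 - 2 else 0)" for n
  define g where "g n = exp (s (real n)) - 1 + 3 * exp (- ((ln (real n))\<^sup>2 / 4))" for n
  have hlim: "filterlim h at_top sequentially"
  proof -
    have ev: "\<forall>\<^sub>F n in sequentially. ln (real n) / 4 - 2 = h n"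
      using eventually_ge_at_top[of "nat \<lceil>x0\<rceil>"] by eventually_elim (auto simp: h_def)
    have "filterlim (\<lambda>n. ln (real n) / 4 - 2) at_top sequentially" by real_asymp
    then show ?thesis by (rule iffD1[OF filterlim_cong[OF refl refl ev]])
  qed
  have glim: "g \<longlonglongrightarrow> 0"
  proof -
    have "(\<lambda>n. s (real n)) \<longlonglongrightarrow> 0" by (rule filterlim_compose[OF s0 filterlim_real_sequentially])
    from tendsto_exp[OF this] have "(\<lambda>n. exp (s (real n)) - 1) \<longlonglongrightarrow> exp 0 - 1" by (intro tendsto_diff) auto
    moreover have "(\<lambda>n. 3 * exp (- ((ln (real n))\<^sup>2 / 4))) \<longlonglongrightarrow> 0" by real_asymp
    ultimately have "g \<longlonglongrightarrow> exp 0 - 1 + 0" unfolding g_def by (rule tendsto_add)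
    then show ?thesis by simp
  qed
  have main: "\<exists>W. PrB_set k n m W \<ge> 1 - real n powr (- h n) \<and> PrD_set k n m W \<ge> 1 - real n powr (- h n)
      \<and> (\<forall>d\<in>W. \<bar>PrD k n m d - PrB k n m d\<bar> \<le> g n * PrB k n m d)"
    if C: "C < 1/9" and k: "3 \<le> k" "real k < real n powr C" and m: "sqrt (real n) < real m" "real m < 1 / real k * real (n choose k)" for C n k m
  proof -
    have n0: "n \<noteq> 0" using k by (intro notI) simp
    show ?thesis
    proof (cases "x0 \<le> real n")
      case False
      then have "h n = 0" by (simp add: h_def)
      then show ?thesis using n0 by (intro exI[of _ "{}"]) (simp add: PrB_set_def PrD_set_def)
    next
      case True
      note X = x0[rule_format, OF True]
      let ?x = "real n"
      have \<kappa>: "real k \<le> ?x powr (1/9)" using k(2) C n0 powr_mono[of C "1/9" ?x] by linarith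
      have kn: "k < n"
      proof -
        have "real k < ?x powr C" by (rule k)
        also have "\<dots> \<le> ?x powr 1" using C n0 by (intro powr_mono) auto
        finally show ?thesis using n0 by simp
      qed
      interpret kgraph n k by unfold_locales (use k kn in auto)
      \<comment> \<open>This is \<open>m < 1 / k * M\<close> with \<open>c = 1\<close>; it keeps the
        edge density below \<open>1 / k \<le> 1/3\<close>.\<close>
      have mk: "real k * real m < real M"
        using m(2) k(1) by (simp add: M_def field_simps)
      define \<tau> where "\<tau> = exp (- ((ln ?x)\<^sup>2 / 2))"
      have MI: "8 * ?x powr (1/9) \<le> real i \<and> ((ln ?x)\<^sup>2 + 4 * ln (real i)) ^ 5 \<le> 2 * real i \<and> 2 * ((ln ?x)\<^sup>2 + 4 * ln (real i)) \<le> real i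
        \<and> sqrt (?x powr (1/9) * ((ln ?x)\<^sup>2 + 4 * ln (real i)) / real i) \<le> 1 / 30
        \<and> sqrt (?x powr (1/9) * ((ln ?x)\<^sup>2 + 4 * ln (real i)) / real i) ^ 3 \<le> ?x powr (-72/10000) * real i powr (-101/100)"
        if i: "?x powr (36/100) < real i" for i :: nat
      proof -
        have "y0 \<le> real i" using X i by linarith
        from y0[OF this] show ?thesis using i n0 by (intro late_index) auto
      qed
      have "\<exists>W. PrB_set k n m W \<ge> 1 - sqrt \<tau> \<and> PrD_set k n m W \<ge> 1 - 3 * (sqrt \<tau> + \<tau>)
        \<and> (\<forall>d\<in>W. \<bar>PrD k n m d - PrB k n m d\<bar> \<le> (exp (s ?x) - 1 + 3 * sqrt \<tau>) * PrB k n m d)"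
      proof (rule assembly[OF m(1) mk refl _ \<kappa>, where a = "?x powr (-42/100)" and b = "?x powr (-9/10)" and E = "?x powr (16/100) / 8"
            and ?I0.0 = "?x powr (36/100)" and B = "?x powr (15/100)" and \<delta> = "?x powr (-72/10000)" and S = S])
        show "?x powr (-9/10) \<le> 1" using X powr_ge_zero[of ?x "-9/10"] powr_ge_zero[of ?x "-42/100"] by linarith
        show "?x powr (36/100) * (480 * ?x powr (-42/100) + 9 * ?x powr (1/9) * ?x powr (-9/10) + 12 * (?x powr (1/9))\<^sup>2 / ?x
          + 3 * ?x powr (1/9) * (2 * (ln ?x)\<^sup>2 / sqrt ?x + ?x powr (15/100) / ?x\<^sup>2))
          + 832 * ?x powr (-42/100) * ?x powr (1/9) * ((ln ?x)\<^sup>2 + 4 * ?x powr (1/9) * ln ?x) * (1 + ?x powr (1/9) * ln ?x)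
          + 3584 * ?x powr (-72/10000) * S + 2688 * (?x powr (1/9) * ?x\<^sup>2 * exp (- (ln ?x)\<^sup>2)) \<le> s ?x"
          unfolding s_def by linarith
      qed (use X MI S n0 in \<open>auto simp: \<tau>_def\<close>)
      then obtain W where W: "PrB_set k n m W \<ge> 1 - sqrt \<tau>" "PrD_set k n m W \<ge> 1 - 3 * (sqrt \<tau> + \<tau>)"
        "\<forall>d\<in>W. \<bar>PrD k n m d - PrB k n m d\<bar> \<le> (exp (s ?x) - 1 + 3 * sqrt \<tau>) * PrB k n m d" by blast
      have sq: "sqrt \<tau> = exp (- ((ln ?x)\<^sup>2 / 4))"
      proof (rule real_sqrt_unique)
        show "(exp (- ((ln ?x)\<^sup>2 / 4)))\<^sup>2 = \<tau>" unfolding \<tau>_def by (simp add: power2_eq_square exp_add[symmetric])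
      qed simp
      have \<tau>s: "\<tau> \<le> sqrt \<tau>" unfolding sq unfolding \<tau>_def by simp
      \<comment> \<open>\<open>sqrt \<tau>\<close> is \<open>n powr (- ln n / 4)\<close>. The
        \<open>- 2\<close> in \<open>h\<close> leaves a factor \<open>n\<^sup>2\<close>, which
        absorbs the constant.\<close>
      have "6 * sqrt \<tau> \<le> ?x powr (- h n)"
      proof -
        have "?x powr (- h n) = exp (2 * ln ?x - (ln ?x)\<^sup>2 / 4)"
          using n0 True by (simp add: powr_def h_def power2_eq_square algebra_simps)
        also have "\<dots> = exp (ln ?x) * exp (ln ?x) * sqrt \<tau>" unfolding sq exp_add[symmetric] by (rule arg_cong[of _ _ exp]) simp
        also have "\<dots> = ?x * ?x * sqrt \<tau>" using n0 by simp
        finally have e: "?x powr (- h n) = ?x * ?x * sqrt \<tau>" .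
        have "4 * 4 \<le> ?x * ?x" using X by (intro mult_mono) auto
        then have "6 \<le> ?x * ?x" by linarith
        then show ?thesis unfolding e by (rule mult_right_mono) (simp add: sq)
      qed
      moreover have "0 \<le> sqrt \<tau>" unfolding sq by simp
      moreover have "3 * (sqrt \<tau> + \<tau>) \<le> 6 * sqrt \<tau>" using \<tau>s by simp
      ultimately have "1 - ?x powr (- h n) \<le> 1 - sqrt \<tau>" "1 - ?x powr (- h n) \<le> 1 - 3 * (sqrt \<tau> + \<tau>)"
        by linarith+
      then show ?thesis using W unfolding g_def sq[symmetric] by (intro exI[of _ W]) auto
    qed
  qed
  show ?thesis
  proof (intro exI[of _ 1] conjI allI impI)
    fix C :: real assume C: "0 < C \<and> C < 1/9"
    \<comment> \<open>The range conditions are put inside \<open>Q\<close>, so that a witness exists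
      for all \<open>n\<close>, \<open>k\<close> and \<open>m\<close> and can be chosen by
      \<open>SOME\<close>.\<close>
    define Q where "Q n k m W \<longleftrightarrow> (3 \<le> k \<and> real k < real n powr C \<and> sqrt (real n) < real m \<and> real m < 1 / real k * real (n choose k) \<longrightarrow>
       PrB_set k n m W \<ge> 1 - real n powr (- h n) \<and> PrD_set k n m W \<ge> 1 - real n powr (- h n) \<and>
       (\<forall>d \<in> W. \<bar>PrD k n m d - PrB k n m d\<bar> \<le> g n * PrB k n m d))" for n k m W
    define W where "W n k m = (SOME W. Q n k m W)" for n k m
    have "Q n k m (W n k m)" for n k m
      unfolding W_def
    proof (rule someI_ex)
      show "\<exists>W. Q n k m W" unfolding Q_def using main[of C k n m] C by blast
    qed
    then show "\<exists>(W :: nat \<Rightarrow> nat \<Rightarrow> nat \<Rightarrow> nat list set) (h :: nat \<Rightarrow> real) (g :: nat \<Rightarrow> real).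
          filterlim h at_top sequentially \<and> g \<longlonglongrightarrow> 0 \<and>
          (\<forall>n k m :: nat.
             3 \<le> k \<and> real k < real n powr C \<and>
             sqrt (real n) < real m \<and> real m < 1 / real k * real (n choose k) \<longrightarrow>
               PrB_set k n m (W n k m) \<ge> 1 - real n powr (- h n) \<and>
               PrD_set k n m (W n k m) \<ge> 1 - real n powr (- h n) \<and>
               (\<forall>d \<in> W n k m. \<bar>PrD k n m d - PrB k n m d\<bar> \<le> g n * PrB k n m d))"
      using hlim glim unfolding Q_def by blast
  qed simp
qed

end
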